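(* Let $H$ be a graph. There are only finitely many (up to isomorphism) $H$-free $4$-vertex-critical graphs if and only if $H$ is an induced subgraph of $P_6$, of $2P_3$, or of $P_4 + kP_1$ for some $k \in \mathbb{N}$.
   Context: All graphs are finite and simple. A graph $G$ is $H$-free if no induced subgraph of $G$ is isomorphic to $H$. A graph is $4$-vertex-critical if it is not $3$-colorable (its chromatic number is exactly $4$) but every proper induced subgraph is $3$-colorable. $P_t$ denotes the path on $t$ vertices, $G_1+G_2$ denotes the disjoint union of graphs, and $kG$ denotes the disjoint union of $k$ copies of $G$; so $2P_3$ is two disjoint copies of $P_3$ and $P_4+kP_1$ is a $P_4$ together with $k$ isolated vertices. *)

theory Defs
  imports "Graph_Theory.Digraph_Isomorphism"
begin

text \<open>
  A finite simple graph is a \<^const>\<open>pair_graph\<close>: a finite vertex set with a symmetric,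
  irreflexive set of arcs, each undirected edge being a pair of opposite arcs. The notions
  below are defined on \<^typ>\<open>('a, 'b) pre_digraph\<close>, where the library defines
  induced subgraphs and isomorphism; \<^const>\<open>with_proj\<close> is the coercion from
  \<^typ>\<open>'a pair_pre_digraph\<close>.
\<close>

definition iso_induced_subgraph :: "('a, 'b) pre_digraph \<Rightarrow> ('c, 'd) pre_digraph \<Rightarrow> bool" where
  "iso_induced_subgraph H G \<longleftrightarrow> (\<exists>F. induced_subgraph F G \<and> digraph_iso F H)"

definition induced_free :: "('a, 'b) pre_digraph \<Rightarrow> ('c, 'd) pre_digraph \<Rightarrow> bool" where
  "induced_free H G \<longleftrightarrow> \<not> iso_induced_subgraph H G"

definition colorable :: "nat \<Rightarrow> ('a, 'b) pre_digraph \<Rightarrow> bool" where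
  "colorable k G \<longleftrightarrow>
     (\<exists>c :: 'a \<Rightarrow> nat. c ` verts G \<subseteq> {..<k} \<and> (\<forall>e \<in> arcs G. c (tail G e) \<noteq> c (head G e)))"

definition chromatic_number :: "('a, 'b) pre_digraph \<Rightarrow> nat" where
  "chromatic_number G = (LEAST k. colorable k G)"

definition four_vertex_critical :: "('a, 'b) pre_digraph \<Rightarrow> bool" where
  "four_vertex_critical G \<longleftrightarrow>
     \<not> colorable 3 G \<and>
     (\<forall>F. induced_subgraph F G \<and> verts F \<subset> verts G \<longrightarrow> colorable 3 F)"

definition path_graph :: "nat \<Rightarrow> nat pair_pre_digraph" where
  "path_graph t =
     \<lparr>pverts = {..<t}, parcs = {(i, j). i < t \<and> j < t \<and> (j = Suc i \<or> i = Suc j)}\<rparr>"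

definition disjoint_union ::
  "'a pair_pre_digraph \<Rightarrow> 'b pair_pre_digraph \<Rightarrow> ('a + 'b) pair_pre_digraph" where
  "disjoint_union G H =
     \<lparr>pverts = pverts G <+> pverts H,
      parcs = {(Inl u, Inl v) |u v. (u, v) \<in> parcs G} \<union> {(Inr u, Inr v) |u v. (u, v) \<in> parcs H}\<rparr>"

definition copies :: "nat \<Rightarrow> 'a pair_pre_digraph \<Rightarrow> (nat \<times> 'a) pair_pre_digraph" where
  "copies k G =
     \<lparr>pverts = {..<k} \<times> pverts G,
      parcs = {((i, u), (i, v)) |i u v. i < k \<and> (u, v) \<in> parcs G}\<rparr>"

definition iso_rel :: "'a pair_pre_digraph rel" where
  "iso_rel = {(G, G'). digraph_iso (with_proj G) (with_proj G')}"

text \<open>Every finite simple graph has an isomorphic copy with vertices in \<^typ>\<open>nat\<close>.\<close>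

lemma pair_graph_iso_nat:
  fixes G :: "'a pair_pre_digraph"
  assumes "pair_graph G"
  shows "\<exists>G' :: nat pair_pre_digraph. pair_graph G' \<and> digraph_iso (with_proj G) (with_proj G')"
proof -
  interpret pair_graph G by (rule assms)
  obtain f :: "'a \<Rightarrow> nat" where f: "inj_on f (pverts G)"
    using finite_imp_inj_to_nat_seg[OF pair_finite_verts] by blast
  define hom where "hom = \<lparr>iso_verts = f, iso_arcs = map_prod f f, iso_head = snd, iso_tail = fst\<rparr>"
  define G' where "G' = \<lparr>pverts = f ` pverts G, parcs = map_prod f f ` parcs G\<rparr>"
  have "inj_on (map_prod f f) (parcs G)"
    by (rule inj_on_subset[OF map_prod_inj_on[OF f f]]) (auto dest: wellformed')
  then have "digraph_isomorphism hom"
    using f wf_digraph_axioms by (auto simp: digraph_isomorphism_def hom_def)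
  moreover have "with_proj G' = app_iso hom (with_proj G)"
    by (simp add: app_iso_def hom_def G'_def with_proj_def)
  ultimately have "digraph_iso (with_proj G) (with_proj G')"
    by (auto simp: digraph_iso_def)
  moreover have "pair_graph G'"
  proof
    show "symmetric (with_proj G')"
    proof -
      have "sym (parcs G)" using pair_sym_arcs by (simp add: symmetric_def)
      then have "sym (map_prod f f ` parcs G)" by (auto intro!: symI dest: symD)
      then show ?thesis by (simp add: symmetric_def G'_def)
    qed
  next
    fix e assume "e \<in> parcs G'"
    then obtain u v where e: "e = (f u, f v)" and uv: "(u, v) \<in> parcs G"
      by (auto simp: G'_def)
    from uv have "u \<in> pverts G" "v \<in> pverts G" "u \<noteq> v"
      using pair_no_loops[OF uv] by (auto dest: wellformed')
    then show "fst e \<noteq> snd e"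
      using f by (simp add: e inj_on_eq_iff)
  qed (auto simp: G'_def dest: wellformed')
  ultimately show ?thesis by blast
qed

lemma four_vertex_critical_chromatic_number:
  fixes G :: "'a pair_pre_digraph"
  assumes "pair_graph G" and crit: "four_vertex_critical (with_proj G)"
  shows "chromatic_number (with_proj G) = 4"
proof -
  interpret pair_graph G by (rule assms)
  have not3: "\<not> colorable 3 (with_proj G)"
    using crit by (simp add: four_vertex_critical_def)
  have "pverts G \<noteq> {}"
  proof
    assume "pverts G = {}"
    moreover from this have "parcs G = {}" using arc_fst_in_verts by blast
    ultimately show False using not3 by (simp add: colorable_def)
  qed
  then obtain v where v: "v \<in> pverts G" by blast
  define F where "F = with_proj G \<restriction> (pverts G - {v})"
  have "induced_subgraph F (with_proj G)"
    unfolding F_def by (rule induced_induce) auto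
  moreover have "verts F \<subset> verts (with_proj G)"
    using v by (auto simp: F_def)
  ultimately have "colorable 3 F"
    using crit by (simp add: four_vertex_critical_def)
  then obtain c where c: "c ` (pverts G - {v}) \<subseteq> {..<3::nat}"
    and arcsF: "\<And>e. e \<in> arcs F \<Longrightarrow> c (fst e) \<noteq> c (snd e)"
    by (auto simp: colorable_def F_def)
  have c3: "c x < 3" if "x \<in> pverts G" "x \<noteq> v" for x
    using c that by (simp add: image_subset_iff)
  have cF: "c x \<noteq> c y" if "(x, y) \<in> parcs G" "x \<noteq> v" "y \<noteq> v" for x y
    using arcsF[of "(x, y)"] that wellformed'[OF that(1)] by (simp add: F_def)
  have "(c(v := 3)) (fst e) \<noteq> (c(v := 3)) (snd e)" if "e \<in> parcs G" for e
  proof -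
    obtain x y where e: "e = (x, y)" by (cases e)
    have xy: "(x, y) \<in> parcs G" using that by (simp add: e)
    have "x \<noteq> y" using pair_no_loops[OF xy] by simp
    then show ?thesis
      using cF[OF xy] c3[OF in_arcsD1[OF xy]] c3[OF in_arcsD2[OF xy]] by (auto simp: e)
  qed
  moreover have "(c(v := 3)) ` pverts G \<subseteq> {..<4}"
  proof
    fix n assume "n \<in> (c(v := 3)) ` pverts G"
    then obtain u where u: "u \<in> pverts G" "n = (c(v := 3)) u" by blast
    then have "u \<noteq> v \<Longrightarrow> c u < 3" by (simp add: c3)
    then show "n \<in> {..<4}" using u(2) by (cases "u = v") simp_all
  qed
  ultimately have "colorable 4 (with_proj G)"
    unfolding colorable_def by (intro exI[of _ "c(v := 3)"]) auto
  moreover have "4 \<le> k" if "colorable k (with_proj G)" for k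
  proof (rule ccontr)
    assume "\<not> 4 \<le> k"
    then have "{..<k} \<subseteq> {..<3}" by auto
    then have "colorable 3 (with_proj G)"
      using that unfolding colorable_def by (meson subset_trans)
    with not3 show False ..
  qed
  ultimately show ?thesis
    unfolding chromatic_number_def by (rule Least_equality)
qed

end

theory Submission
  imports Defs "HOL-Library.FuncSet" "HOL-Library.Ramsey"
begin

text \<open>
  Finiteness: fixing the colours of boundedly many vertices reduces 3-colouring a large critical graph to a
  colouring problem in which every vertex has lost a colour. If that problem is solvable on all small vertex sets but
  not globally, then there are arbitrarily long chains of forced colours; by compactness and Ramsey's theorem they
  have a regular infinite limit, and such a limit contains \<open>P6\<close> and every \<open>P4 + kP1\<close>, and, together with the
  neighbours that removed the colours, \<open>2P3\<close>. Hence the order of a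
  critical graph avoiding one of these is bounded.

  Infinitude: the Mycielskians of odd cycles are triangle-free, the squares of the cycles of length \<open>3r + 1\<close> are
  claw-free and contain no short induced cycles of length at least four, and a third family of circulants on \<open>3r + 1\<close>
  vertices contains no \<open>2P2 + P1\<close>; all of them are critical. A graph that escapes all three families is a linear forest without
  \<open>2P2 + P1\<close>, which leaves the graphs listed in the theorem.
\<close>


text \<open>Arguments such as "guess the colours of S" or "either A is monochromatic or two of its
  vertices differ" have to be run on a graph that has no 3-colouring at all. They are run on the
  budget \<open>lc N \<Phi>\<close>: every set of at most \<open>N\<close> vertices has a
  \<open>\<Phi>\<close>-colouring. Each guess and each case distinction lowers \<open>N\<close> in a
  controlled way.

  The obstacle is to make every vertex lose a colour. For \<open>P4 + kP1\<close>, an induced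
  \<open>P4\<close> with its few non-neighbours does so at once, and if there is no
  \<open>P4\<close> to be found in a \<open>P6\<close>, the \<open>P6\<close> case applies. For
  \<open>P6\<close>, a smallest connected dominating set has its colours determined by at most six
  of its vertices, or is a single vertex, or is a join with a monochromatic side; the vertices that
  then keep three colours form components that can be recoloured. For \<open>2P3\<close>, the
  precoloured vertices contain an induced \<open>P3\<close> avoiding each colour, and the chains
  need more care, since a half graph contains no \<open>2P3\<close>: the missing \<open>P3\<close>
  passes through a neighbour of forced colour.\<close>

datatype col = CA | CB | CC

lemma UNIV_col: "(UNIV :: col set) = {CA, CB, CC}"
  using col.exhaust by blast

instance col :: finite
  by standard (simp add: UNIV_col)

lemma card_col [simp]: "card (UNIV :: col set) = 3"
  by (simp add: UNIV_col)

lemma third_col: "a \<noteq> b ==> b \<noteq> c ==> a \<noteq> c ==> (x :: col) = a \<or> x = b \<or> x = c"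
  by (cases a; cases b; cases c; cases x) auto

lemma col_eqI: "(x :: col) \<noteq> a ==> x \<noteq> b ==> y \<noteq> a ==> y \<noteq> b ==> a \<noteq> b ==> x = y"
  by (cases a; cases b; cases x; cases y) auto

section \<open>Induced paths, hereditary colouring properties and local colourability\<close>

text \<open>For a symmetric irreflexive relation the adjacencies already make the six vertices
  distinct, and likewise for \<open>indP4\<close>. The ends of a \<open>P3\<close> have the same
  adjacencies, which is why \<open>indP3\<close> states that they differ.\<close>

definition indP6 :: "('b => 'b => bool) => 'b => 'b => 'b => 'b => 'b => 'b => bool" where
  "indP6 R a b c d e f \<longleftrightarrow> R a b \<and> R b c \<and> R c d \<and> R d e \<and> R e f \<and> \<not> R a c \<and> \<not> R a d \<and> \<not> R a e \<and> \<not> R a f \<and>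
    \<not> R b d \<and> \<not> R b e \<and> \<not> R b f \<and> \<not> R c e \<and> \<not> R c f \<and> \<not> R d f"

definition indP4 :: "('b => 'b => bool) => 'b => 'b => 'b => 'b => bool" where
  "indP4 R a b c d \<longleftrightarrow> R a b \<and> R b c \<and> R c d \<and> \<not> R a c \<and> \<not> R a d \<and> \<not> R b d"

definition indP3 :: "('b => 'b => bool) => 'b => 'b => 'b => bool" where
  "indP3 R a b c \<longleftrightarrow> a \<noteq> c \<and> R a b \<and> R b c \<and> \<not> R a c"

locale fgraph =
  fixes V :: "'a set" and E :: "'a => 'a => bool"
  assumes finV: "finite V" and symE: "E x y ==> E y x" and irrE: "\<not> E x x"
    and EV: "E x y ==> x \<in> V"
begin

definition proper :: "'a set => ('a => col) => bool" where
  "proper X f \<longleftrightarrow> (\<forall>x\<in>X. \<forall>y\<in>X. E x y --> f x \<noteq> f y)"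

text \<open>Heredity and properness are all that is asked, so that fixing colours, adding auxiliary
  vertices and imposing pointwise constraints stay within the class.\<close>

definition adm :: "('a set => ('a => col) => bool) => bool" where
  "adm \<Phi> \<longleftrightarrow> (\<forall>X Y f. X \<subseteq> Y --> \<Phi> Y f --> \<Phi> X f) \<and> (\<forall>X f. \<Phi> X f --> proper X f)"

definition lc :: "nat => ('a set => ('a => col) => bool) => bool" where
  "lc N \<Phi> \<longleftrightarrow> (\<forall>X. X \<subseteq> V --> card X \<le> N --> (\<exists>f. \<Phi> X f))"

definition fx :: "('a set => ('a => col) => bool) => 'a set => ('a => col) => 'a set => ('a => col) => bool" where
  "fx \<Phi> S \<sigma> X f \<longleftrightarrow> \<Phi> (X \<union> S) f \<and> (\<forall>s\<in>S. f s = \<sigma> s)"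

text \<open>The vertices in \<open>D x\<close> are witnesses coloured along with \<open>x\<close>.
  Whatever their colours imply for \<open>x\<close> thereby becomes a constraint on \<open>x\<close>
  alone.\<close>

definition cl :: "('a set => ('a => col) => bool) => ('a => 'a set) => 'a set => ('a => col) => bool" where
  "cl \<Phi> D X f \<longleftrightarrow> \<Phi> (X \<union> \<Union>(D ` X)) f"

lemma admD: "adm \<Phi> ==> \<Phi> Y f ==> X \<subseteq> Y ==> \<Phi> X f"
  unfolding adm_def by blast

lemma adm_proper: "adm \<Phi> ==> \<Phi> X f ==> x \<in> X ==> y \<in> X ==> E x y ==> f x \<noteq> f y"
  unfolding adm_def proper_def by blast

lemma adm_proper_self: "adm proper"
  unfolding adm_def proper_def by blast

lemma adm_fx: "adm \<Phi> ==> adm (fx \<Phi> S \<sigma>)"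
  proof -
  assume a: "adm \<Phi>"
  have "fx \<Phi> S \<sigma> X f" if "X \<subseteq> Y" "fx \<Phi> S \<sigma> Y f" for X Y f
  proof -
    have "X \<union> S \<subseteq> Y \<union> S" using that(1) by blast
    then show ?thesis using that(2) admD[OF a] unfolding fx_def by blast
  qed
  moreover have "proper X f" if "fx \<Phi> S \<sigma> X f" for X f
    using that adm_proper[OF a, of _ f] unfolding fx_def proper_def by (meson UnI1)
  ultimately show ?thesis unfolding adm_def by blast
qed

lemma adm_cl: "adm \<Phi> ==> adm (cl \<Phi> D)"
proof -
  assume a: "adm \<Phi>"
  have "cl \<Phi> D X f" if "X \<subseteq> Y" "cl \<Phi> D Y f" for X Y f
  proof -
    have "X \<union> \<Union>(D ` X) \<subseteq> Y \<union> \<Union>(D ` Y)" using that(1) by blast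
    then show ?thesis using that(2) admD[OF a] unfolding cl_def by blast
  qed
  moreover have "proper X f" if "cl \<Phi> D X f" for X f
    using that adm_proper[OF a, of _ f] unfolding cl_def proper_def by (meson UnI1)
  ultimately show ?thesis unfolding adm_def by blast
qed

lemma adm_conj:
  assumes a: "adm \<Phi>" and R: "\<And>X Y f. X \<subseteq> Y ==> R Y f ==> R X f"
  shows "adm (\<lambda>X f. \<Phi> X f \<and> R X f)"
proof -
  have "\<Phi> X f \<and> R X f" if "X \<subseteq> Y" "\<Phi> Y f \<and> R Y f" for X Y f
    using that admD[OF a, of Y f X] R[of X Y f] by simp
  moreover have "proper X f" if "\<Phi> X f" for X f using a that unfolding adm_def by simp
  ultimately show ?thesis unfolding adm_def by simp
qed

lemma lcD: "lc N \<Phi> ==> X \<subseteq> V ==> card X \<le> N ==> \<exists>f. \<Phi> X f"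
  unfolding lc_def by blast

lemma lc_mono: "lc N \<Phi> ==> M \<le> N ==> lc M \<Phi>"
  unfolding lc_def by force

lemma fxD: "fx \<Phi> S \<sigma> X f ==> \<Phi> (X \<union> S) f" "fx \<Phi> S \<sigma> X f ==> s \<in> S ==> f s = \<sigma> s"
  unfolding fx_def by auto

lemma fx_mono:
  assumes "adm \<Phi>" "lc N (fx \<Phi> S \<sigma>)" "S' \<subseteq> S"
  shows "lc N (fx \<Phi> S' \<sigma>)"
proof -
  have "fx \<Phi> S' \<sigma> X f" if "fx \<Phi> S \<sigma> X f" for X f
    using that assms(3) admD[OF assms(1), of "X \<union> S" f "X \<union> S'"] unfolding fx_def by blast
  then show ?thesis using assms(2) unfolding lc_def by blast
qed

text \<open>A finite compactness argument: if each of the at most \<open>3 ^ s\<close> colourings of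
  \<open>S\<close> were refuted by \<open>N\<close> vertices, then \<open>S\<close> together with
  all these refutations would have no \<open>\<Phi>\<close>-colouring. This is how the colours of
  \<open>S\<close> are guessed.\<close>

lemma query:
  assumes adm: "adm \<Phi>" and S: "S \<subseteq> V" "card S \<le> s" and lc: "lc (s + 3 ^ s * N) \<Phi>"
  shows "\<exists>\<sigma>. lc N (fx \<Phi> S \<sigma>)"
proof (rule ccontr)
  assume "\<nexists>\<sigma>. lc N (fx \<Phi> S \<sigma>)"
  then have "\<forall>\<sigma>. \<exists>X. X \<subseteq> V \<and> card X \<le> N \<and> (\<forall>f. \<not> fx \<Phi> S \<sigma> X f)"
    by (simp add: lc_def)
  from choice[OF this] obtain B where
    B0: "\<forall>\<sigma>. B \<sigma> \<subseteq> V \<and> card (B \<sigma>) \<le> N \<and> (\<forall>f. \<not> fx \<Phi> S \<sigma> (B \<sigma>) f)" ..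
  have B: "B \<sigma> \<subseteq> V" "card (B \<sigma>) \<le> N" "\<not> fx \<Phi> S \<sigma> (B \<sigma>) f" for \<sigma> f
    using B0 by simp_all
  have finS: "finite S" using S finV finite_subset by blast
  let ?P = "S \<rightarrow>\<^sub>E (UNIV :: col set)"
  have finP: "finite ?P" using finS by (simp add: finite_PiE)
  have cardP: "card ?P \<le> 3 ^ s"
    using S finS by (simp add: card_PiE power_increasing)
  let ?X = "S \<union> (\<Union>\<sigma>\<in>?P. B \<sigma>)"
  have "card (\<Union>\<sigma>\<in>?P. B \<sigma>) \<le> (\<Sum>\<sigma>\<in>?P. card (B \<sigma>))" by (rule card_UN_le[OF finP])
  also have "\<dots> \<le> (\<Sum>\<sigma>\<in>?P. N)" using B(2) by (intro sum_mono)
  also have "\<dots> = card ?P * N" by simp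
  also have "\<dots> \<le> 3 ^ s * N" using cardP by (intro mult_right_mono) auto
  finally have "card ?X \<le> s + 3 ^ s * N"
    using card_Un_le[of S "\<Union>\<sigma>\<in>?P. B \<sigma>"] S by linarith
  moreover have "?X \<subseteq> V" using S B by auto
  ultimately obtain f where f: "\<Phi> ?X f" using lcD[OF lc, of ?X] by metis
  let ?s = "restrict f S"
  have P: "?s \<in> ?P" by auto
  then have "B ?s \<union> S \<subseteq> ?X" by blast
  then have "\<Phi> (B ?s \<union> S) f" by (rule admD[OF adm f])
  then have "fx \<Phi> S ?s (B ?s) f" unfolding fx_def by auto
  then show False using B(3) by simp
qed

text \<open>Colouring \<open>N\<close> vertices under \<open>cl\<close> means colouring at most
  \<open>N * (k + 1)\<close> vertices under \<open>\<Phi>\<close>.\<close>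

lemma closure:
  assumes D: "\<And>x. x \<in> V ==> D x \<subseteq> V" "\<And>x. x \<in> V ==> card (D x) \<le> k" and lc: "lc (N * (k + 1)) \<Phi>"
  shows "lc N (cl \<Phi> D)"
  unfolding lc_def
proof (intro allI impI)
  fix X assume X: "X \<subseteq> V" "card X \<le> N"
  then have finX: "finite X" using finV finite_subset by blast
  have "card (\<Union>(D ` X)) \<le> (\<Sum>x\<in>X. card (D x))" by (rule card_UN_le[OF finX])
  also have "\<dots> \<le> (\<Sum>x\<in>X. k)" using D(2) X(1) by (intro sum_mono) blast
  also have "\<dots> = card X * k" by simp
  also have "\<dots> \<le> N * k" using X by simp
  finally have "card (X \<union> \<Union>(D ` X)) \<le> N * (k + 1)"
    using card_Un_le[of X "\<Union>(D ` X)"] X by simp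
  moreover have "X \<union> \<Union>(D ` X) \<subseteq> V" using X(1) D(1) by blast
  ultimately show "\<exists>f. cl \<Phi> D X f" using lcD[OF lc, of "X \<union> \<Union>(D ` X)"] by (simp add: cl_def)
qed

text \<open>A case distinction at bounded cost: \<open>query\<close> fixes the colours of any
  \<open>X\<close> with at most \<open>N\<close> vertices. Either the fixed colours always satisfy
  \<open>R\<close>, which may then be imposed, or some \<open>X\<close> carries a fixed violation of
  \<open>R\<close>.\<close>

lemma option_gen:
  assumes adm: "adm \<Phi>" and lc: "lc (N + 3 ^ N * N) \<Phi>"
    and R: "\<And>X f g. (\<And>x. x \<in> X ==> f x = g x) ==> R X f ==> R X g"
  shows "lc N (\<lambda>X f. \<Phi> X f \<and> R X f) \<or>
    (\<exists>X \<sigma>. X \<subseteq> V \<and> card X \<le> N \<and> \<not> R X \<sigma> \<and> lc N (fx \<Phi> X \<sigma>))"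
proof (rule disjCI)
  assume no: "\<nexists>X \<sigma>. X \<subseteq> V \<and> card X \<le> N \<and> \<not> R X \<sigma> \<and> lc N (fx \<Phi> X \<sigma>)"
  show "lc N (\<lambda>X f. \<Phi> X f \<and> R X f)"
    unfolding lc_def
  proof (intro allI impI)
    fix X assume X: "X \<subseteq> V" "card X \<le> N"
    from query[OF adm X lc] obtain \<sigma> where s: "lc N (fx \<Phi> X \<sigma>)" ..
    then have "R X \<sigma>" using no X by metis
    obtain f where f: "fx \<Phi> X \<sigma> {} f" using lcD[OF s, of "{}"] by auto
    have "R X f" by (rule R[OF _ \<open>R X \<sigma>\<close>]) (simp add: fxD(2)[OF f])
    then show "\<exists>f. \<Phi> X f \<and> R X f" using fxD(1)[OF f] by (intro exI[of _ f]) simp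
  qed
qed

text \<open>A pointwise constraint is violated at a single vertex \<open>q\<close>; the other fixed
  colours are dropped again, so the second alternative costs one vertex.\<close>

lemma option_pt:
  assumes adm: "adm \<Phi>" and lc: "lc (N + 3 ^ N * N) \<Phi>"
  shows "lc N (\<lambda>X f. \<Phi> X f \<and> (\<forall>x\<in>X. P x (f x))) \<or>
    (\<exists>q c. q \<in> V \<and> \<not> P q c \<and> lc N (fx \<Phi> {q} (\<lambda>_. c)))"
proof -
  have "lc N (\<lambda>X f. \<Phi> X f \<and> (\<forall>x\<in>X. P x (f x))) \<or>
    (\<exists>X \<sigma>. X \<subseteq> V \<and> card X \<le> N \<and> \<not> (\<forall>x\<in>X. P x (\<sigma> x)) \<and> lc N (fx \<Phi> X \<sigma>))"
    by (rule option_gen[OF adm lc]) auto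
  then show ?thesis
  proof (elim disjE exE conjE)
    fix X \<sigma> assume X: "X \<subseteq> V" "\<not> (\<forall>x\<in>X. P x (\<sigma> x))" "lc N (fx \<Phi> X \<sigma>)"
    obtain q where q: "q \<in> X" "\<not> P q (\<sigma> q)" using X(2) by auto
    have "lc N (fx \<Phi> {q} \<sigma>)" using fx_mono[OF adm X(3), of "{q}"] q by simp
    moreover have "fx \<Phi> {q} \<sigma> = fx \<Phi> {q} (\<lambda>_. \<sigma> q)" unfolding fx_def by (intro ext) auto
    ultimately have "lc N (fx \<Phi> {q} (\<lambda>_. \<sigma> q))" by simp
    then have "\<exists>q c. q \<in> V \<and> \<not> P q c \<and> lc N (fx \<Phi> {q} (\<lambda>_. c))"
      using q X(1) by (intro exI[of _ q] exI[of _ "\<sigma> q"]) auto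
    then show ?thesis by (rule disjI2)
  qed (rule disjI1)
qed

end


section \<open>Compactness and Ramsey tools\<close>

text \<open>Koenig's lemma: the prefix is extended value by value while infinitely many
  \<open>K\<close> still agree with it; as there are finitely many values, one of them always
  survives.\<close>

lemma sequence_limit:
  fixes F :: "nat => nat => 'b :: finite"
  shows "\<exists>g. \<forall>n. infinite {K. \<forall>i<n. F K i = g i}"
proof -
  define P where "P n h \<longleftrightarrow> infinite {K. \<forall>i<n. F K i = h i}" for n and h :: "nat => 'b"
  have step: "\<exists>x. P (Suc n) (h(n := x))" if "P n h" for n h
  proof (rule ccontr)
    assume "\<nexists>x. P (Suc n) (h(n := x))"
    then have "finite (\<Union>x. {K. \<forall>i<Suc n. F K i = (h(n := x)) i})" unfolding P_def by (intro finite_UN_I) auto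
    moreover have "{K. \<forall>i<n. F K i = h i} \<subseteq> (\<Union>x. {K. \<forall>i<Suc n. F K i = (h(n := x)) i})"
      by (auto simp: less_Suc_eq)
    ultimately show False using that finite_subset unfolding P_def by blast
  qed
  define G where "G = rec_nat undefined (\<lambda>n h. h(n := SOME x. P (Suc n) (h(n := x))))"
  have G: "G 0 = undefined" "G (Suc n) = (G n)(n := SOME x. P (Suc n) ((G n)(n := x)))" for n by (simp_all add: G_def)
  have PG: "P n (G n)" for n
  proof (induction n)
    case 0 then show ?case by (simp add: P_def)
  next
    case (Suc n)
    show ?case unfolding G(2) by (rule someI_ex[OF step[OF Suc]])
  qed
  have agree: "G n i = G (Suc i) i" if "i < n" for n i
    using that by (induction n) (auto simp: G(2) less_Suc_eq)
  have "infinite {K. \<forall>i<n. F K i = G (Suc i) i}" for n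
    using PG[of n] agree[of _ n] unfolding P_def by (simp cong: conj_cong)
  then show ?thesis by (intro exI[of _ "\<lambda>i. G (Suc i) i"] allI)
qed

text \<open>Pairs are coded as single indices, \<open>N\<close> bounds the codes of all pairs below
  \<open>n\<close>, and infinitude provides an agreeing \<open>K\<close> beyond
  \<open>n\<close>.\<close>

lemma pair_sequence_limit:
  fixes F :: "nat => nat => nat => 'b :: finite"
  shows "\<exists>g. \<forall>n. \<exists>K\<ge>n. \<forall>i<n. \<forall>j<n. F K i j = g i j"
proof -
  obtain g where g: "\<And>n. infinite {K. \<forall>m<n. F K (fst (prod_decode m)) (snd (prod_decode m)) = g m}"
    using sequence_limit[of "\<lambda>K m. F K (fst (prod_decode m)) (snd (prod_decode m))"] by blast
  have "\<exists>K\<ge>n. \<forall>i<n. \<forall>j<n. F K i j = g (prod_encode (i, j))" for n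
  proof -
    obtain N where N: "\<And>i j. i < n ==> j < n ==> prod_encode (i, j) < N"
    proof
      fix i j assume "i < n" "j < n"
      then have "prod_encode (i, j) \<in> prod_encode ` ({..<n} \<times> {..<n})" by blast
      then show "prod_encode (i, j) < Suc (Max (prod_encode ` ({..<n} \<times> {..<n})))" by (intro le_imp_less_Suc Max_ge) auto
    qed
    obtain K where K: "n \<le> K" "\<forall>m<N. F K (fst (prod_decode m)) (snd (prod_decode m)) = g m"
      using g[of N] unfolding infinite_nat_iff_unbounded_le by blast
    have "F K i j = g (prod_encode (i, j))" if "i < n" "j < n" for i j
      using K(2)[rule_format, OF N[OF that]] by simp
    then show ?thesis using K(1) by blast
  qed
  then show ?thesis by (intro exI[of _ "\<lambda>i j. g (prod_encode (i, j))"]) blast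
qed

text \<open>The unordered theorem suffices: \<open>Min\<close> and \<open>Max\<close> recover the
  order of a pair, and the homogeneous set is enumerated increasingly.\<close>

lemma ramsey_pairs:
  fixes h :: "nat => nat => 'b"
  assumes fin: "finite B" and hB: "\<And>k l. k < l ==> h k l \<in> B"
  shows "\<exists>r b. strict_mono (r :: nat => nat) \<and> (\<forall>k l. k < l --> h (r k) (r l) = b)"
proof -
  obtain e :: "'b => nat" and n where e: "e ` B = {i. i < n}" "inj_on e B"
    using finite_imp_inj_to_nat_seg[OF fin] by blast
  let ?f = "\<lambda>X. e (h (Min X) (Max X))"
  have f: "?f {x, y} = e (h (min x y) (max x y))" for x y :: nat by simp
  have "\<forall>x\<in>UNIV. \<forall>y\<in>UNIV. x \<noteq> y --> ?f {x, y} < n"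
  proof (intro ballI impI)
    fix x y :: nat assume "x \<noteq> y"
    then have "h (min x y) (max x y) \<in> B" by (intro hB) (auto simp: min_def max_def)
    then show "?f {x, y} < n" using e(1) f by auto
  qed
  then obtain Y t where Y: "infinite Y" "\<And>x y. x \<in> Y ==> y \<in> Y ==> x \<noteq> y ==> ?f {x, y} = t"
    using Ramsey2[of "UNIV :: nat set" ?f n] by auto
  define r where "r = enumerate Y"
  have r: "strict_mono r" "\<And>k. r k \<in> Y" unfolding r_def using Y(1) by (auto simp: strict_mono_enumerate enumerate_in_set)
  have eq: "h (r k) (r l) = h (r 0) (r 1)" if "k < l" for k l
  proof -
    have l: "r k < r l" "r 0 < r 1" using r(1) that by (auto simp: strict_mono_less)
    then have "e (h (r k) (r l)) = t" "e (h (r 0) (r 1)) = t"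
      using Y(2)[of "r k" "r l"] Y(2)[of "r 0" "r 1"] r(2) f[of "r k" "r l"] f[of "r 0" "r 1"] by (auto simp: min_def max_def)
    then show ?thesis using e(2) hB l unfolding inj_on_def by metis
  qed
  show ?thesis using r(1) eq by blast
qed

section \<open>Infinite propagation chains: anticomplete windows\<close>

text \<open>The infinite limit of propagation chains: \<open>p i\<close> is the colour forced on the vertex before
  \<open>i\<close>, so vertex \<open>i\<close> has the list \<open>{p i, c i}\<close>.\<close>

locale chain =
  fixes R :: "nat => nat => bool" and p c :: "nat => col"
  assumes Rsym: "R i j ==> R j i" and Rirr: "\<not> R i i" and Rsuc: "R i (Suc i)"
    and pc: "p i \<noteq> c i" and pSuc: "p (Suc i) = c i"
    and chord: "R i j ==> Suc i < j ==> c i \<noteq> p j \<and> c i \<noteq> c j \<and> p i \<noteq> p j"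
begin

text \<open>\<open>c i\<close> is the colour missing from the list of \<open>j\<close>, so
  \<open>p i\<close>, being neither \<open>c i\<close> nor \<open>p j\<close>, must be
  \<open>c j\<close>.\<close>

lemma chord_eq: "R i j ==> Suc i < j ==> p i = c j"
  using chord[of i j] pc[of i] pc[of j] col_eqI[of "p i" "c i" "p j" "c j"] by metis

lemma Rcomm: "R i j \<longleftrightarrow> R j i"
  using Rsym by blast

text \<open>Two chords from \<open>r\<close> to consecutive vertices would equate \<open>c i\<close>
  with \<open>c (Suc i)\<close> if \<open>r\<close> comes first, and \<open>p i\<close> with
  \<open>p (Suc i)\<close> if it comes last.\<close>

lemma not_both:
  assumes "R i r" "R (Suc i) r" "r \<noteq> i" "r \<noteq> Suc i" "Suc r \<noteq> i" "r \<noteq> Suc (Suc i)"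
  shows False
proof (cases "r < i")
  case True
  then have "p r = c i" "p r = c (Suc i)" using assms chord_eq[of r i] chord_eq[of r "Suc i"] Rsym by auto
  then show False using pc[of "Suc i"] pSuc[of i] by simp
next
  case False
  then have "p i = c r" "p (Suc i) = c r" using assms chord_eq[of i r] chord_eq[of "Suc i" r] by auto
  then show False using pc[of i] pSuc[of i] by simp
qed

text \<open>Otherwise adjacency to \<open>r\<close> would spread along consecutive vertices through
  the whole window, against \<open>not_both\<close>.\<close>

lemma mixed_edge:
  assumes r: "r \<notin> {s..<s + n}" and n: "4 \<le> n" and i: "i \<in> {s..<s + n}" "R i r"
  shows "\<exists>a\<in>{s..<s + n}. \<exists>b\<in>{s..<s + n}. R a b \<and> R a r \<and> \<not> R b r"
proof (rule ccontr)
  assume no: "\<not> ?thesis"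
  have up: "R (i + k) r" if "i + k < s + n" for k
    using that
  proof (induction k)
    case (Suc k)
    then show ?case using no i Rsuc[of "i + k"] by auto
  qed (use i in simp)
  have down: "R (i - k) r" if "s \<le> i - k" for k
    using that
  proof (induction k)
    case (Suc k)
    show ?case
    proof (cases "i - k = 0")
      case False
      then have "Suc (i - Suc k) = i - k" by simp
      then have "R (i - k) (i - Suc k)" using Rsuc[of "i - Suc k"] Rsym by metis
      moreover have "i - k \<in> {s..<s + n}" "i - Suc k \<in> {s..<s + n}" using Suc.prems i by auto
      moreover have "R (i - k) r" using Suc by simp
      ultimately show ?thesis using no by blast
    qed (use Suc in auto)
  qed (use i in simp)
  have all: "R j r" if "j \<in> {s..<s + n}" for j
    using up[of "j - i"] down[of "i - j"] that by (cases "i \<le> j") auto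
  have "r < s \<or> s + n \<le> r" using r by auto
  then show False using not_both[of "s + 1" r] all[of "s + 1"] all[of "s + 2"] n
    not_both[of s r] all[of s] by auto
qed

text \<open>Consecutive edges connect the chain, so a shortest walk from \<open>A\<close> to
  \<open>B\<close> exists. Each clause denies a shortcut, where minimality is over all pairs of
  endpoints.\<close>

lemma shortest_connection:
  assumes AB: "\<And>a b. a \<in> A ==> b \<in> B ==> a \<noteq> b \<and> \<not> R a b" and ne: "A \<noteq> {}" "B \<noteq> {}"
  shows "\<exists>k g. 2 \<le> k \<and> g 0 \<in> A \<and> g k \<in> B \<and> (\<forall>i<k. R (g i) (g (Suc i))) \<and>
    (\<forall>i. 0 < i \<and> i < k --> g i \<notin> A \<and> g i \<notin> B) \<and> (\<forall>i j. i + 2 \<le> j \<and> j \<le> k --> \<not> R (g i) (g j)) \<and>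
    (\<forall>i a. 2 \<le> i \<and> i \<le> k \<and> a \<in> A --> \<not> R a (g i)) \<and> (\<forall>i b. i + 2 \<le> k \<and> b \<in> B --> \<not> R b (g i))"
proof -
  let ?S = "{(i, j). R i j}"
  define W where "W k \<longleftrightarrow> (\<exists>a\<in>A. \<exists>b\<in>B. (a, b) \<in> ?S ^^ k)" for k
  have step: "(i, i + d) \<in> ?S ^^ d" for i d
  proof (induction d)
    case (Suc d)
    have "(i + d, i + Suc d) \<in> ?S" using Rsuc[of "i + d"] by simp
    then show ?case using Suc by auto
  qed simp
  have step': "(i + d, i) \<in> ?S ^^ d" for i d
  proof (induction d)
    case (Suc d)
    have "(i + Suc d, i + d) \<in> ?S" using Rsuc[of "i + d"] Rsym by simp
    then show ?case using Suc by (meson relpow_Suc_I2)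
  qed simp
  obtain a b where ab: "a \<in> A" "b \<in> B" using ne by blast
  have "\<exists>k. W k"
    using ab step[of a "b - a"] step'[of b "a - b"] unfolding W_def by (cases "a \<le> b") auto
  define k where "k = (LEAST k. W k)"
  have Wk: "W k" unfolding k_def using \<open>\<exists>k. W k\<close> by (rule LeastI_ex)
  have min: "\<not> W m" if "m < k" for m using that not_less_Least unfolding k_def by blast
  obtain g where g: "g 0 \<in> A" "g k \<in> B" "\<And>i. i < k ==> R (g i) (g (Suc i))"
    using Wk unfolding W_def relpow_fun_conv by auto
  have k2: "2 \<le> k"
  proof -
    have "k \<noteq> 0" using AB[OF g(1)] g(2) by (metis)
    moreover have "k \<noteq> 1" using AB[OF g(1)] g(2) g(3)[of 0] by auto
    ultimately show ?thesis by linarith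
  qed
  have seg: "(g i, g j) \<in> ?S ^^ (j - i)" if "i \<le> j" "j \<le> k" for i j
  proof -
    have "\<exists>h. h 0 = g i \<and> h (j - i) = g j \<and> (\<forall>m<j - i. (h m, h (Suc m)) \<in> ?S)"
      using that g(3) by (intro exI[of _ "\<lambda>m. g (i + m)"]) auto
    then show ?thesis unfolding relpow_fun_conv by blast
  qed
  have notA: "g i \<notin> A" if "0 < i" "i \<le> k" for i
  proof
    assume "g i \<in> A"
    then have "W (k - i)" using seg[of i k] that g(2) unfolding W_def by auto
    then show False using min[of "k - i"] that by simp
  qed
  have notB: "g i \<notin> B" if "i < k" for i
  proof
    assume "g i \<in> B"
    then have "W i" using seg[of 0 i] that g(1) unfolding W_def by auto
    then show False using min[of i] that by simp
  qed
  have ind: "\<not> R (g i) (g j)" if ij: "i + 2 \<le> j" "j \<le> k" for i j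
  proof
    assume "R (g i) (g j)"
    then have "(g 0, g k) \<in> (?S ^^ i O ?S ^^ 1) O ?S ^^ (k - j)"
      using seg[of 0 i] seg[of j k] ij by (intro relcomp.relcompI) auto
    then have "(g 0, g k) \<in> ?S ^^ (i + 1 + (k - j))" by (simp only: relpow_add)
    then have "W (i + 1 + (k - j))" using g(1,2) unfolding W_def by blast
    moreover have "i + 1 + (k - j) < k" using ij by linarith
    ultimately show False using min by blast
  qed
  have farA: "\<not> R a (g i)" if ij: "2 \<le> i" "i \<le> k" "a \<in> A" for i a
  proof
    assume "R a (g i)"
    then have "(a, g k) \<in> ?S ^^ 1 O ?S ^^ (k - i)" using seg[of i k] ij by (intro relcomp.relcompI) auto
    then have "(a, g k) \<in> ?S ^^ (1 + (k - i))" by (simp only: relpow_add)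
    then have "W (1 + (k - i))" using ij(3) g(2) unfolding W_def by blast
    moreover have "1 + (k - i) < k" using ij by linarith
    ultimately show False using min by blast
  qed
  have farB: "\<not> R b (g i)" if ij: "i + 2 \<le> k" "b \<in> B" for i b
  proof
    assume "R b (g i)"
    then have "(g 0, b) \<in> ?S ^^ i O ?S ^^ 1" using seg[of 0 i] ij Rsym by (intro relcomp.relcompI) auto
    then have "(g 0, b) \<in> ?S ^^ (i + 1)" by (simp only: relpow_add)
    then have "W (i + 1)" using ij(2) g(1) unfolding W_def by blast
    moreover have "i + 1 < k" using ij by linarith
    ultimately show False using min by blast
  qed
  show ?thesis using k2 g notA notB ind farA farB by (intro exI[of _ k] exI[of _ g]) auto
qed

text \<open>If no such path exists, then away from the ends every neighbour of \<open>r\<close> in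
  the window is followed by another one two or three places later. All these neighbours have the
  same colours \<open>p\<close> and \<open>c\<close>, which forbids chords among them and among
  their successors, and four of them with their successors provide a \<open>P6\<close>. The length
  30 leaves room for four neighbours far from both ends.\<close>

lemma triple_or_P6:
  assumes P6: "\<And>a b c d e f. \<not> indP6 R a b c d e f"
    and r: "r \<notin> {s..<s + n}" and n: "30 \<le> n" and i0: "i0 \<in> {s..<s + n}" "R i0 r"
  shows "\<exists>x\<in>{s..<s + n}. \<exists>y\<in>{s..<s + n}. \<exists>z\<in>{s..<s + n}. R x y \<and> R y z \<and> \<not> R x z \<and> R z r \<and> \<not> R x r \<and> \<not> R y r"
proof (rule ccontr)
  assume no: "\<not> ?thesis"
  have no': "R x z" if "R x y" "R y z" "R z r" "\<not> R x r" "\<not> R y r" "x \<in> {s..<s + n}" "y \<in> {s..<s + n}" "z \<in> {s..<s + n}" for x y z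
    using no that by blast
  let ?D = "\<lambda>i. R i r"
  have single: "\<not> ?D (Suc i)" if "?D i" "s < i" "Suc (Suc i) < s + n" for i
    using not_both[of i r] that r by auto
  have single': "\<not> ?D (i - 1)" if i: "?D i" "s + 1 < i" "i + 1 < s + n" for i
  proof -
    obtain k where "i = Suc k" using i(2) by (cases i) auto
    then show ?thesis using single[of k] i by auto
  qed
  have up: "?D (i + 2) \<or> (R i (i + 2) \<and> ?D (i + 3))" if i: "?D i" "s < i" "i + 4 < s + n" for i
  proof (rule ccontr)
    assume a: "\<not> ?thesis"
    have n1: "\<not> ?D (i + 1)" using single[of i] i by simp
    have n2: "\<not> ?D (i + 2)" using a by simp
    have "R i (i + 2)"
      using no'[of "i + 2" "i + 1" i] Rsuc[of i] Rsuc[of "i + 1"] Rsym n1 n2 i by (auto simp: numeral_2_eq_2)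
    moreover from this have n3: "\<not> ?D (i + 3)" using a by simp
    moreover have "R (i + 3) (i + 2)" using Rsuc[of "i + 2"] Rsym by (simp add: numeral_3_eq_3)
    ultimately have "R (i + 3) i" using no'[of "i + 3" "i + 2" i] n2 i Rsym[of i "i + 2"] by auto
    then have "p i = c (i + 3)" "p i = c (i + 2)" using chord_eq[of i "i + 3"] chord_eq[of i "i + 2"] \<open>R i (i + 2)\<close> Rsym by auto
    then show False using pc[of "i + 3"] pSuc[of "i + 2"] by (simp add: numeral_3_eq_3)
  qed
  have down: "?D (i - 2) \<or> (R (i - 2) i \<and> ?D (i - 3))" if i: "?D i" "s + 4 < i" "i + 1 < s + n" for i
  proof (rule ccontr)
    assume a: "\<not> ?thesis"
    have e: "R (i - 1) i" "R (i - 2) (i - 1)" "R (i - 3) (i - 2)" using Rsuc[of "i - 1"] Rsuc[of "i - 2"] Rsuc[of "i - 3"] i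
      by (auto simp: Suc_diff_Suc numeral_2_eq_2 numeral_3_eq_3)
    have n1: "\<not> ?D (i - 1)" using single'[of i] i by simp
    have n2: "\<not> ?D (i - 2)" using a by simp
    have m: "i - 1 \<in> {s..<s + n}" "i - 2 \<in> {s..<s + n}" "i - 3 \<in> {s..<s + n}" "i \<in> {s..<s + n}" using i by auto
    have d2: "R (i - 2) i" by (rule no'[OF e(2,1) i(1) n2 n1 m(2,1,4)])
    have n3: "\<not> ?D (i - 3)" using a d2 by simp
    have "R (i - 3) i" by (rule no'[OF e(3) d2 i(1) n3 n2 m(3,2,4)])
    then have "p (i - 3) = c i" "p (i - 2) = c i" using chord_eq[of "i - 3" i] chord_eq[of "i - 2" i] d2 i by auto
    moreover have "p (i - 2) = c (i - 3)" using pSuc[of "i - 3"] i by (simp add: Suc_diff_Suc numeral_2_eq_2 numeral_3_eq_3)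
    ultimately show False using pc[of "i - 3"] by simp
  qed
  \<comment> \<open>A neighbour near the left end: \<open>down\<close> walks there from the right,
    \<open>up\<close> walks inwards from the left, and \<open>ends\<close> excludes that only the
    two extreme vertices are adjacent to \<open>r\<close>.\<close>
  have ex: "\<exists>d. ?D d \<and> s + 5 < d \<and> d < s + 10"
  proof -
    have small: "\<exists>d. ?D d \<and> s + 5 < d \<and> d < s + 10" if "?D i" "s + 5 < i" "i + 1 < s + n" for i
      using that
    proof (induction i rule: less_induct)
      case (less i)
      show ?case
      proof (cases "i < s + 10")
        case False
        then have "?D (i - 2) \<or> ?D (i - 3)" using down[of i] less.prems by linarith
        moreover have "i - 2 < i" "s + 5 < i - 2" "i - 2 + 1 < s + n" "i - 3 < i" "s + 5 < i - 3" "i - 3 + 1 < s + n"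
          using less.prems False by auto
        ultimately show ?thesis using less.IH[of "i - 2"] less.IH[of "i - 3"] by metis
      qed (use less.prems in blast)
    qed
    have big: "\<exists>d. ?D d \<and> s + 5 < d \<and> d + 1 < s + n" if "?D i" "s < i" "i \<le> s + 5" for i
    proof -
      have "\<exists>d. ?D d \<and> s + 5 < d \<and> d < s + 10" using that
      proof (induction "s + 5 - i" arbitrary: i rule: less_induct)
        case less
        have "i + 4 < s + n" using less.prems n by linarith
        then have D23: "?D (i + 2) \<or> ?D (i + 3)" using up[of i] less.prems(1,2) by blast
        define j where "j = (if ?D (i + 2) then i + 2 else i + 3)"
        have j: "?D j" "i < j" "j \<le> i + 3" using D23 unfolding j_def by auto
        show ?case
        proof (cases "j \<le> s + 5")
          case True
          then have "s + 5 - j < s + 5 - i" "s < j" using j less.prems by linarith+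
          then show ?thesis using less.hyps[of j] j(1) True by blast
        next
          case False then show ?thesis using j less.prems by (intro exI[of _ j]) auto
        qed
      qed
      then show ?thesis using n by auto
    qed
    have ends: "\<exists>i. ?D i \<and> s < i \<and> i + 1 < s + n"
    proof (rule ccontr)
      assume a: "\<not> ?thesis"
      have nD: "\<not> ?D i" if "s < i" "i + 1 < s + n" for i using a that by blast
      have "i0 = s \<or> i0 = s + n - 1" using i0 nD[of i0] by (cases "i0 = s"; cases "Suc i0 < s + n") auto
      then show False
      proof
        assume e: "i0 = s"
        have r2: "R s (s + 2)" using no'[of "s + 2" "s + 1" s] nD[of "s + 1"] nD[of "s + 2"] i0 e n Rsuc[of s] Rsuc[of "s + 1"] Rsym
          by (auto simp: numeral_2_eq_2)
        have "R (s + 3) s" using no'[of "s + 3" "s + 2" s] nD[of "s + 3"] nD[of "s + 2"] i0 e n Rsuc[of "s + 2"] Rsym r2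
          by (auto simp: numeral_3_eq_3)
        then have "p s = c (s + 3)" "p s = c (s + 2)" using chord_eq[of s "s + 3"] chord_eq[of s "s + 2"] r2 Rsym by auto
        then show False using pc[of "s + 3"] pSuc[of "s + 2"] by (simp add: numeral_3_eq_3)
      next
        assume e: "i0 = s + n - 1"
        define m where "m = s + n - 4"
        have m: "i0 = m + 3" "s < m" "m + 4 = s + n" using e n unfolding m_def by auto
        have r2: "R (m + 1) (m + 3)" using no'[of "m + 1" "m + 2" "m + 3"] nD[of "m + 1"] nD[of "m + 2"] i0 m Rsuc[of "m + 1"] Rsuc[of "m + 2"]
          by (auto simp: numeral_2_eq_2 numeral_3_eq_3)
        have r3: "R m (m + 3)" using no'[of m "m + 1" "m + 3"] nD[of "m + 1"] nD[of m] i0 m Rsuc[of m] r2 by auto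
        have "p m = c (m + 3)" "p (m + 1) = c (m + 3)" using chord_eq[of m "m + 3"] chord_eq[of "m + 1" "m + 3"] r2 r3 by auto
        then show False using pc[of m] pSuc[of m] by simp
      qed
    qed
    then obtain i where i: "?D i" "s < i" "i + 1 < s + n" by blast
    show ?thesis
    proof (cases "s + 5 < i")
      case True then show ?thesis using small i by blast
    next
      case False
      then obtain d where "?D d" "s + 5 < d" "d + 1 < s + n" using big[OF i(1,2)] by auto
      then show ?thesis using small by blast
    qed
  qed
  \<comment> \<open>The next neighbour of \<open>r\<close>. If it is three places away, a chord from
    \<open>d + 1\<close> skips the vertex in between.\<close>
  define nx where "nx d = (if ?D (d + 2) then d + 2 else d + 3)" for d
  have nxD: "?D (nx d)" "R (d + 1) (nx d)" "d + 2 \<le> nx d" "nx d \<le> d + 3" if d: "?D d" "s + 5 < d" "d + 5 < s + n" for d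
  proof -
    show "?D (nx d)" using up[of d] d unfolding nx_def by auto
    show "R (d + 1) (nx d)"
    proof (cases "?D (d + 2)")
      case True then show ?thesis using Rsuc[of "d + 1"] unfolding nx_def by simp
    next
      case False
      then have D3: "?D (d + 3)" using up[of d] d by auto
      have "\<not> ?D (d + 1)" using single[of d] d by simp
      then show ?thesis using down[of "d + 3"] D3 d False unfolding nx_def by auto
    qed
    show "d + 2 \<le> nx d" "nx d \<le> d + 3" unfolding nx_def by auto
  qed
  obtain d1 where d1: "?D d1" "s + 5 < d1" "d1 < s + 10" using ex by blast
  define d2 d3 d4 where "d2 = nx d1" and "d3 = nx d2" and "d4 = nx d3"
  have b: "d1 + 5 < s + n" using d1 n by simp
  have D2: "?D d2" "R (d1 + 1) d2" "d1 + 2 \<le> d2" "d2 \<le> d1 + 3" using nxD[OF d1(1,2) b] unfolding d2_def by auto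
  have b2: "s + 5 < d2" "d2 + 5 < s + n" using D2 d1 n by auto
  have D3: "?D d3" "R (d2 + 1) d3" "d2 + 2 \<le> d3" "d3 \<le> d2 + 3" using nxD[OF D2(1) b2] unfolding d3_def by auto
  have b3: "s + 5 < d3" "d3 + 5 < s + n" using D3 D2 d1 n by auto
  have D4: "?D d4" "R (d3 + 1) d4" "d3 + 2 \<le> d4" "d4 \<le> d3 + 3" using nxD[OF D3(1) b3] unfolding d4_def by auto
  have b4: "d4 + 4 < s + n" using D4 D3 D2 d1 n by auto
  \<comment> \<open>\<open>r\<close> lies on one side of the window, so all chords to it have the
    same orientation and fix the colours of their ends in the same way.\<close>
  have ty: "c x = c y \<and> p x = p y" if "?D x" "?D y" "s + 5 < x" "s + 5 < y" "x + 2 < s + n" "y + 2 < s + n" for x y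
  proof (cases "r < s")
    case True
    have "Suc r < x" "Suc r < y" using that True by auto
    then have "p r = c x" "p r = c y" "c r \<noteq> p x" "c r \<noteq> p y" "c r \<noteq> c x" using that chord_eq[of r x] chord_eq[of r y] chord[of r x] chord[of r y] Rsym by auto
    then show ?thesis using pc[of x] pc[of y] col_eqI[of "p x" "c x" "c r" "p y"] by auto
  next
    case False
    then have "Suc x < r" "Suc y < r" using r that by auto
    then have "p x = c r" "p y = c r" "c x \<noteq> p r" "c y \<noteq> p r" using that chord_eq[of x r] chord_eq[of y r] chord[of x r] chord[of y r] by auto
    then show ?thesis using pc[of x] pc[of y] pc[of r] col_eqI[of "c x" "c r" "p r" "c y"] by auto
  qed
  have t2: "c d2 = c d1" "p d2 = p d1" and t3: "c d3 = c d1" "p d3 = p d1" and t4: "c d4 = c d1" "p d4 = p d1"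
    using ty[of d2 d1] ty[of d3 d1] ty[of d4 d1] d1 D2 D3 D4 n by auto
  have pk: "p (d + 1) = c d" for d using pSuc[of d] by simp
  have dd: "\<not> R x y" if "c x = c y" "Suc x < y" for x y using chord[of x y] that by blast
  have kk: "\<not> R x y" if "p x = p y" "Suc x < y" for x y using chord[of x y] that by blast
  have dk: "\<not> R x (y + 1)" if "c x = c y" "x < y" for x y using chord[of x "y + 1"] that pk[of y] by auto
  have kd: "\<not> R (x + 1) z" if x: "?D x" "s + 5 < x" "x + 5 < s + n" and z: "nx x < z" "?D z" "z < s + n" "c z = c x" "p z = p x" for x z
  proof
    assume a: "R (x + 1) z"
    have n1: "\<not> ?D (x + 1)" using single[of x] x by simp
    show False
    proof (cases "?D (x + 2)")
      case True
      have "c (x + 1) = p x" using ty[of "x + 2" x] True x pk[of "x + 1"] by auto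
      then show False using chord[of "x + 1" z] a z nxD[OF x] by auto
    next
      case False
      have "s \<le> z" using z(1) nxD(3)[OF x] x by linarith
      then have "R (x + 2) z" using no'[of "x + 2" "x + 1" z] a n1 False z x Rsuc[of "x + 1"] Rsym by (auto simp: numeral_2_eq_2)
      moreover have "c (x + 2) = p x" using ty[of "nx x" x] nxD[OF x] pk[of "x + 2"] x False unfolding nx_def by (auto simp: numeral_3_eq_3)
      moreover have "Suc (x + 2) < z" using z False unfolding nx_def by auto
      ultimately show False using chord[of "x + 2" z] z by auto
    qed
  qed
  have "indP6 R (d1 + 1) d2 (d2 + 1) d3 (d3 + 1) d4"
    unfolding indP6_def
    using D2 D3 D4 Rsuc[of d2] Rsuc[of d3]
      kk[of "d1 + 1" "d2 + 1"] kk[of "d1 + 1" "d3 + 1"] kk[of "d2 + 1" "d3 + 1"] pk t2 t3 t4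
      dd[of d2 d3] dd[of d2 d4] dd[of d3 d4] dk[of d2 d3]
      kd[OF d1(1,2) b, of d3] kd[OF d1(1,2) b, of d4] kd[OF D2(1) b2, of d4] d2_def[symmetric] d3_def[symmetric] d4_def[symmetric] b4
    by auto
  then show False using P6 by blast
qed

text \<open>A shortest connection of the windows is prolonged inside them by mixed edges. If only
  one vertex lies between the windows, this gives five vertices, and the longer tail of
  \<open>triple_or_P6\<close> on one side supplies the sixth.\<close>

lemma anticomplete_windows_P6:
  assumes P6: "\<And>a b c d e f. \<not> indP6 R a b c d e f" and n: "30 \<le> n"
    and st: "s + n < t" and ac: "\<And>i j. i \<in> {s..<s + n} ==> j \<in> {t..<t + n} ==> \<not> R i j"
  shows False
proof -
  let ?A = "{s..<s + n}" and ?B = "{t..<t + n}"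
  obtain k g where k: "2 \<le> k" and g: "g 0 \<in> ?A" "g k \<in> ?B" "\<And>i. i < k ==> R (g i) (g (Suc i))"
    and nA: "\<And>i. 0 < i ==> i < k ==> g i \<notin> ?A" and nB: "\<And>i. 0 < i ==> i < k ==> g i \<notin> ?B"
    and ind: "\<And>i j. i + 2 \<le> j ==> j \<le> k ==> \<not> R (g i) (g j)"
    and fA: "\<And>i a. 2 \<le> i ==> i \<le> k ==> a \<in> ?A ==> \<not> R a (g i)" and fB: "\<And>i b. i + 2 \<le> k ==> b \<in> ?B ==> \<not> R b (g i)"
    using shortest_connection[of ?A ?B] ac st n by (auto simp: Ball_def)
  have r1: "g 1 \<notin> ?A" "R (g 0) (g 1)" using nA[of 1] g(3)[of 0] k by auto
  obtain p1 p2 where p: "p1 \<in> ?A" "p2 \<in> ?A" "R p1 p2" "R p1 (g 1)" "\<not> R p2 (g 1)"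
    using mixed_edge[OF r1(1) _ g(1) r1(2)] n by auto
  define l where "l = k - 1"
  have l: "k = Suc l" "1 \<le> l" using k unfolding l_def by auto
  have r2: "g l \<notin> ?B" "R (g k) (g l)" using nB[of l] g(3)[of l] l Rsym by auto
  obtain q1 q2 where q: "q1 \<in> ?B" "q2 \<in> ?B" "R q1 q2" "R q1 (g l)" "\<not> R q2 (g l)"
    using mixed_edge[OF r2(1) _ g(2) r2(2)] n by auto
  consider "k = 2" | "k = 3" | "4 \<le> k" using k by linarith
  then show False
  proof cases
    case 1
    then have l1: "l = 1" using l by simp
    obtain x y z where x: "x \<in> ?A" "y \<in> ?A" "z \<in> ?A" "R x y" "R y z" "\<not> R x z" "R z (g 1)" "\<not> R x (g 1)" "\<not> R y (g 1)"
      using triple_or_P6[OF P6 r1(1) n g(1) r1(2)] by blast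
    have "indP6 R x y z (g 1) q1 q2"
      unfolding indP6_def using x q ac[of x q1] ac[of x q2] ac[of y q1] ac[of y q2] ac[of z q1] ac[of z q2] Rsym l1 by blast
    then show False using P6 by blast
  next
    case 2
    then have "l = 2" using l by simp
    then have "indP6 R p2 p1 (g 1) (g 2) q1 q2"
      unfolding indP6_def using p q g(3)[of 1] 2 ac[of p1 q1] ac[of p1 q2] ac[of p2 q1] ac[of p2 q2] fA[of 2 p1] fA[of 2 p2] fB[of 1 q1] fB[of 1 q2] Rsym
      by (auto simp: numeral_2_eq_2)
    then show False using P6 by blast
  next
    case 3
    have "indP6 R p2 p1 (g 1) (g 2) (g 3) (g 4)"
      unfolding indP6_def using p g(3)[of 1] g(3)[of 2] g(3)[of 3] 3 fA[of 2 p1] fA[of 2 p2] fA[of 3 p1] fA[of 3 p2] fA[of 4 p1] fA[of 4 p2]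
        ind[of 1 3] ind[of 1 4] ind[of 2 4] Rsym
      by (auto simp: numeral_2_eq_2 numeral_3_eq_3 eval_nat_numeral)
    then show False using P6 by blast
  qed
qed

end


section \<open>Repeating windows and half graphs\<close>

context chain
begin

text \<open>The colours, the inner adjacencies and the cross adjacencies are packed into finite
  sets, so that a single application of Ramsey's theorem makes all of them independent of the chosen
  tuples.\<close>

lemma tuple_ramsey:
  fixes q :: "nat => nat => nat"
  shows "\<exists>r M I pt ct. strict_mono (r :: nat => nat) \<and>
    (\<forall>k a. a < t --> p (q (r k) a) = pt a \<and> c (q (r k) a) = ct a) \<and>
    (\<forall>k a b. a < t --> b < t --> R (q (r k) a) (q (r k) b) = I a b) \<and>
    (\<forall>k l a b. k < l --> a < t --> b < t --> R (q (r k) a) (q (r l) b) = M a b)"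
proof -
  let ?h = "\<lambda>k l. ({(a, x, y). a < t \<and> x = p (q k a) \<and> y = c (q k a)}, {(a, b). a < t \<and> b < t \<and> R (q k a) (q k b)},
    {(a, b). a < t \<and> b < t \<and> R (q k a) (q l b)})"
  let ?B = "Pow ({..<t} \<times> (UNIV :: (col \<times> col) set)) \<times> Pow ({..<t} \<times> {..<t}) \<times> Pow ({..<t} \<times> {..<t})"
  define h where "h = ?h"
  have fin: "finite ?B" by simp
  have hB: "h k l \<in> ?B" for k l unfolding h_def by auto
  obtain r b where r0: "strict_mono (r :: nat => nat) \<and> (\<forall>k l. k < l --> h (r k) (r l) = b)"
    using ramsey_pairs[of ?B h, OF fin hB] by (elim exE)
  have r: "strict_mono r" "\<And>k l. k < l ==> ?h (r k) (r l) = b"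
    using r0 unfolding h_def by simp_all
  have eq: "?h (r k) (r l) = ?h (r 0) (r 1)" if "k < l" for k l using r(2)[OF that] r(2)[of 0 1] by simp
  have t: "p (q (r k) a) = p (q (r 0) a) \<and> c (q (r k) a) = c (q (r 0) a)" if "a < t" for k a
  proof -
    have "{(a, x, y). a < t \<and> x = p (q (r k) a) \<and> y = c (q (r k) a)} = {(a, x, y). a < t \<and> x = p (q (r 0) a) \<and> y = c (q (r 0) a)}"
      using eq[of k "Suc k"] by simp
    then have "(a, p (q (r k) a), c (q (r k) a)) \<in> {(a, x, y). a < t \<and> x = p (q (r 0) a) \<and> y = c (q (r 0) a)} \<longleftrightarrow>
      (a, p (q (r k) a), c (q (r k) a)) \<in> {(a, x, y). a < t \<and> x = p (q (r k) a) \<and> y = c (q (r k) a)}" by simp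
    then show ?thesis using that by simp
  qed
  have i: "R (q (r k) a) (q (r k) b) = R (q (r 0) a) (q (r 0) b)" if "a < t" "b < t" for k a b
  proof -
    have "{(a, b). a < t \<and> b < t \<and> R (q (r k) a) (q (r k) b)} = {(a, b). a < t \<and> b < t \<and> R (q (r 0) a) (q (r 0) b)}"
      using eq[of k "Suc k"] by simp
    then have "(a, b) \<in> {(a, b). a < t \<and> b < t \<and> R (q (r k) a) (q (r k) b)} \<longleftrightarrow> (a, b) \<in> {(a, b). a < t \<and> b < t \<and> R (q (r 0) a) (q (r 0) b)}" by simp
    then show ?thesis using that by simp
  qed
  have m: "R (q (r k) a) (q (r l) b) = R (q (r 0) a) (q (r 1) b)" if "k < l" "a < t" "b < t" for k l a b
  proof -
    have "{(a, b). a < t \<and> b < t \<and> R (q (r k) a) (q (r l) b)} = {(a, b). a < t \<and> b < t \<and> R (q (r 0) a) (q (r 1) b)}"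
      using eq[OF that(1)] by simp
    then have "(a, b) \<in> {(a, b). a < t \<and> b < t \<and> R (q (r k) a) (q (r l) b)} \<longleftrightarrow> (a, b) \<in> {(a, b). a < t \<and> b < t \<and> R (q (r 0) a) (q (r 1) b)}" by simp
    then show ?thesis using that by simp
  qed
  show ?thesis
    by (intro exI[of _ r] exI[of _ "\<lambda>a b. R (q (r 0) a) (q (r 1) b)"] exI[of _ "\<lambda>a b. R (q (r 0) a) (q (r 0) b)"]
        exI[of _ "\<lambda>a. p (q (r 0) a)"] exI[of _ "\<lambda>a. c (q (r 0) a)"] conjI allI impI)
      ((rule r(1) | rule t[THEN conjunct1] | rule t[THEN conjunct2] | rule i | rule m); assumption)+
qed

end

text \<open>Equally spaced windows of length \<open>t\<close> starting at \<open>w 0 < w 1 < \<dots>\<close> that all look alike,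
  \<open>M\<close> being the common adjacency from an earlier to a later window.\<close>

locale windows = chain +
  fixes w :: "nat => nat" and t :: nat and M I :: "nat => nat => bool" and pt ct :: "nat => col"
  assumes sep: "k < l ==> w k + t < w l"
    and ptw: "a < t ==> p (w k + a) = pt a" and ctw: "a < t ==> c (w k + a) = ct a"
    and Iw: "a < t ==> b < t ==> R (w k + a) (w k + b) = I a b"
    and Mw: "k < l ==> a < t ==> b < t ==> R (w k + a) (w l + b) = M a b"
begin

text \<open>Adjacency of position \<open>a\<close> in window \<open>k\<close> to position
  \<open>b\<close> in window \<open>l\<close>. Only the order of \<open>k\<close> and
  \<open>l\<close> matters, so checking a \<open>P6\<close> reduces to evaluating \<open>M\<close>
  and \<open>I\<close>.\<close>

definition Q :: "nat => nat => nat => nat => bool" where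
  "Q k a l b \<longleftrightarrow> (if k < l then M a b else if l < k then M b a else I a b)"

lemma RQ: "a < t ==> b < t ==> R (w k + a) (w l + b) = Q k a l b"
  using Mw[of k l a b] Mw[of l k b a] Iw[of a b k] Rcomm[of "w k + a" "w l + b"] unfolding Q_def
  by (cases "k < l"; cases "l < k") auto

lemma pct: "a < t ==> pt a \<noteq> ct a"
  using pc[of "w 0 + a"] ptw[of a 0] ctw[of a 0] by simp

lemma ptSuc: "Suc a < t ==> pt (Suc a) = ct a"
  using pSuc[of "w 0 + a"] ptw[of "Suc a" 0] ctw[of a 0] by simp

lemma ISuc: "Suc a < t ==> I a (Suc a)" "Suc a < t ==> I (Suc a) a"
  using Rsuc[of "w 0 + a"] Iw[of a "Suc a" 0] Iw[of "Suc a" a 0] Rsym[of "w 0 + a" "w 0 + Suc a"] by auto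

lemma Icomm: "a < t ==> b < t ==> I a b = I b a"
  using Iw[of a b 0] Iw[of b a 0] Rcomm by blast

lemma Ieqc: "a < t ==> b < t ==> Suc a < b ==> ct a = ct b ==> \<not> I a b"
  using Iw[of a b 0] chord[of "w 0 + a" "w 0 + b"] ctw[of a 0] ctw[of b 0] by auto

lemma Mrule: "M a b ==> a < t ==> b < t ==> pt a = ct b \<and> ct a \<noteq> pt b \<and> ct a \<noteq> ct b \<and> pt a \<noteq> pt b"
proof -
  assume a: "M a b" "a < t" "b < t"
  have R: "R (w 0 + a) (w 1 + b)" using Mw[of 0 1 a b] a by simp
  have l: "Suc (w 0 + a) < w 1 + b" using sep[of 0 1] a by simp
  show ?thesis using chord[OF R l] chord_eq[OF R l] ptw ctw a by simp
qed

lemma Mii: "a < t ==> \<not> M a a"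
  using Mrule[of a a] pct[of a] by auto

lemma MSuc: "Suc a < t ==> \<not> M a (Suc a)"
  using Mrule[of a "Suc a"] ptSuc[of a] by auto

lemma P6Q:
  assumes P6: "\<And>a b c d e f. \<not> indP6 R a b c d e f"
    and "i1 < t" "i2 < t" "i3 < t" "i4 < t" "i5 < t" "i6 < t"
    and "Q k1 i1 k2 i2" "Q k2 i2 k3 i3" "Q k3 i3 k4 i4" "Q k4 i4 k5 i5" "Q k5 i5 k6 i6"
    "\<not> Q k1 i1 k3 i3" "\<not> Q k1 i1 k4 i4" "\<not> Q k1 i1 k5 i5" "\<not> Q k1 i1 k6 i6" "\<not> Q k2 i2 k4 i4" "\<not> Q k2 i2 k5 i5" "\<not> Q k2 i2 k6 i6"
    "\<not> Q k3 i3 k5 i5" "\<not> Q k3 i3 k6 i6" "\<not> Q k4 i4 k6 i6"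
  shows False
  using P6[of "w k1 + i1" "w k2 + i2" "w k3 + i3" "w k4 + i4" "w k5 + i5" "w k6 + i6"] assms(2-) unfolding indP6_def by (simp add: RQ)

text \<open>By \<open>Mrule\<close> a cross edge ties the colours at \<open>x\<close> and
  \<open>y\<close> together, and neighbouring positions share a colour with them; each cross edge
  excluded here would break the chord rule.\<close>

lemma half_graph_facts:
  assumes M: "M x y" and b: "x < t" "y < t"
  shows "\<not> M y x" "Suc x < t ==> \<not> M (Suc x) y" "Suc y < t ==> \<not> M (Suc y) x" "Suc y < t ==> \<not> M x (Suc y)"
    "y = Suc ym ==> \<not> M x ym" "x = Suc xm ==> \<not> M xm y" "x = Suc xm ==> \<not> M y xm"
proof -
  note r = Mrule[OF M b]
  show "\<not> M y x" using Mrule[of y x] r b by auto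
  show "Suc x < t ==> \<not> M (Suc x) y" using Mrule[of "Suc x" y] r b ptSuc[of x] by auto
  show "Suc y < t ==> \<not> M (Suc y) x" using Mrule[of "Suc y" x] r b ptSuc[of y] by auto
  show "Suc y < t ==> \<not> M x (Suc y)" using Mrule[of x "Suc y"] r b ptSuc[of y] pct[of "Suc y"] by auto
  show "y = Suc ym ==> \<not> M x ym" using Mrule[of x ym] r b ptSuc[of ym] by auto
  show "x = Suc xm ==> \<not> M xm y" using Mrule[of xm y] r b ptSuc[of xm] pct[of xm] by auto
  show "x = Suc xm ==> \<not> M y xm" using Mrule[of y xm] r b ptSuc[of xm] pct[of y] by auto
qed

text \<open>The positions \<open>x\<close> and \<open>y\<close> form a half graph across the
  windows. In it, \<open>x\<close> of window 5, \<open>y\<close> of window 8, \<open>x\<close> of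
  window 0 and \<open>y\<close> of window 3 induce a \<open>P4\<close>, and the neighbours
  \<open>pp\<close> and \<open>qq\<close> inside windows 5 and 3 prolong it at both ends. If
  \<open>qq\<close> is adjacent to later copies of \<open>pp\<close>, that edge becomes part of
  another \<open>P6\<close>.\<close>

lemma half_graph_ends:
  assumes P6: "\<And>a b c d e f. \<not> indP6 R a b c d e f"
    and M: "M x y" and b: "x < t" "y < t" "pp < t" "qq < t" and I: "I pp x" "I y qq"
    and n: "\<not> M y pp" "\<not> M x pp" "\<not> M pp y" "\<not> M qq x" "\<not> M qq y" "\<not> M x qq" and e: "M qq pp ==> \<not> M pp x"
  shows False
proof (cases "M qq pp")
  case False
  show False
    by (rule P6Q[OF P6 b(3,1,2,1,2,4), of 5 5 8 0 3 3]) (use M I n False half_graph_facts[OF M b(1,2)] Mii b in \<open>simp_all add: Q_def\<close>)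
next
  case True
  show False
    by (rule P6Q[OF P6 b(2,4,3,1,2,1), of 3 3 5 5 8 6]) (use M I n e True half_graph_facts[OF M b(1,2)] Mii b in \<open>simp_all add: Q_def\<close>)
qed

text \<open>Choosing \<open>pp\<close> and \<open>qq\<close> just before or just after
  \<open>x\<close> and \<open>y\<close> gives four instances of \<open>half_graph_ends\<close>. Each
  can only fail through a further cross edge, and \<open>e13\<close> and \<open>e42\<close> derive
  more cross edges from these.\<close>

lemma half_graph_dense:
  assumes P6: "\<And>a b c d e f. \<not> indP6 R a b c d e f"
    and M: "M x y" and x: "x = Suc xm" and y: "y = Suc ym" and b: "Suc x < t" "Suc y < t"
  shows "M x xm \<and> (M y (Suc x) \<or> M ym x)"
proof -
  have b': "x < t" "y < t" "xm < t" "ym < t" using b x y by auto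
  note r = Mrule[OF M b'(1,2)]
  note h = half_graph_facts[OF M b'(1,2)]
  note I = ISuc[of xm] ISuc[of x] ISuc[of ym] ISuc[of y]
  have pty: "ct ym = pt y" "pt (Suc y) = ct y" "ct xm = pt x" "pt (Suc x) = ct x" using ptSuc b b' x y by auto
  have h': "\<not> M x ym" "\<not> M xm y" "\<not> M y xm" using h x y by auto
  have pxp: "M qq (Suc x) ==> \<not> M (Suc x) x" if "qq = Suc y \<or> qq = ym" for qq
  proof -
    assume m: "M qq (Suc x)"
    have q: "qq < t" using that b b' by auto
    have "ct (Suc x) = pt x"
    proof -
      have "pt qq \<noteq> pt y" using that pty r pct[of ym] b' by auto
      then have "ct (Suc x) \<noteq> pt y" "ct (Suc x) \<noteq> ct x" using Mrule[OF m q b(1)] pty pct[of "Suc x"] b by auto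
      then show ?thesis using col_eqI[of "ct (Suc x)" "pt y" "ct x" "pt x"] r pct[of x] b' by auto
    qed
    then show "\<not> M (Suc x) x" using Mrule[of "Suc x" x] b b' by auto
  qed
  have n1: "M y (Suc x) \<or> M ym x"
    using half_graph_ends[OF P6 M b'(1,2) b(1) b'(4)] I h h' pxp[of ym] MSuc[of ym] MSuc[of x] b b' x y by auto
  have n2: "M y (Suc x) \<or> M (Suc y) y"
    using half_graph_ends[OF P6 M b'(1,2) b(1) b(2)] I h h' pxp[of "Suc y"] MSuc[of x] b b' x y by auto
  have n3: "M x xm \<or> M ym x"
    using half_graph_ends[OF P6 M b'(1,2,3,4)] I h h' MSuc[of ym] MSuc[of xm] b b' x y by auto
  have n4: "M x xm \<or> M (Suc y) y"
    using half_graph_ends[OF P6 M b'(1,2,3) b(2)] I h h' MSuc[of xm] b b' x y by auto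
  have e13: "M (Suc y) y" if e1: "M y (Suc x)"
  proof (rule ccontr)
    assume e3: "\<not> M (Suc y) y"
    have "\<not> M (Suc y) (Suc x)" using Mrule[of "Suc y" "Suc x"] Mrule[OF e1 b'(2) b(1)] pty r b pct[of y] b' by auto
    then show False
      using P6Q[OF P6 b(2) b'(2) b(1) b'(1,2,1), of 0 0 3 3 5 1] M e1 e3 h I Mii MSuc[of x] b b' unfolding Q_def by auto
  qed
  have e42: "M x xm" if e4: "M ym x"
  proof (rule ccontr)
    assume e2: "\<not> M x xm"
    have "\<not> M ym xm" using Mrule[of ym xm] Mrule[OF e4 b'(4,1)] pty r b' pct[of x] by auto
    then show False
      using P6Q[OF P6 b'(3,1,4,2,1,2), of 5 5 2 2 0 4] M e4 e2 h h' I Mii MSuc[of ym] b b' x y unfolding Q_def by auto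
  qed
  show ?thesis using n1 n2 n3 n4 e13 e42 by blast
qed

text \<open>A first use of \<open>half_graph_dense\<close> yields a half graph between the
  consecutive positions \<open>x\<close> and \<open>y\<close>. A second one leads to the cyclic
  pattern \<open>M x y\<close>, \<open>M y v\<close>, \<open>M v x\<close>, which contains a
  \<open>P6\<close> whether or not \<open>v\<close> and \<open>x\<close> are adjacent within a
  window.\<close>

lemma no_half_graph_P6:
  assumes P6: "\<And>a b c d e f. \<not> indP6 R a b c d e f"
    and M0: "M x y0" and x0: "x = Suc (Suc v)" "y0 = Suc ym0" and b0: "Suc x < t" "Suc y0 < t"
  shows False
proof -
  define y where "y = Suc v"
  have x: "x = Suc y" "y = Suc v" using x0 unfolding y_def by auto
  have b: "x < t" "y < t" "v < t" "Suc x < t" "Suc y < t" using b0 x by auto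
  have M: "M x y" using half_graph_dense[OF P6 M0 x(1) x0(2) b0] by simp
  note r = Mrule[OF M b(1,2)]
  note h = half_graph_facts[OF M b(1,2)]
  note I = ISuc[of y] ISuc[of v] ISuc[of x]
  have ptv: "ct v = pt y" "ct y = pt x" "pt (Suc x) = ct x" using ptSuc b x by auto
  have d: "M y (Suc x) \<or> M v x" using half_graph_dense[OF P6 M x(1,2) b(4,5)] by simp
  have e4: "M v x"
  proof (rule ccontr)
    assume e4: "\<not> M v x"
    then have e1: "M y (Suc x)" using d by simp
    have "\<not> M v (Suc x)" using Mrule[of v "Suc x"] Mrule[OF e1 b(2,4)] ptv b pct[of v] by auto
    then show False
      using P6Q[OF P6 b(3,2,4,1,2,1), of 0 0 3 3 5 1] M e1 e4 h I Mii MSuc[of x] MSuc[of v] b x unfolding Q_def by auto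
  qed
  have xv: "\<not> M x v" using h x by auto
  have vy: "\<not> M y x" "\<not> M v y" using h MSuc[of v] b x by auto
  have yv: "M y v"
  proof (rule ccontr)
    assume "\<not> M y v"
    then show False
      using P6Q[OF P6 b(2,1,2,3,1,3), of 0 0 3 3 5 1] M e4 h I Mii xv vy b x unfolding Q_def by auto
  qed
  show False
  proof (cases "I v x")
    case False
    then show False
      using P6Q[OF P6 b(3,1,2,1,2,3), of 0 2 3 0 1 2] M e4 yv h I Mii xv vy b x Icomm[of v x] unfolding Q_def by auto
  next
    case True
    then show False
      using P6Q[OF P6 b(3,1,2,3,2,3), of 0 2 4 4 1 3] M e4 yv h I Mii xv vy b x Icomm[of v x] unfolding Q_def by auto
  qed
qed

end

context chain
begin

text \<open>Candidate windows start at multiples of \<open>t + 2\<close>; the gap makes every edge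
  between two windows a chord.\<close>

lemma windows_exist: "\<exists>w M I pt ct. windows R p c w t M I pt ct"
proof -
  obtain r M I pt ct where r: "strict_mono (r :: nat => nat)"
    "\<And>k a. a < t ==> p (r k * (t + 2) + a) = pt a \<and> c (r k * (t + 2) + a) = ct a"
    "\<And>k a b. a < t ==> b < t ==> R (r k * (t + 2) + a) (r k * (t + 2) + b) = I a b"
    "\<And>k l a b. k < l ==> a < t ==> b < t ==> R (r k * (t + 2) + a) (r l * (t + 2) + b) = M a b"
    using tuple_ramsey[of t "\<lambda>k a. k * (t + 2) + a"] by auto
  have sep: "r k * (t + 2) + t < r l * (t + 2)" if "k < l" for k l
  proof -
    have "r k < r l" using r(1) that by (simp add: strict_mono_less)
    then have "Suc (r k) * (t + 2) \<le> r l * (t + 2)" by (intro mult_right_mono) auto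
    then show ?thesis by simp
  qed
  have "windows R p c (\<lambda>k. r k * (t + 2)) t M I pt ct"
    by unfold_locales (use r sep in auto)
  then show ?thesis by blast
qed

theorem chain_has_P6: "\<exists>a b c d e f. indP6 R a b c d e f"
proof (rule ccontr)
  assume "\<not> ?thesis"
  then have P6: "\<And>a b c d e f. \<not> indP6 R a b c d e f" by blast
  \<comment> \<open>Thirty positions for \<open>anticomplete_windows_P6\<close>, and a margin of
    three on either side for \<open>no_half_graph_P6\<close>.\<close>
  obtain w M I pt ct where "windows R p c w 36 M I pt ct" using windows_exist by blast
  then interpret windows R p c w 36 M I pt ct .
  show False
  proof (cases "\<exists>x\<in>{3..<33}. \<exists>y\<in>{3..<33}. M x y")
    case True
    then obtain x y where xy: "x \<in> {3..<33}" "y \<in> {3..<33}" "M x y" by blast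
    then have "x = Suc (Suc (x - 2))" "y = Suc (y - 1)" by auto
    then show False using no_half_graph_P6[OF P6 xy(3), of "x - 2" "y - 1"] xy by auto
  next
    case False
    have "\<not> R i j" if i: "i \<in> {w 0 + 3..<w 0 + 3 + 30}" and j: "j \<in> {w 1 + 3..<w 1 + 3 + 30}" for i j
    proof -
      have "R i j = M (i - w 0) (j - w 1)" using Mw[of 0 1 "i - w 0" "j - w 1"] i j by auto
      moreover have "i - w 0 \<in> {3..<33}" "j - w 1 \<in> {3..<33}" using i j by auto
      ultimately show ?thesis using False by blast
    qed
    then show False using anticomplete_windows_P6[OF P6, of 30 "w 0 + 3" "w 1 + 3"] sep[of 0 1] by auto
  qed
qed

end


section \<open>Forced colours as 2-satisfiability, and long propagation paths\<close>

context fgraph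
begin

text \<open>The colours of \<open>v\<close> that no \<open>s\<close> further vertices can refute.
  Propagation uses these lists because both colours of a chain vertex have to be realisable together
  with the whole chain.\<close>

definition flist :: "('a set => ('a => col) => bool) => nat => 'a => col set" where
  "flist \<Phi> s v = {d. \<forall>X. X \<subseteq> V --> card X \<le> s --> (\<exists>f. \<Phi> (insert v X) f \<and> f v = d)}"

definition two_lists :: "('a set => ('a => col) => bool) => bool" where
  "two_lists \<Phi> \<longleftrightarrow> (\<forall>v\<in>V. \<exists>c. \<forall>f. \<Phi> {v} f --> f v \<noteq> c)"

text \<open>The implications of a 2-satisfiability instance: the literal \<open>(v, a)\<close> takes
  \<open>a\<close> away from the neighbour \<open>w\<close> and leaves it the other colour
  \<open>b\<close> of its list.\<close>

definition st :: "('a => col set) => (('a \<times> col) \<times> ('a \<times> col)) set" where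
  "st L = {((v, a), (w, b)). v \<in> V \<and> w \<in> V \<and> E v w \<and> a \<in> L v \<and> a \<in> L w \<and> b \<in> L w \<and> a \<noteq> b}"

text \<open>A shortest chain of forced colours: colouring \<open>v i\<close> with \<open>c i\<close> forces \<open>c (Suc i)\<close>
  on \<open>v (Suc i)\<close>. Besides minimality, the chord rule uses that both colours of every list
  extend to the whole chain.\<close>

definition ppath :: "('a set => ('a => col) => bool) => nat => (nat => 'a) => (nat => col) => bool" where
  "ppath \<Phi> K v c \<longleftrightarrow>
    inj_on v {1..K} \<and> v ` {1..K} \<subseteq> V \<and>
    (\<forall>i. 1 \<le> i \<and> i < K --> E (v i) (v (Suc i))) \<and>
    (\<forall>i<K. c i \<noteq> c (Suc i)) \<and>
    (\<forall>i j. 1 \<le> i \<and> Suc i < j \<and> j \<le> K \<and> E (v i) (v j) -->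
       c i \<noteq> c (j - 1) \<and> c i \<noteq> c j \<and> c (i - 1) \<noteq> c (j - 1)) \<and>
    (\<forall>i f. 1 \<le> i \<and> i \<le> K \<and> \<Phi> {v i} f --> f (v i) = c (i - 1) \<or> f (v i) = c i) \<and>
    (\<forall>i d X. 1 \<le> i \<and> i \<le> K \<and> d \<in> {c (i - 1), c i} \<and> X \<subseteq> V \<and> card X \<le> K -->
       (\<exists>f. \<Phi> (insert (v i) X) f \<and> f (v i) = d))"

lemma flistD: "d \<in> flist \<Phi> s v ==> X \<subseteq> V ==> card X \<le> s ==> \<exists>f. \<Phi> (insert v X) f \<and> f v = d"
  unfolding flist_def by simp

text \<open>Every colour outside the list is refuted by some \<open>s\<close> vertices; the at most
  three refutations together keep \<open>v\<close> within its list.\<close>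

lemma flist_cert:
  assumes adm: "adm \<Phi>"
  shows "\<exists>C. C \<subseteq> V \<and> card C \<le> 3 * s \<and> (\<forall>X f. insert v C \<subseteq> X --> \<Phi> X f --> f v \<in> flist \<Phi> s v)"
proof -
  have "\<exists>X. X \<subseteq> V \<and> card X \<le> s \<and> (d \<notin> flist \<Phi> s v --> (\<forall>f. \<Phi> (insert v X) f --> f v \<noteq> d))" for d
  proof (cases "d \<in> flist \<Phi> s v")
    case True then show ?thesis by (intro exI[of _ "{}"]) simp
  next
    case False
    then obtain X where "X \<subseteq> V" "card X \<le> s" "\<not> (\<exists>f. \<Phi> (insert v X) f \<and> f v = d)"
      unfolding flist_def by auto
    then show ?thesis by (intro exI[of _ X]) auto
  qed
  then have "\<forall>d. \<exists>X. X \<subseteq> V \<and> card X \<le> s \<and> (d \<notin> flist \<Phi> s v --> (\<forall>f. \<Phi> (insert v X) f --> f v \<noteq> d))" ..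
  from choice[OF this] obtain B where B0: "\<forall>d. B d \<subseteq> V \<and> card (B d) \<le> s \<and>
     (d \<notin> flist \<Phi> s v --> (\<forall>f. \<Phi> (insert v (B d)) f --> f v \<noteq> d))" ..
  let ?C = "B CA \<union> B CB \<union> B CC"
  have "card ?C \<le> card (B CA) + card (B CB) + card (B CC)"
    using card_Un_le[of "B CA \<union> B CB" "B CC"] card_Un_le[of "B CA" "B CB"] by linarith
  also have "\<dots> \<le> s + s + s" using B0 by (intro add_mono) simp_all
  finally have c: "card ?C \<le> 3 * s" by simp
  have "f v \<in> flist \<Phi> s v" if X: "insert v ?C \<subseteq> X" "\<Phi> X f" for X f
  proof (rule ccontr)
    assume n: "f v \<notin> flist \<Phi> s v"
    have "B (f v) \<subseteq> ?C" by (cases "f v") auto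
    then have "insert v (B (f v)) \<subseteq> X" using X(1) by auto
    then have "\<Phi> (insert v (B (f v))) f" by (rule admD[OF adm X(2)])
    then show False using B0[rule_format, of "f v"] n by (metis (no_types))
  qed
  then show ?thesis using B0 c by (intro exI[of _ ?C]) auto
qed

lemma two_lists_eq:
  assumes "adm \<Phi>" "two_lists \<Phi>" "v \<in> V" "a \<in> flist \<Phi> s v" "b \<in> flist \<Phi> s v" "a \<noteq> b" "\<Phi> X f" "v \<in> X"
  shows "f v = a \<or> f v = b"
proof -
  obtain c where c: "\<And>f. \<Phi> {v} f ==> f v \<noteq> c" using assms(2,3) unfolding two_lists_def by auto
  obtain fa where fa: "\<Phi> (insert v {}) fa" "fa v = a" using flistD[OF assms(4), of "{}"] by auto
  obtain fb where fb: "\<Phi> (insert v {}) fb" "fb v = b" using flistD[OF assms(5), of "{}"] by auto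
  have "\<Phi> {v} f" by (rule admD[OF assms(1,7)]) (use assms(8) in simp)
  then have "f v \<noteq> c" "a \<noteq> c" "b \<noteq> c" using c fa fb by auto
  then show ?thesis using third_col[of a b c "f v"] assms(6) by auto
qed

lemma st_force:
  assumes "adm \<Phi>" "two_lists \<Phi>" "((v, a), (w, b)) \<in> st (flist \<Phi> s)" "\<Phi> X f" "v \<in> X" "w \<in> X" "f v = a"
  shows "f w = b"
proof -
  have s: "w \<in> V" "E v w" "a \<in> flist \<Phi> s w" "b \<in> flist \<Phi> s w" "a \<noteq> b" using assms(3) unfolding st_def by auto
  have "f w = a \<or> f w = b" using two_lists_eq[OF assms(1,2) s(1,3,4,5) assms(4,6)] .
  moreover have "f v \<noteq> f w" using adm_proper[OF assms(1,4,5,6)] s(2) by simp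
  ultimately show ?thesis using assms(7) by auto
qed

text \<open>A derivation with \<open>n\<close> steps involves \<open>n + 1\<close> vertices only, so
  it binds every local colouring that contains them.\<close>

lemma st_path_force:
  assumes adm: "adm \<Phi>" and two: "two_lists \<Phi>"
  shows "(x, y) \<in> st (flist \<Phi> s) ^^ n ==> fst x \<in> V ==>
    \<exists>P. P \<subseteq> V \<and> card P \<le> n + 1 \<and> fst x \<in> P \<and> fst y \<in> P \<and>
     (\<forall>X f. P \<subseteq> X --> \<Phi> X f --> f (fst x) = snd x --> f (fst y) = snd y)"
proof (induction n arbitrary: y)
  case 0
  then show ?case by (intro exI[of _ "{fst x}"]) auto
next
  case (Suc n)
  then obtain z where z: "(x, z) \<in> st (flist \<Phi> s) ^^ n" "(z, y) \<in> st (flist \<Phi> s)" by auto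
  obtain P where P: "P \<subseteq> V" "card P \<le> n + 1" "fst x \<in> P" "fst z \<in> P"
    "\<And>X f. P \<subseteq> X ==> \<Phi> X f ==> f (fst x) = snd x ==> f (fst z) = snd z"
    using Suc.IH[OF z(1) Suc.prems(2)] by auto
  have yV: "fst y \<in> V" using z(2) unfolding st_def by auto
  have z2: "((fst z, snd z), (fst y, snd y)) \<in> st (flist \<Phi> s)" using z(2) by simp
  have "f (fst y) = snd y" if X: "insert (fst y) P \<subseteq> X" "\<Phi> X f" "f (fst x) = snd x" for X f
  proof -
    have "f (fst z) = snd z" using P(5)[of X f] X by simp
    then show ?thesis using st_force[OF adm two z2 X(2)] X(1) P(4) by auto
  qed
  moreover have "card (insert (fst y) P) \<le> Suc n + 1"
    using P(2) card_insert_le_m1[of "n+2" P "fst y"] by simp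
  ultimately show ?case using P yV by (intro exI[of _ "insert (fst y) P"]) auto
qed

definition good :: "('a => col set) => ('a \<times> col) set => bool" where
  "good L S \<longleftrightarrow> S \<subseteq> (SIGMA v:V. L v) \<and> (\<forall>x\<in>S. \<forall>y. (x, y) \<in> st L --> y \<in> S) \<and>
    (\<forall>x\<in>S. \<forall>y\<in>S. (fst x = fst y --> snd x = snd y) \<and> (E (fst x) (fst y) --> snd x \<noteq> snd y))"

lemma st_rtrancl_lit: "(x, y) \<in> (st L)\<^sup>* ==> x \<in> (SIGMA v:V. L v) ==> y \<in> (SIGMA v:V. L v)"
  by (induction rule: rtrancl_induct) (auto simp: st_def)

text \<open>The usual argument for 2-satisfiability: a closed partial solution is not disturbed by
  deciding another vertex and propagating. Undecided vertices have two colours, so implications can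
  be reversed; if the propagation reached a decided vertex with the wrong colour, its predecessor
  would have been decided before.\<close>

lemma good_extend:
  assumes two: "\<And>w. w \<in> V ==> card (L w) \<le> 2" and g: "good L S"
    and v: "v \<in> V" "a \<in> L v" "v \<notin> fst ` S"
    and un: "\<And>w. w \<in> V ==> w \<notin> fst ` S ==> card (L w) = 2"
    and co: "\<And>x y. ((v, a), x) \<in> (st L)\<^sup>* ==> ((v, a), y) \<in> (st L)\<^sup>* ==>
       (fst x = fst y --> snd x = snd y) \<and> (E (fst x) (fst y) --> snd x \<noteq> snd y)"
  shows "good L (S \<union> (st L)\<^sup>* `` {(v, a)})"
proof -
  have lit: "S \<subseteq> (SIGMA v:V. L v)" and cS: "\<And>x y. x \<in> S ==> (x, y) \<in> st L ==> y \<in> S"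
    and fS: "\<And>x y. x \<in> S ==> y \<in> S ==> fst x = fst y ==> snd x = snd y"
    and eS: "\<And>x y. x \<in> S ==> y \<in> S ==> E (fst x) (fst y) ==> snd x \<noteq> snd y"
    using g unfolding good_def by blast+
  have l2: "L w = {p, q}" if "w \<in> V" "p \<in> L w" "q \<in> L w" "p \<noteq> q" for w p q
  proof -
    have "{p, q} \<subseteq> L w" "card {p, q} = 2" using that by auto
    then show ?thesis using two[OF that(1)] card_seteq[of "L w" "{p, q}"] by (simp add: finite_subset[of "L w" UNIV])
  qed
  have dom: "x \<in> S" if "((v, a), x) \<in> (st L)\<^sup>*" "fst x \<in> fst ` S" for x
    using that
  proof (induction rule: rtrancl_induct)
    case base then show ?case using v by simp
  next
    case (step u x)
    obtain u1 e where u: "u = (u1, e)" by (cases u)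
    obtain w d where x: "x = (w, d)" by (cases x)
    have s: "u1 \<in> V" "w \<in> V" "E u1 w" "e \<in> L u1" "e \<in> L w" "d \<in> L w" "e \<noteq> d" using step(2) unfolding u x st_def by auto
    obtain d' where d': "(w, d') \<in> S" using step.prems x by auto
    then have "d' \<in> L w" using lit by auto
    then have "d' = e \<or> d' = d" using l2[OF s(2,5,6,7)] by auto
    moreover have "d' \<noteq> e"
    proof
      assume "d' = e"
      then have we: "(w, e) \<in> S" using d' by simp
      have "u1 \<in> fst ` S"
      proof (rule ccontr)
        assume "u1 \<notin> fst ` S"
        then have "card (L u1) = 2" using un s(1) by blast
        then obtain e' where e': "e' \<in> L u1" "e' \<noteq> e"
          by (metis card_2_iff' s(4))
        have "((w, e), (u1, e')) \<in> st L" using s e' symE unfolding st_def by auto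
        then have "(u1, e') \<in> S" using cS we by blast
        then show False using \<open>u1 \<notin> fst ` S\<close> by (metis fst_conv imageI)
      qed
      then have "(u1, e) \<in> S" using step.IH u by simp
      then show False using eS[OF _ we, of "(u1, e)"] s(3) by simp
    qed
    ultimately show ?case using d' x by simp
  qed
  have cross: "(fst x = fst y --> snd x = snd y) \<and> (E (fst x) (fst y) --> snd x \<noteq> snd y)"
    if x: "x \<in> S" and y: "((v, a), y) \<in> (st L)\<^sup>*" for x y
  proof
    show "fst x = fst y --> snd x = snd y"
    proof
      assume "fst x = fst y"
      then have "fst y \<in> fst ` S" using x by (metis imageI)
      then have "y \<in> S" using dom[OF y] by blast
      then show "snd x = snd y" using fS[OF x] \<open>fst x = fst y\<close> by blast
    qed
    show "E (fst x) (fst y) --> snd x \<noteq> snd y"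
    proof
      assume e: "E (fst x) (fst y)"
      show "snd x \<noteq> snd y"
      proof
        assume s: "snd x = snd y"
        have yl: "fst y \<in> V" "snd y \<in> L (fst y)" using st_rtrancl_lit[OF y] v by auto
        have xl: "fst x \<in> V" "snd x \<in> L (fst x)" using lit x by auto
        have "fst y \<in> fst ` S"
        proof (rule ccontr)
          assume n: "fst y \<notin> fst ` S"
          then obtain e' where e': "e' \<in> L (fst y)" "e' \<noteq> snd y"
            using un[OF yl(1)] yl(2) by (metis card_2_iff')
          have "((fst x, snd x), (fst y, e')) \<in> st L" using e xl yl s e' unfolding st_def by auto
          then have "(fst y, e') \<in> S" using cS[of "(fst x, snd x)"] x by simp
          then show False using n by (metis fst_conv imageI)
        qed
        then have "y \<in> S" using dom[OF y] by blast
        then show False using eS[OF x _ e] s by blast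
      qed
    qed
  qed
  show ?thesis
    unfolding good_def
  proof (intro conjI ballI allI impI)
    show "S \<union> (st L)\<^sup>* `` {(v, a)} \<subseteq> (SIGMA v:V. L v)" using lit st_rtrancl_lit[of "(v, a)"] v by blast
  next
    fix x y assume "x \<in> S \<union> (st L)\<^sup>* `` {(v, a)}" "(x, y) \<in> st L"
    then show "y \<in> S \<union> (st L)\<^sup>* `` {(v, a)}" by (metis Image_singleton_iff Un_iff cS rtrancl.rtrancl_into_rtrancl)
  next
    fix x y assume "x \<in> S \<union> (st L)\<^sup>* `` {(v, a)}" "y \<in> S \<union> (st L)\<^sup>* `` {(v, a)}" "fst x = fst y"
    then show "snd x = snd y" using fS co cross by (metis Image_singleton_iff Un_iff)
  next
    fix x y assume "x \<in> S \<union> (st L)\<^sup>* `` {(v, a)}" "y \<in> S \<union> (st L)\<^sup>* `` {(v, a)}" "E (fst x) (fst y)"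
    then show "snd x \<noteq> snd y" using eS co cross symE by (metis Image_singleton_iff Un_iff)
  qed
qed

text \<open>A maximal closed partial solution above the consequences of all one-element lists
  decides every vertex, since otherwise \<open>good_extend\<close> enlarges it.\<close>

lemma maximal_good_colours:
  assumes two: "\<And>w. w \<in> V ==> card (L w) \<le> 2" and ne: "\<And>w. w \<in> V ==> L w \<noteq> {}"
    and units: "good L ((st L)\<^sup>* `` {(w, d). w \<in> V \<and> L w = {d}})"
    and co: "\<And>v a x y. v \<in> V ==> a \<in> L v ==> ((v, a), x) \<in> (st L)\<^sup>* ==> ((v, a), y) \<in> (st L)\<^sup>* ==>
       (fst x = fst y --> snd x = snd y) \<and> (E (fst x) (fst y) --> snd x \<noteq> snd y)"
  shows "\<exists>f. proper V f"
proof -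
  let ?S0 = "(st L)\<^sup>* `` {(w, d). w \<in> V \<and> L w = {d}}"
  let ?F = "{S. ?S0 \<subseteq> S \<and> good L S}"
  have finL: "finite (SIGMA v:V. L v)" using finV by (auto intro: finite_subset[OF _ finite[of "UNIV :: col set"]])
  have "?F \<subseteq> Pow (SIGMA v:V. L v)" unfolding good_def by blast
  then have "finite ?F" using finL by (meson finite_Pow_iff finite_subset)
  moreover have "?F \<noteq> {}" using units by blast
  ultimately have "\<exists>m\<in>?F. \<forall>b\<in>?F. m \<le> b --> m = b" by (rule finite_has_maximal)
  then obtain S where S0: "S \<in> ?F" and mx0: "\<forall>b\<in>?F. S \<le> b --> S = b" ..
  have S: "?S0 \<subseteq> S" "good L S" using S0 by simp_all
  have mx: "S' = S" if "?S0 \<subseteq> S'" "good L S'" "S \<subseteq> S'" for S'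
    using mx0[rule_format, of S'] that by simp
  have un: "card (L w) = 2" if w: "w \<in> V" "w \<notin> fst ` S" for w
  proof (rule ccontr)
    assume "card (L w) \<noteq> 2"
    moreover have "card (L w) \<noteq> 0" using ne[OF w(1)] by (simp add: finite_subset[of "L w" UNIV])
    ultimately have "card (L w) = 1" using two[OF w(1)] by linarith
    then obtain d where "L w = {d}" using card_1_singletonE by blast
    then have "(w, d) \<in> S" using S(1) w by blast
    then show False using w(2) by (metis fst_conv imageI)
  qed
  have dom: "fst ` S = V"
  proof (rule ccontr)
    assume "fst ` S \<noteq> V"
    moreover have "S \<subseteq> (SIGMA v:V. L v)" using S(2) by (simp add: good_def)
    then have "fst ` S \<subseteq> V" by auto
    ultimately obtain v where v: "v \<in> V" "v \<notin> fst ` S" by auto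
    obtain a where a: "a \<in> L v" using ne[OF v(1)] by blast
    have g: "good L (S \<union> (st L)\<^sup>* `` {(v, a)})"
      by (rule good_extend[OF two S(2) v(1) a v(2) un co[OF v(1) a]])
    have "S \<union> (st L)\<^sup>* `` {(v, a)} = S" by (rule mx[OF le_supI1[OF S(1)] g Un_upper1])
    moreover have "(v, a) \<in> (st L)\<^sup>* `` {(v, a)}" by simp
    ultimately have "(v, a) \<in> S" by (metis UnI2)
    then show False using v(2) by (metis fst_conv imageI)
  qed
  have "proper V (\<lambda>v. SOME a. (v, a) \<in> S)"
    unfolding proper_def
  proof (intro ballI impI)
    fix x y assume xy: "x \<in> V" "y \<in> V" "E x y"
    have ex: "(z, SOME a. (z, a) \<in> S) \<in> S" if z: "z \<in> V" for z
    proof -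
      obtain a where "(z, a) \<in> S" using dom z by (metis imageE prod.collapse)
      then show ?thesis by (rule someI)
    qed
    show "(SOME a. (x, a) \<in> S) \<noteq> (SOME a. (y, a) \<in> S)"
    proof -
      have "\<forall>x\<in>S. \<forall>y\<in>S. (fst x = fst y --> snd x = snd y) \<and> (E (fst x) (fst y) --> snd x \<noteq> snd y)" using S(2) unfolding good_def by (elim conjE)
      from this[rule_format, OF ex[OF xy(1)] ex[OF xy(2)]] show ?thesis using xy(3) by simp
    qed
  qed
  then show ?thesis by blast
qed

text \<open>If all implications have derivations with fewer than \<open>K\<close> steps, each is
  witnessed by at most \<open>K\<close> vertices, local colourability excludes contradictions, and
  the instance is solvable, contrary to \<open>nc\<close>. So some implication needs at least
  \<open>K\<close> steps, and a shortest derivation of it is the path.\<close>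

lemma ppath_exists:
  assumes adm: "adm \<Phi>" and two: "two_lists \<Phi>" and K: "2 \<le> K"
    and lc: "lc (8 * (2 * K + 2) + 2) \<Phi>" and nc: "\<nexists>f. proper V f"
  shows "\<exists>v c. ppath \<Phi> K v c"
proof -
  \<comment> \<open>Room for two derivations with at most \<open>K\<close> vertices each.\<close>
  define s where "s = 2 * K"
  define L where "L = flist \<Phi> s"
  \<comment> \<open>Two certificates with \<open>3 * s\<close> vertices, their two centres and two
    derivations are coloured at the same time.\<close>
  have lcs: "lc (6 * s + 2 * K + 2) \<Phi>" by (rule lc_mono[OF lc]) (simp add: s_def)
  have "\<forall>v. \<exists>C. C \<subseteq> V \<and> card C \<le> 3 * s \<and> (\<forall>X f. insert v C \<subseteq> X --> \<Phi> X f --> f v \<in> L v)"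
    unfolding L_def by (intro allI flist_cert[OF adm])
  from choice[OF this] obtain C where C0: "\<forall>v. C v \<subseteq> V \<and> card (C v) \<le> 3 * s \<and>
      (\<forall>X f. insert v (C v) \<subseteq> X --> \<Phi> X f --> f v \<in> L v)" ..
  have C: "C v \<subseteq> V" "card (C v) \<le> 3 * s" for v using C0 by simp_all
  have Cf: "f v \<in> L v" if "insert v (C v) \<subseteq> X" "\<Phi> X f" for v X f
    using C0[rule_format, of v] that by (elim conjE) metis
  have ne: "L w \<noteq> {}" if w: "w \<in> V" for w
  proof -
    have "card (insert w (C w)) \<le> 6 * s + 2 * K + 2"
      using C(2)[of w] card_insert_le_m1[of "3 * s + 1" "C w" w] by simp
    then obtain f where "\<Phi> (insert w (C w)) f" using lcD[OF lcs, of "insert w (C w)"] C(1)[of w] w by auto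
    then show ?thesis using Cf[of w "insert w (C w)" f] by auto
  qed
  have two': "card (L w) \<le> 2" if w: "w \<in> V" for w
  proof -
    obtain c where c: "\<And>f. \<Phi> {w} f ==> f w \<noteq> c" using two w unfolding two_lists_def by auto
    have "c \<notin> L w" using c flistD[of c \<Phi> s w "{}"] unfolding L_def by auto
    then have "L w \<subseteq> UNIV - {c}" by blast
    then have "card (L w) \<le> card (UNIV - {c})" by (intro card_mono) auto
    then show ?thesis by (simp add: card_Diff_singleton)
  qed
  show ?thesis
  proof (cases "\<forall>x y. x \<in> (SIGMA v:V. L v) --> (x, y) \<in> (st L)\<^sup>* --> (\<exists>n<K. (x, y) \<in> st L ^^ n)")
    case True
    have force: "\<exists>P. P \<subseteq> V \<and> card P \<le> K \<and> fst x \<in> P \<and> fst y \<in> P \<and>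
       (\<forall>X f. P \<subseteq> X --> \<Phi> X f --> f (fst x) = snd x --> f (fst y) = snd y)"
      if xy: "x \<in> (SIGMA v:V. L v)" "(x, y) \<in> (st L)\<^sup>*" for x y
    proof -
      obtain n where n: "n < K" "(x, y) \<in> st (flist \<Phi> s) ^^ n" using True xy unfolding L_def by blast
      have "fst x \<in> V" using xy by auto
      from st_path_force[OF adm two n(2) this] obtain P where P: "P \<subseteq> V" "card P \<le> n + 1" "fst x \<in> P" "fst y \<in> P"
       "\<forall>X f. P \<subseteq> X --> \<Phi> X f --> f (fst x) = snd x --> f (fst y) = snd y" by (elim exE conjE)
      show ?thesis using P n(1) by (intro exI[of _ P]) simp
    qed
    have gu: "good L ((st L)\<^sup>* `` {(w, d). w \<in> V \<and> L w = {d}})"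
      unfolding good_def
    proof (intro conjI ballI allI impI)
      show "(st L)\<^sup>* `` {(w, d). w \<in> V \<and> L w = {d}} \<subseteq> (SIGMA v:V. L v)"
        using st_rtrancl_lit[of _ _ L] by fastforce
    next
      fix x y assume "x \<in> (st L)\<^sup>* `` {(w, d). w \<in> V \<and> L w = {d}}" "(x, y) \<in> st L"
      then show "y \<in> (st L)\<^sup>* `` {(w, d). w \<in> V \<and> L w = {d}}" by (meson Image_iff rtrancl_into_rtrancl)
    next
      have both: "\<exists>X f. X \<subseteq> V \<and> \<Phi> X f \<and> fst x \<in> X \<and> fst y \<in> X \<and> f (fst x) = snd x \<and> f (fst y) = snd y"
        if xy: "x \<in> (st L)\<^sup>* `` {(w, d). w \<in> V \<and> L w = {d}}" "y \<in> (st L)\<^sup>* `` {(w, d). w \<in> V \<and> L w = {d}}" for x y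
      proof -
        obtain w d where w: "w \<in> V" "L w = {d}" "((w, d), x) \<in> (st L)\<^sup>*" using xy by auto
        obtain w' d' where w': "w' \<in> V" "L w' = {d'}" "((w', d'), y) \<in> (st L)\<^sup>*" using xy by auto
        obtain P where P: "P \<subseteq> V" "card P \<le> K" "fst x \<in> P"
          "\<And>X f. P \<subseteq> X ==> \<Phi> X f ==> f w = d ==> f (fst x) = snd x" using force[OF _ w(3)] w by auto
        obtain P' where P': "P' \<subseteq> V" "card P' \<le> K" "fst y \<in> P'"
          "\<And>X f. P' \<subseteq> X ==> \<Phi> X f ==> f w' = d' ==> f (fst y) = snd y" using force[OF _ w'(3)] w' by auto
        let ?A = "insert w (C w)" and ?B = "insert w' (C w')"
        let ?X = "(P \<union> P') \<union> (?A \<union> ?B)"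
        have "card ?A \<le> 3 * s + 1" "card ?B \<le> 3 * s + 1"
          using C(2)[of w] C(2)[of w'] card_insert_le_m1[of "3 * s + 1" "C w" w] card_insert_le_m1[of "3 * s + 1" "C w'" w'] by simp_all
        then have "card ?X \<le> 6 * s + 2 * K + 2"
          using card_Un_le[of "P \<union> P'" "?A \<union> ?B"] card_Un_le[of P P'] card_Un_le[of ?A ?B] P(2) P'(2) by linarith
        moreover have XV: "?X \<subseteq> V" using P P' C w w' by auto
        ultimately obtain f where f: "\<Phi> ?X f" using lcD[OF lcs, of ?X] by metis
        have "f w = d" using Cf[OF _ f, of w] w by auto
        moreover have "f w' = d'" using Cf[OF _ f, of w'] w' by auto
        ultimately have "f (fst x) = snd x" "f (fst y) = snd y" using P(4)[OF _ f] P'(4)[OF _ f] by auto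
        then show ?thesis using f XV P(3) P'(3) by (intro exI[of _ ?X] exI[of _ f]) simp
      qed
      {
        fix x y assume "x \<in> (st L)\<^sup>* `` {(w, d). w \<in> V \<and> L w = {d}}" "y \<in> (st L)\<^sup>* `` {(w, d). w \<in> V \<and> L w = {d}}" "fst x = fst y"
        then show "snd x = snd y" using both[of x y] by force
      next
        fix x y assume xy: "x \<in> (st L)\<^sup>* `` {(w, d). w \<in> V \<and> L w = {d}}" "y \<in> (st L)\<^sup>* `` {(w, d). w \<in> V \<and> L w = {d}}" "E (fst x) (fst y)"
        obtain X f where "\<Phi> X f" "fst x \<in> X" "fst y \<in> X" "f (fst x) = snd x" "f (fst y) = snd y" using both[OF xy(1,2)] by (elim exE conjE)
        then show "snd x \<noteq> snd y" using adm_proper[OF adm, of X f "fst x" "fst y"] xy(3) by simp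
      }
    qed
    have co: "(fst x = fst y --> snd x = snd y) \<and> (E (fst x) (fst y) --> snd x \<noteq> snd y)"
      if v: "v \<in> V" "a \<in> L v" "((v, a), x) \<in> (st L)\<^sup>*" "((v, a), y) \<in> (st L)\<^sup>*" for v a x y
    proof -
      obtain P where P: "P \<subseteq> V" "card P \<le> K" "fst x \<in> P"
        "\<And>X f. P \<subseteq> X ==> \<Phi> X f ==> f v = a ==> f (fst x) = snd x" using force[OF _ v(3)] v by auto
      obtain P' where P': "P' \<subseteq> V" "card P' \<le> K" "fst y \<in> P'"
        "\<And>X f. P' \<subseteq> X ==> \<Phi> X f ==> f v = a ==> f (fst y) = snd y" using force[OF _ v(4)] v by auto
      have "card (P \<union> P') \<le> s" using card_Un_le[of P P'] P(2) P'(2) unfolding s_def by linarith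
      then obtain f where f: "\<Phi> (insert v (P \<union> P')) f" "f v = a"
        using flistD[of a \<Phi> s v "P \<union> P'"] v(2) P(1) P'(1) unfolding L_def by auto
      have "f (fst x) = snd x" "f (fst y) = snd y" using P(4)[OF _ f(1)] P'(4)[OF _ f(1)] f(2) by auto
      then show ?thesis using adm_proper[OF adm f(1), of "fst x" "fst y"] P(3) P'(3) by auto
    qed
    have "\<exists>f. proper V f" by (rule maximal_good_colours[of L, OF two' ne gu co])
    then show ?thesis using nc by simp
  next
    case False
    then obtain x y where xy: "x \<in> (SIGMA v:V. L v)" "(x, y) \<in> (st L)\<^sup>*" "\<forall>n<K. (x, y) \<notin> st L ^^ n" by auto
    obtain n0 where "(x, y) \<in> st L ^^ n0" using xy(2) rtrancl_imp_relpow by blast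
    then have ex: "\<exists>n. (x, y) \<in> st L ^^ n" by blast
    define n where "n = (LEAST n. (x, y) \<in> st L ^^ n)"
    have n: "(x, y) \<in> st L ^^ n" unfolding n_def using ex by (rule LeastI_ex)
    have nm: "(x, y) \<notin> st L ^^ m" if "m < n" for m using that not_less_Least unfolding n_def by blast
    have nK: "K \<le> n" using n xy(3) by (meson not_le)
    obtain g where g: "g 0 = x" "g n = y" "\<And>i. i < n ==> (g i, g (Suc i)) \<in> st L"
      using n unfolding relpow_fun_conv by blast
    have seg: "(g i, g j) \<in> st L ^^ (j - i)" if "i \<le> j" "j \<le> n" for i j
    proof -
      have "\<exists>h. h 0 = g i \<and> h (j - i) = g j \<and> (\<forall>k<j - i. (h k, h (Suc k)) \<in> st L)"
        using that g(3) by (intro exI[of _ "\<lambda>k. g (i + k)"]) auto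
      then show ?thesis unfolding relpow_fun_conv by blast
    qed
    have short: "(g i, g j) \<notin> st L ^^ m" if "i \<le> j" "j \<le> n" "m < j - i" for i j m
    proof
      assume "(g i, g j) \<in> st L ^^ m"
      moreover have "(g 0, g i) \<in> st L ^^ i" "(g j, g n) \<in> st L ^^ (n - j)" using seg[of 0 i] seg[of j n] that by auto
      ultimately have "(g 0, g n) \<in> (st L ^^ i O st L ^^ m) O st L ^^ (n - j)" by (meson relcomp.relcompI)
      then have "(g 0, g n) \<in> st L ^^ (i + m + (n - j))" by (simp add: relpow_add)
      moreover have lt: "i + m + (n - j) < n" using that by linarith
      ultimately show False using nm[OF lt] g(1,2) by simp
    qed
    define v where "v = (\<lambda>i. fst (g i))"
    define c where "c = (\<lambda>i. snd (g i))"
    have stp: "v i \<in> V" "v (Suc i) \<in> V" "E (v i) (v (Suc i))" "c i \<in> L (v (Suc i))" "c (Suc i) \<in> L (v (Suc i))" "c i \<noteq> c (Suc i)"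
      if "i < K" for i
    proof -
      have "((v i, c i), (v (Suc i), c (Suc i))) \<in> st L" using g(3)[of i] that nK by (simp add: v_def c_def)
      then show "v i \<in> V" "v (Suc i) \<in> V" "E (v i) (v (Suc i))" "c i \<in> L (v (Suc i))" "c (Suc i) \<in> L (v (Suc i))" "c i \<noteq> c (Suc i)"
        unfolding st_def by simp_all
    qed
    have stp': "v i \<in> V" "c (i - 1) \<in> L (v i)" "c i \<in> L (v i)" "c (i - 1) \<noteq> c i" if "1 \<le> i" "i \<le> K" for i
      using stp[of "i - 1"] that by auto
    have eq: "f (v i) = c (i - 1) \<or> f (v i) = c i" if "1 \<le> i" "i \<le> K" "\<Phi> X f" "v i \<in> X" for i X f
      using two_lists_eq[OF adm two stp'(1)[OF that(1,2)], of "c (i - 1)" s "c i"] stp'[OF that(1,2)] that(3,4) unfolding L_def by blast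
    define P where "P = v ` {1..K}"
    have PV: "P \<subseteq> V" "card P \<le> s" using stp'(1) card_image_le[of "{1..K}" v] unfolding P_def s_def by auto
    have vP: "v i \<in> P" if "1 \<le> i" "i \<le> K" for i using that unfolding P_def by auto
    \<comment> \<open>Giving \<open>v 1\<close> the colour \<open>c 1\<close> forces
      \<open>c i\<close> on all of the path; \<open>f2\<close> below propagates backwards from the
      last vertex. These two colourings yield the chord conditions that do not come from
      minimality.\<close>
    obtain f1 where f1: "\<Phi> (insert (v 1) P) f1" "f1 (v 1) = c 1"
      using flistD[of "c 1" \<Phi> s "v 1" P] stp'[of 1] K PV unfolding L_def by auto
    have fwd: "f1 (v i) = c i" if "1 \<le> i" "i \<le> K" for i
      using that
    proof (induction i rule: dec_induct)
      case base then show ?case using f1 by simp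
    next
      case (step i)
      have "f1 (v (Suc i)) = c i \<or> f1 (v (Suc i)) = c (Suc i)" using eq[OF _ _ f1(1), of "Suc i"] vP step by auto
      moreover have "f1 (v i) \<noteq> f1 (v (Suc i))"
        using adm_proper[OF adm f1(1), of "v i" "v (Suc i)"] stp(3)[of i] vP step by auto
      ultimately show ?case using step by auto
    qed
    obtain f2 where f2: "\<Phi> (insert (v K) P) f2" "f2 (v K) = c (K - 1)"
      using flistD[of "c (K - 1)" \<Phi> s "v K" P] stp'[of K] K PV unfolding L_def by auto
    have bwd: "f2 (v (K - i)) = c (K - i - 1)" if "i < K" for i
      using that
    proof (induction i)
      case 0 then show ?case using f2 by simp
    next
      case (Suc i)
      have j: "1 \<le> K - Suc i" "K - Suc i \<le> K" "Suc (K - Suc i) = K - i" using Suc by auto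
      have "f2 (v (K - Suc i)) = c (K - Suc i - 1) \<or> f2 (v (K - Suc i)) = c (K - Suc i)"
        using eq[OF j(1,2) f2(1)] vP[OF j(1,2)] by blast
      moreover have "f2 (v (K - Suc i)) \<noteq> f2 (v (K - i))"
        using adm_proper[OF adm f2(1), of "v (K - Suc i)" "v (K - i)"] stp(3)[of "K - Suc i"] vP[OF j(1,2)] vP[of "K - i"] j Suc by auto
      moreover have "f2 (v (K - i)) = c (K - Suc i)" using Suc by simp
      ultimately show ?case by auto
    qed
    have bwd': "f2 (v i) = c (i - 1)" if "1 \<le> i" "i \<le> K" for i using bwd[of "K - i"] that by simp
    have "ppath \<Phi> K v c"
      unfolding ppath_def
    proof (intro conjI allI impI)
      show "inj_on v {1..K}"
      proof (rule linorder_inj_onI')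
        fix i j assume ij: "i \<in> {1..K}" "j \<in> {1..K}" "i < j"
        show "v i \<noteq> v j"
        proof
          assume e: "v i = v j"
          then have "c i = c j" using fwd[of i] fwd[of j] ij by auto
          then have "g i = g j" using e unfolding v_def c_def by (simp add: prod_eq_iff)
          then show False using short[of i j 0] ij nK by auto
        qed
      qed
      show "v ` {1..K} \<subseteq> V" using PV unfolding P_def by simp
    next
      fix i assume "1 \<le> i \<and> i < K" then show "E (v i) (v (Suc i))" using stp by simp
    next
      fix i assume "i < K" then show "c i \<noteq> c (Suc i)" using stp by simp
    next
      fix i j assume ij: "1 \<le> i \<and> Suc i < j \<and> j \<le> K \<and> E (v i) (v j)"
      show "c i \<noteq> c (j - 1)"
      proof
        assume e: "c i = c (j - 1)"
        have "((v i, c i), (v j, c j)) \<in> st L"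
          using ij stp'[of i] stp'[of j] e unfolding st_def by simp
        then have "(g i, g j) \<in> st L" by (simp add: v_def c_def)
        then have "(g i, g j) \<in> st L ^^ 1" by simp
        moreover have "1 < j - i" "i \<le> j" "j \<le> n" using ij nK by linarith+
        ultimately show False using short[of i j 1] by simp
      qed
      show "c i \<noteq> c j"
      proof -
        have r: "1 \<le> i" "i \<le> K" "1 \<le> j" "j \<le> K" using ij by linarith+
        have "f1 (v i) \<noteq> f1 (v j)"
          by (rule adm_proper[OF adm f1(1)]) (use ij vP[OF r(1,2)] vP[OF r(3,4)] in simp_all)
        then show ?thesis using fwd[OF r(1,2)] fwd[OF r(3,4)] by simp
      qed
      show "c (i - 1) \<noteq> c (j - 1)"
      proof -
        have r: "1 \<le> i" "i \<le> K" "1 \<le> j" "j \<le> K" using ij by linarith+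
        have "f2 (v i) \<noteq> f2 (v j)"
          by (rule adm_proper[OF adm f2(1)]) (use ij vP[OF r(1,2)] vP[OF r(3,4)] in simp_all)
        then show ?thesis using bwd'[OF r(1,2)] bwd'[OF r(3,4)] by simp
      qed
    next
      fix i f assume "1 \<le> i \<and> i \<le> K \<and> \<Phi> {v i} f"
      then show "f (v i) = c (i - 1) \<or> f (v i) = c i" using eq[of i "{v i}" f] by simp
    next
      fix i d X assume a: "1 \<le> i \<and> i \<le> K \<and> d \<in> {c (i - 1), c i} \<and> X \<subseteq> V \<and> card X \<le> K"
      then have "d \<in> L (v i)" using stp'(2)[of i] stp'(3)[of i] by auto
      then have d: "d \<in> flist \<Phi> s (v i)" unfolding L_def .
      have "X \<subseteq> V" "card X \<le> s" using a unfolding s_def by simp_all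
      then show "\<exists>f. \<Phi> (insert (v i) X) f \<and> f (v i) = d" by (rule flistD[OF d])
    qed
    then show ?thesis by (intro exI)
  qed
qed

end


section \<open>Chains contain every P4 + kP1\<close>

definition indP4k :: "('b => 'b => bool) => 'b => 'b => 'b => 'b => 'b set => bool" where
  "indP4k R a b c d S \<longleftrightarrow> indP4 R a b c d \<and>
    (\<forall>x\<in>S. \<not> R a x \<and> \<not> R b x \<and> \<not> R c x \<and> \<not> R d x) \<and> (\<forall>x\<in>S. \<forall>y\<in>S. \<not> R x y)"

context chain
begin

text \<open>The \<open>P4\<close> is the one present in every half graph. Vertices
  \<open>X k\<close> with \<open>k\<close> beyond 8 are isolated from it, because \<open>Y l\<close>
  is adjacent to earlier \<open>X\<close> only.\<close>

lemma half_graph_P4k: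
  fixes X Y :: "nat => nat"
  assumes p: "\<And>k. p (X k) = px" "\<And>k. p (Y k) = py" and c: "\<And>k. c (X k) = cx" "\<And>k. c (Y k) = cy"
    and sep: "\<And>k l. k < l ==> Suc (X k) < X l \<and> Suc (X k) < Y l \<and> Suc (Y k) < X l \<and> Suc (Y k) < Y l"
    and e: "\<And>k l. k < l ==> R (X k) (Y l)"
  shows "indP4k R (X 5) (Y 8) (X 0) (Y 3) (X ` {9..<9 + k})"
proof -
  have n: "\<not> R (X k) (X l) \<and> \<not> R (Y k) (Y l) \<and> \<not> R (Y k) (X l)" if "k < l" for k l
    using chord[of "X k" "X l"] chord[of "Y k" "Y l"] chord_eq[of "Y k" "X l"] chord[OF e[OF that]] p c sep[OF that] by auto
  have n': "\<not> R (X k) (X l)" for k l using n[of k l] n[of l k] Rcomm[of "X l"] Rirr by (cases k l rule: linorder_cases) auto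
  have n'': "\<not> R (Y k) (X l)" if "k < l" for k l using n[OF that] by simp
  have "\<not> R (X 5) (Y 3)" "\<not> R (Y 8) (Y 3)" "R (Y 8) (X 0)" using n''[of 3 5] n[of 3 8] e[of 0 8] Rcomm by auto
  then have "indP4 R (X 5) (Y 8) (X 0) (Y 3)" unfolding indP4_def using n' e[of 5 8] e[of 0 3] by simp
  then show ?thesis unfolding indP4k_def using n' n'' by auto
qed

text \<open>A mixed edge in the first window, followed by two vertices of a shortest connection to
  the second.\<close>

lemma anticomplete_windows_P4:
  assumes n: "4 \<le> n" and st: "s + n < t" and ac: "\<And>i j. i \<in> {s..<s + n} ==> j \<in> {t..<t + n} ==> \<not> R i j"
  shows "\<exists>a b c d. indP4 R a b c d"
proof -
  let ?A = "{s..<s + n}" and ?B = "{t..<t + n}"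
  obtain k g where k: "2 \<le> k" and g: "g 0 \<in> ?A" "g k \<in> ?B" "\<And>i. i < k ==> R (g i) (g (Suc i))"
    and nA: "\<And>i. 0 < i ==> i < k ==> g i \<notin> ?A" and nB: "\<And>i. 0 < i ==> i < k ==> g i \<notin> ?B"
    and ind: "\<And>i j. i + 2 \<le> j ==> j \<le> k ==> \<not> R (g i) (g j)"
    and fA: "\<And>i a. 2 \<le> i ==> i \<le> k ==> a \<in> ?A ==> \<not> R a (g i)"
    using shortest_connection[of ?A ?B] ac st n by (auto simp: Ball_def)
  have r1: "g 1 \<notin> ?A" "R (g 0) (g 1)" using nA[of 1] g(3)[of 0] k by auto
  obtain p1 p2 where p: "p1 \<in> ?A" "p2 \<in> ?A" "R p1 p2" "R p1 (g 1)" "\<not> R p2 (g 1)"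
    using mixed_edge[OF r1(1) _ g(1) r1(2)] n by auto
  have "indP4 R p2 p1 (g 1) (g 2)"
    unfolding indP4_def using p g(3)[of 1] fA[of 2 p1] fA[of 2 p2] Rcomm[of p2] k by (simp add: numeral_2_eq_2)
  then show ?thesis by blast
qed

lemma chain_has_P4: "\<exists>a b c d. indP4 R a b c d"
proof -
  obtain w M I pt ct where "windows R p c w 4 M I pt ct" using windows_exist by blast
  then interpret windows R p c w 4 M I pt ct .
  show ?thesis
  proof (cases "\<exists>x<4. \<exists>y<4. M x y")
    case True
    then obtain x y where xy: "x < 4" "y < 4" "M x y" by blast
    have "indP4k R (w 5 + x) (w 8 + y) (w 0 + x) (w 3 + y) ((\<lambda>k. w k + x) ` {9..<9 + 0})"
    proof (rule half_graph_P4k[of _ "pt x" _ "pt y" "ct x" "ct y"])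
      fix k l :: nat assume kl: "k < l"
      show "Suc (w k + x) < w l + x \<and> Suc (w k + x) < w l + y \<and> Suc (w k + y) < w l + x \<and> Suc (w k + y) < w l + y"
        using sep[OF kl] xy by simp
      show "R (w k + x) (w l + y)" using Mw[OF kl] xy by simp
    qed (use xy ptw ctw in simp_all)
    then have "indP4 R (w 5 + x) (w 8 + y) (w 0 + x) (w 3 + y)" unfolding indP4k_def by (rule conjunct1)
    then show ?thesis by (intro exI)
  next
    case False
    have "\<not> R i j" if i: "i \<in> {w 0..<w 0 + 4}" and j: "j \<in> {w 1..<w 1 + 4}" for i j
    proof -
      have "R i j = M (i - w 0) (j - w 1)" using Mw[of 0 1 "i - w 0" "j - w 1"] i j by auto
      moreover have "i - w 0 < 4" "j - w 1 < 4" using i j by auto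
      ultimately show ?thesis using False by blast
    qed
    moreover have "w 0 + 4 < w 1" using sep[of 0 1] by simp
    ultimately show ?thesis by (intro anticomplete_windows_P4[of 4 "w 0" "w 1"]) simp_all
  qed
qed

text \<open>A tail of a chain is again a chain.\<close>

lemma far_P4: "\<exists>q :: nat => nat. indP4 R (q 0) (q 1) (q 2) (q 3) \<and> (\<forall>a<4. n \<le> q a)"
proof -
  interpret s: chain "\<lambda>i j. R (i + n) (j + n)" "\<lambda>i. p (i + n)" "\<lambda>i. c (i + n)"
  proof
    fix i j show "R (i + n) (j + n) ==> R (j + n) (i + n)" by (rule Rsym)
    show "\<not> R (i + n) (i + n)" by (rule Rirr)
    show "R (i + n) (Suc i + n)" using Rsuc[of "i + n"] by simp
    show "p (i + n) \<noteq> c (i + n)" by (rule pc)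
    show "p (Suc i + n) = c (i + n)" using pSuc[of "i + n"] by simp
    show "c (i + n) \<noteq> p (j + n) \<and> c (i + n) \<noteq> c (j + n) \<and> p (i + n) \<noteq> p (j + n)" if "R (i + n) (j + n)" "Suc i < j"
      using chord[OF that(1)] that(2) by simp
  qed
  obtain a b d e where q: "indP4 (\<lambda>i j. R (i + n) (j + n)) a b d e" using s.chain_has_P4 by blast
  have "(\<forall>k<4. n \<le> [a + n, b + n, d + n, e + n] ! k)" by (auto simp: less_Suc_eq numeral_eq_Suc)
  moreover have "indP4 R ([a + n, b + n, d + n, e + n] ! 0) ([a + n, b + n, d + n, e + n] ! 1) ([a + n, b + n, d + n, e + n] ! 2) ([a + n, b + n, d + n, e + n] ! 3)"
    using q unfolding indP4_def by simp
  ultimately show ?thesis by (intro exI[of _ "\<lambda>k. [a + n, b + n, d + n, e + n] ! k"]) simp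
qed

text \<open>Infinitely many separated copies of \<open>P4\<close> are made uniform by Ramsey's
  theorem. Either some cross adjacency produces a half graph, or the copies are pairwise
  anticomplete and one vertex from each of \<open>m\<close> other copies joins the first.\<close>

theorem chain_has_P4k: "\<exists>a b d e S. finite S \<and> card S = m \<and> indP4k R a b d e S"
proof -
  obtain F :: "nat => nat => nat" where F: "\<And>n. indP4 R (F n 0) (F n 1) (F n 2) (F n 3)" "\<And>n a. a < 4 ==> n \<le> F n a"
    using far_P4 by metis
  \<comment> \<open>The next copy starts beyond all vertices of the previous one, with a gap, so
    that edges between copies are chords.\<close>
  define b where "b = rec_nat 0 (\<lambda>_ n. F n 0 + F n 1 + F n 2 + F n 3 + 2)"
  have b: "b (Suc k) = F (b k) 0 + F (b k) 1 + F (b k) 2 + F (b k) 3 + 2" for k unfolding b_def by simp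
  define q where "q k = F (b k)" for k
  have q: "indP4 R (q k 0) (q k 1) (q k 2) (q k 3)" for k using F unfolding q_def by simp
  have lo: "b k \<le> q k a" if "a < 4" for k a using F(2)[OF that] unfolding q_def by simp
  have hi: "Suc (q k a) < b (Suc k)" if "a < 4" for k a
  proof -
    have "a = 0 \<or> a = 1 \<or> a = 2 \<or> a = 3" using that by auto
    then show ?thesis unfolding b q_def by auto
  qed
  have bm: "b k \<le> b l" if "k \<le> l" for k l
    using that
  proof (induction rule: dec_induct)
    case (step l) then show ?case using lo[of 0 l] hi[of 0 l] by simp
  qed simp
  have sep: "Suc (q k a) < q l a'" if "k < l" "a < 4" "a' < 4" for k l a a'
    using hi[OF that(2), of k] lo[OF that(3), of l] bm[of "Suc k" l] that(1) by simp
  obtain r M I pt ct where r: "strict_mono (r :: nat => nat)"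
    "\<And>k a. a < 4 ==> p (q (r k) a) = pt a \<and> c (q (r k) a) = ct a"
    "\<And>k l a b. k < l ==> a < 4 ==> b < 4 ==> R (q (r k) a) (q (r l) b) = M a b"
    using tuple_ramsey[of 4 q] by auto
  have sepr: "Suc (q (r k) a) < q (r l) a'" if "k < l" "a < 4" "a' < 4" for k l a a'
    using sep[of "r k" "r l"] that r(1) by (simp add: strict_mono_less)
  show ?thesis
  proof (cases "\<exists>x<4. \<exists>y<4. M x y")
    case True
    then obtain x y where xy: "x < 4" "y < 4" "M x y" by blast
    let ?X = "\<lambda>k. q (r k) x" and ?Y = "\<lambda>k. q (r k) y"
    have "indP4k R (?X 5) (?Y 8) (?X 0) (?Y 3) (?X ` {9..<9 + m})"
      by (rule half_graph_P4k[of _ "pt x" _ "pt y" "ct x" "ct y"]) (use xy r sepr in auto)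
    moreover have "inj ?X" using sepr[of _ _ x x] xy by (intro linorder_injI) (metis Suc_lessD less_irrefl)
    then have "card (?X ` {9..<9 + m}) = m" by (subst card_image) (auto intro: inj_on_subset)
    ultimately show ?thesis by blast
  next
    case False
    let ?X = "\<lambda>k. q (r k) 0"
    have no: "\<not> R (q (r k) x) (q (r l) y)" if "k < l" "x < 4" "y < 4" for k l x y
      using r(3)[OF that] False that by blast
    have "\<not> R (?X k) (?X l)" for k l using no[of k l 0 0] no[of l k 0 0] Rcomm[of "?X l"] Rirr by (cases k l rule: linorder_cases) auto
    then have "indP4k R (q (r 0) 0) (q (r 0) 1) (q (r 0) 2) (q (r 0) 3) (?X ` {1..<1 + m})"
      using q[of "r 0"] no[of 0] unfolding indP4k_def by auto
    moreover have "inj ?X" using sepr[of _ _ 0 0] by (intro linorder_injI) (metis Suc_lessD less_irrefl zero_less_numeral)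
    then have "card (?X ` {1..<1 + m}) = m" by (subst card_image) (auto intro: inj_on_subset)
    ultimately show ?thesis by blast
  qed
qed

end


section \<open>Chains with helper neighbours and 2P3\<close>

text \<open>Every chain vertex \<open>i\<close> has a helper neighbour outside the chain, and \<open>G i j\<close> says that the helper
  of \<open>i\<close> is adjacent to \<open>j\<close>. Vertices in \<open>T\<close> take their helpers from a fixed set of size \<open>\<kappa>\<close>.\<close>

locale helper_chain = chain +
  fixes G :: "nat => nat => bool" and T :: "nat => bool" and \<kappa> :: nat
  assumes Gtype: "G i j ==> {p i, c i} = {p j, c j}"
    and few: "\<not> T i ==> finite A ==> (\<And>j. j \<in> A ==> R i j) ==> card A \<le> 8"
    and pigeon: "finite A ==> \<kappa> < card A ==> (\<And>i. i \<in> A ==> T i) ==> \<exists>i\<in>A. \<exists>j\<in>A. i < j \<and> G i j"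
    and F0: "indP3 R a b d ==> indP3 R a' b' d' ==> \<exists>x\<in>{a, b, d}. \<exists>y\<in>{a', b', d'}. R x y"
    and F1: "R i j ==> \<not> G i j ==> indP3 R a b d ==> \<exists>x\<in>{a, b, d}. R i x \<or> R j x \<or> G i x"
    and F2: "G i j ==> i \<noteq> j ==> \<not> R i j ==> indP3 R a b d ==> \<exists>x\<in>{a, b, d}. R i x \<or> R j x \<or> G i x"
begin

text \<open>Three consecutive vertices induce a \<open>P3\<close> unless the outer two are adjacent.
  If that happens twice in a row, the colours forbid a chord from \<open>i\<close> to
  \<open>i + 3\<close>, and \<open>i\<close>, \<open>i + 1\<close>, \<open>i + 3\<close> is
  induced.\<close>

lemma P3_in_window: "\<exists>a\<in>{i..<i + 4}. \<exists>b\<in>{i..<i + 4}. \<exists>d\<in>{i..<i + 4}. indP3 R a b d"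
proof -
  have r: "R i (i + 1)" "R (i + 1) (i + 2)" "R (i + 2) (i + 3)"
    using Rsuc[of i] Rsuc[of "i + 1"] Rsuc[of "i + 2"] by (simp_all add: numeral_2_eq_2 numeral_3_eq_3)
  consider "\<not> R i (i + 2)" | "\<not> R (i + 1) (i + 3)" | "R i (i + 2)" "R (i + 1) (i + 3)" by blast
  then have "indP3 R i (i + 1) (i + 2) \<or> indP3 R (i + 1) (i + 2) (i + 3) \<or> indP3 R i (i + 1) (i + 3)"
  proof cases
    case 3
    have "p i = c (i + 2)" "p (i + 1) = c (i + 3)" "p (i + 1) = c i"
      using chord_eq[of i "i + 2"] chord_eq[of "i + 1" "i + 3"] 3 pSuc[of i] by auto
    then have "\<not> R i (i + 3)" using chord_eq[of i "i + 3"] pc[of i] by auto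
    then show ?thesis using 3 r by (simp add: indP3_def)
  qed (use r in \<open>simp_all add: indP3_def\<close>)
  moreover have "i \<in> {i..<i + 4}" "i + 1 \<in> {i..<i + 4}" "i + 2 \<in> {i..<i + 4}" "i + 3 \<in> {i..<i + 4}" by auto
  ultimately show ?thesis by metis
qed

end

locale helper_windows = helper_chain + windows
begin

lemma wne: "k < l ==> a < t ==> w k + a \<noteq> w l + b \<and> w l + b \<noteq> w k + a"
  using sep[of k l] by auto

lemma noG: "G (w k + a) (w l + b) ==> a < t ==> b < t ==> {pt a, ct a} = {pt b, ct b}"
  using Gtype[of "w k + a" "w l + b"] ptw ctw by simp

text \<open>Vertices in \<open>T\<close> take their helpers from a set of size
  \<open>\<kappa>\<close>, so among \<open>\<kappa> + 1\<close> copies of position \<open>z\<close>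
  two are joined through a helper.\<close>

lemma SE_pair:
  assumes z: "z < t" and T: "\<And>k. k0 \<le> k ==> T (w k + z)"
  shows "\<exists>k l. k0 \<le> k \<and> k < l \<and> G (w k + z) (w l + z)"
proof -
  let ?A = "(\<lambda>k. w k + z) ` {k0..k0 + \<kappa>}"
  have "inj (\<lambda>k. w k + z)" by (intro linorder_injI) (use wne[OF _ z] in blast)
  then have "card ?A = Suc \<kappa>" by (subst card_image) (auto intro: inj_on_subset)
  then have c: "\<kappa> < card ?A" by simp
  have TA: "T i" if "i \<in> ?A" for i using T that by (elim imageE) simp
  have "\<exists>i\<in>?A. \<exists>j\<in>?A. i < j \<and> G i j" by (rule pigeon[OF _ c TA]) simp_all
  then obtain i j where ij: "i \<in> ?A" "j \<in> ?A" "i < j" "G i j" by (elim bexE conjE)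
  then obtain k l where kl: "k0 \<le> k" "i = w k + z" "j = w l + z" by auto
  have "k < l" using ij(3) kl sep[of l k] by (cases k l rule: linorder_cases) auto
  then show ?thesis using ij kl by (intro exI[of _ k] exI[of _ l]) simp
qed

text \<open>A half graph contains no \<open>2P3\<close>, so the \<open>P3\<close> in
  \<open>YXY\<close> must be paired with one through a helper. If the position \<open>W\<close>
  after \<open>x\<close>, or the one before \<open>y\<close>, has a list other than those of
  \<open>x\<close> and \<open>y\<close>, then by \<open>Gtype\<close> its helper sees neither, and
  the helper lies on such a \<open>P3\<close> by \<open>F1\<close> or \<open>F2\<close>. In the
  remaining case \<open>N\<close> these positions repeat the lists of \<open>x\<close> and
  \<open>y\<close>, and the chain itself contains a \<open>2P3\<close>.\<close>

lemma half_graph_contra: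
  assumes M: "M x y" and x: "x = Suc xm" and y: "y = Suc ym" "ym = Suc ymm" and b: "Suc x < t" "Suc y < t"
    and xx: "M x xm ==> y = xm"
  shows False
proof -
  have b': "x < t" "y < t" "xm < t" "ym < t" "ymm < t" using b x y by auto
  note r = Mrule[OF M b'(1,2)]
  note h = half_graph_facts[OF M b'(1,2)]
  define W where "W = Suc x"
  have Wt: "W < t" using b unfolding W_def by simp
  have I: "I xm x" "I x xm" "I x W" "I W x" "I ym y" "I y ym" "I ymm ym" "I ym ymm"
    using ISuc[of xm] ISuc[of x] ISuc[of ym] ISuc[of ymm] x y b b' unfolding W_def by auto
  note pcs = pct[of xm] pct[of x] pct[of ym] pct[of ymm] pct[of y] pct[of W]
  have pty: "ct ym = pt y" "ct xm = pt x" "pt W = ct x" "ct ymm = pt ym" using ptSuc b b' x y unfolding W_def by auto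
  have YXY: "indP3 R (w k + y) (w j + x) (w l + y)" if "j < k" "k < l" for k j l
    using that M b' Mii[of y] wne[of k l y y] unfolding indP3_def by (simp add: RQ Q_def)
  consider (W) "ct W \<noteq> pt x" | (V) "pt ym \<noteq> ct y" | (N) "ct W = pt x" "pt ym = ct y" by blast
  then show False
  proof cases
    case W
    have cW: "ct W = pt y" using W r pty pcs Wt b' col_eqI[of "ct W" "pt x" "ct x" "pt y"] by auto
    have WX: "\<not> M x W" "\<not> M W y" using Mrule[of x W] Mrule[of W y] cW r pty Wt b' by auto
    have nG: "\<not> G (w k + W) (w l + x)" "\<not> G (w k + W) (w l + y)" for k l
      using noG[of k W l x] noG[of k W l y] Wt b' pty cW r pcs by (auto simp: doubleton_eq_iff)
    show False
    proof (cases "M y W")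
      case True
      \<comment> \<open>In window \<open>k\<close> the vertex \<open>W\<close> sees \<open>y\<close>
        in each of the windows 0 to 8, one neighbour more than \<open>few\<close> allows outside
        \<open>T\<close>.\<close>
      have "T (w k + W)" if k: "9 \<le> k" for k
      proof (rule ccontr)
        assume nT: "\<not> T (w k + W)"
        have "inj (\<lambda>k. w k + y)" by (intro linorder_injI) (use wne[OF _ b'(2)] in blast)
        then have "card ((\<lambda>k. w k + y) ` {..<9}) = 9" by (subst card_image) (auto intro: inj_on_subset)
        moreover have "card ((\<lambda>k. w k + y) ` {..<9}) \<le> 8"
          by (rule few[OF nT]) (use k True Wt b' in \<open>auto simp: RQ Q_def\<close>)
        ultimately show False by simp
      qed
      then obtain k l where kl: "9 \<le> k" "k < l" "G (w k + W) (w l + W)" using SE_pair[of W 9] Wt by blast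
      show False
        using F2[OF kl(3) _ _ YXY[of 0 "l + 1" "l + 2"]] kl wne[of k l W W] nG WX Wt b' Mii[of W] by (auto simp: RQ Q_def)
    next
      case False
      have "\<not> M y x" by (rule h(1))
      then show False using F1[of "w 9 + W" "w 9 + x", OF _ _ YXY[of 1 3 4]] False nG WX I Wt b' Mii[of x] by (auto simp: RQ Q_def)
    qed
  next
    case V
    have pV: "pt ym = ct x" using V r pty pcs b' col_eqI[of "pt ym" "ct y" "pt y" "ct x"] by auto
    have VX: "\<not> M x ym" "\<not> M ym y" using h(5)[OF y(1)] MSuc[of ym] y b' by auto
    have nG: "\<not> G (w k + ym) (w l + x)" "\<not> G (w k + ym) (w l + y)" for k l
      using noG[of k ym l x] noG[of k ym l y] Wt b' pty pV r pcs by (auto simp: doubleton_eq_iff)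
    show False
    proof (cases "M ym x")
      case True
      have "T (w k + ym)" if k: "1 \<le> k" for k
      proof (rule ccontr)
        assume nT: "\<not> T (w k + ym)"
        have "inj (\<lambda>k. w k + x)" by (intro linorder_injI) (use wne[OF _ b'(1)] in blast)
        then have "card ((\<lambda>k. w k + x) ` {k<..k + 9}) = 9" by (subst card_image) (auto intro: inj_on_subset)
        moreover have "card ((\<lambda>k. w k + x) ` {k<..k + 9}) \<le> 8"
          by (rule few[OF nT]) (use k True Wt b' in \<open>auto simp: RQ Q_def\<close>)
        ultimately show False by simp
      qed
      then obtain k l where kl: "1 \<le> k" "k < l" "G (w k + ym) (w l + ym)" using SE_pair[of ym 1] b' by blast
      show False
        using F2[OF kl(3) _ _ YXY[of 0 "l + 1" "l + 2"]] kl wne[of k l ym ym] nG VX Wt b' Mii[of ym] by (auto simp: RQ Q_def)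
    next
      case False
      have "\<not> M y x" by (rule h(1))
      then show False
        using F1[of "w 1 + ym" "w 1 + y", OF _ _ YXY[of 5 8 9]] False nG VX I Wt b' Mii[of y] by (auto simp: RQ Q_def)
    qed
  next
    case N
    have xp: "\<not> M x W" "\<not> M W y" "\<not> M y W" "\<not> M W ym"
      using Mrule[of x W] Mrule[of W y] Mrule[of y W] Mrule[of W ym] N r pty Wt b' pcs by auto
    have xm: "\<not> M xm y" "\<not> M y xm" "\<not> M xm ym" using h(6,7)[OF x] Mrule[of xm ym] N r pty b' by auto
    have ym: "\<not> M x ym" "\<not> M y ym" "\<not> M ym x" using Mrule[of x ym] Mrule[of y ym] Mrule[of ym x] N r pty b' pcs by auto
    have P: False if x': "M ym x'" "x' < t" "I x' x" "\<not> M x x'" "\<not> M x' y" "\<not> M y x'" "\<not> M x' ym" for x'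
    proof -
      have "indP3 R (w 9 + x') (w 9 + x) (w 12 + y)" "indP3 R (w 15 + x') (w 13 + ym) (w 16 + x')"
        using x' M b' Mii[of x'] wne[of 9 12 x' y] wne[of 15 16 x' x'] unfolding indP3_def by (simp_all add: RQ Q_def)
      from F0[OF this] show False using x' M b' Mii[of x'] h ym by (auto simp: RQ Q_def)
    qed
    show False
    proof (cases "M ym xm \<or> M ym W")
      case True
      have "\<not> M ym xm" if "M x xm" using xx[OF that] MSuc[of ym] y b' by auto
      then show False using True P[of xm] P[of W] xp xm I Wt b' by auto
    next
      case False
      have i: "\<not> I ymm y" "\<not> I xm W" using Ieqc[of ymm y] Ieqc[of xm W] N pty r Wt b' x y unfolding W_def by auto
      have ymm: "\<not> M ymm xm" "\<not> M ymm x" "\<not> M ymm W"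
        using Mrule[of ymm xm] Mrule[of ymm x] Mrule[of ymm W] N pty r Wt b' by auto
      have ne: "ymm \<noteq> y" "xm \<noteq> W" using x y unfolding W_def by auto
      have "indP3 R (w 3 + ymm) (w 3 + ym) (w 3 + y)" "indP3 R (w 9 + xm) (w 9 + x) (w 9 + W)"
        using i I Wt b' ne unfolding indP3_def by (simp_all add: RQ Q_def)
      from F0[OF this] show False using Wt b' False ymm xm xp ym h by (auto simp: RQ Q_def)
    qed
  qed
qed

end

context helper_chain
begin

theorem helper_chain_False: False
proof -
  obtain w M I pt ct where W: "windows R p c w 12 M I pt ct" using windows_exist by blast
  interpret w: windows R p c w 12 M I pt ct by (rule W)
  interpret helper_windows R p c G T \<kappa> w 12 M I pt ct by unfold_locales
  show False
  proof (cases "\<exists>x\<in>{4..<8}. \<exists>y\<in>{4..<8}. M x y")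
    case True
    then obtain x y where xy: "x \<in> {4..<8}" "y \<in> {4..<8}" "M x y" by blast
    have x2: "x = Suc (Suc (Suc (x - 3)))" "x - 1 = Suc (Suc (x - 3))" "x - 2 = Suc (x - 3)" using xy(1) by auto
    have y2: "y = Suc (y - 1)" "y - 1 = Suc (y - 2)" using xy(2) by auto
    \<comment> \<open>If \<open>M x (x - 1)\<close> holds, this pair takes the place of
      \<open>M x y\<close>; otherwise the last hypothesis of \<open>half_graph_contra\<close> is
      vacuous.\<close>
    show False
    proof (cases "M x (x - 1)")
      case True
      have "x = Suc (x - 1)" "x - 1 = Suc (x - 2)" "Suc x < 12" "Suc (x - 1) < 12" using xy(1) by auto
      then show False using half_graph_contra[OF True, of "x - 1" "x - 2" "x - 3"] x2(3) by blast
    next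
      case False
      moreover have "x = Suc (x - 1)" "Suc x < 12" "Suc y < 12" using xy by auto
      ultimately show False using half_graph_contra[OF xy(3), of "x - 1" "y - 1" "y - 2"] y2 by blast
    qed
  next
    case False
    obtain a b d where A: "a \<in> {w 0 + 4..<w 0 + 4 + 4}" "b \<in> {w 0 + 4..<w 0 + 4 + 4}" "d \<in> {w 0 + 4..<w 0 + 4 + 4}" "indP3 R a b d"
      using P3_in_window[of "w 0 + 4"] by blast
    obtain a' b' d' where A': "a' \<in> {w 1 + 4..<w 1 + 4 + 4}" "b' \<in> {w 1 + 4..<w 1 + 4 + 4}" "d' \<in> {w 1 + 4..<w 1 + 4 + 4}" "indP3 R a' b' d'"
      using P3_in_window[of "w 1 + 4"] by blast
    have "\<not> R i j" if i: "i \<in> {w 0 + 4..<w 0 + 4 + 4}" and j: "j \<in> {w 1 + 4..<w 1 + 4 + 4}" for i j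
    proof -
      have "R i j = M (i - w 0) (j - w 1)" using w.Mw[of 0 1 "i - w 0" "j - w 1"] i j by auto
      moreover have "i - w 0 \<in> {4..<8}" "j - w 1 \<in> {4..<8}" using i j by auto
      ultimately show ?thesis using False by blast
    qed
    then show False using F0[OF A(4) A'(4)] A A' by blast
  qed
qed

end


section \<open>Limits of finite chains; uniform bounds for two-list problems\<close>

text \<open>The chain axioms below \<open>K\<close>, all of them conditions on two indices, so that
  they pass to a pointwise limit.\<close>

definition fchain :: "nat => (nat => nat => bool) => (nat => col) => (nat => col) => bool" where
  "fchain K R p c \<longleftrightarrow> (\<forall>i<K. \<forall>j<K. (R i j --> R j i) \<and> \<not> R i i \<and> p i \<noteq> c i \<and>
    (j = Suc i --> R i j \<and> p j = c i) \<and> (R i j --> Suc i < j --> c i \<noteq> p j \<and> c i \<noteq> c j \<and> p i \<noteq> p j))"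

lemma fchain_mono: "fchain K R p c ==> M \<le> K ==> fchain M R p c"
  unfolding fchain_def
proof (intro allI impI)
  fix i j
  assume a: "\<forall>i<K. \<forall>j<K. (R i j --> R j i) \<and> \<not> R i i \<and> p i \<noteq> c i \<and>
    (j = Suc i --> R i j \<and> p j = c i) \<and> (R i j --> Suc i < j --> c i \<noteq> p j \<and> c i \<noteq> c j \<and> p i \<noteq> p j)"
    and b: "M \<le> K" "i < M" "j < M"
  have "i < K" "j < K" using b by simp_all
  from a[rule_format, OF this]
  show "(R i j --> R j i) \<and> \<not> R i i \<and> p i \<noteq> c i \<and>
    (j = Suc i --> R i j \<and> p j = c i) \<and> (R i j --> Suc i < j --> c i \<noteq> p j \<and> c i \<noteq> c j \<and> p i \<noteq> p j)" .
qed

text \<open>Each initial part of the limit is copied from a single chain of arbitrary length,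
  including helper relation and \<open>T\<close>. A finite configuration in the limit therefore
  occurs in one of the graphs.\<close>

lemma chain_limit:
  fixes R G :: "nat => nat => nat => bool" and p c :: "nat => nat => col" and T :: "nat => nat => bool"
  assumes fc: "\<And>K. fchain K (R K) (p K) (c K)"
  shows "\<exists>R' p' c' G' T'. chain R' p' c' \<and> (\<forall>n. \<exists>K\<ge>n. \<forall>i<n. \<forall>j<n. R' i j = R K i j \<and> p' i = p K i \<and>
    c' i = c K i \<and> G' i j = G K i j \<and> T' i = T K i)"
proof -
  let ?F = "\<lambda>K i j. (R K i j, p K i, c K i, G K i j, T K i)"
  obtain g where g0: "\<forall>n. \<exists>K\<ge>n. \<forall>i<n. \<forall>j<n. ?F K i j = g i j"
    using pair_sequence_limit[of ?F] by (elim exE)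
  define R' where "R' i j = fst (g i j)" for i j
  define p' where "p' i = fst (snd (g i 0))" for i
  define c' where "c' i = fst (snd (snd (g i 0)))" for i
  define G' where "G' i j = fst (snd (snd (snd (g i j))))" for i j
  define T' where "T' i = snd (snd (snd (snd (g i 0))))" for i
  have ag: "\<exists>K\<ge>n. \<forall>i<n. \<forall>j<n. R' i j = R K i j \<and> p' i = p K i \<and> c' i = c K i \<and> G' i j = G K i j \<and> T' i = T K i" for n
  proof -
    obtain K where K: "n \<le> K" "\<forall>i<n. \<forall>j<n. ?F K i j = g i j" using g0[rule_format, of n] by (elim exE conjE)
    have "R' i j = R K i j \<and> p' i = p K i \<and> c' i = c K i \<and> G' i j = G K i j \<and> T' i = T K i" if ij: "i < n" "j < n" for i j
    proof -
      have "0 < n" using ij by simp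
      then show ?thesis
        using K(2)[rule_format, OF ij, symmetric] K(2)[rule_format, OF ij(1), of 0, symmetric]
        unfolding R'_def p'_def c'_def G'_def T'_def by simp
    qed
    then show ?thesis using K(1) by (intro exI[of _ K]) simp
  qed
  have "chain R' p' c'"
  proof
    fix i j :: nat
    define n where "n = Suc (Suc (i + j))"
    obtain K where K: "n \<le> K" "\<forall>i<n. \<forall>j<n. R' i j = R K i j \<and> p' i = p K i \<and> c' i = c K i \<and> G' i j = G K i j \<and> T' i = T K i"
      using ag[of n] by (elim exE conjE)
    have eR: "R' k l = R K k l" if "k < n" "l < n" for k l using K(2) that by simp
    have e: "p' k = p K k" "c' k = c K k" if "k < n" for k using K(2) that by auto
    have b: "i < n" "j < n" "Suc i < n" unfolding n_def by simp_all
    have f: "(R' k l --> R' l k) \<and> \<not> R' k k \<and> p' k \<noteq> c' k \<and>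
      (l = Suc k --> R' k l \<and> p' l = c' k) \<and> (R' k l --> Suc k < l --> c' k \<noteq> p' l \<and> c' k \<noteq> c' l \<and> p' k \<noteq> p' l)"
      if kl: "k < n" "l < n" for k l
    proof -
      have kK: "k < K" "l < K" using K(1) kl by simp_all
      show ?thesis using fc[of K, unfolded fchain_def, rule_format, OF kK]
        unfolding e[OF kl(1)] e[OF kl(2)] eR[OF kl] eR[OF kl(2,1)] eR[OF kl(1,1)] .
    qed
    show "R' i j ==> R' j i" "\<not> R' i i" "R' i (Suc i)" "p' i \<noteq> c' i" "p' (Suc i) = c' i"
      "R' i j ==> Suc i < j ==> c' i \<noteq> p' j \<and> c' i \<noteq> c' j \<and> p' i \<noteq> p' j"
      using f[OF b(1,2)] f[OF b(1,3)] by simp_all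
  qed
  then show ?thesis using ag by (intro exI[of _ R'] exI[of _ p'] exI[of _ c'] exI[of _ G'] exI[of _ T']) simp
qed

lemma chain_limit_adj:
  fixes R :: "nat => nat => nat => bool"
  assumes fc: "\<And>K. fchain K (R K) (p K) (c K)"
  shows "\<exists>R' p' c'. chain R' p' c' \<and> (\<forall>n. \<exists>K\<ge>n. \<forall>i<n. \<forall>j<n. R' i j = R K i j)"
proof -
  from chain_limit[of R p c "\<lambda>_ _ _. True" "\<lambda>_ _. True", OF fc]
  obtain R' p' c' G' T' where ch: "chain R' p' c'" and ag: "\<forall>n. \<exists>K\<ge>n. \<forall>i<n. \<forall>j<n. R' i j = R K i j \<and> p' i = p K i \<and>
    c' i = c K i \<and> G' i j = True \<and> T' i = True" by (elim exE conjE)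
  have "\<exists>K\<ge>n. \<forall>i<n. \<forall>j<n. R' i j = R K i j" for n
  proof -
    obtain K where K: "n \<le> K" "\<forall>i<n. \<forall>j<n. R' i j = R K i j \<and> p' i = p K i \<and>
      c' i = c K i \<and> G' i j = True \<and> T' i = True" using ag[rule_format, of n] by (elim exE conjE)
    show ?thesis using K by (intro exI[of _ K]) simp
  qed
  then show ?thesis using ch by (intro exI[of _ R'] exI[of _ p'] exI[of _ c']) simp
qed

context fgraph
begin

text \<open>The path starts at vertex 1 and \<open>c 0\<close> is the colour arriving there, hence
  the shift by one.\<close>

lemma ppath_fchain:
  assumes "ppath \<Phi> K v c"
  shows "fchain K (\<lambda>i j. E (v (Suc i)) (v (Suc j))) c (\<lambda>i. c (Suc i))"
proof -
  have s: "E (v i) (v (Suc i))" if "1 \<le> i" "i < K" for i using assms that unfolding ppath_def by (elim conjE) simp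
  have n: "c i \<noteq> c (Suc i)" if "i < K" for i using assms that unfolding ppath_def by (elim conjE) simp
  have ch: "c i \<noteq> c (j - 1) \<and> c i \<noteq> c j \<and> c (i - 1) \<noteq> c (j - 1)" if "1 \<le> i" "Suc i < j" "j \<le> K" "E (v i) (v j)" for i j
    using assms that unfolding ppath_def by (elim conjE) simp
  show ?thesis
    unfolding fchain_def
  proof (intro allI impI conjI)
    fix i j assume ij: "i < K" "j < K"
    show "E (v (Suc j)) (v (Suc i))" if "E (v (Suc i)) (v (Suc j))" using that by (rule symE)
    show "\<not> E (v (Suc i)) (v (Suc i))" by (rule irrE)
    show "c i \<noteq> c (Suc i)" by (rule n[OF ij(1)])
    show "E (v (Suc i)) (v (Suc j))" if "j = Suc i" using s[of "Suc i"] ij that by simp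
    show "c j = c (Suc i)" if "j = Suc i" using that by simp
    show "c (Suc i) \<noteq> c j" "c (Suc i) \<noteq> c (Suc j)" "c i \<noteq> c j" if "E (v (Suc i)) (v (Suc j))" "Suc i < j"
      using ch[of "Suc i" "Suc j"] that ij by simp_all
  qed
qed

end

definition kfree :: "nat => 'b set => ('b => 'b => bool) => bool" where
  "kfree k V R \<longleftrightarrow> (\<forall>a b c d S. S \<subseteq> V --> finite S --> card S = k --> \<not> indP4k R a b c d S)"

definition p6free :: "('b => 'b => bool) => bool" where
  "p6free R \<longleftrightarrow> (\<forall>a b c d e f. \<not> indP6 R a b c d e f)"

definition p33free :: "('b => 'b => bool) => bool" where
  "p33free R \<longleftrightarrow> (\<forall>a b c a' b' c'. indP3 R a b c --> indP3 R a' b' c' --> (\<exists>x\<in>{a, b, c}. \<exists>y\<in>{a', b', c'}. R x y))"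

text \<open>If there were no uniform bound, every \<open>K\<close> would have a counterexample and
  in it a path of length \<open>K + 2\<close>. The bounds obtained from this are not
  explicit.\<close>

lemma long_ppaths:
  fixes P :: "'a set => ('a => 'a => bool) => ('a set => ('a => col) => bool) => bool"
  assumes no: "\<nexists>N. \<forall>V E \<Phi>. fgraph V E --> P V E \<Phi> --> fgraph.adm E \<Phi> --> fgraph.lc V N \<Phi> -->
    fgraph.two_lists V \<Phi> --> (\<exists>f. fgraph.proper E V f)"
  shows "\<exists>V E \<Phi> v c. \<forall>K. fgraph (V K) (E K) \<and> P (V K) (E K) (\<Phi> K) \<and> fgraph.ppath (V K) (E K) (\<Phi> K) (K + 2) (v K) (c K)"
proof -
  have "\<exists>V E \<Phi> v c. fgraph V E \<and> P V E \<Phi> \<and> fgraph.ppath V E \<Phi> (K + 2) v c" for K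
  proof -
    have "\<exists>V E \<Phi>. fgraph V E \<and> P V E \<Phi> \<and> fgraph.adm E \<Phi> \<and> fgraph.lc V (8 * (2 * (K + 2) + 2) + 2) \<Phi> \<and>
      fgraph.two_lists V \<Phi> \<and> \<not> (\<exists>f. fgraph.proper E V f)"
      using no by (simp only: not_ex not_all not_imp)
    then obtain V E \<Phi> where a: "fgraph V E" "P V E \<Phi>" "fgraph.adm E \<Phi>" "fgraph.lc V (8 * (2 * (K + 2) + 2) + 2) \<Phi>"
      "fgraph.two_lists V \<Phi>" "\<not> (\<exists>f. fgraph.proper E V f)" by (elim exE conjE)
    have "2 \<le> K + 2" by simp
    from fgraph.ppath_exists[OF a(1,3,5) this a(4,6)] obtain v c where "fgraph.ppath V E \<Phi> (K + 2) v c" by (elim exE)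
    then show ?thesis using a(1,2) by (intro exI conjI)
  qed
  then show ?thesis by metis
qed

text \<open>Arbitrarily long paths would have an infinite limit, and the \<open>P6\<close> in the
  limit occupies finitely many positions, so one of the graphs contains it.\<close>

theorem two_lists_P6:
  "\<exists>N. \<forall>V (E :: 'a => 'a => bool) \<Phi>. fgraph V E --> p6free E --> fgraph.adm E \<Phi> --> fgraph.lc V N \<Phi> -->
    fgraph.two_lists V \<Phi> --> (\<exists>f. fgraph.proper E V f)"
proof (rule ccontr)
  assume no: "\<not> ?thesis"
  from long_ppaths[of "\<lambda>V E \<Phi>. p6free E", OF no]
  obtain V and E :: "nat => 'a => 'a => bool" and \<Phi> v c where
    a: "\<forall>K. fgraph (V K) (E K) \<and> p6free (E K) \<and> fgraph.ppath (V K) (E K) (\<Phi> K) (K + 2) (v K) (c K)" by (elim exE)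
  have fc: "fchain K (\<lambda>i j. E K (v K (Suc i)) (v K (Suc j))) (c K) (\<lambda>i. c K (Suc i))" for K
    using fgraph.ppath_fchain[of "V K" "E K" "\<Phi> K" "K + 2" "v K" "c K"] a fchain_mono[of "K + 2" _ _ _ K] by simp
  from chain_limit_adj[of "\<lambda>K i j. E K (v K (Suc i)) (v K (Suc j))" c "\<lambda>K i. c K (Suc i)", OF fc]
  obtain R' p' c' where ch: "chain R' p' c'" and ag: "\<forall>n. \<exists>K\<ge>n. \<forall>i<n. \<forall>j<n. R' i j = E K (v K (Suc i)) (v K (Suc j))"
    by (elim exE conjE)
  obtain x1 x2 x3 x4 x5 x6 where x: "indP6 R' x1 x2 x3 x4 x5 x6" using chain.chain_has_P6[OF ch] by blast
  define n where "n = Suc (x1 + x2 + x3 + x4 + x5 + x6)"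
  obtain K where "\<forall>i<n. \<forall>j<n. R' i j = E K (v K (Suc i)) (v K (Suc j))" using ag[rule_format, of n] by (elim exE conjE)
  then have e: "R' i j = E K (v K (Suc i)) (v K (Suc j))" if "i < n" "j < n" for i j using that by simp
  have b: "x1 < n" "x2 < n" "x3 < n" "x4 < n" "x5 < n" "x6 < n" unfolding n_def by auto
  have "indP6 (E K) (v K (Suc x1)) (v K (Suc x2)) (v K (Suc x3)) (v K (Suc x4)) (v K (Suc x5)) (v K (Suc x6))"
    using x unfolding indP6_def by (simp add: e[OF b(1)] e[OF b(2)] e[OF b(3)] e[OF b(4)] e[OF b(5)] b)
  then show False using a[rule_format, of K] unfolding p6free_def by blast
qed

theorem two_lists_P4k:
  "\<exists>N. \<forall>V (E :: 'a => 'a => bool) \<Phi>. fgraph V E --> kfree k V E --> fgraph.adm E \<Phi> --> fgraph.lc V N \<Phi> -->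
    fgraph.two_lists V \<Phi> --> (\<exists>f. fgraph.proper E V f)"
proof (rule ccontr)
  assume no: "\<not> ?thesis"
  from long_ppaths[of "\<lambda>V E \<Phi>. kfree k V E", OF no]
  obtain V and E :: "nat => 'a => 'a => bool" and \<Phi> v c where
    a: "\<forall>K. fgraph (V K) (E K) \<and> kfree k (V K) (E K) \<and> fgraph.ppath (V K) (E K) (\<Phi> K) (K + 2) (v K) (c K)" by (elim exE)
  have fc: "fchain K (\<lambda>i j. E K (v K (Suc i)) (v K (Suc j))) (c K) (\<lambda>i. c K (Suc i))" for K
    using fgraph.ppath_fchain[of "V K" "E K" "\<Phi> K" "K + 2" "v K" "c K"] a fchain_mono[of "K + 2" _ _ _ K] by simp
  from chain_limit_adj[of "\<lambda>K i j. E K (v K (Suc i)) (v K (Suc j))" c "\<lambda>K i. c K (Suc i)", OF fc]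
  obtain R' p' c' where ch: "chain R' p' c'" and ag: "\<forall>n. \<exists>K\<ge>n. \<forall>i<n. \<forall>j<n. R' i j = E K (v K (Suc i)) (v K (Suc j))"
    by (elim exE conjE)
  obtain x1 x2 x3 x4 S where S: "finite S" "card S = k" and x: "indP4k R' x1 x2 x3 x4 S" using chain.chain_has_P4k[OF ch, of k] by blast
  define n where "n = Suc (x1 + x2 + x3 + x4 + Max (insert 0 S))"
  obtain K where nK: "n \<le> K" and "\<forall>i<n. \<forall>j<n. R' i j = E K (v K (Suc i)) (v K (Suc j))" using ag[rule_format, of n] by (elim exE conjE)
  then have e: "R' i j = E K (v K (Suc i)) (v K (Suc j))" if "i < n" "j < n" for i j using that by simp
  have b: "x1 < n" "x2 < n" "x3 < n" "x4 < n" unfolding n_def by auto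
  have bS: "s < n" if s: "s \<in> S" for s
  proof -
    have "s \<le> Max (insert 0 S)" by (rule Max_ge) (use S s in auto)
    then show ?thesis unfolding n_def by simp
  qed
  let ?w = "\<lambda>i. v K (Suc i)"
  have "indP4 (E K) (?w x1) (?w x2) (?w x3) (?w x4)"
    using x unfolding indP4k_def indP4_def by (simp add: e[OF b(1)] e[OF b(2)] e[OF b(3)] b)
  moreover have "\<not> E K (?w x1) y \<and> \<not> E K (?w x2) y \<and> \<not> E K (?w x3) y \<and> \<not> E K (?w x4) y" if "y \<in> ?w ` S" for y
    using x that bS e[OF b(1)] e[OF b(2)] e[OF b(3)] e[OF b(4)] unfolding indP4k_def by auto
  moreover have "\<not> E K y z" if "y \<in> ?w ` S" "z \<in> ?w ` S" for y z
    using x that bS e unfolding indP4k_def by auto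
  ultimately have "indP4k (E K) (?w x1) (?w x2) (?w x3) (?w x4) (?w ` S)" unfolding indP4k_def by blast
  moreover have "card (?w ` S) = k"
  proof -
    have "fgraph (V K) (E K)" "fgraph.ppath (V K) (E K) (\<Phi> K) (K + 2) (v K) (c K)" using a by simp_all
    then have i: "inj_on (v K) {1..K + 2}" by (simp add: fgraph.ppath_def)
    have "inj_on ?w S"
    proof (rule inj_onI)
      fix x y assume xy: "x \<in> S" "y \<in> S" "v K (Suc x) = v K (Suc y)"
      have "Suc x \<in> {1..K + 2}" "Suc y \<in> {1..K + 2}" using bS[OF xy(1)] bS[OF xy(2)] nK by simp_all
      then show "x = y" using inj_onD[OF i xy(3)] by simp
    qed
    then show ?thesis using S by (simp add: card_image)
  qed
  moreover have "?w ` S \<subseteq> V K"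
  proof -
    have "fgraph (V K) (E K)" "fgraph.ppath (V K) (E K) (\<Phi> K) (K + 2) (v K) (c K)" using a by simp_all
    then have i: "v K ` {1..K + 2} \<subseteq> V K" by (simp add: fgraph.ppath_def)
    have "Suc s \<in> {1..K + 2}" if "s \<in> S" for s using bS[OF that] nK by simp
    then show ?thesis using i by blast
  qed
  moreover have "kfree k (V K) (E K)" using a by simp
  ultimately show False using S(1) unfolding kfree_def by blast
qed

definition forced :: "('a set => ('a => col) => bool) => 'a => bool" where
  "forced \<Phi> v \<longleftrightarrow> (\<exists>d. \<forall>f. \<Phi> {v} f --> f v = d)"

text \<open>Neighbours of forced colour are what removes a colour from \<open>v\<close>. Either they
  come from a bounded set, or \<open>v\<close> has few unforced neighbours; the latter bounds its
  degree in a chain, because chain vertices are unforced.\<close>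

definition helpers :: "nat => 'a set => ('a => 'a => bool) => ('a set => ('a => col) => bool) => ('a => 'a) => 'a set => bool" where
  "helpers \<kappa> V E \<Phi> h S \<longleftrightarrow> finite S \<and> card S \<le> \<kappa> \<and>
    (\<forall>v\<in>V. \<not> forced \<Phi> v --> E v (h v) \<and> forced \<Phi> (h v) \<and> (h v \<in> S \<or> card {u \<in> V. E v u \<and> \<not> forced \<Phi> u} \<le> 8))"

lemma two_colours_eq: "(a :: col) \<noteq> b ==> a \<noteq> m ==> b \<noteq> m ==> a' \<noteq> b' ==> a' \<noteq> m ==> b' \<noteq> m ==> {a, b} = {a', b'}"
  by (cases a; cases b; cases m; cases a'; cases b') auto

context fgraph
begin

text \<open>Both colours of a path vertex are realisable, so it is not forced. Its list avoids the
  colour of every forced neighbour, hence all path vertices adjacent to one helper have the same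
  list.\<close>

lemma ppath_helpers:
  assumes pp: "ppath \<Phi> (K + 2) v c" and adm: "adm \<Phi>" and h: "helpers \<kappa> V E \<Phi> h S" and i: "i < K"
  shows "v (Suc i) \<in> V" "E (v (Suc i)) (h (v (Suc i)))" "\<not> forced \<Phi> (v (Suc i))"
    "h (v (Suc i)) \<in> S \<or> card {u \<in> V. E (v (Suc i)) u \<and> \<not> forced \<Phi> u} \<le> 8"
    "j < K ==> E (h (v (Suc i))) (v (Suc j)) ==> {c i, c (Suc i)} = {c j, c (Suc j)}"
proof -
  have im: "v ` {1..K + 2} \<subseteq> V" using pp unfolding ppath_def by (elim conjE)
  have n: "c i \<noteq> c (Suc i)" if "i < K" for i using pp that unfolding ppath_def by (elim conjE) simp
  have both: "\<exists>f. \<Phi> (insert (v (Suc i)) X) f \<and> f (v (Suc i)) = d" if "i < K" "d = c i \<or> d = c (Suc i)" "X \<subseteq> V" "card X \<le> 1" for i d X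
  proof -
    have "\<forall>i d X. 1 \<le> i \<and> i \<le> K + 2 \<and> d \<in> {c (i - 1), c i} \<and> X \<subseteq> V \<and> card X \<le> K + 2 -->
       (\<exists>f. \<Phi> (insert (v i) X) f \<and> f (v i) = d)" using pp unfolding ppath_def by (elim conjE)
    from this[rule_format, of "Suc i" d X] show ?thesis using that by simp
  qed
  have nf: "\<not> forced \<Phi> (v (Suc i))" if iK: "i < K" for i
  proof
    assume "forced \<Phi> (v (Suc i))"
    then obtain d where "\<forall>f. \<Phi> {v (Suc i)} f --> f (v (Suc i)) = d" unfolding forced_def by (elim exE)
    note d = this[rule_format]
    obtain f where f: "\<Phi> {v (Suc i)} f" "f (v (Suc i)) = c i" using both[OF iK, of "c i" "{}"] by auto
    obtain g where g: "\<Phi> {v (Suc i)} g" "g (v (Suc i)) = c (Suc i)" using both[OF iK, of "c (Suc i)" "{}"] by auto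
    show False using d[OF f(1)] d[OF g(1)] f(2) g(2) n[OF iK] by simp
  qed
  have V: "v (Suc i) \<in> V" if "i < K" for i using im that by (auto simp: image_subset_iff)
  have hv: "E (v (Suc i)) (h (v (Suc i)))" "forced \<Phi> (h (v (Suc i)))"
    "h (v (Suc i)) \<in> S \<or> card {u \<in> V. E (v (Suc i)) u \<and> \<not> forced \<Phi> u} \<le> 8"
    using h V[OF i] nf[OF i] unfolding helpers_def by simp_all
  obtain m where "\<forall>f. \<Phi> {h (v (Suc i))} f --> f (h (v (Suc i))) = m" using hv(2) unfolding forced_def by (elim exE)
  note m = this[rule_format]
  have hV: "h (v (Suc i)) \<in> V" using hv(1) symE EV by metis
  have ne: "d \<noteq> m" if j: "j < K" "E (h (v (Suc i))) (v (Suc j))" "d = c j \<or> d = c (Suc j)" for j d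
  proof -
    obtain f where f: "\<Phi> (insert (v (Suc j)) {h (v (Suc i))}) f" "f (v (Suc j)) = d"
      using both[OF j(1,3), of "{h (v (Suc i))}"] hV by auto
    have "\<Phi> {h (v (Suc i))} f" by (rule admD[OF adm f(1)]) simp
    then have "f (h (v (Suc i))) = m" by (rule m)
    moreover have "f (h (v (Suc i))) \<noteq> f (v (Suc j))" by (rule adm_proper[OF adm f(1)]) (use j(2) in simp_all)
    ultimately show ?thesis using f(2) by simp
  qed
  show "v (Suc i) \<in> V" "E (v (Suc i)) (h (v (Suc i)))" "\<not> forced \<Phi> (v (Suc i))"
    "h (v (Suc i)) \<in> S \<or> card {u \<in> V. E (v (Suc i)) u \<and> \<not> forced \<Phi> u} \<le> 8"
    using V[OF i] nf[OF i] hv by simp_all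
  show "{c i, c (Suc i)} = {c j, c (Suc j)}" if j: "j < K" "E (h (v (Suc i))) (v (Suc j))"
    by (rule two_colours_eq[of _ _ m]) (use n i j ne[OF i symE[OF hv(1)]] ne[OF j] in simp_all)
qed

end

theorem two_lists_2P3:
  "\<exists>N. \<forall>V (E :: 'a => 'a => bool) \<Phi>. fgraph V E --> (p33free E \<and> fgraph.adm E \<Phi> \<and> (\<exists>h S. helpers \<kappa> V E \<Phi> h S)) -->
    fgraph.adm E \<Phi> --> fgraph.lc V N \<Phi> --> fgraph.two_lists V \<Phi> --> (\<exists>f. fgraph.proper E V f)"
proof (rule ccontr)
  assume no: "\<not> ?thesis"
  from long_ppaths[of "\<lambda>V E \<Phi>. p33free E \<and> fgraph.adm E \<Phi> \<and> (\<exists>h S. helpers \<kappa> V E \<Phi> h S)", OF no]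
  obtain V and E :: "nat => 'a => 'a => bool" and \<Phi> v c where
    a: "\<forall>K. fgraph (V K) (E K) \<and> (p33free (E K) \<and> fgraph.adm (E K) (\<Phi> K) \<and> (\<exists>h S. helpers \<kappa> (V K) (E K) (\<Phi> K) h S)) \<and>
      fgraph.ppath (V K) (E K) (\<Phi> K) (K + 2) (v K) (c K)" by (elim exE)
  have "\<forall>K. \<exists>h S. helpers \<kappa> (V K) (E K) (\<Phi> K) h S" using a by simp
  then have "\<exists>h S. \<forall>K. helpers \<kappa> (V K) (E K) (\<Phi> K) (h K) (S K)" by metis
  then obtain h S where "\<forall>K. helpers \<kappa> (V K) (E K) (\<Phi> K) (h K) (S K)" by (elim exE)
  note hS = this[rule_format]
  have fg: "fgraph (V K) (E K)" and ad: "fgraph.adm (E K) (\<Phi> K)" and fr: "p33free (E K)" and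
    pp: "fgraph.ppath (V K) (E K) (\<Phi> K) (K + 2) (v K) (c K)" for K using a by simp_all
  note H = fgraph.ppath_helpers[OF fg pp ad hS]
  have fc: "fchain K (\<lambda>i j. E K (v K (Suc i)) (v K (Suc j))) (c K) (\<lambda>i. c K (Suc i))" for K
    using fgraph.ppath_fchain[of "V K" "E K" "\<Phi> K" "K + 2" "v K" "c K"] a fchain_mono[of "K + 2" _ _ _ K] by simp
  have inj: "inj_on (\<lambda>i. v K (Suc i)) A" if "\<And>i. i \<in> A ==> i < K" for K A
  proof -
    have i: "inj_on (v K) {1..K + 2}" using pp[of K] by (simp add: fgraph.ppath_def[OF fg[of K]])
    show ?thesis
    proof (rule inj_onI)
      fix x y assume xy: "x \<in> A" "y \<in> A" "v K (Suc x) = v K (Suc y)"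
      have "Suc x \<in> {1..K + 2}" "Suc y \<in> {1..K + 2}" using that[OF xy(1)] that[OF xy(2)] by simp_all
      then show "x = y" using inj_onD[OF i xy(3)] by simp
    qed
  qed
  let ?G = "\<lambda>K i j. E K (h K (v K (Suc i))) (v K (Suc j))" and ?T = "\<lambda>K i. h K (v K (Suc i)) \<in> S K"
  from chain_limit[of "\<lambda>K i j. E K (v K (Suc i)) (v K (Suc j))" c "\<lambda>K i. c K (Suc i)" ?G ?T, OF fc]
  obtain R' p' c' G' T' where ch: "chain R' p' c'" and
    ag: "\<forall>n. \<exists>K\<ge>n. \<forall>i<n. \<forall>j<n. R' i j = E K (v K (Suc i)) (v K (Suc j)) \<and> p' i = c K i \<and> c' i = c K (Suc i) \<and>
      G' i j = ?G K i j \<and> T' i = ?T K i"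
    by (elim exE conjE)
  interpret chain R' p' c' by (rule ch)
  have AG: "\<exists>K\<ge>n. (\<forall>i<n. \<forall>j<n. R' i j = E K (v K (Suc i)) (v K (Suc j))) \<and> (\<forall>i<n. p' i = c K i \<and> c' i = c K (Suc i)) \<and>
      (\<forall>i<n. \<forall>j<n. G' i j = ?G K i j) \<and> (\<forall>i<n. T' i = ?T K i)" for n
  proof -
    obtain K where K: "n \<le> K" "\<forall>i<n. \<forall>j<n. R' i j = E K (v K (Suc i)) (v K (Suc j)) \<and> p' i = c K i \<and> c' i = c K (Suc i) \<and>
      G' i j = ?G K i j \<and> T' i = ?T K i" using ag[rule_format, of n] by (elim exE conjE)
    have "p' i = c K i" "c' i = c K (Suc i)" "T' i = ?T K i" if "i < n" for i using K(2) that by auto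
    then show ?thesis using K by (intro exI[of _ K]) simp
  qed
  interpret helper_chain R' p' c' G' T' \<kappa>
  proof
    fix i j assume g: "G' i j"
    define n where "n = Suc (i + j)"
    have b: "i < n" "j < n" unfolding n_def by simp_all
    obtain K where K: "n \<le> K" "\<forall>i<n. p' i = c K i \<and> c' i = c K (Suc i)" "\<forall>i<n. \<forall>j<n. G' i j = ?G K i j"
      using AG[of n] by (elim exE conjE)
    show "{p' i, c' i} = {p' j, c' j}" using H(5)[of i K j] K g b by simp
  next
    fix i A assume nT: "\<not> T' i" and A: "finite A" "\<And>j. j \<in> A ==> R' i j"
    define n where "n = Suc (i + Max (insert 0 A))"
    have b: "i < n" unfolding n_def by simp
    have bA: "j < n" if j: "j \<in> A" for j
    proof -
      have "j \<le> Max (insert 0 A)" by (rule Max_ge) (use A(1) j in auto)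
      then show ?thesis unfolding n_def by simp
    qed
    obtain K where K: "n \<le> K" "\<forall>i<n. \<forall>j<n. R' i j = E K (v K (Suc i)) (v K (Suc j))" "\<forall>i<n. T' i = ?T K i"
      using AG[of n] by (elim exE conjE)
    let ?N = "{u \<in> V K. E K (v K (Suc i)) u \<and> \<not> forced (\<Phi> K) u}"
    have iK: "i < K" using b K(1) by simp
    have "card ?N \<le> 8" using H(4)[OF iK] nT K(3) b by simp
    moreover have "(\<lambda>j. v K (Suc j)) ` A \<subseteq> ?N"
    proof
      fix u assume "u \<in> (\<lambda>j. v K (Suc j)) ` A"
      then obtain j where j: "j \<in> A" "u = v K (Suc j)" by (elim imageE)
      have jK: "j < K" using bA[OF j(1)] K(1) by simp
      show "u \<in> ?N" using H(1)[OF jK] H(3)[OF jK] A(2)[OF j(1)] K(2) b bA[OF j(1)] j(2) by simp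
    qed
    moreover have "finite ?N" using fgraph.finV[OF fg[of K]] by simp
    moreover have "card ((\<lambda>j. v K (Suc j)) ` A) = card A"
      by (rule card_image, rule inj) (use bA K(1) in fastforce)
    ultimately show "card A \<le> 8" using card_mono[of ?N "(\<lambda>j. v K (Suc j)) ` A"] by simp
  next
    fix A assume A: "finite A" "\<kappa> < card A" "\<And>i. i \<in> A ==> T' i"
    define n where "n = Suc (Max (insert 0 A))"
    have bA: "j < n" if j: "j \<in> A" for j
    proof -
      have "j \<le> Max (insert 0 A)" by (rule Max_ge) (use A(1) j in auto)
      then show ?thesis unfolding n_def by simp
    qed
    obtain K where K: "n \<le> K" "\<forall>i<n. \<forall>j<n. G' i j = ?G K i j" "\<forall>i<n. T' i = ?T K i"
      using AG[of n] by (elim exE conjE)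
    have S: "finite (S K)" "card (S K) \<le> \<kappa>" using hS[of K] unfolding helpers_def by simp_all
    have "(\<lambda>i. h K (v K (Suc i))) ` A \<subseteq> S K" using A(3) bA K(3) by (simp add: image_subset_iff)
    from card_mono[OF S(1) this] have "card ((\<lambda>i. h K (v K (Suc i))) ` A) < card A" using S(2) A(2) by linarith
    then have "\<not> inj_on (\<lambda>i. h K (v K (Suc i))) A" by (rule pigeonhole)
    then obtain i j where ij: "i \<in> A" "j \<in> A" "i < j" "h K (v K (Suc i)) = h K (v K (Suc j))"
      unfolding inj_on_def by (metis linorder_neqE_nat)
    have jK: "j < K" using bA[OF ij(2)] K(1) by simp
    have "E K (h K (v K (Suc j))) (v K (Suc j))" using H(2)[OF jK] fgraph.symE[OF fg] by metis
    then have "G' i j" using K(2) ij bA by simp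
    then show "\<exists>i\<in>A. \<exists>j\<in>A. i < j \<and> G' i j" using ij by blast
  next
    fix x y z x' y' z' assume P: "indP3 R' x y z" "indP3 R' x' y' z'"
    define n where "n = Suc (x + y + z + x' + y' + z')"
    have b: "x < n" "y < n" "z < n" "x' < n" "y' < n" "z' < n" unfolding n_def by simp_all
    obtain K where K: "n \<le> K" "\<forall>i<n. \<forall>j<n. R' i j = E K (v K (Suc i)) (v K (Suc j))"
      using AG[of n] by (elim exE conjE)
    let ?w = "\<lambda>i. v K (Suc i)"
    have iw: "inj_on ?w {..<n}" by (rule inj) (use K(1) in simp)
    have "indP3 (E K) (?w x) (?w y) (?w z)" "indP3 (E K) (?w x') (?w y') (?w z')"
      using P b K(2) inj_on_eq_iff[OF iw] unfolding indP3_def by simp_all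
    from fr[of K, unfolded p33free_def, rule_format, OF this]
    have "\<exists>u\<in>{?w x, ?w y, ?w z}. \<exists>u'\<in>{?w x', ?w y', ?w z'}. E K u u'" .
    then show "\<exists>u\<in>{x, y, z}. \<exists>u'\<in>{x', y', z'}. R' u u'" using b K(2) by simp
  next
    fix i j x y z assume ij: "R' i j" "\<not> G' i j" and P: "indP3 R' x y z"
    define n where "n = Suc (x + y + z + i + j)"
    have b: "x < n" "y < n" "z < n" "i < n" "j < n" unfolding n_def by simp_all
    obtain K where K: "n \<le> K" "\<forall>i<n. \<forall>j<n. R' i j = E K (v K (Suc i)) (v K (Suc j))" "\<forall>i<n. \<forall>j<n. G' i j = ?G K i j"
      using AG[of n] by (elim exE conjE)
    let ?w = "\<lambda>i. v K (Suc i)"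
    have iw: "inj_on ?w {..<n}" by (rule inj) (use K(1) in simp)
    have iK: "i < K" using b K by simp
    have P1: "indP3 (E K) (?w x) (?w y) (?w z)" using P b K(2) inj_on_eq_iff[OF iw] unfolding indP3_def by simp
    have Eg: "E K (h K (?w i)) (?w i)" using H(2)[OF iK] fgraph.symE[OF fg] by metis
    have nEj: "\<not> E K (h K (?w i)) (?w j)" and Eij: "E K (?w i) (?w j)" using ij K b by simp_all
    \<comment> \<open>Helpers are forced and path vertices are not, so a helper never lies on the
      path.\<close>
    have "h K (?w i) \<noteq> ?w j"
    proof
      assume e: "h K (?w i) = ?w j"
      have "i \<noteq> j" using Eij fgraph.irrE[OF fg] by metis
      have "forced (\<Phi> K) (h K (?w i))" using hS[of K] H(1)[OF iK] H(3)[OF iK] unfolding helpers_def by simp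
      moreover have "j < K" using b K by simp
      ultimately show False using H(3)[of j K] e by simp
    qed
    then have P2: "indP3 (E K) (h K (?w i)) (?w i) (?w j)" using Eg nEj Eij unfolding indP3_def by simp
    have "\<exists>u\<in>{h K (?w i), ?w i, ?w j}. \<exists>u'\<in>{?w x, ?w y, ?w z}. E K u u'" using fr[of K, unfolded p33free_def, rule_format, OF P2 P1] .
    then show "\<exists>u\<in>{x, y, z}. R' i u \<or> R' j u \<or> G' i u" using b K(2,3) by (simp add: disj_ac)
  next
    fix i j x y z assume ij: "G' i j" "i \<noteq> j" "\<not> R' i j" and P: "indP3 R' x y z"
    define n where "n = Suc (x + y + z + i + j)"
    have b: "x < n" "y < n" "z < n" "i < n" "j < n" unfolding n_def by simp_all
    obtain K where K: "n \<le> K" "\<forall>i<n. \<forall>j<n. R' i j = E K (v K (Suc i)) (v K (Suc j))" "\<forall>i<n. \<forall>j<n. G' i j = ?G K i j"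
      using AG[of n] by (elim exE conjE)
    let ?w = "\<lambda>i. v K (Suc i)"
    have iw: "inj_on ?w {..<n}" by (rule inj) (use K(1) in simp)
    have iK: "i < K" using b K by simp
    have P1: "indP3 (E K) (?w x) (?w y) (?w z)" using P b K(2) inj_on_eq_iff[OF iw] unfolding indP3_def by simp
    have P2: "indP3 (E K) (?w i) (h K (?w i)) (?w j)"
      using H(2)[OF iK] ij K(2,3) b inj_on_eq_iff[OF iw] unfolding indP3_def by simp
    have "\<exists>u\<in>{?w i, h K (?w i), ?w j}. \<exists>u'\<in>{?w x, ?w y, ?w z}. E K u u'" using fr[of K, unfolded p33free_def, rule_format, OF P2 P1] .
    then show "\<exists>u\<in>{x, y, z}. R' i u \<or> R' j u \<or> G' i u" using b K(2,3) by (simp add: disj_ac)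
  qed
  show False by (rule helper_chain_False)
qed


section \<open>P6-free graphs: components of vertices that keep three colours\<close>

definition oth :: "col => col => col" where
  "oth a b = (SOME c. c \<noteq> a \<and> c \<noteq> b)"

lemma oth: "oth a b \<noteq> a" "oth a b \<noteq> b"
proof -
  have "\<exists>c :: col. c \<noteq> a \<and> c \<noteq> b" by (cases a; cases b) auto
  from someI_ex[OF this] show "oth a b \<noteq> a" "oth a b \<noteq> b" unfolding oth_def by simp_all
qed

lemma walk_alternates:
  fixes f :: "'a => col"
  assumes "\<And>i. i < n ==> f (g i) \<noteq> f (g (Suc i))" "\<And>i. i \<le> n ==> f (g i) \<noteq> m"
  shows "(f (g n) = f (g 0)) = even n"
  using assms
proof (induction n)
  case (Suc n)
  have IH: "(f (g n) = f (g 0)) = even n" using Suc by simp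
  have s: "f (g n) \<noteq> f (g (Suc n))" "f (g (Suc n)) \<noteq> m" "f (g n) \<noteq> m" "f (g 0) \<noteq> m" using Suc.prems by simp_all
  show ?case
  proof (cases "even n")
    case True then show ?thesis using IH s by auto
  next
    case False
    then have "f (g (Suc n)) = f (g 0)" using IH s col_eqI[of "f (g (Suc n))" m "f (g n)" "f (g 0)"] by auto
    then show ?thesis using False by simp
  qed
qed simp

locale p6graph = fgraph +
  fixes N0 :: nat
  assumes p6: "p6free E"
    and two_listed: "adm \<Phi> ==> lc N0 \<Phi> ==> two_lists \<Phi> ==> \<exists>f. proper V f"
begin

lemma noP6: "indP6 E a b c d e f ==> False"
  using p6 unfolding p6free_def by blast

lemma Ecomm: "E x y \<longleftrightarrow> E y x"
  using symE by blast

definition stp :: "'a set => ('a \<times> 'a) set" where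
  "stp U = {(x, y). x \<in> U \<and> y \<in> U \<and> E x y}"

lemma sym_stp: "sym ((stp U)\<^sup>*)"
  by (rule sym_rtrancl) (auto simp: sym_def stp_def intro: symE)

text \<open>The first five edges of a longer shortest path would induce a \<open>P6\<close>.\<close>

lemma short_path:
  assumes "(u, v) \<in> (stp U)\<^sup>*"
  shows "\<exists>n\<le>4. (u, v) \<in> stp U ^^ n"
proof -
  define n where "n = (LEAST n. (u, v) \<in> stp U ^^ n)"
  have ex: "\<exists>n. (u, v) \<in> stp U ^^ n" using assms by (rule rtrancl_imp_relpow[THEN exE]) blast
  have n: "(u, v) \<in> stp U ^^ n" unfolding n_def using ex by (rule LeastI_ex)
  have nm: "(u, v) \<notin> stp U ^^ m" if "m < n" for m using that not_less_Least unfolding n_def by blast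
  show ?thesis
  proof (cases "n \<le> 4")
    case False
    then have n5: "5 \<le> n" by simp
    obtain g where g: "g 0 = u" "g n = v" "\<forall>i<n. (g i, g (Suc i)) \<in> stp U"
      using n unfolding relpow_fun_conv by (elim exE conjE)
    have seg: "(g i, g j) \<in> stp U ^^ (j - i)" if "i \<le> j" "j \<le> n" for i j
    proof -
      have "\<exists>h. h 0 = g i \<and> h (j - i) = g j \<and> (\<forall>k<j - i. (h k, h (Suc k)) \<in> stp U)"
        using that g(3) by (intro exI[of _ "\<lambda>k. g (i + k)"]) auto
      then show ?thesis unfolding relpow_fun_conv .
    qed
    have gU: "g i \<in> U" if "i < n" for i using g(3)[rule_format, OF that] unfolding stp_def by simp
    have e: "E (g i) (g (Suc i))" if "i < n" for i using g(3)[rule_format, OF that] unfolding stp_def by simp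
    have gU': "g i \<in> U" if "i \<le> 5" for i
    proof (cases i)
      case 0 then show ?thesis using gU[of 0] n5 by simp
    next
      case (Suc j)
      have "j < n" using Suc that n5 by simp
      from g(3)[rule_format, OF this] show ?thesis unfolding stp_def Suc by simp
    qed
    have ne: "\<not> E (g i) (g j)" if ij: "Suc i < j" "j \<le> 5" for i j
    proof
      assume "E (g i) (g j)"
      then have s: "(g i, g j) \<in> stp U" using gU'[of i] gU'[of j] ij unfolding stp_def by simp
      have "(g 0, g i) \<in> stp U ^^ i" "(g j, g n) \<in> stp U ^^ (n - j)" using seg[of 0 i] seg[of j n] ij n5 by auto
      then have "(g 0, g n) \<in> (stp U ^^ i O stp U ^^ 1) O stp U ^^ (n - j)" using s by (intro relcomp.relcompI) auto
      then have "(g 0, g n) \<in> stp U ^^ (i + 1 + (n - j))" by (simp only: relpow_add)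
      moreover have "i + 1 + (n - j) < n" using ij n5 by linarith
      ultimately show False using nm g(1,2) by metis
    qed
    have "indP6 E (g 0) (g 1) (g 2) (g 3) (g 4) (g 5)"
      unfolding indP6_def using e[of 0] e[of 1] e[of 2] e[of 3] e[of 4] n5 by (simp add: ne eval_nat_numeral)
    then show ?thesis using noP6 by blast
  qed (use n in blast)
qed

text \<open>\<open>U\<close> collects the vertices that may still have three colours. A vertex of
  \<open>H\<close> adjacent to a vertex of \<open>U\<close> is adjacent to its whole component, and
  it never has colour \<open>one\<close>; so each component uses \<open>one\<close> and just one
  other colour. If some vertex of the component is never \<open>one\<close>, parity of walks from it
  tells which vertices are \<open>one\<close>. If there is none, the component may be recoloured
  with \<open>one\<close> on the even vertices, since all its outside neighbours lie in
  \<open>H\<close>. In both cases every vertex is left with two colours.\<close>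

lemma ending:
  assumes adm: "adm \<Phi>" and lc: "lc (N0 * 7) \<Phi>" and UV: "U \<subseteq> V"
    and H_def: "H = {z \<in> V - U. (\<forall>f. \<Phi> {z} f --> f z \<noteq> one) \<and> (\<forall>x\<in>U. \<forall>y\<in>U. E x y --> E z x --> E z y)}"
    and lists: "\<And>v. v \<in> V ==> v \<notin> U ==> \<exists>c. \<forall>f. \<Phi> {v} f --> f v \<noteq> c"
    and dom: "\<And>u. u \<in> U ==> \<exists>z\<in>H. E z u"
    and out: "\<And>v x f. v \<in> V ==> v \<notin> U ==> v \<notin> H ==> x \<in> U ==> E v x ==> \<Phi> {x} f ==> f x \<noteq> one"
  shows "\<exists>f. proper V f"
proof -
  define comp where "comp u = (stp U)\<^sup>* `` {u}" for u
  define Q where "Q = {q \<in> U. \<forall>f. \<Phi> {q} f --> f q \<noteq> one}"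
  define rt where "rt u = (SOME r. r \<in> comp u \<and> (comp u \<inter> Q \<noteq> {} --> r \<in> Q))" for u
  define zz where "zz u = (SOME z. z \<in> H \<and> (\<forall>v\<in>comp u. E z v))" for u
  have self: "u \<in> comp u" for u unfolding comp_def by simp
  have compU: "v \<in> U" if "u \<in> U" "v \<in> comp u" for u v
  proof -
    have "(u, v) \<in> (stp U)\<^sup>*" using that(2) unfolding comp_def by simp
    then show ?thesis using that(1) by (induction rule: rtrancl_induct) (auto simp: stp_def)
  qed
  have comp_eq: "comp u = comp v" if "(u, v) \<in> stp U" for u v
  proof -
    have 1: "(u, v) \<in> (stp U)\<^sup>*" using that by simp
    then have 2: "(v, u) \<in> (stp U)\<^sup>*" using sym_stp[of U] by (simp add: sym_def)
    show ?thesis unfolding comp_def using 1 2 by (auto intro: rtrancl_trans)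
  qed
  have rt: "rt u \<in> comp u" "comp u \<inter> Q \<noteq> {} ==> rt u \<in> Q" for u
  proof -
    have "\<exists>r. r \<in> comp u \<and> (comp u \<inter> Q \<noteq> {} --> r \<in> Q)" using self by blast
    from someI_ex[OF this] show "rt u \<in> comp u" "comp u \<inter> Q \<noteq> {} ==> rt u \<in> Q" unfolding rt_def by simp_all
  qed
  have hom: "E z y" if "z \<in> H" "E z u" "(u, y) \<in> (stp U)\<^sup>*" for z u y
    using that(3,2)
  proof (induction rule: rtrancl_induct)
    case (step y y')
    have "y \<in> U" "y' \<in> U" "E y y'" using step.hyps(2) unfolding stp_def by simp_all
    then show ?case using that(1) step.IH[OF step.prems] unfolding H_def by simp
  qed simp
  have zz: "zz u \<in> H" "v \<in> comp u ==> E (zz u) v" if u: "u \<in> U" for u v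
  proof -
    obtain z where z: "z \<in> H" "E z u" using dom[OF u] by (elim bexE)
    have "\<forall>v\<in>comp u. E z v" using hom[OF z] unfolding comp_def by simp
    then have "\<exists>z. z \<in> H \<and> (\<forall>v\<in>comp u. E z v)" using z(1) by blast
    from someI_ex[OF this] show "zz u \<in> H" "v \<in> comp u ==> E (zz u) v" unfolding zz_def by simp_all
  qed
  have "\<exists>n g. n \<le> 4 \<and> g 0 = rt u \<and> g n = u \<and> (\<forall>i<n. (g i, g (Suc i)) \<in> stp U)" for u
  proof -
    have "(u, rt u) \<in> (stp U)\<^sup>*" using rt(1)[of u] unfolding comp_def by simp
    then have "(rt u, u) \<in> (stp U)\<^sup>*" using sym_stp[of U] by (simp add: sym_def)
    from short_path[OF this] obtain n where "n \<le> 4" "(rt u, u) \<in> stp U ^^ n" by (elim exE conjE)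
    then show ?thesis unfolding relpow_fun_conv by (intro exI[of _ n]) simp
  qed
  then have "\<forall>u. \<exists>n g. n \<le> 4 \<and> g 0 = rt u \<and> g n = u \<and> (\<forall>i<n. (g i, g (Suc i)) \<in> stp U)" by simp
  then have "\<exists>n g. \<forall>u. n u \<le> 4 \<and> g u 0 = rt u \<and> g u (n u) = u \<and> (\<forall>i<n u. (g u i, g u (Suc i)) \<in> stp U)" by metis
  then obtain n :: "'a => nat" and g where ng: "\<forall>u. n u \<le> 4 \<and> g u 0 = rt u \<and> g u (n u) = u \<and> (\<forall>i<n u. (g u i, g u (Suc i)) \<in> stp U)"
    by (elim exE)
  have n4: "n u \<le> 4" and g0: "g u 0 = rt u" and gn: "g u (n u) = u" and gs: "\<And>i. i < n u ==> (g u i, g u (Suc i)) \<in> stp U" for u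
    using ng by simp_all
  have gE: "E (g u i) (g u (Suc i))" if "i < n u" for u i using gs[OF that] unfolding stp_def by simp
  have gcomp: "g u i \<in> comp u" if "i \<le> n u" for u i
    using that
  proof (induction i)
    case 0 then show ?case using rt(1) g0 by simp
  next
    case (Suc i)
    then have "(u, g u i) \<in> (stp U)\<^sup>*" "(g u i, g u (Suc i)) \<in> stp U" using gs[of i u] unfolding comp_def by simp_all
    then show ?case unfolding comp_def by (auto intro: rtrancl_into_rtrancl)
  qed
  \<comment> \<open>At most five vertices on a walk and one vertex of \<open>H\<close>; with
    \<open>u\<close> itself they account for the factor 7.\<close>
  define D where "D u = (if u \<in> U then insert (zz u) (g u ` {..n u}) else {})" for u
  have DV: "D u \<subseteq> V" "card (D u) \<le> 6" for u
  proof -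
    show "D u \<subseteq> V"
    proof (cases "u \<in> U")
      case True
      have "zz u \<in> V" using zz(1)[OF True] unfolding H_def by simp
      moreover have "g u i \<in> V" if "i \<le> n u" for i using compU[OF True gcomp[OF that]] UV by blast
      ultimately show ?thesis unfolding D_def by auto
    qed (simp add: D_def)
    have "card (g u ` {..n u}) \<le> 5" using card_image_le[of "{..n u}" "g u"] n4[of u] by simp
    then show "card (D u) \<le> 6" unfolding D_def using card_insert_le_m1[of 6 "g u ` {..n u}" "zz u"] by simp
  qed
  have lc': "lc N0 (cl \<Phi> D)" by (rule closure[OF DV]) (use lc in simp)
  note adm' = adm_cl[OF adm, of D]
  have toP: "\<Phi> {v} f" if "cl \<Phi> D X f" "v \<in> X \<union> \<Union>(D ` X)" for v X f
    by (rule admD[OF adm that(1)[unfolded cl_def]]) (use that(2) in simp)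
  have prp: "f x \<noteq> f y" if "cl \<Phi> D X f" "x \<in> X \<union> \<Union>(D ` X)" "y \<in> X \<union> \<Union>(D ` X)" "E x y" for X f x y
    by (rule adm_proper[OF adm that(1)[unfolded cl_def] that(2-4)])
  have zD: "zz u \<in> X \<union> \<Union>(D ` X)" and gD: "i \<le> n u ==> g u i \<in> X \<union> \<Union>(D ` X)" if "u \<in> X" "u \<in> U" for u X i
    using that unfolding D_def by auto
  have znot: "f (zz u) \<noteq> one" if "cl \<Phi> D X f" "u \<in> X" "u \<in> U" for X f u
    using toP[OF that(1) zD[OF that(2,3)]] zz(1)[OF that(3)] unfolding H_def by simp
  have zg: "f (g u i) \<noteq> f (zz u)" if "cl \<Phi> D X f" "u \<in> X" "u \<in> U" "i \<le> n u" for X f u i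
    using prp[OF that(1) zD[OF that(2,3)] gD[OF that(2-4)] zz(2)[OF that(3) gcomp[OF that(4)]]] by simp
  have alt: "(f u = f (rt u)) = even (n u)" if c: "cl \<Phi> D X f" "u \<in> X" "u \<in> U" for X f u
  proof -
    have "(f (g u (n u)) = f (g u 0)) = even (n u)"
    proof (rule walk_alternates[of _ _ _ "f (zz u)"])
      fix i assume "i < n u"
      then show "f (g u i) \<noteq> f (g u (Suc i))" using prp[OF c(1) gD[OF c(2,3)] gD[OF c(2,3)] gE] by simp
    qed (rule zg[OF c])
    then show ?thesis unfolding g0 gn .
  qed
  define bad where "bad = {u \<in> U. comp u \<inter> Q = {}}"
  \<comment> \<open>The walk length \<open>n x\<close> need not be the distance from the root: only
    its parity is used, and by \<open>alt\<close> it matches the colouring.\<close>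
  define rec where "rec f x = (if x \<in> bad then (if even (n x) then one else oth one (f (zz x))) else f x)" for f x
  define \<Psi> where "\<Psi> X f \<longleftrightarrow> (\<exists>h. cl \<Phi> D X h \<and> (\<forall>x\<in>X. f x = rec h x))" for X f
  have uzz: "f u \<noteq> f (zz u)" if "cl \<Phi> D X f" "u \<in> X" "u \<in> U" for X f u
    using zg[OF that, of "n u"] gn by simp
  have rzz: "f (rt u) \<noteq> f (zz u)" if "cl \<Phi> D X f" "u \<in> X" "u \<in> U" for X f u
    using zg[OF that, of 0] g0 by simp
  \<comment> \<open>A neighbour of \<open>x\<close> outside \<open>U\<close> and \<open>H\<close>
    would put \<open>x\<close> into \<open>Q\<close> by \<open>out\<close>.\<close>
  have badout: "y \<in> H" if x: "x \<in> bad" and y: "y \<in> V" "y \<notin> bad" and e: "E y x" for x y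
  proof (rule ccontr)
    assume nH: "y \<notin> H"
    have xU: "x \<in> U" "comp x \<inter> Q = {}" using x unfolding bad_def by simp_all
    show False
    proof (cases "y \<in> U")
      case True
      have "comp y = comp x" by (rule comp_eq) (use True xU e in \<open>simp add: stp_def\<close>)
      then show False using y(2) True xU unfolding bad_def by simp
    next
      case False
      have "x \<in> Q" unfolding Q_def using out[OF y(1) False nH xU(1) e] xU(1) by simp
      then show False using xU(2) self[of x] by blast
    qed
  qed
  have recprop: "rec h x \<noteq> rec h y" if c: "cl \<Phi> D X h" and xy: "x \<in> X" "y \<in> X" "E x y" and b: "x \<in> bad" for X h x y
  proof -
    have xU: "x \<in> U" "comp x \<inter> Q = {}" using b unfolding bad_def by simp_all
    have yV: "y \<in> V" using EV[OF symE[OF xy(3)]] .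
    have hxy: "h x \<noteq> h y" by (rule prp[OF c _ _ xy(3)]) (use xy in simp_all)
    show ?thesis
    proof (cases "y \<in> bad")
      case True
      then have yU: "y \<in> U" unfolding bad_def by simp
      have ce: "comp x = comp y" by (rule comp_eq) (use xU yU xy in \<open>simp add: stp_def\<close>)
      have r: "rt y = rt x" "zz y = zz x" unfolding rt_def zz_def ce by simp_all
      note ax = alt[OF c xy(1) xU(1)] and ay = alt[OF c xy(2) yU]
      have "even (n x) \<noteq> even (n y)"
      proof
        assume ev: "even (n x) = even (n y)"
        show False
        proof (cases "even (n x)")
          case True then show False using ev ax ay r hxy by simp
        next
          case False
          then have "h x \<noteq> h (rt x)" "h y \<noteq> h (rt x)" using ev ax ay r by simp_all
          moreover have "h x \<noteq> h (zz x)" "h y \<noteq> h (zz x)" "h (rt x) \<noteq> h (zz x)"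
            using uzz[OF c xy(1) xU(1)] uzz[OF c xy(2) yU] rzz[OF c xy(1) xU(1)] r by simp_all
          ultimately have "h x = h y" using col_eqI[of "h x" "h (rt x)" "h (zz x)" "h y"] by simp
          then show False using hxy by simp
        qed
      qed
      then show ?thesis using b True oth[of one "h (zz x)"] oth[of one "h (zz y)"] unfolding rec_def by (cases "even (n x)") auto
    next
      case False
      have yH: "y \<in> H" by (rule badout[OF b yV False symE[OF xy(3)]])
      have y1: "h y \<noteq> one" using toP[OF c, of y] xy(2) yH unfolding H_def by simp
      show ?thesis
      proof (cases "even (n x)")
        case True then show ?thesis using b False y1 unfolding rec_def by simp
      next
        case odd: False
        then obtain k where k: "n x = Suc k" by (cases "n x") auto
        let ?x' = "g x k"
        have ex: "E ?x' x" "?x' \<in> U" using gs[of k x] gn[of x] k unfolding stp_def by simp_all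
        \<comment> \<open>\<open>y\<close> sees \<open>x\<close> and its predecessor, whose colours
          are the two that \<open>zz x\<close> does not have. So \<open>y\<close> has the colour of
          \<open>zz x\<close>, which the new colour of \<open>x\<close> avoids.\<close>
        have "E y ?x'" using yH ex xU(1) symE[OF ex(1)] symE[OF xy(3)] unfolding H_def by blast
        then have 1: "h y \<noteq> h ?x'" by (intro prp[OF c _ gD[OF xy(1) xU(1)]]) (use xy(2) k in simp_all)
        have 2: "h ?x' \<noteq> h x" by (rule prp[OF c gD[OF xy(1) xU(1)] _ ex(1)]) (use xy(1) k in simp_all)
        have 3: "h ?x' \<noteq> h (zz x)" using zg[OF c xy(1) xU(1), of k] k by simp
        have 4: "h x \<noteq> h (zz x)" by (rule uzz[OF c xy(1) xU(1)])
        have "h y = h (zz x)"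
          using col_eqI[of "h y" "h x" "h ?x'" "h (zz x)"] 1 2 3 4 hxy by auto
        then show ?thesis using b False odd oth[of one "h (zz x)"] unfolding rec_def by auto
      qed
    qed
  qed
  have admPsi: "adm \<Psi>"
    unfolding adm_def
  proof (intro conjI allI impI)
    fix X Y f assume XY: "X \<subseteq> Y" and "\<Psi> Y f"
    then obtain h where h: "cl \<Phi> D Y h" "\<forall>x\<in>Y. f x = rec h x" unfolding \<Psi>_def by (elim exE conjE)
    show "\<Psi> X f" unfolding \<Psi>_def using admD[OF adm' h(1) XY] h(2) XY by (intro exI[of _ h]) auto
  next
    fix X f assume "\<Psi> X f"
    then obtain h where h: "cl \<Phi> D X h" "\<forall>x\<in>X. f x = rec h x" unfolding \<Psi>_def by (elim exE conjE)
    show "proper X f"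
      unfolding proper_def
    proof (intro ballI impI)
      fix x y assume xy: "x \<in> X" "y \<in> X" "E x y"
      have "rec h x \<noteq> rec h y"
      proof (cases "x \<in> bad \<or> y \<in> bad")
        case True
        then show ?thesis using recprop[OF h(1) xy] recprop[OF h(1) xy(2,1) symE[OF xy(3)]] by auto
      next
        case False
        have "h x \<noteq> h y" by (rule prp[OF h(1) _ _ xy(3)]) (use xy in simp_all)
        then show ?thesis using False unfolding rec_def by simp
      qed
      then show "f x \<noteq> f y" using h(2) xy by simp
    qed
  qed
  have lcPsi: "lc N0 \<Psi>"
    unfolding lc_def
  proof (intro allI impI)
    fix X assume "X \<subseteq> V" "card X \<le> N0"
    from lcD[OF lc' this] obtain h where "cl \<Phi> D X h" by (elim exE)
    then show "\<exists>f. \<Psi> X f" unfolding \<Psi>_def by (intro exI[of _ "rec h"] exI[of _ h]) simp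
  qed
  have two: "two_lists \<Psi>"
    unfolding two_lists_def
  proof
    fix v assume v: "v \<in> V"
    consider "v \<notin> U" | "v \<in> bad" "even (n v)" | "v \<in> bad" "odd (n v)" | "v \<in> U" "v \<notin> bad" by blast
    then show "\<exists>c. \<forall>f. \<Psi> {v} f --> f v \<noteq> c"
    proof cases
      case 1
      from lists[OF v this] obtain c where c: "\<forall>f. \<Phi> {v} f --> f v \<noteq> c" by (elim exE)
      have "f v \<noteq> c" if "\<Psi> {v} f" for f
      proof -
        obtain h where h: "cl \<Phi> D {v} h" "f v = rec h v" using \<open>\<Psi> {v} f\<close> unfolding \<Psi>_def by auto
        have "\<Phi> {v} h" by (rule toP[OF h(1)]) simp
        then show ?thesis using c h(2) 1 unfolding rec_def bad_def by simp
      qed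
      then show ?thesis by (intro exI[of _ c]) simp
    next
      case 2
      have "f v \<noteq> oth one one" if "\<Psi> {v} f" for f
      proof -
        obtain h where h: "f v = rec h v" using \<open>\<Psi> {v} f\<close> unfolding \<Psi>_def by auto
        then show ?thesis using 2 oth[of one one] unfolding rec_def by simp
      qed
      then show ?thesis by (intro exI[of _ "oth one one"]) simp
    next
      case 3
      have "f v \<noteq> one" if "\<Psi> {v} f" for f
      proof -
        obtain h where h: "f v = rec h v" using \<open>\<Psi> {v} f\<close> unfolding \<Psi>_def by auto
        then show ?thesis using 3 oth[of one "h (zz v)"] unfolding rec_def by simp
      qed
      then show ?thesis by (intro exI[of _ one]) simp
    next
      case 4
      then have "rt v \<in> Q" using rt(2)[of v] unfolding bad_def by simp
      have key: "(even (n v) --> f v \<noteq> one) \<and> (odd (n v) --> f v = one)" if "\<Psi> {v} f" for f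
      proof -
        obtain h where h: "cl \<Phi> D {v} h" "f v = rec h v" using \<open>\<Psi> {v} f\<close> unfolding \<Psi>_def by auto
        have f: "f v = h v" using h(2) 4 unfolding rec_def by simp
        have vv: "v \<in> {v}" by simp
        have "\<Phi> {rt v} h" using toP[OF h(1) gD[OF vv 4(1), of 0]] g0 by simp
        then have r: "h (rt v) \<noteq> one" using \<open>rt v \<in> Q\<close> unfolding Q_def by simp
        note a = alt[OF h(1) vv 4(1)]
        have "h v = one" if o: "odd (n v)"
          using col_eqI[of "h v" "h (rt v)" "h (zz v)" one] a o r uzz[OF h(1) vv 4(1)] rzz[OF h(1) vv 4(1)] znot[OF h(1) vv 4(1)] by simp
        then show ?thesis using a r f by auto
      qed
      show ?thesis
      proof (cases "even (n v)")
        case True then show ?thesis using key by (intro exI[of _ one]) simp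
      next
        case False then show ?thesis using key oth[of one one] by (intro exI[of _ "oth one one"]) auto
      qed
    qed
  qed
  show ?thesis by (rule two_listed[OF admPsi lcPsi two])
qed

end


section \<open>P6-free graphs dominated by a complete pair with a monochromatic side\<close>

text \<open>The budgets consumed by \<open>option_gen\<close> and by a \<open>query\<close> on a
  single vertex.\<close>

definition opt :: "nat => nat" where "opt n = n + 3 ^ n * n"
definition qry :: "nat => nat" where "qry n = 1 + 3 ^ 1 * n"

lemma opt_ge: "n \<le> opt n" and qry_ge: "n \<le> qry n"
  unfolding opt_def qry_def by simp_all

context fgraph
begin

lemma adm_pt: "adm \<Phi> ==> adm (\<lambda>X f. \<Phi> X f \<and> (\<forall>x\<in>X. P x (f x)))"
  by (rule adm_conj) auto

lemma option_vertex:
  assumes "adm \<Phi>" "lc (opt N) \<Phi>"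
  obtains "lc N (\<lambda>X f. \<Phi> X f \<and> (\<forall>x\<in>X. P x (f x)))" | q c where "q \<in> V" "\<not> P q c" "lc N (fx \<Phi> {q} (\<lambda>_. c))"
  using option_pt[OF assms(1) assms(2)[unfolded opt_def], of P] by (elim disjE exE conjE)

lemma query_vertex:
  assumes "adm \<Phi>" "lc (qry N) \<Phi>" "v \<in> V"
  obtains c where "lc N (fx \<Phi> {v} (\<lambda>_. c))"
proof -
  have "{v} \<subseteq> V" "card {v} \<le> 1" using assms(3) by simp_all
  from query[OF assms(1) this assms(2)[unfolded qry_def]] obtain s where s: "lc N (fx \<Phi> {v} s)" by (elim exE)
  have "fx \<Phi> {v} s = fx \<Phi> {v} (\<lambda>_. s v)" unfolding fx_def by (intro ext) simp
  then show ?thesis using that[of "s v"] s by simp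
qed

lemma fx_dest: "fx \<Phi> {q} (\<lambda>_. c) X f ==> \<Phi> (insert q X) f \<and> f q = c"
  unfolding fx_def by simp

end

text \<open>\<open>A\<close> is to be the monochromatic side and \<open>c0\<close> a vertex of
  another colour away from it. With a vertex \<open>a\<close> of \<open>A\<close>, they provide the
  tail \<open>a\<close>, \<open>b0\<close>, \<open>c0\<close> of the forbidden paths.\<close>

locale p6core = p6graph +
  fixes A B :: "'a set" and b0 c0 :: 'a
  assumes AB: "a \<in> A ==> b \<in> B ==> E a b"
    and domAB: "v \<in> V ==> v \<in> A \<or> v \<in> B \<or> (\<exists>x\<in>A \<union> B. E v x)"
    and Aind: "a \<in> A ==> a' \<in> A ==> \<not> E a a'" and Ane: "A \<noteq> {}"
    and b0: "b0 \<in> B" and c0: "c0 \<in> V" "c0 \<notin> A" "a \<in> A ==> \<not> E c0 a" and bc: "E b0 c0"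
begin

text \<open>A classification by what is forced once \<open>A\<close> has colour \<open>one\<close>
  and \<open>b0\<close>, \<open>c0\<close> are coloured: \<open>Z\<close> avoids \<open>one\<close>,
  so \<open>F0\<close> and then \<open>F1\<close> are forced; \<open>W\<close> has a neighbour of
  known colour; \<open>T\<close> has only lost \<open>one\<close>; and \<open>U1\<close> is the part
  that may keep three colours.\<close>

definition Z where "Z = {v. \<exists>a\<in>A. E v a}"
definition U where "U = V - A - Z"
definition F0 where "F0 = {z \<in> Z. z = b0 \<or> E z b0 \<or> E z c0}"
definition F1 where "F1 = {z \<in> Z - F0. \<exists>y\<in>F0. E z y}"
definition T where "T = Z - F0 - F1"
definition U1 where "U1 = {u \<in> U. u \<noteq> c0 \<and> \<not> E u b0 \<and> \<not> E u c0 \<and> (\<forall>y\<in>F0 \<union> F1. \<not> E u y)}"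
definition W where "W = U - U1 - {c0}"

lemma BZ: "b \<in> B ==> b \<in> Z"
  using AB Ane symE unfolding Z_def by fastforce

lemma UA: "u \<in> U ==> a \<in> A ==> \<not> E u a"
  unfolding U_def Z_def by blast

lemma c0U: "c0 \<in> U"
  using c0 unfolding U_def Z_def by blast

lemma U1U: "u \<in> U1 ==> u \<in> U \<and> \<not> E u b0 \<and> \<not> E u c0" and U1F: "u \<in> U1 ==> y \<in> F0 ==> \<not> E u y" "u \<in> U1 ==> y \<in> F1 ==> \<not> E u y"
  unfolding U1_def by simp_all

lemma WU: "w \<in> W ==> w \<in> U"
  unfolding W_def by simp

lemma Tb0: "z \<in> T ==> \<not> E z b0 \<and> \<not> E z c0" and TF0: "z \<in> T ==> y \<in> F0 ==> \<not> E z y"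
  unfolding T_def F1_def F0_def by auto

lemma Tdom:
  assumes u: "u \<in> U1"
  shows "\<exists>z\<in>T. E z u"
proof -
  have uU: "u \<in> V" "u \<notin> A" "u \<notin> Z" using U1U[OF u] unfolding U_def by simp_all
  have "u \<notin> B" using BZ uU(3) by blast
  then obtain x where x: "x \<in> A \<union> B" "E u x" using domAB[OF uU(1)] uU(2) by blast
  then have xB: "x \<in> B" using uU(3) unfolding Z_def by blast
  have "x \<notin> F0" "x \<notin> F1" using U1F[OF u] x(2) by blast+
  then have "x \<in> T" using BZ[OF xB] unfolding T_def by simp
  then show ?thesis using symE[OF x(2)] by blast
qed

lemma T_hom:
  assumes z: "z \<in> T" and x: "x \<in> U1" "y \<in> U1" "E x y" "E z x"
  shows "E z y"
proof (rule ccontr)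
  assume n: "\<not> E z y"
  obtain a where a: "a \<in> A" "E z a" using z unfolding T_def Z_def by blast
  have "indP6 E y x z a b0 c0"
    unfolding indP6_def using n x(3,4) a(2) AB[OF a(1) b0] bc U1U[OF x(1)] U1U[OF x(2)] Tb0[OF z] UA[of x a] UA[of y a] UA[OF c0U a(1)] a(1)
    by (simp add: Ecomm)
  then show False by (rule noP6)
qed

text \<open>\<open>w\<close> has a neighbour among \<open>b0\<close>, \<open>c0\<close>,
  \<open>F0\<close> and \<open>F1\<close>. From \<open>u\<close> through \<open>w\<close> and this
  neighbour one reaches \<open>a\<close> and \<open>z\<close>, or \<open>b0\<close> and
  \<open>c0\<close>, along an induced path with six vertices; the cases say where the neighbour
  lies.\<close>

lemma W_T_cross:
  assumes w: "w \<in> W" and z: "z \<in> T" and wz: "\<not> E w z"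
    and u: "u \<in> U1" "E w u" "\<not> E z u" and u': "u' \<in> U1" "E z u'" "\<not> E w u'"
  shows False
proof -
  obtain a where a: "a \<in> A" "E z a" using z unfolding T_def Z_def by blast
  note uu = U1U[OF u(1)] and uu' = U1U[OF u'(1)]
  have n: "\<not> E u a" "\<not> E u' a" "\<not> E w a" "\<not> E c0 a" using UA[OF _ a(1)] uu uu' WU[OF w] c0U by blast+
  have ab: "E a b0" by (rule AB[OF a(1) b0])
  have nn: "\<not> E u u'"
  proof
    assume "E u u'"
    then show False using T_hom[OF z u'(1) u(1) symE u'(2)] u(3) by blast
  qed
  note F = u u' wz a(2) n ab nn uu uu' Tb0[OF z] bc
  show False
  proof (cases "E w b0")
    case True
    have "indP6 E u w b0 a z u'" unfolding indP6_def using F True by (simp add: Ecomm)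
    then show False by (rule noP6)
  next
    case wb: False
    show False
    proof (cases "E w c0")
      case True
      have "indP6 E u w c0 b0 a z" unfolding indP6_def using F True wb by (simp add: Ecomm)
      then show False by (rule noP6)
    next
      case wc: False
      obtain f where f: "f \<in> F0 \<union> F1" "E w f" using w wb wc unfolding W_def U1_def by blast
      show False
      proof (cases "f \<in> F0")
        case True
        have nf: "\<not> E u f" "\<not> E u' f" "\<not> E z f" using U1F(1)[OF u(1) True] U1F(1)[OF u'(1) True] TF0[OF z True] by simp_all
        consider "E f a" | "\<not> E f a" "E f b0" | "\<not> E f a" "\<not> E f b0" "E f c0" | "f = b0" using True unfolding F0_def by blast
        then show False
        proof cases
          case 1
          have "indP6 E u w f a z u'" unfolding indP6_def using F nf f(2) 1 by (simp add: Ecomm)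
          then show False by (rule noP6)
        next
          case 2
          have "indP6 E u w f b0 a z" unfolding indP6_def using F nf f(2) 2 wb by (simp add: Ecomm)
          then show False by (rule noP6)
        next
          case 3
          have "indP6 E u w f c0 b0 a" unfolding indP6_def using F nf f(2) 3 wb wc by (simp add: Ecomm)
          then show False by (rule noP6)
        qed (use f(2) wb in blast)
      next
        case False
        then have f1: "f \<in> F1" using f(1) by simp
        obtain a' where a': "a' \<in> A" "E f a'" using f1 unfolding F1_def Z_def by blast
        have nf: "\<not> E f b0" "\<not> E f c0" using f1 unfolding F1_def F0_def by simp_all
        have n': "\<not> E u a'" "\<not> E w a'" "\<not> E c0 a'" using UA[OF _ a'(1)] uu WU[OF w] c0U by blast+
        have "indP6 E u w f a' b0 c0"
          unfolding indP6_def using F nf f(2) a'(2) n' wb wc AB[OF a'(1) b0] U1F(2)[OF u(1) f1] by (simp add: Ecomm)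
        then show False by (rule noP6)
      qed
    qed
  qed
qed

lemma W_not_mixed:
  assumes w: "w \<in> W" and z: "z \<in> T" and wz: "\<not> E w z" and u1: "u1 \<in> U1" "E w u1" "E z u1"
    and x: "x \<in> U1" "y \<in> U1" "E x y" "E w x" "\<not> E z x" "\<not> E z y"
  shows "E w y"
proof (rule ccontr)
  assume n: "\<not> E w y"
  obtain a where a: "a \<in> A" "E z a" using z unfolding T_def Z_def by blast
  note uu = U1U[OF u1(1)] and ux = U1U[OF x(1)] and uy = U1U[OF x(2)]
  have na: "\<not> E u1 a" "\<not> E x a" "\<not> E y a" "\<not> E w a" using UA[OF _ a(1)] uu ux uy WU[OF w] by blast+
  have "\<not> E u1 x" "\<not> E u1 y" using T_hom[OF z u1(1) x(1) _ u1(3)] T_hom[OF z u1(1) x(2) _ u1(3)] x(5,6) by blast+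
  then have "indP6 E y x w u1 z a" unfolding indP6_def using n na wz u1 x a(2) by (simp add: Ecomm)
  then show False by (rule noP6)
qed

lemma nbrs_U1:
  assumes "v \<in> V" "x \<in> U1" "E v x"
  shows "v \<in> T \<or> v \<in> W \<or> v \<in> U1"
proof -
  have xU: "x \<in> U" "\<not> E x b0" "\<not> E x c0" using U1U[OF assms(2)] by simp_all
  have "v \<notin> A" using UA[OF xU(1)] symE[OF assms(3)] by blast
  moreover have "v \<notin> F0" "v \<notin> F1" using U1F[OF assms(2)] symE[OF assms(3)] by blast+
  moreover have "v \<noteq> c0" using xU symE[OF assms(3)] by blast
  ultimately show ?thesis using assms(1) unfolding T_def W_def U_def by blast
qed

end


lemma forced_list:
  assumes "\<And>f :: 'a => col. Q f ==> f v = k"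
  shows "\<exists>c. \<forall>f. Q f --> f v \<noteq> c"
proof (intro exI allI impI)
  fix f :: "'a => col" assume "Q f"
  then have "f v = k" by (rule assms)
  then show "f v \<noteq> oth k k" using oth(1)[of k k] by metis
qed

lemma forced_list':
  assumes "\<And>X (f :: 'a => col). Q X f ==> v \<in> X ==> f v = k"
  shows "\<exists>c. \<forall>X f. Q X f --> v \<in> X --> f v \<noteq> c"
proof (intro exI allI impI)
  fix X and f :: "'a => col" assume "Q X f" "v \<in> X"
  then have "f v = k" by (rule assms)
  then show "f v \<noteq> oth k k" using oth(1)[of k k] by metis
qed

context p6graph
begin

text \<open>The constants are read backwards along \<open>mono_side\<close>. In \<open>M7\<close>,
  14 is the 7 of \<open>ending\<close> times 2 for a closure, preceded by an option and the queries
  for \<open>z0\<close> and \<open>w1\<close>. In \<open>M2\<close>, the factor 4 pays for the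
  closures \<open>D1\<close> and \<open>D2\<close>, the query is for \<open>b0\<close>, and the
  outer option finds \<open>c0\<close>.\<close>

definition M7 where "M7 = qry (qry (opt (N0 * 14)))"
definition M2 where "M2 = opt (qry (opt M7 * 4))"

lemma N0_le: "N0 * 14 \<le> M7" "M7 \<le> opt M7 * 4" "opt M7 * 4 \<le> M2" "2 \<le> M2 * 2"
proof -
  show "N0 * 14 \<le> M7" unfolding M7_def using opt_ge[of "N0 * 14"] qry_ge[of "opt (N0 * 14)"] qry_ge[of "qry (opt (N0 * 14))"] by linarith
  show "M7 \<le> opt M7 * 4" using opt_ge[of M7] by linarith
  show "opt M7 * 4 \<le> M2" unfolding M2_def using qry_ge[of "opt M7 * 4"] opt_ge[of "qry (opt M7 * 4)"] by linarith
  show "2 \<le> M2 * 2" unfolding M2_def using opt_ge[of "qry (opt M7 * 4)"] by (simp add: qry_def)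
qed

text \<open>At each option either every vertex has lost a colour, or \<open>ending\<close> applies,
  or a further vertex is coloured that controls the others: first \<open>c0\<close> with its
  neighbour \<open>b0\<close>, then \<open>u1\<close> with \<open>w1\<close> and \<open>z0\<close>,
  finally \<open>z1\<close>.\<close>

lemma mono_side:
  assumes adm: "adm \<Phi>" and lc: "lc (M2 * 2) \<Phi>" and AV: "A \<subseteq> V" and Ane: "A \<noteq> {}"
    and AB: "\<And>a b. a \<in> A ==> b \<in> B ==> E a b"
    and dom: "\<And>v. v \<in> V ==> v \<in> A \<or> v \<in> B \<or> (\<exists>x\<in>A \<union> B. E v x)"
    and mono: "\<And>X f v. \<Phi> X f ==> v \<in> X ==> v \<in> A ==> f v = one"
  shows "\<exists>f. proper V f"
proof -
  have Aind: "\<not> E a a'" if "a \<in> A" "a' \<in> A" for a a'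
  proof
    assume e: "E a a'"
    have "card {a, a'} \<le> M2 * 2" using N0_le(4) card_insert_le_m1[of 2 "{a'}" a] by simp
    moreover have "{a, a'} \<subseteq> V" using that AV by blast
    ultimately obtain f where f: "\<Phi> {a, a'} f" using lcD[OF lc] by (elim exE[rotated]) auto
    have "f a \<noteq> f a'" by (rule adm_proper[OF adm f _ _ e]) simp_all
    then show False using mono[OF f _ that(1)] mono[OF f _ that(2)] by simp
  qed
  let ?Z = "{v. \<exists>a\<in>A. E v a}" and ?U = "V - A - {v. \<exists>a\<in>A. E v a}"
  define D where "D v = (if v \<in> ?Z then {SOME a. a \<in> A \<and> E v a} else {})" for v
  have D: "\<exists>a. D v = {a} \<and> a \<in> A \<and> E v a" if "v \<in> ?Z" for v
  proof -
    have "\<exists>a. a \<in> A \<and> E v a" using that by blast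
    from someI_ex[OF this] show ?thesis using that unfolding D_def by simp
  qed
  have DV: "D v \<subseteq> V" "card (D v) \<le> 1" for v
    using D[of v] AV by (cases "v \<in> ?Z"; auto simp: D_def)+
  define \<Phi>2 where "\<Phi>2 = cl \<Phi> D"
  have adm2: "adm \<Phi>2" unfolding \<Phi>2_def by (rule adm_cl[OF adm])
  have lc2: "lc M2 \<Phi>2" unfolding \<Phi>2_def by (rule closure[OF DV]) (use lc in \<open>simp add: mult_2_right\<close>)
  have P2A: "f v = one" if "\<Phi>2 X f" "v \<in> X" "v \<in> A" for X f v
    using mono[OF admD[OF adm that(1)[unfolded \<Phi>2_def cl_def]]] that(2,3) by blast
  have P2Z: "f v \<noteq> one" if h: "\<Phi>2 X f" "v \<in> X" "v \<in> ?Z" for X f v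
  proof -
    obtain a where a: "D v = {a}" "a \<in> A" "E v a" using D[OF h(3)] by (elim exE conjE)
    note c = h(1)[unfolded \<Phi>2_def cl_def]
    have aX: "a \<in> X \<union> \<Union>(D ` X)" using a(1) h(2) by blast
    have "f v \<noteq> f a" by (rule adm_proper[OF adm c _ aX a(3)]) (use h(2) in simp)
    then show ?thesis using mono[OF c aX a(2)] by simp
  qed
  show ?thesis
  proof (rule option_vertex[OF adm2 lc2[unfolded M2_def], of "\<lambda>v c. v \<in> ?U --> c = one"])
    assume l: "lc (qry (opt M7 * 4)) (\<lambda>X f. \<Phi>2 X f \<and> (\<forall>x\<in>X. x \<in> ?U --> f x = one))"
    have "N0 \<le> qry (opt M7 * 4)" using N0_le qry_ge[of "opt M7 * 4"] by linarith
    from lc_mono[OF l this] adm_pt[OF adm2, of "\<lambda>v c. v \<in> ?U --> c = one"]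
    show ?thesis
    proof (intro two_listed)
      show "two_lists (\<lambda>X f. \<Phi>2 X f \<and> (\<forall>x\<in>X. x \<in> ?U --> f x = one))"
        unfolding two_lists_def
      proof
        fix v assume v: "v \<in> V"
        show "\<exists>c. \<forall>f. \<Phi>2 {v} f \<and> (\<forall>x\<in>{v}. x \<in> ?U --> f x = one) --> f v \<noteq> c"
        proof (cases "v \<in> ?Z")
          case True
          show ?thesis by (intro exI[of _ one] allI impI, rule P2Z[of "{v}" _ v]) (use True in simp_all)
        next
          case False
          show ?thesis
          proof (rule forced_list[of _ v one])
            fix f assume "\<Phi>2 {v} f \<and> (\<forall>x\<in>{v}. x \<in> ?U --> f x = one)"
            then show "f v = one" using P2A[of "{v}" f v] v False by (cases "v \<in> A") simp_all
          qed
        qed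
      qed
    qed
  next
    fix c0 q assume c0V: "c0 \<in> V" and "\<not> (c0 \<in> ?U --> q = one)" and l0: "lc (qry (opt M7 * 4)) (fx \<Phi>2 {c0} (\<lambda>_. q))"
    then have c0: "c0 \<notin> A" "\<And>a. a \<in> A ==> \<not> E c0 a" and q1: "q \<noteq> one" by auto
    obtain a0 where a0: "a0 \<in> A" using Ane by blast
    have "c0 \<notin> B" using AB[OF a0] c0(2)[OF a0] symE by blast
    then obtain b0 where b0: "b0 \<in> B" "E b0 c0" using dom[OF c0V] c0 symE by blast
    have b0V: "b0 \<in> V" by (rule EV[OF b0(2)])
    have b0Z: "b0 \<in> ?Z" using AB[OF a0 b0(1)] symE a0 by blast
    obtain p where l3: "lc (opt M7 * 4) (fx (fx \<Phi>2 {c0} (\<lambda>_. q)) {b0} (\<lambda>_. p))"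
      by (rule query_vertex[OF adm_fx[OF adm2] l0 b0V])
    define \<Phi>3 where "\<Phi>3 = fx (fx \<Phi>2 {c0} (\<lambda>_. q)) {b0} (\<lambda>_. p)"
    have adm3: "adm \<Phi>3" unfolding \<Phi>3_def by (intro adm_fx adm2)
    have P3: "\<Phi>2 (insert c0 (insert b0 X)) f \<and> f b0 = p \<and> f c0 = q" if "\<Phi>3 X f" for X f
      using fx_dest[OF that[unfolded \<Phi>3_def]] fx_dest[of \<Phi>2 c0 q "insert b0 X" f] by simp
    obtain f0 where f0: "\<Phi>3 {} f0" using lcD[OF l3, of "{}"] unfolding \<Phi>3_def by auto
    have p1: "p \<noteq> one" using P3[OF f0] P2Z[of "{c0, b0}" f0 b0] b0Z by simp
    have pq: "p \<noteq> q" using P3[OF f0] adm_proper[OF adm2, of "{c0, b0}" f0 b0 c0] b0(2) by simp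
    interpret p6core V E N0 A B b0 c0
      by unfold_locales (use AB dom Aind Ane b0 c0V c0 in blast)+
    have Zeq: "?Z = Z" unfolding Z_def by simp
    have AA: "f v = one" if "\<Phi>3 X f" "v \<in> X" "v \<in> A" for X f v
      using P2A[of "insert c0 (insert b0 X)" f v] P3[OF that(1)] that(2,3) by simp
    have ZZ: "f v \<noteq> one" if "\<Phi>3 X f" "v \<in> X" "v \<in> Z" for X f v
      using P2Z[of "insert c0 (insert b0 X)" f v, unfolded Zeq] P3[OF that(1)] that(2,3) by simp
    have prp3: "f x \<noteq> f y" if "\<Phi>3 X f" "x \<in> insert c0 (insert b0 X)" "y \<in> insert c0 (insert b0 X)" "E x y" for X f x y
      using adm_proper[OF adm2 _ that(2-4), of f] P3[OF that(1)] by simp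
    \<comment> \<open>Vertices of \<open>F0\<close> avoid \<open>one\<close> and are
      \<open>b0\<close> itself or see \<open>b0\<close> or \<open>c0\<close>, whose colours
      \<open>p\<close> and \<open>q\<close> are the other two.\<close>
    define k0 where "k0 z = (if z = b0 then p else if E z b0 then q else p)" for z
    have k0: "f z = k0 z" if h: "\<Phi>3 X f" "z \<in> X" "z \<in> F0" for X f z
    proof -
      have z1: "f z \<noteq> one" by (rule ZZ[OF h(1,2)]) (use h(3) in \<open>simp add: F0_def\<close>)
      consider "z = b0" | "z \<noteq> b0" "E z b0" | "z \<noteq> b0" "\<not> E z b0" "E z c0" using h(3) unfolding F0_def by blast
      then show ?thesis
      proof cases
        case 1 then show ?thesis using P3[OF h(1)] unfolding k0_def by simp
      next
        case 2
        have "f z \<noteq> p" using prp3[OF h(1), of z b0] h(2) 2 P3[OF h(1)] by simp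
        then show ?thesis using z1 2 p1 pq q1 col_eqI[of "f z" one p q] unfolding k0_def by simp
      next
        case 3
        have "f z \<noteq> q" using prp3[OF h(1), of z c0] h(2) 3 P3[OF h(1)] by simp
        then show ?thesis using z1 3 p1 pq q1 col_eqI[of "f z" one q p] unfolding k0_def by simp
      qed
    qed
    have k01: "k0 z \<noteq> one" for z unfolding k0_def using p1 q1 by simp
    define D1 where "D1 z = (if z \<in> F1 then {SOME y. y \<in> F0 \<and> E z y} else {})" for z
    have D1: "\<exists>y. D1 z = {y} \<and> y \<in> F0 \<and> E z y" if "z \<in> F1" for z
    proof -
      have "\<exists>y. y \<in> F0 \<and> E z y" using that unfolding F1_def by blast
      from someI_ex[OF this] show ?thesis using that unfolding D1_def by simp
    qed
    have D1V: "D1 z \<subseteq> V" "card (D1 z) \<le> 1" for z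
      using D1[of z] EV symE by (cases "z \<in> F1"; auto simp: D1_def)+
    define \<Phi>4 where "\<Phi>4 = cl \<Phi>3 D1"
    have adm4: "adm \<Phi>4" unfolding \<Phi>4_def by (rule adm_cl[OF adm3])
    have lc4: "lc (opt M7 * 2) \<Phi>4" unfolding \<Phi>4_def by (rule closure[OF D1V]) (use l3 in \<open>simp add: \<Phi>3_def mult.commute\<close>)
    have P4: "\<Phi>3 X f" if "\<Phi>4 X f" for X f
      by (rule admD[OF adm3 that[unfolded \<Phi>4_def cl_def]]) simp
    have k1: "\<exists>k. \<forall>X f. \<Phi>4 X f --> z \<in> X --> f z = k" if z: "z \<in> F1" for z
    proof -
      obtain y where y: "D1 z = {y}" "y \<in> F0" "E z y" using D1[OF z] by (elim exE conjE)
      have "f z = oth one (k0 y)" if h: "\<Phi>4 X f" "z \<in> X" for X f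
      proof -
        note c = h(1)[unfolded \<Phi>4_def cl_def]
        have yX: "y \<in> X \<union> \<Union>(D1 ` X)" "z \<in> X \<union> \<Union>(D1 ` X)" using y(1) h(2) by blast+
        have "f z \<noteq> k0 y" using adm_proper[OF adm3 c yX(2,1) y(3)] k0[OF c yX(1) y(2)] by simp
        moreover have "f z \<noteq> one" by (rule ZZ[OF P4[OF h(1)] h(2)]) (use z in \<open>simp add: F1_def\<close>)
        ultimately show ?thesis using col_eqI[of "f z" one "k0 y" "oth one (k0 y)"] oth[of one "k0 y"] k01[of y] by auto
      qed
      then show ?thesis by (intro exI[of _ "oth one (k0 y)"] allI impI)
    qed
    have kn: "\<exists>k. \<forall>X f. \<Phi>4 X f --> z \<in> X --> f z = k" if "z = b0 \<or> z = c0 \<or> z \<in> F0 \<or> z \<in> F1" for z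
    proof -
      from that consider "z = b0" | "z = c0" | "z \<in> F0" | "z \<in> F1" by blast
      then show ?thesis
      proof cases
        case 1 then show ?thesis using P3[OF P4] by (intro exI[of _ p] allI impI) simp
      next
        case 2 then show ?thesis using P3[OF P4] by (intro exI[of _ q] allI impI) simp
      next
        case 3
        show ?thesis by (intro exI[of _ "k0 z"] allI impI) (rule k0[OF P4 _ 3])
      qed (rule k1)
    qed
    define D2 where "D2 w = (if w \<in> W then {SOME y. (y = b0 \<or> y = c0 \<or> y \<in> F0 \<or> y \<in> F1) \<and> E w y} else {})" for w
    have D2: "\<exists>y. D2 w = {y} \<and> (y = b0 \<or> y = c0 \<or> y \<in> F0 \<or> y \<in> F1) \<and> E w y" if "w \<in> W" for w
    proof -
      have "\<exists>y. (y = b0 \<or> y = c0 \<or> y \<in> F0 \<or> y \<in> F1) \<and> E w y" using that unfolding W_def U1_def by blast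
      from someI_ex[OF this] show ?thesis using that unfolding D2_def by simp
    qed
    have D2V: "D2 w \<subseteq> V" "card (D2 w) \<le> 1" for w
      using D2[of w] EV symE by (cases "w \<in> W"; auto simp: D2_def)+
    define \<Phi>5 where "\<Phi>5 = cl \<Phi>4 D2"
    have adm5: "adm \<Phi>5" unfolding \<Phi>5_def by (rule adm_cl[OF adm4])
    have lc5: "lc (opt M7) \<Phi>5" unfolding \<Phi>5_def by (rule closure[OF D2V]) (use lc4 in \<open>simp add: mult_2_right\<close>)
    have P5: "\<Phi>4 X f" if "\<Phi>5 X f" for X f
      by (rule admD[OF adm4 that[unfolded \<Phi>5_def cl_def]]) simp
    have Wk: "\<exists>c. \<forall>X f. \<Phi>5 X f --> w \<in> X --> f w \<noteq> c" if w: "w \<in> W" for w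
    proof -
      obtain y where y: "D2 w = {y}" "y = b0 \<or> y = c0 \<or> y \<in> F0 \<or> y \<in> F1" "E w y" using D2[OF w] by (elim exE conjE)
      obtain k where k: "\<forall>X f. \<Phi>4 X f --> y \<in> X --> f y = k" using kn[OF y(2)] by (elim exE)
      have "f w \<noteq> k" if h: "\<Phi>5 X f" "w \<in> X" for X f
      proof -
        note c = h(1)[unfolded \<Phi>5_def cl_def]
        have yX: "y \<in> X \<union> \<Union>(D2 ` X)" "w \<in> X \<union> \<Union>(D2 ` X)" using y(1) h(2) by blast+
        show ?thesis using adm_proper[OF adm4 c yX(2,1) y(3)] k[rule_format, OF c yX(1)] by simp
      qed
      then show ?thesis by (intro exI[of _ k] allI impI)
    qed
    have TT: "f z \<noteq> one" if "\<Phi>5 X f" "z \<in> X" "z \<in> T" for X f z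
      by (rule ZZ[OF P4[OF P5[OF that(1)]] that(2)]) (use that(3) in \<open>simp add: T_def\<close>)
    have lists5: "\<exists>c. \<forall>X f. \<Phi>5 X f --> v \<in> X --> f v \<noteq> c" if v: "v \<in> V" "v \<notin> U1" for v
    proof -
      consider "v \<in> A" | "v \<in> Z" | "v = c0" | "v \<in> W" using v unfolding W_def U_def by blast
      then show ?thesis
      proof cases
        case 1
        show ?thesis by (rule forced_list'[of _ v one]) (rule AA[OF P4[OF P5] _ 1])
      next
        case 2
        show ?thesis by (intro exI[of _ one] allI impI) (rule ZZ[OF P4[OF P5] _ 2])
      next
        case 3
        show ?thesis by (rule forced_list'[of _ v q]) (simp add: 3 P3[OF P4[OF P5]])
      qed (rule Wk)
    qed
    have U1V: "U1 \<subseteq> V" unfolding U1_def U_def by blast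
    have TV: "z \<in> V \<and> z \<notin> U1" if "z \<in> T" for z
      using that EV unfolding T_def Z_def U1_def U_def by blast
    have WV: "w \<in> V" if "w \<in> W" for w using that unfolding W_def U_def by blast
    \<comment> \<open>If no vertex of \<open>U1\<close> with a neighbour in \<open>W\<close> has
      colour \<open>one\<close>, then \<open>ending\<close> applies with \<open>T\<close> inside
      \<open>H\<close>. Otherwise such a vertex \<open>u1\<close> is fixed with colour
      \<open>one\<close>.\<close>
    show ?thesis
    proof (rule option_vertex[OF adm5 lc5, of "\<lambda>v c. v \<in> U1 \<and> (\<exists>w\<in>W. E w v) --> c \<noteq> one"])
      let ?\<Phi> = "\<lambda>X f. \<Phi>5 X f \<and> (\<forall>x\<in>X. x \<in> U1 \<and> (\<exists>w\<in>W. E w x) --> f x \<noteq> one)"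
      let ?H = "{z \<in> V - U1. (\<forall>f. ?\<Phi> {z} f --> f z \<noteq> one) \<and> (\<forall>x\<in>U1. \<forall>y\<in>U1. E x y --> E z x --> E z y)}"
      assume l: "lc M7 ?\<Phi>"
      have l': "lc (N0 * 7) ?\<Phi>" by (rule lc_mono[OF l]) (use N0_le(1) in linarith)
      have TH: "z \<in> ?H" if z: "z \<in> T" for z
        using TV[OF z] TT[of "{z}" _ z] z T_hom[OF z] by simp
      show ?thesis
      proof (rule ending[OF adm_pt[OF adm5, of "\<lambda>v c. v \<in> U1 \<and> (\<exists>w\<in>W. E w v) --> c \<noteq> one"] l' U1V, of ?H one])
        fix v assume v: "v \<in> V" "v \<notin> U1"
        obtain c where c: "\<forall>X f. \<Phi>5 X f --> v \<in> X --> f v \<noteq> c" using lists5[OF v] by (elim exE)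
        show "\<exists>c. \<forall>f. ?\<Phi> {v} f --> f v \<noteq> c" by (intro exI[of _ c] allI impI, elim conjE) (rule c[rule_format, of "{v}"], simp_all)
      next
        fix u assume "u \<in> U1"
        from Tdom[OF this] obtain z where z: "z \<in> T" "E z u" by (elim bexE)
        show "\<exists>z\<in>?H. E z u" by (rule bexI[of _ z], rule z(2), rule TH[OF z(1)])
      next
        fix v x f assume h: "v \<in> V" "v \<notin> U1" "v \<notin> ?H" "x \<in> U1" "E v x" "?\<Phi> {x} f"
        have "v \<notin> T" using TH h(3) by blast
        then have "v \<in> W" using nbrs_U1[OF h(1,4,5)] h(2) by simp
        then show "f x \<noteq> one" using h(4-6) by auto
      qed (rule refl)
    next
      fix u1 c1 assume "u1 \<in> V" and "\<not> (u1 \<in> U1 \<and> (\<exists>w\<in>W. E w u1) --> c1 \<noteq> one)" and "lc M7 (fx \<Phi>5 {u1} (\<lambda>_. c1))"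
      then obtain w1 where u1: "u1 \<in> U1" and w1: "w1 \<in> W" "E w1 u1" and l6: "lc M7 (fx \<Phi>5 {u1} (\<lambda>_. one))" by auto
      obtain z0 where z0: "z0 \<in> T" "E z0 u1" using Tdom[OF u1] by (elim bexE)
      note adm6 = adm_fx[OF adm5, of "{u1}" "\<lambda>_. one"]
      obtain cw where l7: "lc (qry (opt (N0 * 14))) (fx (fx \<Phi>5 {u1} (\<lambda>_. one)) {w1} (\<lambda>_. cw))"
        by (rule query_vertex[OF adm6 l6[unfolded M7_def] WV[OF w1(1)]])
      have z0V: "z0 \<in> V" using TV[OF z0(1)] by simp
      obtain y where l8: "lc (opt (N0 * 14)) (fx (fx (fx \<Phi>5 {u1} (\<lambda>_. one)) {w1} (\<lambda>_. cw)) {z0} (\<lambda>_. y))"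
        by (rule query_vertex[OF adm_fx[OF adm6] l7 z0V])
      define \<Phi>8 where "\<Phi>8 = fx (fx (fx \<Phi>5 {u1} (\<lambda>_. one)) {w1} (\<lambda>_. cw)) {z0} (\<lambda>_. y)"
      have adm8: "adm \<Phi>8" unfolding \<Phi>8_def by (intro adm_fx adm5)
      have P8: "\<Phi>5 (X \<union> {u1, w1, z0}) f \<and> f u1 = one \<and> f w1 = cw \<and> f z0 = y" if "\<Phi>8 X f" for X f
      proof -
        have "insert u1 (insert w1 (insert z0 X)) = X \<union> {u1, w1, z0}" by blast
        then show ?thesis using fx_dest[OF that[unfolded \<Phi>8_def]] fx_dest[of "fx \<Phi>5 {u1} (\<lambda>_. one)" w1 cw "insert z0 X" f]
          fx_dest[of \<Phi>5 u1 one "insert w1 (insert z0 X)" f] by simp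
      qed
      have P85: "\<Phi>5 X f" if "\<Phi>8 X f" for X f by (rule admD[OF adm5 conjunct1[OF P8[OF that]]]) blast
      have prp8: "f x \<noteq> f x'" if "\<Phi>8 X f" "x \<in> X \<union> {u1, w1, z0}" "x' \<in> X \<union> {u1, w1, z0}" "E x x'" for X f x x'
        using adm_proper[OF adm5 _ that(2-4), of f] P8[OF that(1)] by simp
      obtain f1 where f1: "\<Phi>8 {} f1" using lcD[OF l8, of "{}"] unfolding \<Phi>8_def by auto
      have cw1: "cw \<noteq> one" using prp8[OF f1, of w1 u1] w1(2) P8[OF f1] by simp
      have y1: "y \<noteq> one" using TT[of "{} \<union> {u1, w1, z0}" f1 z0] z0(1) P8[OF f1] by simp
      \<comment> \<open>If all neighbours of \<open>u1\<close> in \<open>T\<close> have colour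
        \<open>y\<close>, every vertex of \<open>U1\<close> loses a colour. Otherwise
        \<open>z0\<close> and \<open>z1\<close> show the two colours other than
        \<open>one\<close>.\<close>
      show ?thesis
      proof (rule option_vertex[OF adm8 l8[folded \<Phi>8_def], of "\<lambda>v c. v \<in> T \<and> E v u1 --> c = y"])
        let ?\<Phi> = "\<lambda>X f. \<Phi>8 X f \<and> (\<forall>x\<in>X. x \<in> T \<and> E x u1 --> f x = y)"
        assume l9: "lc (N0 * 14) ?\<Phi>"
        note adm9 = adm_pt[OF adm8, of "\<lambda>v c. v \<in> T \<and> E v u1 --> c = y"]
        define D3 where "D3 u = (if u \<in> U1 then {SOME z. z \<in> T \<and> E z u} else {})" for u
        have D3: "\<exists>z. D3 u = {z} \<and> z \<in> T \<and> E z u" if "u \<in> U1" for u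
        proof -
          have "\<exists>z. z \<in> T \<and> E z u" using Tdom[OF that] by blast
          from someI_ex[OF this] show ?thesis using that unfolding D3_def by simp
        qed
        have D3V: "D3 u \<subseteq> V" "card (D3 u) \<le> 1" for u
          using D3[of u] TV by (cases "u \<in> U1"; auto simp: D3_def)+
        have l10: "lc N0 (cl ?\<Phi> D3)"
        proof (rule closure[OF D3V])
          show "lc (N0 * (1 + 1)) ?\<Phi>" by (rule lc_mono[OF l9]) simp
        qed
        show ?thesis
        proof (rule two_listed[OF adm_cl[OF adm9] l10], unfold two_lists_def, intro ballI)
          fix v assume v: "v \<in> V"
          show "\<exists>c. \<forall>f. cl ?\<Phi> D3 {v} f --> f v \<noteq> c"
          proof (cases "v \<in> U1")
            case False
            obtain c where c: "\<forall>X f. \<Phi>5 X f --> v \<in> X --> f v \<noteq> c" using lists5[OF v False] by (elim exE)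
            have "f v \<noteq> c" if h: "cl ?\<Phi> D3 {v} f" for f
            proof -
              have "\<Phi>5 ({v} \<union> \<Union>(D3 ` {v})) f" using h unfolding cl_def by (intro P85) simp
              then show ?thesis using c by simp
            qed
            then show ?thesis by (intro exI[of _ c] allI impI)
          next
            case True
            obtain z where z: "D3 v = {z}" "z \<in> T" "E z v" using D3[OF True] by (elim exE conjE)
            have h8: "\<Phi>8 {v, z} f \<and> (z \<in> T \<and> E z u1 --> f z = y)" if "cl ?\<Phi> D3 {v} f" for f
              using that unfolding cl_def by (simp add: z(1) insert_commute)
            have pr: "f a \<noteq> f b" if "cl ?\<Phi> D3 {v} f" "a \<in> {v, z, u1, w1, z0}" "b \<in> {v, z, u1, w1, z0}" "E a b" for f a b
              by (rule prp8[OF conjunct1[OF h8[OF that(1)]] _ _ that(4)]) (use that(2,3) in blast)+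
            have co: "f u1 = one \<and> f w1 = cw" if "cl ?\<Phi> D3 {v} f" for f using P8[of "{v, z}" f] h8[OF that] by simp
            \<comment> \<open>If \<open>z\<close> misses \<open>u1\<close> and \<open>v\<close>
              misses \<open>w1\<close>, then \<open>w1\<close> and \<open>z\<close> are adjacent by
              \<open>W_T_cross\<close>, which leaves \<open>z\<close> only the colour other than
              \<open>one\<close> and \<open>cw\<close>.\<close>
            consider "v = u1" | "E v w1" | "E v u1" | "E z u1" | "\<not> E v w1" "\<not> E z u1" "E w1 z" | "\<not> E v w1" "\<not> E z u1" "\<not> E w1 z" by blast
            then show ?thesis
            proof cases
              case 1
              show ?thesis by (rule forced_list[of _ v one]) (simp only: 1 co)
            next
              case 2
              have "f v \<noteq> cw" if h: "cl ?\<Phi> D3 {v} f" for f using pr[OF h, of v w1] co[OF h] 2 by simp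
              then show ?thesis by (intro exI[of _ cw] allI impI)
            next
              case 3
              have "f v \<noteq> one" if h: "cl ?\<Phi> D3 {v} f" for f using pr[OF h, of v u1] co[OF h] 3 by simp
              then show ?thesis by (intro exI[of _ one] allI impI)
            next
              case 4
              have "f v \<noteq> y" if h: "cl ?\<Phi> D3 {v} f" for f using pr[OF h, of z v] h8[OF h] 4 z by simp
              then show ?thesis by (intro exI[of _ y] allI impI)
            next
              case 5
              have "f v \<noteq> oth one cw" if h: "cl ?\<Phi> D3 {v} f" for f
              proof -
                have "f z \<noteq> one" by (rule TT[OF P85, of "{v, z}"]) (use h8[OF h] z(2) in simp_all)
                moreover have "f z \<noteq> cw" using pr[OF h, of w1 z] 5 co[OF h] by simp
                ultimately have "f z = oth one cw" using col_eqI[of "f z" one cw "oth one cw"] oth[of one cw] cw1 by auto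
                then show ?thesis using pr[OF h, of z v] z(3) by simp
              qed
              then show ?thesis by (intro exI[of _ "oth one cw"] allI impI)
            next
              case 6
              have "False" by (rule W_T_cross[OF w1(1) z(2) 6(3) u1 w1(2) 6(2) True z(3)]) (use 6(1) symE in blast)
              then show ?thesis ..
            qed
          qed
        qed
      next
        fix z1 c assume "z1 \<in> V" and "\<not> (z1 \<in> T \<and> E z1 u1 --> c = y)" and l9: "lc (N0 * 14) (fx \<Phi>8 {z1} (\<lambda>_. c))"
        then have z1: "z1 \<in> T" "E z1 u1" and cy: "c \<noteq> y" by auto
        define \<Phi>9 where "\<Phi>9 = fx \<Phi>8 {z1} (\<lambda>_. c)"
        have adm9: "adm \<Phi>9" unfolding \<Phi>9_def by (rule adm_fx[OF adm8])
        have P9: "\<Phi>8 (insert z1 X) f \<and> f z1 = c" if "\<Phi>9 X f" for X f using fx_dest[OF that[unfolded \<Phi>9_def]] .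
        have P95: "\<Phi>5 X f" if "\<Phi>9 X f" for X f
          by (rule admD[OF adm5 P85[of "insert z1 X" f]]) (use P9[OF that] in auto)
        have pr9: "f a \<noteq> f b" if "\<Phi>9 X f" "a \<in> insert z1 X \<union> {u1, w1, z0}" "b \<in> insert z1 X \<union> {u1, w1, z0}" "E a b" for X f a b
          using prp8[of "insert z1 X" f a b] P9[OF that(1)] that(2-4) by simp
        have co: "f u1 = one \<and> f z0 = y \<and> f z1 = c" if "\<Phi>9 X f" for X f
          using P8[of "insert z1 X" f] P9[OF that] by simp
        have cl1: "c \<noteq> one"
        proof -
          obtain f where f: "\<Phi>9 {} f" using lcD[OF l9, of "{}"] unfolding \<Phi>9_def by auto
          have "f z1 \<noteq> f u1" by (rule pr9[OF f _ _ z1(2)]) simp_all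
          then show ?thesis using co[OF f] by simp
        qed
        \<comment> \<open>A vertex of \<open>U1\<close> that sees \<open>z0\<close> or
          \<open>z1\<close> loses a colour. A vertex of \<open>W\<close> that sees both has colour
          \<open>one\<close>; one that misses either of them and has a neighbour in
          \<open>U2\<close> is adjacent to \<open>u1\<close> by \<open>W_T_cross\<close> and belongs
          to \<open>H\<close> by \<open>W_not_mixed\<close>.\<close>
        define U2 where "U2 = {u \<in> U1. \<not> E z0 u \<and> \<not> E z1 u}"
        define Y where "Y = {w \<in> W. E w z0 \<and> E w z1}"
        define D4 where "D4 x = (if \<exists>w\<in>Y. E w x then {SOME w. w \<in> Y \<and> E w x} else {})" for x
        have D4: "\<exists>w. D4 x = {w} \<and> w \<in> Y \<and> E w x" if "\<exists>w\<in>Y. E w x" for x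
        proof -
          have "\<exists>w. w \<in> Y \<and> E w x" using that by blast
          from someI_ex[OF this] show ?thesis using that unfolding D4_def by simp
        qed
        have D4V: "D4 x \<subseteq> V" "card (D4 x) \<le> 1" for x
          using D4[of x] WV by (cases "\<exists>w\<in>Y. E w x"; auto simp: D4_def Y_def)+
        define \<Phi>10 where "\<Phi>10 = cl \<Phi>9 D4"
        have adm10: "adm \<Phi>10" unfolding \<Phi>10_def by (rule adm_cl[OF adm9])
        have lc10: "lc (N0 * 7) \<Phi>10" unfolding \<Phi>10_def by (rule closure[OF D4V]) (use l9 in \<open>simp add: \<Phi>9_def mult.commute\<close>)
        have P10: "\<Phi>9 X f" if "\<Phi>10 X f" for X f
          by (rule admD[OF adm9 that[unfolded \<Phi>10_def cl_def]]) simp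
        have Yone: "f w = one" if h: "\<Phi>9 X f" "w \<in> X" "w \<in> Y" for X f w
        proof -
          have "f w \<noteq> f z0" "f w \<noteq> f z1" using pr9[OF h(1), of w z0] pr9[OF h(1), of w z1] h(2,3) unfolding Y_def by simp_all
          then show ?thesis using co[OF h(1)] y1 cl1 cy col_eqI[of "f w" y c one] by auto
        qed
        let ?H = "{z \<in> V - U2. (\<forall>f. \<Phi>10 {z} f --> f z \<noteq> one) \<and> (\<forall>x\<in>U2. \<forall>y\<in>U2. E x y --> E z x --> E z y)}"
        have TH: "z \<in> ?H" if z: "z \<in> T" for z
        proof -
          have "f z \<noteq> one" if "\<Phi>10 {z} f" for f by (rule TT[OF P95[OF P10[OF that]] _ z]) simp
          moreover have "E z y'" if "x \<in> U2" "y' \<in> U2" "E x y'" "E z x" for x y'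
            by (rule T_hom[OF z _ _ that(3,4)]) (use that(1,2) in \<open>simp_all add: U2_def\<close>)
          moreover have "z \<in> V - U2" using TV[OF z] unfolding U2_def by simp
          ultimately show ?thesis by simp
        qed
        have U2V: "U2 \<subseteq> V" using U1V unfolding U2_def by blast
        show ?thesis
        proof (rule ending[OF adm10 lc10 U2V, of ?H one])
          fix v assume v: "v \<in> V" "v \<notin> U2"
          show "\<exists>d. \<forall>f. \<Phi>10 {v} f --> f v \<noteq> d"
          proof (cases "v \<in> U1")
            case False
            obtain d where "\<forall>X f. \<Phi>5 X f --> v \<in> X --> f v \<noteq> d" using lists5[OF v(1) False] by (elim exE)
            note d = this[rule_format, OF P95[OF P10]]
            show ?thesis by (intro exI[of _ d] allI impI) (rule d[of "{v}"], simp_all)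
          next
            case True
            then consider "E z0 v" | "E z1 v" using v(2) unfolding U2_def by blast
            then show ?thesis
            proof cases
              case 1
              have "f v \<noteq> y" if h: "\<Phi>10 {v} f" for f using pr9[OF P10[OF h], of z0 v] co[OF P10[OF h]] 1 by auto
              then show ?thesis by (intro exI[of _ y] allI impI)
            next
              case 2
              have "f v \<noteq> c" if h: "\<Phi>10 {v} f" for f using pr9[OF P10[OF h], of z1 v] co[OF P10[OF h]] 2 by auto
              then show ?thesis by (intro exI[of _ c] allI impI)
            qed
          qed
        next
          fix u assume "u \<in> U2"
          then have "u \<in> U1" unfolding U2_def by simp
          from Tdom[OF this] obtain z where z: "z \<in> T" "E z u" by (elim bexE)
          show "\<exists>z\<in>?H. E z u" by (rule bexI[of _ z], rule z(2), rule TH[OF z(1)])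
        next
          fix v x f assume v: "v \<in> V" "v \<notin> U2" and vH: "v \<notin> ?H" and x: "x \<in> U2" and e: "E v x" and f: "\<Phi>10 {x} f"
          have x1: "x \<in> U1" "\<not> E z0 x" "\<not> E z1 x" using x unfolding U2_def by simp_all
          have vT: "v \<notin> T" using TH vH by blast
          have vU: "v \<notin> U1"
          proof
            assume vU: "v \<in> U1"
            then have "E z0 v \<or> E z1 v" using v(2) unfolding U2_def by simp
            then show False using T_hom[OF z0(1) vU x1(1) e] T_hom[OF z1(1) vU x1(1) e] x1 by blast
          qed
          have vW: "v \<in> W" using nbrs_U1[OF v(1) x1(1) e] vT vU by simp
          show "f x \<noteq> one"
          proof (cases "E v z0 \<and> E v z1")
            case True
            then have "\<exists>w\<in>Y. E w x" using vW e unfolding Y_def by blast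
            from D4[OF this] obtain w where w: "D4 x = {w}" "w \<in> Y" "E w x" by (elim exE conjE)
            have g: "\<Phi>9 {x, w} f" using f unfolding \<Phi>10_def cl_def by (simp add: w(1) insert_commute)
            show ?thesis using Yone[OF g _ w(2)] pr9[OF g, of w x] w(3) by simp
          next
            case False
            then obtain z where z: "z \<in> T" "E z u1" "\<not> E v z" "\<not> E z x" "z = z0 \<or> z = z1" using z0 z1 x1 by blast
            have vu: "E v u1"
            proof (rule ccontr)
              assume n: "\<not> E v u1"
              show False by (rule W_T_cross[OF vW z(1,3) x1(1) e z(4) u1 z(2) n])
            qed
            have "v \<in> ?H"
            proof -
              have "f v \<noteq> one" if h: "\<Phi>10 {v} f" for f using pr9[OF P10[OF h], of v u1] co[OF P10[OF h]] vu by auto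
              moreover have "E v y'" if xy: "x' \<in> U2" "y' \<in> U2" "E x' y'" "E v x'" for x' y'
                by (rule W_not_mixed[OF vW z(1,3) u1 vu z(2), of x']) (use xy z(5) in \<open>auto simp: U2_def\<close>)
              ultimately show ?thesis using v by simp
            qed
            then show ?thesis using vH by simp
          qed
        qed (rule refl)
      qed
    qed
  qed
qed

end


section \<open>Graphs without an induced P4\<close>

definition split :: "('b => 'b => bool) => 'b set => bool" where
  "split R X \<longleftrightarrow> (\<exists>A B. A \<union> B = X \<and> A \<inter> B = {} \<and> A \<noteq> {} \<and> B \<noteq> {} \<and>
    ((\<forall>a\<in>A. \<forall>b\<in>B. R a b) \<or> (\<forall>a\<in>A. \<forall>b\<in>B. \<not> R a b)))"

text \<open>Let \<open>C\<close> be the component in \<open>Y\<close> of a non-neighbour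
  \<open>y\<close> of \<open>x\<close>, found as a smallest closed set. If \<open>x\<close> has no
  neighbour in \<open>C\<close>, or none in the rest of \<open>Y\<close>, that part splits off.
  Otherwise an edge of \<open>C\<close> with exactly one end adjacent to \<open>x\<close>, then
  \<open>x\<close>, then a neighbour of \<open>x\<close> outside \<open>C\<close>, form a
  \<open>P4\<close>.\<close>

lemma split_step:
  assumes sym: "\<And>x y. R x y ==> R y x" and fin: "finite Y" and x: "x \<notin> Y"
    and AB: "A \<union> B = Y" "A \<inter> B = {}" "A \<noteq> {}" "B \<noteq> {}" "\<And>a b. a \<in> A ==> b \<in> B ==> \<not> R a b"
    and P4: "\<And>a b c d. a \<in> insert x Y ==> b \<in> insert x Y ==> c \<in> insert x Y ==> d \<in> insert x Y ==> \<not> indP4 R a b c d"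
  shows "split R (insert x Y)"
proof -
  define closed where "closed C \<longleftrightarrow> C \<subseteq> Y \<and> (\<forall>a\<in>C. \<forall>b\<in>Y - C. \<not> R a b)" for C
  have c1: ?thesis if C: "closed C" "C \<noteq> {}" "\<And>c. c \<in> C ==> \<not> R x c" for C
  proof -
    have "\<forall>a\<in>C. \<forall>b\<in>insert x (Y - C). \<not> R a b" using C sym unfolding closed_def by blast
    moreover have "C \<union> insert x (Y - C) = insert x Y" "C \<inter> insert x (Y - C) = {}" using C(1) x unfolding closed_def by blast+
    ultimately show ?thesis unfolding split_def using C(2) by (intro exI[of _ C] exI[of _ "insert x (Y - C)"]) simp
  qed
  show ?thesis
  proof (cases "\<forall>y\<in>Y. R x y")
    case True
    have "{x} \<union> Y = insert x Y" "{x} \<inter> Y = {}" "Y \<noteq> {}" using x AB by auto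
    then show ?thesis unfolding split_def using True by (intro exI[of _ "{x}"] exI[of _ Y]) simp
  next
    case False
    then obtain y where y: "y \<in> Y" "\<not> R x y" by blast
    have cA: "closed A" "closed B" "closed Y" using AB sym unfolding closed_def by blast+
    have "\<exists>C. (closed C \<and> y \<in> C) \<and> (\<forall>C'. closed C' \<and> y \<in> C' --> card C \<le> card C')"
      by (rule exE[OF ex_has_least_nat[of "\<lambda>C. closed C \<and> y \<in> C" Y card]]) (use cA(3) y in auto)
    then obtain C where C: "closed C" "y \<in> C" and mn: "\<And>C'. closed C' ==> y \<in> C' ==> card C \<le> card C'" by blast
    have CY: "C \<subseteq> Y" using C(1) unfolding closed_def by simp
    have "C \<noteq> Y"
    proof
      assume "C = Y"
      moreover have "A \<subset> Y" "B \<subset> Y" using AB by blast+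
      then have "card A < card Y" "card B < card Y" using psubset_card_mono[OF fin] by simp_all
      ultimately show False using mn[OF cA(1)] mn[OF cA(2)] y(1) AB(1) by fastforce
    qed
    then have ne: "Y - C \<noteq> {}" using CY by blast
    have cl': "closed (Y - C)" using C(1) sym unfolding closed_def by blast
    show ?thesis
    proof (cases "\<exists>b\<in>Y - C. R x b")
      case False
      then show ?thesis using c1[OF cl' ne] by blast
    next
      case True
      then obtain b where b: "b \<in> Y - C" "R x b" by blast
      show ?thesis
      proof (cases "\<exists>a\<in>C. R x a")
        case False
        then show ?thesis using c1[OF C(1)] C(2) by blast
      next
        case True
        then obtain a0 where a0: "a0 \<in> C" "R x a0" by blast
        let ?A2 = "{c \<in> C. \<not> R x c}"
        have "\<not> closed ?A2"
        proof
          assume "closed ?A2"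
          then have "card C \<le> card ?A2" using mn C(2) y(2) by simp
          moreover have "?A2 \<subset> C" using a0 by blast
          then have "card ?A2 < card C" by (rule psubset_card_mono[OF finite_subset[OF CY fin]])
          ultimately show False by simp
        qed
        then obtain a' a where a: "a' \<in> C" "\<not> R x a'" "a \<in> Y" "a \<notin> ?A2" "R a' a" using CY unfolding closed_def by blast
        then have aC: "a \<in> C" using C(1) unfolding closed_def by blast
        then have "R x a" using a(4) by simp
        have nb: "\<not> R a' b" "\<not> R a b" using C(1) a(1) aC b(1) unfolding closed_def by blast+
        have "indP4 R a' a x b" unfolding indP4_def using a(2,5) \<open>R x a\<close> b(2) nb sym by blast
        moreover have "a' \<in> insert x Y" "a \<in> insert x Y" "x \<in> insert x Y" "b \<in> insert x Y" using a(1,3) b(1) CY by blast+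
        ultimately show ?thesis using P4 by blast
      qed
    qed
  qed
qed

text \<open>Induction over the vertices. A complete split is anticomplete in the complement, and the
  complement of a \<open>P4\<close> is a \<open>P4\<close>, so \<open>split_step\<close> serves both
  cases.\<close>

lemma cograph_split:
  assumes sym: "\<And>x y. R x y ==> R y x" and fin: "finite X" and c2: "2 \<le> card X"
    and P4: "\<And>a b c d. a \<in> X ==> b \<in> X ==> c \<in> X ==> d \<in> X ==> \<not> indP4 R a b c d"
  shows "split R X"
  using fin c2 P4
proof (induction X rule: finite_induct)
  case (insert x Y)
  show ?case
  proof (cases "2 \<le> card Y")
    case False
    then have "card Y = 1" using insert.prems(1) insert.hyps by simp
    then obtain y where y: "Y = {y}" by (rule card_1_singletonE)
    have "{x} \<union> {y} = insert x Y" "{x} \<inter> {y} = {}" using y insert.hyps by auto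
    then show ?thesis unfolding split_def by (intro exI[of _ "{x}"] exI[of _ "{y}"]) simp
  next
    case True
    have "split R Y" by (rule insert.IH[OF True]) (use insert.prems(2) in blast)
    then obtain A B where AB: "A \<union> B = Y" "A \<inter> B = {}" "A \<noteq> {}" "B \<noteq> {}"
      and d: "(\<forall>a\<in>A. \<forall>b\<in>B. R a b) \<or> (\<forall>a\<in>A. \<forall>b\<in>B. \<not> R a b)" unfolding split_def by (elim exE conjE)
    from d show ?thesis
    proof
      assume nR: "\<forall>a\<in>A. \<forall>b\<in>B. \<not> R a b"
      show ?thesis by (rule split_step[OF sym insert.hyps(1,2) AB nR[rule_format] insert.prems(2)])
    next
      assume R: "\<forall>a\<in>A. \<forall>b\<in>B. R a b"
      let ?R = "\<lambda>a b. a \<noteq> b \<and> \<not> R a b"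
      have "split ?R (insert x Y)"
      proof (rule split_step[OF _ insert.hyps(1,2) AB])
        fix a b c d assume "a \<in> insert x Y" "b \<in> insert x Y" "c \<in> insert x Y" "d \<in> insert x Y"
        then have "\<not> indP4 R b d a c" using insert.prems(2) by blast
        then show "\<not> indP4 ?R a b c d" unfolding indP4_def using sym by metis
      qed (use R sym in auto)
      then obtain A' B' where 1: "A' \<union> B' = insert x Y" "A' \<inter> B' = {}" "A' \<noteq> {}" "B' \<noteq> {}"
        and 2: "(\<forall>a\<in>A'. \<forall>b\<in>B'. ?R a b) \<or> (\<forall>a\<in>A'. \<forall>b\<in>B'. \<not> ?R a b)" unfolding split_def by (elim exE conjE)
      have ne: "a \<noteq> b" if "a \<in> A'" "b \<in> B'" for a b using 1(2) that by blast
      from 2 have "(\<forall>a\<in>A'. \<forall>b\<in>B'. R a b) \<or> (\<forall>a\<in>A'. \<forall>b\<in>B'. \<not> R a b)"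
      proof
        assume "\<forall>a\<in>A'. \<forall>b\<in>B'. ?R a b" then show ?thesis by simp
      next
        assume "\<forall>a\<in>A'. \<forall>b\<in>B'. \<not> ?R a b" then show ?thesis using ne by simp
      qed
      then show ?thesis unfolding split_def using 1 by (intro exI[of _ A'] exI[of _ B']) simp
    qed
  qed
qed simp

section \<open>P6-free graphs: smallest connected dominating sets\<close>

context fgraph
begin

text \<open>Connectedness in terms of cuts, since what is needed below are edges leaving a given
  set.\<close>

definition connS :: "'a set => bool" where
  "connS X \<longleftrightarrow> X \<noteq> {} \<and> (\<forall>A. A \<subseteq> X --> A \<noteq> {} --> A \<noteq> X --> (\<exists>a\<in>A. \<exists>b\<in>X - A. E a b))"

definition domS :: "'a set => bool" where
  "domS X \<longleftrightarrow> (\<forall>v\<in>V. v \<in> X \<or> (\<exists>x\<in>X. E v x))"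

lemma connS_cut: "connS X ==> A \<subseteq> X ==> A \<noteq> {} ==> A \<noteq> X ==> \<exists>a\<in>A. \<exists>b\<in>X - A. E a b"
  unfolding connS_def by simp

lemma connS_single: "connS {x}"
  unfolding connS_def by auto

lemma connS_insert:
  assumes C: "connS C" and c: "c \<in> C" "E x c"
  shows "connS (insert x C)"
  unfolding connS_def
proof (intro conjI allI impI)
  fix A assume A: "A \<subseteq> insert x C" "A \<noteq> {}" "A \<noteq> insert x C"
  consider "A \<inter> C = {}" | "A \<inter> C = C" | "A \<inter> C \<noteq> {}" "A \<inter> C \<noteq> C" by blast
  then show "\<exists>a\<in>A. \<exists>b\<in>insert x C - A. E a b"
  proof cases
    case 1
    then have "x \<in> A" "c \<in> insert x C - A" using A c by blast+
    then show ?thesis using c(2) by blast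
  next
    case 2
    then have "c \<in> A" "x \<in> insert x C - A" using A c by blast+
    then show ?thesis using symE[OF c(2)] by blast
  next
    case 3
    then obtain a b where "a \<in> A \<inter> C" "b \<in> C - A \<inter> C" "E a b" using connS_cut[OF C, of "A \<inter> C"] by blast
    then show ?thesis by blast
  qed
qed simp

lemma indP4_distinct: "indP4 E a b c d ==> a \<noteq> b \<and> a \<noteq> c \<and> a \<noteq> d \<and> b \<noteq> c \<and> b \<noteq> d \<and> c \<noteq> d"
  unfolding indP4_def using symE irrE by metis

lemma indP4_rev: "indP4 E a b c d ==> indP4 E d c b a"
  unfolding indP4_def using symE by metis

lemma connS_P4: "indP4 E a b c d ==> connS {a, b, c, d}" "indP4 E a b c d ==> connS {b, c, d}"
proof -
  assume p: "indP4 E a b c d"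
  then have e: "E a b" "E b c" "E c d" unfolding indP4_def by simp_all
  have "connS {c, d}" by (rule connS_insert[OF connS_single _ e(3)]) simp
  then have 3: "connS {b, c, d}" by (rule connS_insert[OF _ _ e(2)]) simp
  then have "connS {a, b, c, d}" by (rule connS_insert[OF _ _ e(1)]) simp
  then show "connS {a, b, c, d}" "connS {b, c, d}" using 3 by simp_all
qed

end

locale p6dom = p6graph +
  fixes X :: "'a set"
  assumes XV: "X \<subseteq> V" and conn: "connS X" and dom: "domS X"
    and minimal: "x \<in> X ==> \<not> (connS (X - {x}) \<and> domS (X - {x}))"
begin

text \<open>Deleting \<open>x\<close> destroys domination or connectedness. In the first case
  \<open>t\<close> is a vertex dominated by \<open>x\<close> alone; in the second it is a neighbour
  of \<open>x\<close> in a part of \<open>X - {x}\<close> that the connected set \<open>C\<close>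
  does not meet.\<close>

lemma extend:
  assumes x: "x \<in> X" and C: "C \<subseteq> X - {x}" "connS C"
  shows "\<exists>t. E x t \<and> t \<notin> C \<and> (\<forall>c\<in>C. \<not> E t c) \<and> (t \<in> X \<or> (\<forall>y\<in>X. E t y --> y = x))"
proof -
  have Cne: "C \<noteq> {}" using C(2) unfolding connS_def by simp
  obtain b where b: "b \<in> X - {x}" "E x b" using connS_cut[OF conn, of "{x}"] x C(1) Cne by blast
  show ?thesis
  proof (cases "domS (X - {x})")
    case False
    then obtain v where v: "v \<in> V" "v \<notin> X - {x}" "\<And>y. y \<in> X - {x} ==> \<not> E v y" unfolding domS_def by blast
    have vX: "v \<notin> X" using v(2,3) b by blast
    then obtain y where y: "y \<in> X" "E v y" using dom v(1) unfolding domS_def by blast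
    then have "y = x" using v(3) by blast
    then show ?thesis using y(2) v(3) C(1) vX symE by (intro exI[of _ v]) blast
  next
    case True
    then have "\<not> connS (X - {x})" using minimal[OF x] by blast
    then obtain A where A: "A \<subseteq> X - {x}" "A \<noteq> {}" "A \<noteq> X - {x}" and nA: "\<And>a b. a \<in> A ==> b \<in> X - {x} - A ==> \<not> E a b"
      using b(1) unfolding connS_def by blast
    have part: "\<exists>t. E x t \<and> t \<notin> C \<and> (\<forall>c\<in>C. \<not> E t c) \<and> (t \<in> X \<or> (\<forall>y\<in>X. E t y --> y = x))"
      if B: "B \<subseteq> X - {x}" "B \<noteq> {}" "B \<inter> C = {}" "\<And>a b. a \<in> B ==> b \<in> X - {x} - B ==> \<not> E a b" for B
    proof -
      obtain t s where t: "t \<in> B" "s \<in> X - B" "E t s" using connS_cut[OF conn, of B] B(1,2) x by blast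
      then have "s = x" using B(4) by blast
      moreover have "\<forall>c\<in>C. \<not> E t c" using B(3,4) t(1) C(1) by blast
      ultimately show ?thesis using t B(1,3) symE by (intro exI[of _ t]) blast
    qed
    have "A \<inter> C = {} \<or> A \<inter> C = C"
    proof (rule ccontr)
      assume "\<not> ?thesis"
      then obtain a b where "a \<in> A \<inter> C" "b \<in> C - A \<inter> C" "E a b" using connS_cut[OF C(2), of "A \<inter> C"] by blast
      then show False using nA C(1) by blast
    qed
    then show ?thesis
    proof
      assume "A \<inter> C = {}"
      then show ?thesis using part[OF A(1,2)] nA by blast
    next
      assume AC: "A \<inter> C = C"
      have "\<not> E a b" if "a \<in> X - {x} - A" "b \<in> X - {x} - (X - {x} - A)" for a b
        using nA[of b a] that symE by blast
      then show ?thesis using part[of "X - {x} - A"] A(1,3) AC by blast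
    qed
  qed
qed

text \<open>If \<open>extend\<close> returned a vertex of \<open>X\<close>, using it once more on
  that vertex would prolong the \<open>P4\<close> to a \<open>P6\<close>.\<close>

lemma private_end:
  assumes P: "indP4 E x1 x2 x3 x4" and X: "x1 \<in> X" "x2 \<in> X" "x3 \<in> X" "x4 \<in> X"
  shows "\<exists>y. E x1 y \<and> (\<forall>z\<in>X. E y z --> z = x1)"
proof -
  have "{x2, x3, x4} \<subseteq> X - {x1}" using X indP4_distinct[OF P] by blast
  from extend[OF X(1) this connS_P4(2)[OF P]] obtain t where
    t: "E x1 t" "t \<notin> {x2, x3, x4}" "\<forall>c\<in>{x2, x3, x4}. \<not> E t c" "t \<in> X \<or> (\<forall>y\<in>X. E t y --> y = x1)" by (elim exE conjE)
  show ?thesis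
  proof (cases "t \<in> X")
    case False
    then show ?thesis using t(1,4) by blast
  next
    case True
    have "t \<noteq> x1" using t(1) irrE by blast
    then have "{x1, x2, x3, x4} \<subseteq> X - {t}" using X t(2) by blast
    from extend[OF True this connS_P4(1)[OF P]] obtain s where
      s: "E t s" "\<forall>c\<in>{x1, x2, x3, x4}. \<not> E s c" by (elim exE conjE)
    have "indP6 E s t x1 x2 x3 x4"
      using P s t(1,3) unfolding indP6_def indP4_def by (simp add: Ecomm)
    then show ?thesis using noP6 by blast
  qed
qed

text \<open>The private neighbours \<open>y1\<close> and \<open>y4\<close> of the two ends must be
  adjacent, so the path closes to an induced six-cycle. A vertex of \<open>X\<close> attached to the
  path, but not to both ends, has a further neighbour away from the path by \<open>extend\<close>,
  and a \<open>P6\<close> runs through both into the cycle. By connectedness no vertex of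
  \<open>X\<close> is unattached.\<close>

lemma ends_adjacent:
  assumes P: "indP4 E x1 x2 x3 x4" and X: "x1 \<in> X" "x2 \<in> X" "x3 \<in> X" "x4 \<in> X"
    and x5: "x5 \<in> X" "x5 \<notin> {x1, x2, x3, x4}"
  shows "E x5 x1 \<and> E x5 x4"
proof -
  let ?P = "{x1, x2, x3, x4}"
  note P' = P[unfolded indP4_def]
  obtain y1 where y1: "E x1 y1" "\<forall>z\<in>X. E y1 z --> z = x1" using private_end[OF P X] by (elim exE conjE)
  obtain y4 where y4: "E x4 y4" "\<forall>z\<in>X. E y4 z --> z = x4" using private_end[OF indP4_rev[OF P] X(4,3,2,1)] by (elim exE conjE)
  have ds: "x1 \<noteq> x2" "x1 \<noteq> x3" "x1 \<noteq> x4" "x2 \<noteq> x3" "x2 \<noteq> x4" "x3 \<noteq> x4" using indP4_distinct[OF P] by simp_all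
  have n1: "\<not> E y1 x2" "\<not> E y1 x3" "\<not> E y1 x4" "\<not> E y4 x1" "\<not> E y4 x2" "\<not> E y4 x3" using y1(2) y4(2) X ds by blast+
  have yy: "E y1 y4"
  proof (rule ccontr)
    assume "\<not> E y1 y4"
    then have "indP6 E y1 x1 x2 x3 x4 y4" unfolding indP6_def using P' y1(1) y4(1) n1 by (simp add: Ecomm)
    then show False by (rule noP6)
  qed
  have far: "\<not> E t y1 \<and> \<not> E t y4" if t: "\<forall>c\<in>?P. \<not> E t c" for t
  proof (rule ccontr)
    assume "\<not> ?thesis"
    then consider "E t y1" | "E t y4" by blast
    then show False
    proof cases
      case 1
      have "indP6 E x4 x3 x2 x1 y1 t" unfolding indP6_def using P' y1(1) n1 t 1 by (simp add: Ecomm)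
      then show False by (rule noP6)
    next
      case 2
      have "indP6 E x1 x2 x3 x4 y4 t" unfolding indP6_def using P' y4(1) n1 t 2 by (simp add: Ecomm)
      then show False by (rule noP6)
    qed
  qed
  have Xy: "\<not> E z y1" "\<not> E z y4" if "z \<in> X" "z \<notin> ?P" for z using y1(2) y4(2) that symE by blast+
  have PX: "?P \<subseteq> X" using X by blast
  have step: "E x x1 \<and> E x x4" if x: "x \<in> X" "x \<notin> ?P" "\<exists>c\<in>?P. E x c" for x
  proof (rule ccontr)
    assume n: "\<not> ?thesis"
    have "?P \<subseteq> X - {x}" using PX x(2) by blast
    from extend[OF x(1) this connS_P4(1)[OF P]] obtain t where t: "E x t" "\<forall>c\<in>?P. \<not> E t c" by (elim exE conjE)
    note F = P' t far[OF t(2)] Xy[OF x(1,2)] y1(1) y4(1) n1 yy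
    consider "E x x1" "\<not> E x x4" | "\<not> E x x1" "E x x4" | "\<not> E x x1" "\<not> E x x4" "E x x2" | "\<not> E x x1" "\<not> E x x4" "E x x3" using n x(3) by blast
    then show False
    proof cases
      case 1
      have "indP6 E t x x1 y1 y4 x4" unfolding indP6_def using F 1 by (simp add: Ecomm)
      then show False by (rule noP6)
    next
      case 2
      have "indP6 E t x x4 y4 y1 x1" unfolding indP6_def using F 2 by (simp add: Ecomm)
      then show False by (rule noP6)
    next
      case 3
      have "indP6 E t x x2 x1 y1 y4" unfolding indP6_def using F 3 by (simp add: Ecomm)
      then show False by (rule noP6)
    next
      case 4
      have "indP6 E t x x3 x4 y4 y1" unfolding indP6_def using F 4 by (simp add: Ecomm)
      then show False by (rule noP6)
    qed
  qed
  let ?A = "?P \<union> {x \<in> X. \<exists>c\<in>?P. E x c}"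
  have "?A = X"
  proof (rule ccontr)
    assume ne: "?A \<noteq> X"
    have "?A \<subseteq> X" "?A \<noteq> {}" using PX by blast+
    from connS_cut[OF conn this ne] obtain x6 x where x6: "x6 \<in> ?A" "x \<in> X - ?A" "E x6 x" by (elim bexE)
    have "x6 \<notin> ?P" using x6(2) symE[OF x6(3)] by blast
    then have x6': "x6 \<in> X" "x6 \<notin> ?P" "\<exists>c\<in>?P. E x6 c" using x6(1) by blast+
    have xP: "x \<in> X" "x \<notin> ?P" "\<forall>c\<in>?P. \<not> E x c" using x6(2) by blast+
    note e6 = step[OF x6']
    have "connS (insert x6 ?P)" by (rule connS_insert[OF connS_P4(1)[OF P], of x1]) (use e6 in simp_all)
    moreover have "insert x6 ?P \<subseteq> X - {x}" using PX xP(2) x6' x6(3) irrE by blast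
    ultimately have "\<exists>t. E x t \<and> t \<notin> insert x6 ?P \<and> (\<forall>c\<in>insert x6 ?P. \<not> E t c) \<and> (t \<in> X \<or> (\<forall>y\<in>X. E t y --> y = x))"
      by (intro extend[OF xP(1)])
    then obtain t where t: "E x t" "\<forall>c\<in>insert x6 ?P. \<not> E t c" by (elim exE conjE)
    have t': "\<forall>c\<in>?P. \<not> E t c" "\<not> E t x6" using t(2) by simp_all
    have "indP6 E t x x6 x1 y1 y4"
      unfolding indP6_def using t(1) t' far[OF t'(1)] Xy[OF xP(1,2)] Xy[OF x6'(1,2)] y1(1) n1 yy e6 x6(3) xP(3) by (simp add: Ecomm)
    then show False by (rule noP6)
  qed
  then have "\<exists>c\<in>?P. E x5 c" using x5 by blast
  then show ?thesis by (rule step[OF x5])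
qed

text \<open>Applying \<open>ends_adjacent\<close> also to \<open>x2\<close>, \<open>x1\<close>,
  \<open>v\<close>, \<open>x4\<close> and to \<open>x3\<close>, \<open>x4\<close>, \<open>v\<close>,
  \<open>x1\<close> shows that at most one further vertex of \<open>X\<close> misses
  \<open>x2\<close> and at most one misses \<open>x3\<close>. With these at most six vertices fixed,
  the others in \<open>X\<close> see \<open>x1\<close> and \<open>x2\<close> and are forced; since
  \<open>X\<close> dominates, every vertex outside loses a colour.\<close>

lemma colour_P4:
  assumes P: "indP4 E x1 x2 x3 x4" and X: "x1 \<in> X" "x2 \<in> X" "x3 \<in> X" "x4 \<in> X"
    and lc: "lc (6 + 3 ^ 6 * (N0 * 2)) proper"
  shows "\<exists>f. proper V f"
proof -
  let ?P = "{x1, x2, x3, x4}"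
  have e12: "E x1 x2" using P unfolding indP4_def by simp
  have pn: "E x1 x2" "E x2 x3" "E x3 x4" "\<not> E x1 x3" "\<not> E x1 x4" "\<not> E x2 x4" using P unfolding indP4_def by simp_all
  define O2 where "O2 = {v \<in> X - ?P. \<not> E v x2}"
  define O3 where "O3 = {v \<in> X - ?P. \<not> E v x3}"
  have one: "v = v'" if "v \<in> O2" "v' \<in> O2" for v v'
  proof (rule ccontr)
    assume ne: "v \<noteq> v'"
    have v: "v \<in> X" "v \<notin> ?P" "\<not> E v x2" "v' \<in> X" "v' \<notin> ?P" "\<not> E v' x2" using that unfolding O2_def by simp_all
    have e: "E v x1" "E v x4" using ends_adjacent[OF P X v(1,2)] by simp_all
    have "indP4 E x2 x1 v x4" unfolding indP4_def using pn e v(3) by (simp add: Ecomm)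
    from ends_adjacent[OF this X(2,1) v(1) X(4) v(4)] show False using v(5,6) ne by simp
  qed
  have one': "v = v'" if "v \<in> O3" "v' \<in> O3" for v v'
  proof (rule ccontr)
    assume ne: "v \<noteq> v'"
    have v: "v \<in> X" "v \<notin> ?P" "\<not> E v x3" "v' \<in> X" "v' \<notin> ?P" "\<not> E v' x3" using that unfolding O3_def by simp_all
    have e: "E v x1" "E v x4" using ends_adjacent[OF P X v(1,2)] by simp_all
    have "indP4 E x3 x4 v x1" unfolding indP4_def using pn e v(3) by (simp add: Ecomm)
    from ends_adjacent[OF this X(3,4) v(1) X(1) v(4)] show False using v(5,6) ne by simp
  qed
  have "finite X" by (rule finite_subset[OF XV finV])
  then have "finite O2" "finite O3" unfolding O2_def O3_def by simp_all
  then have c1: "card O2 \<le> 1" "card O3 \<le> 1" using one one' by (simp_all add: card_le_Suc0_iff_eq)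
  let ?S = "?P \<union> (O2 \<union> O3)"
  have "card ?P \<le> 4" by (simp add: card_insert_if)
  then have S6: "card ?S \<le> 6" using card_Un_le[of ?P "O2 \<union> O3"] card_Un_le[of O2 O3] c1 by linarith
  have SV: "?S \<subseteq> V" using X XV unfolding O2_def O3_def by blast
  from query[OF adm_proper_self SV S6 lc] obtain \<sigma> where l: "lc (N0 * 2) (fx proper ?S \<sigma>)" by (elim exE)
  define \<Phi> where "\<Phi> = fx proper ?S \<sigma>"
  have adm: "adm \<Phi>" unfolding \<Phi>_def by (rule adm_fx[OF adm_proper_self])
  have P1: "f s = \<sigma> s" if "\<Phi> Y f" "s \<in> ?S" for Y f s by (rule fxD(2)[OF that(1)[unfolded \<Phi>_def] that(2)])
  have P2: "f x \<noteq> f y" if "\<Phi> Y f" "x \<in> Y \<union> ?S" "y \<in> Y \<union> ?S" "E x y" for Y f x y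
    using fxD(1)[OF that(1)[unfolded \<Phi>_def]] that(2-4) unfolding proper_def by blast
  obtain f0 where f0: "\<Phi> {} f0" using lcD[OF l, of "{}"] unfolding \<Phi>_def by auto
  have s12: "\<sigma> x1 \<noteq> \<sigma> x2" using P2[OF f0 _ _ e12] P1[OF f0, of x1] P1[OF f0, of x2] by simp
  have kn: "\<exists>k. \<forall>Y f. \<Phi> Y f --> x \<in> Y --> f x = k" if x: "x \<in> X" for x
  proof (cases "x \<in> ?S")
    case True
    show ?thesis by (intro exI[of _ "\<sigma> x"] allI impI) (rule P1[OF _ True])
  next
    case False
    then have xP: "x \<notin> ?P" "E x x2" using x unfolding O2_def by blast+
    have e: "E x x1" using ends_adjacent[OF P X x xP(1)] by simp
    have "f x = oth (\<sigma> x1) (\<sigma> x2)" if h: "\<Phi> Y f" "x \<in> Y" for Y f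
    proof -
      have "f x \<noteq> \<sigma> x1" "f x \<noteq> \<sigma> x2"
        using P2[OF h(1) _ _ e] P2[OF h(1) _ _ xP(2)] P1[OF h(1), of x1] P1[OF h(1), of x2] h(2) by simp_all
      then show ?thesis using oth[of "\<sigma> x1" "\<sigma> x2"] s12 col_eqI[of "f x" "\<sigma> x1" "\<sigma> x2" "oth (\<sigma> x1) (\<sigma> x2)"] by blast
    qed
    then show ?thesis by (intro exI[of _ "oth (\<sigma> x1) (\<sigma> x2)"] allI impI)
  qed
  define D where "D v = (if \<exists>x\<in>X. E v x then {SOME x. x \<in> X \<and> E v x} else {})" for v
  have D: "\<exists>x. D v = {x} \<and> x \<in> X \<and> E v x" if "\<exists>x\<in>X. E v x" for v
  proof -
    have "\<exists>x. x \<in> X \<and> E v x" using that by blast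
    from someI_ex[OF this] show ?thesis using that unfolding D_def by simp
  qed
  have DV: "D v \<subseteq> V" "card (D v) \<le> 1" for v
    using D[of v] XV by (cases "\<exists>x\<in>X. E v x"; auto simp: D_def)+
  have l': "lc N0 (cl \<Phi> D)" by (rule closure[OF DV]) (use l in \<open>simp add: \<Phi>_def mult_2_right\<close>)
  show ?thesis
  proof (rule two_listed[OF adm_cl[OF adm] l'], unfold two_lists_def, intro ballI)
    fix v assume v: "v \<in> V"
    show "\<exists>c. \<forall>f. cl \<Phi> D {v} f --> f v \<noteq> c"
    proof (cases "v \<in> X")
      case True
      obtain k where k: "\<forall>Y f. \<Phi> Y f --> v \<in> Y --> f v = k" using kn[OF True] by (elim exE)
      show ?thesis by (unfold cl_def, rule forced_list[of _ v k], rule k[rule_format], assumption) simp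
    next
      case False
      then have "\<exists>x\<in>X. E v x" using dom v unfolding domS_def by blast
      from D[OF this] obtain x where x: "D v = {x}" "x \<in> X" "E v x" by (elim exE conjE)
      obtain k where k: "\<forall>Y f. \<Phi> Y f --> x \<in> Y --> f x = k" using kn[OF x(2)] by (elim exE)
      have "f v \<noteq> k" if h: "cl \<Phi> D {v} f" for f
      proof -
        have c: "\<Phi> {v, x} f" using h unfolding cl_def by (simp add: x(1) insert_commute)
        show ?thesis using P2[OF c _ _ x(3)] k[rule_format, OF c] by simp
      qed
      then show ?thesis by (intro exI[of _ k] allI impI)
    qed
  qed
qed

text \<open>A connected graph without \<open>P4\<close> is a join. If one side shows two colours,
  the other side is monochromatic in the third, so one of them qualifies for
  \<open>mono_side\<close>.\<close>

lemma colour_join: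
  assumes nP4: "\<And>a b c d. a \<in> X ==> b \<in> X ==> c \<in> X ==> d \<in> X ==> \<not> indP4 E a b c d"
    and c2: "2 \<le> card X" and lc: "lc (qry (opt (M2 * 2))) proper"
  shows "\<exists>f. proper V f"
proof -
  have "split E X" by (rule cograph_split[OF symE finite_subset[OF XV finV] c2 nP4])
  then obtain A B where AB: "A \<union> B = X" "A \<inter> B = {}" "A \<noteq> {}" "B \<noteq> {}"
    and d: "(\<forall>a\<in>A. \<forall>b\<in>B. E a b) \<or> (\<forall>a\<in>A. \<forall>b\<in>B. \<not> E a b)" unfolding split_def by (elim exE conjE)
  have "\<exists>a\<in>A. \<exists>b\<in>X - A. E a b" by (rule connS_cut[OF conn]) (use AB in blast)+
  then have J: "E a b" if "a \<in> A" "b \<in> B" for a b using d AB(1) that by blast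
  have dm: "v \<in> A \<or> v \<in> B \<or> (\<exists>x\<in>A \<union> B. E v x)" if "v \<in> V" for v
    using dom that AB(1) unfolding domS_def by blast
  obtain a0 where a0: "a0 \<in> A" using AB(3) by blast
  have AV: "A \<subseteq> V" "B \<subseteq> V" using AB(1) XV by blast+
  obtain \<alpha> where l1: "lc (opt (M2 * 2)) (fx proper {a0} (\<lambda>_. \<alpha>))"
    by (rule query_vertex[OF adm_proper_self lc]) (use a0 AV in blast)
  note adm1 = adm_fx[OF adm_proper_self, of "{a0}" "\<lambda>_. \<alpha>"]
  show ?thesis
  proof (rule option_vertex[OF adm1 l1, of "\<lambda>v c. v \<in> A --> c = \<alpha>"])
    assume l: "lc (M2 * 2) (\<lambda>X f. fx proper {a0} (\<lambda>_. \<alpha>) X f \<and> (\<forall>x\<in>X. x \<in> A --> f x = \<alpha>))"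
    show ?thesis
      by (rule mono_side[OF adm_pt[OF adm1, of "\<lambda>v c. v \<in> A --> c = \<alpha>"] l AV(1) AB(3), of B \<alpha>]) (use J dm in blast)+
  next
    fix a1 c assume "a1 \<in> V" and "\<not> (a1 \<in> A --> c = \<alpha>)" and l: "lc (M2 * 2) (fx (fx proper {a0} (\<lambda>_. \<alpha>)) {a1} (\<lambda>_. c))"
    then have a1: "a1 \<in> A" "c \<noteq> \<alpha>" by blast+
    show ?thesis
    proof (rule mono_side[OF adm_fx[OF adm1] l AV(2) AB(4), of A "oth \<alpha> c"])
      fix Y f v assume h: "fx (fx proper {a0} (\<lambda>_. \<alpha>)) {a1} (\<lambda>_. c) Y f" "v \<in> Y" "v \<in> B"
      have 1: "proper (insert a0 (insert a1 Y)) f" "f a0 = \<alpha>" "f a1 = c" using fx_dest[OF h(1)] fx_dest[of proper a0 \<alpha> "insert a1 Y" f] by simp_all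
      have "f a0 \<noteq> f v" "f a1 \<noteq> f v" using 1(1) J[OF a0 h(3)] J[OF a1(1) h(3)] h(2) unfolding proper_def by simp_all
      then show "f v = oth \<alpha> c" using 1(2,3) oth[of \<alpha> c] a1(2) col_eqI[of "f v" \<alpha> c "oth \<alpha> c"] by auto
    next
      show "\<And>v. v \<in> V ==> v \<in> B \<or> v \<in> A \<or> (\<exists>x\<in>B \<union> A. E v x)" using dm by blast
      show "\<And>a b. a \<in> B ==> b \<in> A ==> E a b" using J symE by blast
    qed
  qed
qed

end

context p6graph
begin

text \<open>The three summands pay for the possible shapes of the dominating set: one with a
  \<open>P4\<close>, a single vertex, a join.\<close>

lemma P6_colourable:
  assumes conn: "connS V" and lc: "lc (6 + 3 ^ 6 * (N0 * 2) + qry N0 + qry (opt (M2 * 2))) proper"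
  shows "\<exists>f. proper V f"
proof -
  have "\<exists>X. (X \<subseteq> V \<and> connS X \<and> domS X) \<and> (\<forall>Y. Y \<subseteq> V \<and> connS Y \<and> domS Y --> card X \<le> card Y)"
    by (rule exE[OF ex_has_least_nat[of "\<lambda>X. X \<subseteq> V \<and> connS X \<and> domS X" V card]]) (use conn in \<open>auto simp: domS_def\<close>)
  then obtain X where X: "X \<subseteq> V" "connS X" "domS X" and mn: "\<And>Y. Y \<subseteq> V ==> connS Y ==> domS Y ==> card X \<le> card Y" by blast
  have finX: "finite X" by (rule finite_subset[OF X(1) finV])
  interpret p6dom V E N0 X
  proof
    fix x assume x: "x \<in> X"
    show "\<not> (connS (X - {x}) \<and> domS (X - {x}))"
    proof
      assume "connS (X - {x}) \<and> domS (X - {x})"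
      then have "card X \<le> card (X - {x})" using mn[of "X - {x}"] X(1) by blast
      then show False using card_Diff1_less[OF finX x] by simp
    qed
  qed (use X in simp_all)
  show ?thesis
  proof (cases "\<exists>x1\<in>X. \<exists>x2\<in>X. \<exists>x3\<in>X. \<exists>x4\<in>X. indP4 E x1 x2 x3 x4")
    case True
    then obtain x1 x2 x3 x4 where "indP4 E x1 x2 x3 x4" "x1 \<in> X" "x2 \<in> X" "x3 \<in> X" "x4 \<in> X" by (elim bexE)
    then show ?thesis by (rule colour_P4) (rule lc_mono[OF lc], simp)
  next
    case nP4: False
    show ?thesis
    proof (cases "2 \<le> card X")
      case True
      show ?thesis by (rule colour_join[OF _ True]) (use nP4 lc_mono[OF lc] in auto)
    next
      case False
      have "card X \<noteq> 0" using finX X(2) unfolding connS_def by simp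
      then have "card X = 1" using False by simp
      then obtain x where x: "X = {x}" by (rule card_1_singletonE)
      have lq: "lc (qry N0) proper" by (rule lc_mono[OF lc]) simp
      obtain c where l: "lc N0 (fx proper {x} (\<lambda>_. c))" by (rule query_vertex[OF adm_proper_self lq]) (use X x in blast)
      show ?thesis
      proof (rule two_listed[OF adm_fx[OF adm_proper_self] l], unfold two_lists_def, intro ballI)
        fix v assume v: "v \<in> V"
        show "\<exists>d. \<forall>f. fx proper {x} (\<lambda>_. c) {v} f --> f v \<noteq> d"
        proof (cases "v = x")
          case True
          show ?thesis by (rule forced_list[of _ v c]) (use fx_dest True in blast)
        next
          case False
          then have e: "E v x" using X(3) v x unfolding domS_def by auto
          have "f v \<noteq> c" if "fx proper {x} (\<lambda>_. c) {v} f" for f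
            using fx_dest[OF that] e unfolding proper_def by auto
          then show ?thesis by (intro exI[of _ c] allI impI)
        qed
      qed
    qed
  qed
qed

end

theorem P6_bounded:
  "\<exists>N. \<forall>V (E :: 'a => 'a => bool). fgraph V E --> p6free E --> fgraph.connS E V -->
    fgraph.lc V N (fgraph.proper E) --> (\<exists>f. fgraph.proper E V f)"
proof -
  obtain N0 where N0: "\<forall>V (E :: 'a => 'a => bool) \<Phi>. fgraph V E --> p6free E --> fgraph.adm E \<Phi> --> fgraph.lc V N0 \<Phi> -->
    fgraph.two_lists V \<Phi> --> (\<exists>f. fgraph.proper E V f)" using two_lists_P6 by (elim exE)
  have "\<exists>f. fgraph.proper E V f" if h: "fgraph V E" "p6free E" "fgraph.connS E V"
    "fgraph.lc V (6 + 3 ^ 6 * (N0 * 2) + qry N0 + qry (opt (p6graph.M2 N0 * 2))) (fgraph.proper E)" for V and E :: "'a => 'a => bool"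
  proof -
    have "p6graph V E N0" using h(1,2) N0 by (simp add: p6graph_def p6graph_axioms_def)
    from p6graph.P6_colourable[OF this h(3,4)] show ?thesis .
  qed
  then show ?thesis by (intro exI[of _ "6 + 3 ^ 6 * (N0 * 2) + qry N0 + qry (opt (p6graph.M2 N0 * 2))"] allI impI)
qed


section \<open>The bound for P4 + kP1\<close>

text \<open>Without a \<open>P6\<close> the previous bound applies. Otherwise there is a
  \<open>P4\<close>, and at most \<open>3 * k\<close> vertices outside it see none of it: among
  \<open>3 * k\<close> such vertices, a local colouring has a colour class with \<open>k\<close>
  elements, which completes a \<open>P4 + kP1\<close>. When the \<open>P4\<close> and these vertices
  are fixed, every other vertex has a coloured neighbour.\<close>

theorem P4k_bounded:
  "\<exists>N. \<forall>V (E :: 'a => 'a => bool). fgraph V E --> kfree k V E --> fgraph.connS E V -->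
    fgraph.lc V N (fgraph.proper E) --> (\<exists>f. fgraph.proper E V f)"
proof -
  obtain N1 where N1: "\<forall>V (E :: 'a => 'a => bool). fgraph V E --> p6free E --> fgraph.connS E V -->
    fgraph.lc V N1 (fgraph.proper E) --> (\<exists>f. fgraph.proper E V f)" using P6_bounded by (elim exE)
  obtain N2 where N2: "\<forall>V (E :: 'a => 'a => bool) \<Phi>. fgraph V E --> kfree k V E --> fgraph.adm E \<Phi> --> fgraph.lc V N2 \<Phi> -->
    fgraph.two_lists V \<Phi> --> (\<exists>f. fgraph.proper E V f)" using two_lists_P4k[of k] by (elim exE)
  define s where "s = 4 + 3 * k"
  have "\<exists>f. fgraph.proper E V f" if h: "fgraph V E" "kfree k V E" "fgraph.connS E V"
    "fgraph.lc V (N1 + (s + 3 ^ s * N2) + 3 * k) (fgraph.proper E)" for V and E :: "'a => 'a => bool"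
  proof -
    interpret fgraph V E by (rule h(1))
    have l: "lc N1 proper" "lc (s + 3 ^ s * N2) proper" "lc (3 * k) proper" by (rule lc_mono[OF h(4)], simp)+
    show ?thesis
    proof (cases "p6free E")
      case True
      then show ?thesis using N1 h(1,3) l(1) by blast
    next
      case False
      then obtain a b c d where P: "indP4 E a b c d" unfolding p6free_def indP6_def indP4_def by blast
      then have e: "E a b" "E b c" "E c d" unfolding indP4_def by simp_all
      let ?P = "{a, b, c, d}"
      have PV: "?P \<subseteq> V" using e symE EV by blast
      define I where "I = {v \<in> V. \<forall>x\<in>?P. \<not> E x v} - ?P"
      have finI: "finite I" using finV unfolding I_def by simp
      have cI: "card I \<le> 3 * k"
      proof (rule ccontr)
        assume "\<not> card I \<le> 3 * k"
        then have "3 * k \<le> card I" by simp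
        then obtain Y where Y: "Y \<subseteq> I" "card Y = 3 * k" "finite Y" by (rule obtain_subset_with_card_n)
        have "Y \<subseteq> V" using Y(1) unfolding I_def by blast
        from lcD[OF l(3) this] obtain f where f: "proper Y f" using Y(2) by auto
        have "\<exists>c. k \<le> card {y \<in> Y. f y = c}"
        proof (rule ccontr)
          assume "\<not> ?thesis"
          then have lt: "card {y \<in> Y. f y = c} < k" for c by (simp add: not_le)
          have "Y = {y \<in> Y. f y = CA} \<union> ({y \<in> Y. f y = CB} \<union> {y \<in> Y. f y = CC})" using col.exhaust by blast
          then have "card Y \<le> card {y \<in> Y. f y = CA} + (card {y \<in> Y. f y = CB} + card {y \<in> Y. f y = CC})"
            using card_Un_le[of "{y \<in> Y. f y = CA}" "{y \<in> Y. f y = CB} \<union> {y \<in> Y. f y = CC}"]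
              card_Un_le[of "{y \<in> Y. f y = CB}" "{y \<in> Y. f y = CC}"] by simp
          then show False using lt[of CA] lt[of CB] lt[of CC] Y(2) by linarith
        qed
        then obtain c0 where "k \<le> card {y \<in> Y. f y = c0}" by (elim exE)
        then obtain S where S: "S \<subseteq> {y \<in> Y. f y = c0}" "card S = k" "finite S" by (rule obtain_subset_with_card_n)
        have "\<not> E x y" if "x \<in> S" "y \<in> S" for x y
        proof -
          have "x \<in> Y" "y \<in> Y" "f x = f y" using S(1) that by auto
          then show ?thesis using f unfolding proper_def by blast
        qed
        moreover have "\<not> E a x \<and> \<not> E b x \<and> \<not> E c x \<and> \<not> E d x" if "x \<in> S" for x
        proof -
          have "x \<in> I" using S(1) Y(1) that by blast
          then show ?thesis unfolding I_def by simp
        qed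
        ultimately have "indP4k E a b c d S" using P unfolding indP4k_def by simp
        moreover have "S \<subseteq> V" using S(1) \<open>Y \<subseteq> V\<close> by blast
        ultimately show False using h(2) S(2,3) unfolding kfree_def by blast
      qed
      have "card ?P \<le> 4" by (simp add: card_insert_if)
      then have cS: "card (?P \<union> I) \<le> s" using card_Un_le[of ?P I] cI unfolding s_def by linarith
      have SV: "?P \<union> I \<subseteq> V" using PV unfolding I_def by blast
      from query[OF adm_proper_self SV cS l(2)] obtain \<sigma> where lq: "lc N2 (fx proper (?P \<union> I) \<sigma>)" by (elim exE)
      have "two_lists (fx proper (?P \<union> I) \<sigma>)"
        unfolding two_lists_def
      proof
        fix v assume v: "v \<in> V"
        show "\<exists>c. \<forall>f. fx proper (?P \<union> I) \<sigma> {v} f --> f v \<noteq> c"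
        proof (cases "v \<in> ?P \<union> I")
          case True
          show ?thesis by (rule forced_list[of _ v "\<sigma> v"], rule fxD(2), assumption, rule True)
        next
          case False
          then obtain x where x: "x \<in> ?P" "E x v" using v unfolding I_def by blast
          have "f v \<noteq> \<sigma> x" if g: "fx proper (?P \<union> I) \<sigma> {v} f" for f
          proof -
            have xS: "x \<in> ?P \<union> I" using x(1) by blast
            have fx: "f x = \<sigma> x" by (rule fxD(2)[OF g xS])
            have "f x \<noteq> f v" by (rule adm_proper[OF adm_proper_self fxD(1)[OF g] _ _ x(2)]) (use xS in blast)+
            then show ?thesis using fx by simp
          qed
          then show ?thesis by (intro exI[of _ "\<sigma> x"] allI impI)
        qed
      qed
      then show ?thesis using N2[rule_format, OF h(1,2) adm_fx[OF adm_proper_self] lq] by simp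
    qed
  qed
  then show ?thesis by (intro exI[of _ "N1 + (s + 3 ^ s * N2) + 3 * k"] allI impI)
qed

section \<open>Gluing colourings of cliques\<close>

lemma four_colours:
  assumes "card K = 4" and "\<And>x y. x \<in> K ==> y \<in> K ==> x \<noteq> y ==> (f x :: col) \<noteq> f y"
  shows False
proof -
  have "inj_on f K" using assms(2) by (auto intro: inj_onI)
  then have "card (f ` K) = 4" using assms(1) by (simp add: card_image)
  moreover have "card (f ` K) \<le> 3" using card_mono[of "UNIV :: col set" "f ` K"] by simp
  ultimately show False by simp
qed

context fgraph
begin

lemma clique_small:
  assumes adm: "adm \<Phi>" and lc: "lc 4 \<Phi>" and K: "K \<subseteq> V" "\<And>x y. x \<in> K ==> y \<in> K ==> x \<noteq> y ==> E x y"
  shows "card K \<le> 3"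
proof (rule ccontr)
  assume "\<not> card K \<le> 3"
  then have "4 \<le> card K" by simp
  then obtain Y where Y: "Y \<subseteq> K" "card Y = 4" "finite Y" by (rule obtain_subset_with_card_n)
  have "Y \<subseteq> V" using Y(1) K(1) by blast
  from lcD[OF lc this] obtain f where f: "\<Phi> Y f" using Y(2) by auto
  show False by (rule four_colours[OF Y(2), of f]) (use adm_proper[OF adm f] K(2) Y(1) in blast)
qed

text \<open>If every induced \<open>P3\<close> has a vertex of colour \<open>one\<close> and outside a \<open>P3\<close>-free set \<open>U\<close> it is known which
  vertices have colour \<open>one\<close>, then colourings of the cliques of \<open>U\<close> together with boundedly many neighbours can
  be glued: a vertex of \<open>U\<close> without colour \<open>one\<close> has at most one neighbour in \<open>B\<close>.\<close>

lemma restricted_finish: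
  assumes adm: "adm \<Phi>" and lc: "lc 12 \<Phi>"
    and part: "\<And>v. v \<in> V ==> v \<in> A \<or> v \<in> B \<or> v \<in> U" and AV: "A \<subseteq> V" "B \<subseteq> V" "U \<subseteq> V"
    and dj: "A \<inter> U = {}" "B \<inter> U = {}"
    and A: "\<And>X f v. \<Phi> X f ==> v \<in> X ==> v \<in> A ==> f v = one"
    and B: "\<And>X f v. \<Phi> X f ==> v \<in> X ==> v \<in> B ==> f v \<noteq> one"
    and P3: "\<And>X f a b c. \<Phi> X f ==> a \<in> X ==> b \<in> X ==> c \<in> X ==> indP3 E a b c ==> f a = one \<or> f b = one \<or> f c = one"
    and U: "\<And>a b c. a \<in> U ==> b \<in> U ==> c \<in> U ==> \<not> indP3 E a b c"
  shows "\<exists>f. proper V f"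
proof -
  have two: "f x = one \<or> f y = one \<or> f z = one"
    if f: "\<Phi> X f" "x \<in> X" "y \<in> X" "z \<in> X" "E x y" "E y z" "x \<noteq> z" for X f x y z
  proof (cases "E x z")
    case True
    have "f x \<noteq> f y" "f y \<noteq> f z" "f x \<noteq> f z"
      using adm_proper[OF adm f(1)] f(2-6) True by blast+
    then show ?thesis using third_col[of "f x" "f y" "f z" one] by auto
  next
    case False
    have "indP3 E x y z" unfolding indP3_def using f(5,6,7) False by simp
    then show ?thesis by (rule P3[OF f(1-4)])
  qed
  \<comment> \<open>\<open>B\<close> has maximum degree one inside, because a walk through three
    vertices of \<open>B\<close> would avoid \<open>one\<close>.\<close>
  have Blike: "y = z" if y: "y \<in> B" "z \<in> B" "x \<in> B" "E x y" "E x z" for x y z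
  proof (rule ccontr)
    assume ne: "y \<noteq> z"
    have "{x, y, z} \<subseteq> V" using y AV by blast
    moreover have "card {x, y, z} \<le> 12" by (simp add: card_insert_if)
    ultimately obtain f where f: "\<Phi> {x, y, z} f" using lcD[OF lc] by blast
    have "f y = one \<or> f x = one \<or> f z = one" by (rule two[OF f, of y x z]) (use y ne symE in auto)
    then show False using B[OF f] y by blast
  qed
  define M where "M x = insert x {y \<in> B. E x y}" for x
  have Meq: "M x = M y" if "x \<in> B" "y \<in> B" "E x y" for x y
  proof -
    have "{z \<in> B. E x z} = {y}" using Blike that by blast
    moreover have "{z \<in> B. E y z} = {x}" using Blike that symE by blast
    ultimately show ?thesis unfolding M_def by blast
  qed
  define K where "K u = insert u {v \<in> U. E u v}" for u
  have Kcl: "E x y" if "u \<in> U" "x \<in> K u" "y \<in> K u" "x \<noteq> y" for u x y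
  proof (rule ccontr)
    assume n: "\<not> E x y"
    then have "x \<noteq> u" "y \<noteq> u" using that symE unfolding K_def by blast+
    then have "indP3 E x u y" unfolding indP3_def using that n symE unfolding K_def by blast
    then show False using U[of x u y] that unfolding K_def by blast
  qed
  have Keq: "K u = K v" if uv: "u \<in> U" "v \<in> U" "E u v" for u v
  proof -
    have "K u \<subseteq> K v" if uv: "u \<in> U" "v \<in> U" "E u v" for u v
    proof
      fix x assume x: "x \<in> K u"
      have "v \<in> K u" using uv unfolding K_def by simp
      then have "x = v \<or> E v x" using Kcl[OF uv(1)] x symE by blast
      moreover have "x \<in> U" using x uv(1) unfolding K_def by blast
      ultimately show "x \<in> K v" unfolding K_def by blast
    qed
    then show ?thesis using uv symE by blast
  qed
  have K3: "card (K u) \<le> 3" if "u \<in> U" for u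
  proof (rule clique_small[OF adm lc_mono[OF lc]])
    show "K u \<subseteq> V" using that AV(3) unfolding K_def by blast
  qed (simp, rule Kcl[OF that])
  define pick where "pick Q = (if \<exists>x. Q x then {SOME x. Q x} else {})" for Q :: "'a => bool"
  have pick: "\<exists>y. pick Q = {y} \<and> Q y" if "\<exists>x. Q x" for Q using someI_ex[OF that] that unfolding pick_def by simp
  have pickQ: "Q y" if "y \<in> pick Q" for Q y using pick[of Q] that unfolding pick_def by (cases "\<exists>x. Q x") auto
  have pick1: "card (pick Q) \<le> 1" for Q unfolding pick_def by simp
  \<comment> \<open>Per vertex one witness in \<open>A\<close>, which excludes \<open>one\<close>,
    and two in \<open>B\<close>, which together force it. Cliques have at most three vertices, so a
    clique with its witnesses has at most 12.\<close>
  define W1 where "W1 u = pick (\<lambda>x. x \<in> A \<and> E u x)" for u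
  define W2 where "W2 u = pick (\<lambda>x. x \<in> B \<and> E u x)" for u
  define W3 where "W3 u = pick (\<lambda>x. x \<in> B \<and> E u x \<and> x \<notin> W2 u)" for u
  define W where "W u = W1 u \<union> (W2 u \<union> W3 u)" for u
  have W3c: "card (W u) \<le> 3" for u
    using card_Un_le[of "W1 u" "W2 u \<union> W3 u"] card_Un_le[of "W2 u" "W3 u"] pick1[of "\<lambda>x. x \<in> A \<and> E u x"] pick1[of "\<lambda>x. x \<in> B \<and> E u x"] pick1[of "\<lambda>x. x \<in> B \<and> E u x \<and> x \<notin> W2 u"]
    unfolding W_def W1_def[symmetric] W2_def[symmetric] W3_def[symmetric] by linarith
  have WV: "W u \<subseteq> V" for u
    using pickQ[of _ "\<lambda>x. x \<in> A \<and> E u x"] pickQ[of _ "\<lambda>x. x \<in> B \<and> E u x"] pickQ[of _ "\<lambda>x. x \<in> B \<and> E u x \<and> x \<notin> W2 u"] AV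
    unfolding W_def W1_def W2_def W3_def by blast
  have w1: "\<exists>x\<in>W u. x \<in> A \<and> E u x" if "a \<in> A" "E u a" for u a
    using pick[of "\<lambda>x. x \<in> A \<and> E u x"] that unfolding W_def W1_def by blast
  have w2: "\<exists>x\<in>W2 u. x \<in> B \<and> E u x" if "b \<in> B" "E u b" for u b
    using pick[of "\<lambda>x. x \<in> B \<and> E u x"] that unfolding W2_def by blast
  have w3: "\<exists>x\<in>W u. \<exists>y\<in>W u. x \<noteq> y \<and> x \<in> B \<and> E u x \<and> y \<in> B \<and> E u y" if b: "b \<in> B" "E u b" "b' \<in> B" "E u b'" "b \<noteq> b'" for u b b'
  proof -
    obtain x where x: "W2 u = {x}" "x \<in> B" "E u x" using pick[of "\<lambda>x. x \<in> B \<and> E u x"] b(1,2) unfolding W2_def by blast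
    have "\<exists>y. y \<in> B \<and> E u y \<and> y \<notin> W2 u" using b x(1) by (metis singletonD)
    from pick[OF this] obtain y where "W3 u = {y}" "y \<in> B" "E u y" "y \<notin> W2 u" unfolding W3_def by blast
    then show ?thesis using x unfolding W_def by blast
  qed
  define F where "F C = (SOME f. \<Phi> (C \<union> \<Union>(W ` C)) f)" for C
  have F: "\<Phi> (K u \<union> \<Union>(W ` K u)) (F (K u))" if u: "u \<in> U" for u
  proof -
    have KV: "K u \<subseteq> V" using u AV unfolding K_def by blast
    have "card (\<Union>(W ` K u)) \<le> (\<Sum>x\<in>K u. card (W x))" by (rule card_UN_le) (rule finite_subset[OF KV finV])
    also have "\<dots> \<le> (\<Sum>x\<in>K u. 3)" by (rule sum_mono) (rule W3c)
    also have "\<dots> \<le> 9" using K3[OF u] by simp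
    finally have "card (K u \<union> \<Union>(W ` K u)) \<le> 12" using card_Un_le[of "K u" "\<Union>(W ` K u)"] K3[OF u] by linarith
    moreover have "K u \<union> \<Union>(W ` K u) \<subseteq> V" using KV WV by blast
    ultimately have "\<exists>f. \<Phi> (K u \<union> \<Union>(W ` K u)) f" by (intro lcD[OF lc])
    from someI_ex[OF this] show ?thesis unfolding F_def .
  qed
  define G where "G C = (SOME f. \<Phi> C f)" for C
  have G: "\<Phi> (M x) (G (M x))" if x: "x \<in> B" for x
  proof -
    have MV: "M x \<subseteq> V" using x AV unfolding M_def by blast
    have "finite {y \<in> B. E x y}" using finite_subset[OF AV(2) finV] by simp
    moreover have "\<forall>a\<in>{y \<in> B. E x y}. \<forall>b\<in>{y \<in> B. E x y}. a = b" using Blike x by blast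
    ultimately have "card {y \<in> B. E x y} \<le> Suc 0" by (simp add: card_le_Suc0_iff_eq)
    then have "card (M x) \<le> 12" unfolding M_def using card_insert_le_m1[of 12 "{y \<in> B. E x y}" x] by simp
    from lcD[OF lc MV this] show ?thesis unfolding G_def by (rule someI_ex)
  qed
  define g where "g x = G (M x) x" for x
  have g1: "g x \<noteq> one" if "x \<in> B" for x unfolding g_def by (rule B[OF G[OF that] _ that]) (simp add: M_def)
  have gp: "g x \<noteq> g y" if "x \<in> B" "y \<in> B" "E x y" for x y
    unfolding g_def Meq[OF that, symmetric] by (rule adm_proper[OF adm G[OF that(1)] _ _ that(3)]) (use that in \<open>simp_all add: M_def\<close>)
  define nb where "nb u = (SOME n. n \<in> B \<and> E u n)" for u
  define k where "k u = F (K u) u" for u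
  \<comment> \<open>A vertex of \<open>U\<close> not coloured \<open>one\<close> may have a
    neighbour in \<open>B\<close> whose final colour differs from the one in the local colouring. It
    is the only such neighbour, so the remaining colour is free.\<close>
  define fin where "fin v = (if v \<in> U then (if k v = one then one else if \<exists>n\<in>B. E v n then oth one (g (nb v)) else k v)
    else if v \<in> A then one else g v)" for v
  have AB: "A \<inter> B = {}"
  proof (rule ccontr)
    assume "A \<inter> B \<noteq> {}"
    then obtain v where v: "v \<in> A" "v \<in> B" by blast
    have "{v} \<subseteq> V" "card {v} \<le> 12" using v AV by auto
    from lcD[OF lc this] obtain f where f: "\<Phi> {v} f" by (elim exE)
    show False using A[OF f _ v(1)] B[OF f _ v(2)] by simp
  qed
  have finA: "fin v = one" if "v \<in> A" for v using that dj unfolding fin_def by auto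
  have finB: "fin v = g v" if "v \<in> B" for v using that dj AB unfolding fin_def by auto
  have fin1: "fin v = one \<longleftrightarrow> k v = one" if "v \<in> U" for v using that oth(1)[of one "g (nb v)"] unfolding fin_def by simp
  have inK: "u \<in> K u \<union> \<Union>(W ` K u)" "W u \<subseteq> K u \<union> \<Union>(W ` K u)" for u unfolding K_def by auto
  have UU: "fin x \<noteq> fin y" if xy: "x \<in> U" "y \<in> U" "E x y" for x y
  proof -
    note Kx = Keq[OF xy]
    have yK: "y \<in> K x \<union> \<Union>(W ` K x)" using inK(1)[of y] Kx by simp
    have kk: "k x \<noteq> k y" unfolding k_def Kx[symmetric] by (rule adm_proper[OF adm F[OF xy(1)] inK(1) yK xy(3)])
    show ?thesis
    proof (cases "k x = one \<or> k y = one")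
      case True
      then show ?thesis using fin1[OF xy(1)] fin1[OF xy(2)] kk by metis
    next
      case False
      have no: "\<not> (\<exists>n\<in>B. E u n)" if u: "u \<in> U" "v \<in> U" "E u v" "k u \<noteq> one" "k v \<noteq> one" for u v
      proof
        assume "\<exists>n\<in>B. E u n"
        then obtain n where n: "n \<in> W2 u" "n \<in> B" "E u n" using w2 by blast
        note Ku = Keq[OF u(1-3)]
        have nK: "n \<in> K u \<union> \<Union>(W ` K u)" using n(1) inK(2)[of u] unfolding W_def by blast
        have vK: "v \<in> K u \<union> \<Union>(W ` K u)" using inK(1)[of v] Ku by simp
        have "n \<noteq> v" using n(2) u(2) dj by blast
        then have "F (K u) n = one \<or> F (K u) u = one \<or> F (K u) v = one"
          by (intro two[OF F[OF u(1)] nK inK(1) vK symE[OF n(3)] u(3)])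
        then show False using B[OF F[OF u(1)] nK n(2)] u(4,5) Ku unfolding k_def by simp
      qed
      show ?thesis using no[OF xy] no[OF xy(2,1) symE[OF xy(3)]] False kk xy(1,2) unfolding fin_def by simp
    qed
  qed
  have UA: "fin x \<noteq> fin y" if xy: "x \<in> U" "y \<in> A" "E x y" for x y
  proof -
    have "k x \<noteq> one"
    proof
      assume e: "k x = one"
      obtain a where a: "a \<in> W x" "a \<in> A" "E x a" using w1[OF xy(2,3)] by blast
      have aK: "a \<in> K x \<union> \<Union>(W ` K x)" using a(1) inK(2)[of x] by blast
      have "F (K x) x \<noteq> F (K x) a" by (rule adm_proper[OF adm F[OF xy(1)] inK(1) aK a(3)])
      then show False using A[OF F[OF xy(1)] aK a(2)] e unfolding k_def by simp
    qed
    then show ?thesis using fin1[OF xy(1)] finA[OF xy(2)] by simp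
  qed
  have UB: "fin x \<noteq> fin y" if xy: "x \<in> U" "y \<in> B" "E x y" for x y
  proof (cases "k x = one")
    case True
    then show ?thesis using fin1[OF xy(1)] finB[OF xy(2)] g1[OF xy(2)] by simp
  next
    case False
    have ex: "\<exists>n. n \<in> B \<and> E x n" using xy by blast
    have nb: "nb x \<in> B" "E x (nb x)" using someI_ex[OF ex] unfolding nb_def by simp_all
    have "nb x = y"
    proof (rule ccontr)
      assume "nb x \<noteq> y"
      from w3[OF nb xy(2,3) this] obtain n n' where n: "n \<in> W x" "n' \<in> W x" "n \<noteq> n'" "n \<in> B" "E x n" "n' \<in> B" "E x n'" by blast
      have nK: "n \<in> K x \<union> \<Union>(W ` K x)" "n' \<in> K x \<union> \<Union>(W ` K x)" using n(1,2) inK(2)[of x] by blast+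
      have "F (K x) n = one \<or> F (K x) x = one \<or> F (K x) n' = one"
        by (rule two[OF F[OF xy(1)] nK(1) inK(1) nK(2) symE[OF n(5)] n(7,3)])
      then show False using B[OF F[OF xy(1)] nK(1) n(4)] B[OF F[OF xy(1)] nK(2) n(6)] False unfolding k_def by simp
    qed
    then have "fin x = oth one (g y)" using False xy unfolding fin_def by auto
    then show ?thesis using finB[OF xy(2)] oth(2)[of one "g y"] by simp
  qed
  have AA: "\<not> E x y" if "x \<in> A" "y \<in> A" for x y
  proof
    assume e: "E x y"
    have "{x, y} \<subseteq> V" "card {x, y} \<le> 12" using that AV by (auto simp: card_insert_if)
    from lcD[OF lc this] obtain f where f: "\<Phi> {x, y} f" by (elim exE)
    show False using adm_proper[OF adm f _ _ e] A[OF f _ that(1)] A[OF f _ that(2)] by simp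
  qed
  have AB': "fin x \<noteq> fin y" if "x \<in> A" "y \<in> B" for x y using finA[OF that(1)] finB[OF that(2)] g1[OF that(2)] by simp
  have "proper V fin"
    unfolding proper_def
  proof (intro ballI impI)
    fix x y assume xy: "x \<in> V" "y \<in> V" "E x y"
    note yx = symE[OF xy(3)]
    consider "x \<in> U" "y \<in> U" | "x \<in> U" "y \<in> A" | "x \<in> U" "y \<in> B" | "x \<in> A" "y \<in> U" | "x \<in> B" "y \<in> U" | "x \<in> A" "y \<in> A"
      | "x \<in> A" "y \<in> B" | "x \<in> B" "y \<in> A" | "x \<in> B" "y \<in> B" using part[OF xy(1)] part[OF xy(2)] by blast
    then show "fin x \<noteq> fin y"
    proof cases
      case 1 then show ?thesis using UU xy(3) by blast
    next case 2 then show ?thesis using UA xy(3) by blast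
    next case 3 then show ?thesis using UB xy(3) by blast
    next case 4 then show ?thesis using UA[OF 4(2,1) yx] by simp
    next case 5 then show ?thesis using UB[OF 5(2,1) yx] by simp
    next case 6 then show ?thesis using AA xy(3) by blast
    next case 7 then show ?thesis using AB' by blast
    next case 8 then show ?thesis using AB'[OF 8(2,1)] by simp
    next case 9 then show ?thesis using gp[OF 9 xy(3)] finB[OF 9(1)] finB[OF 9(2)] by simp
    qed
  qed
  then show ?thesis by blast
qed

end


section \<open>2P3-free graphs: precoloured seeds\<close>

definition restr :: "('a => 'a => bool) => col => 'a set => ('a => col) => bool" where
  "restr E m X f \<longleftrightarrow> (\<forall>a\<in>X. \<forall>b\<in>X. \<forall>c\<in>X. indP3 E a b c --> f a = m \<or> f b = m \<or> f c = m)"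

context fgraph
begin

lemma adm_restr: "adm (\<lambda>X f. proper X f \<and> restr E m X f)"
  by (rule adm_conj[OF adm_proper_self]) (auto simp: restr_def)

definition known :: "('a set => ('a => col) => bool) => col => 'a => bool" where
  "known \<Phi> m v \<longleftrightarrow> (\<forall>X f. \<Phi> X f --> v \<in> X --> f v = m) \<or> (\<forall>X f. \<Phi> X f --> v \<in> X --> f v \<noteq> m)"

lemma known_mono: "known \<Phi> m v ==> (\<And>X f. \<Psi> X f ==> \<Phi> X f) ==> known \<Psi> m v"
  unfolding known_def by metis

text \<open>If \<open>s\<close> and some neighbour \<open>n\<close> both avoid \<open>m\<close>, any
  further neighbour of \<open>s\<close> forms with them a triangle or an induced \<open>P3\<close>,
  and must supply the colour \<open>m\<close> itself.\<close>

lemma known_nbrs: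
  assumes adm: "adm \<Phi>" and lc: "lc (opt N) \<Phi>" and s: "\<And>X f. \<Phi> X f ==> proper (insert s X) f \<and> restr E m (insert s X) f \<and> f s = k"
  shows "\<exists>\<Psi>. adm \<Psi> \<and> lc N \<Psi> \<and> (\<forall>X f. \<Psi> X f --> \<Phi> X f) \<and> (\<forall>v. E s v --> known \<Psi> m v)"
proof (cases "k = m")
  case True
  have "f v \<noteq> m" if "\<Phi> X f" "v \<in> X" "E s v" for X f v
    using s[OF that(1)] that(2,3) True unfolding proper_def by (metis insertCI)
  then have "\<forall>v. E s v --> known \<Phi> m v" unfolding known_def by metis
  then show ?thesis using adm lc_mono[OF lc opt_ge] by (intro exI[of _ \<Phi>] conjI) simp_all
next
  case False
  show ?thesis
  proof (rule option_vertex[OF adm lc, of "\<lambda>v c. E s v --> c = m"])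
    let ?\<Psi> = "\<lambda>X f. \<Phi> X f \<and> (\<forall>x\<in>X. E s x --> f x = m)"
    assume l: "lc N ?\<Psi>"
    have "\<forall>v. E s v --> known ?\<Psi> m v" unfolding known_def by simp
    then show ?thesis using adm_pt[OF adm, of "\<lambda>v c. E s v --> c = m"] l by (intro exI[of _ ?\<Psi>] conjI) simp_all
  next
    fix n c assume nV: "n \<in> V" and "\<not> (E s n --> c = m)" and l: "lc N (fx \<Phi> {n} (\<lambda>_. c))"
    then have n: "E s n" "c \<noteq> m" by simp_all
    let ?\<Psi> = "fx \<Phi> {n} (\<lambda>_. c)"
    have P: "\<Phi> (insert n X) f" "f n = c" if "?\<Psi> X f" for X f using fx_dest[OF that] by simp_all
    have "known ?\<Psi> m v" if v: "E s v" for v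
    proof (cases "v = n")
      case True
      have "f v \<noteq> m" if h: "?\<Psi> X f" for X f using P(2)[OF h] n(2) True by simp
      then show ?thesis unfolding known_def by simp
    next
      case vn: False
      have "f v = m" if h: "?\<Psi> X f" "v \<in> X" for X f
      proof (rule ccontr)
        assume ne: "f v \<noteq> m"
        let ?X = "insert s (insert n X)"
        note q = s[OF P(1)[OF h(1)]]
        have i: "v \<in> ?X" "s \<in> ?X" "n \<in> ?X" using h(2) by simp_all
        have pr: "f v \<noteq> f s" "f s \<noteq> f n" "E v n ==> f v \<noteq> f n"
          using q i v n(1) symE[OF v] unfolding proper_def by blast+
        show False
        proof (cases "E v n")
          case True
          then show False using pr q P(2)[OF h(1)] n(2) False ne third_col[of "f v" "f s" "f n" m] by metis
        next
          case nvn: False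
          have "indP3 E v s n" unfolding indP3_def using vn symE[OF v] n(1) nvn by simp
          then have "f v = m \<or> f s = m \<or> f n = m" using q i unfolding restr_def by blast
          then show False using ne q False P(2)[OF h(1)] n(2) by simp
        qed
      qed
      then show ?thesis unfolding known_def by simp
    qed
    moreover have "\<Phi> X f" if "?\<Psi> X f" for X f by (rule admD[OF adm P(1)[OF that]]) blast
    ultimately show ?thesis using adm_fx[OF adm, of "{n}" "\<lambda>_. c"] l by (intro exI[of _ ?\<Psi>] conjI) simp_all
  qed
qed

lemma fx_fx:
  assumes "lc N (fx (fx \<Phi> S \<sigma>) T \<tau>)"
  shows "lc N (fx \<Phi> (S \<union> T) (\<lambda>x. if x \<in> S then \<sigma> x else \<tau> x))" "\<And>x. x \<in> S ==> x \<in> T ==> \<sigma> x = \<tau> x"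
proof -
  have d: "\<Phi> (X \<union> (S \<union> T)) f \<and> (\<forall>s\<in>S. f s = \<sigma> s) \<and> (\<forall>s\<in>T. f s = \<tau> s)" if "fx (fx \<Phi> S \<sigma>) T \<tau> X f" for X f
    using that unfolding fx_def by (simp add: Un_ac)
  show "lc N (fx \<Phi> (S \<union> T) (\<lambda>x. if x \<in> S then \<sigma> x else \<tau> x))"
    unfolding lc_def
  proof (intro allI impI)
    fix X assume "X \<subseteq> V" "card X \<le> N"
    from lcD[OF assms this] obtain f where f: "fx (fx \<Phi> S \<sigma>) T \<tau> X f" by (elim exE)
    show "\<exists>f. fx \<Phi> (S \<union> T) (\<lambda>x. if x \<in> S then \<sigma> x else \<tau> x) X f"
      by (intro exI[of _ f]) (use d[OF f] in \<open>auto simp: fx_def\<close>)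
  qed
  fix x assume x: "x \<in> S" "x \<in> T"
  obtain f where "fx (fx \<Phi> S \<sigma>) T \<tau> {} f" using lcD[OF assms, of "{}"] by auto
  from d[OF this] show "\<sigma> x = \<tau> x" using x by metis
qed

end

locale p33graph = fgraph +
  fixes N0 :: nat
  assumes p33: "p33free E" and deg: "v \<in> V ==> 3 \<le> card {u. E v u}"
    and helped: "adm \<Phi> ==> helpers 17 V E \<Phi> h S ==> lc N0 \<Phi> ==> two_lists \<Phi> ==> \<exists>f. proper V f"
begin

lemma P3_P3: "indP3 E a b c ==> indP3 E a' b' c' ==> \<exists>x\<in>{a, b, c}. \<exists>y\<in>{a', b', c'}. E x y"
  using p33 unfolding p33free_def by blast

lemma nbV: "{u. E v u} \<subseteq> V"
  using EV symE by blast

lemma finN: "finite {u. E v u}"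
  by (rule finite_subset[OF nbV finV])

text \<open>Fix the colours of an induced \<open>P3\<close> and settle its three neighbourhoods by
  \<open>known_nbrs\<close>, one \<open>opt\<close> each. Vertices still undecided about
  \<open>m\<close> are then anticomplete to this \<open>P3\<close>, hence induce no
  \<open>P3\<close>, and \<open>restricted_finish\<close> applies. Minimum degree three is what
  provides a \<open>P3\<close>: without one, a vertex and its neighbours would contain a
  four-clique.\<close>

lemma restricted:
  assumes lc: "lc (3 + 3 ^ 3 * opt (opt (opt 12))) (\<lambda>X f. proper X f \<and> restr E m X f)"
  shows "\<exists>f. proper V f"
proof (cases "V = {}")
  case True
  then show ?thesis unfolding proper_def by simp
next
  case False
  let ?\<Phi> = "\<lambda>X f. proper X f \<and> restr E m X f"
  obtain v where v: "v \<in> V" using False by blast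
  obtain a b c where P: "indP3 E a b c"
  proof (rule ccontr)
    assume "\<not> thesis"
    then have no: "\<not> indP3 E a b c" for a b c using that by blast
    let ?K = "insert v {u. E v u}"
    have cl: "E x y" if "x \<in> ?K" "y \<in> ?K" "x \<noteq> y" for x y
    proof (cases "x = v \<or> y = v")
      case True then show ?thesis using that symE by blast
    next
      case False
      then show ?thesis using that no[of x v y] symE unfolding indP3_def by blast
    qed
    have "card ?K \<le> 3"
    proof (rule clique_small[OF adm_restr lc_mono[OF lc] _ cl])
      show "4 \<le> 3 + 3 ^ 3 * opt (opt (opt 12))" using opt_ge[of 12] opt_ge[of "opt 12"] opt_ge[of "opt (opt 12)"] by simp
      show "?K \<subseteq> V" using v nbV by blast
    qed
    moreover have "card ?K = Suc (card {u. E v u})" using finN irrE by (subst card_insert_disjoint) auto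
    ultimately show False using deg[OF v] by simp
  qed
  let ?S = "{a, b, c}"
  have PE: "E a b" "E b c" using P unfolding indP3_def by simp_all
  then have SV: "?S \<subseteq> V" using EV symE by blast
  have c3: "card ?S \<le> 3" by (simp add: card_insert_if)
  from query[OF adm_restr SV c3 lc] obtain \<sigma> where l: "lc (opt (opt (opt 12))) (fx ?\<Phi> ?S \<sigma>)" by (elim exE)
  define \<Phi>1 where "\<Phi>1 = fx ?\<Phi> ?S \<sigma>"
  have adm1: "adm \<Phi>1" unfolding \<Phi>1_def by (rule adm_fx[OF adm_restr])
  have sP: "proper (insert s X) f \<and> restr E m (insert s X) f \<and> f s = \<sigma> s" if h: "\<Phi>1 X f" and s: "s \<in> ?S" for X f s
  proof -
    have "proper (X \<union> ?S) f \<and> restr E m (X \<union> ?S) f" using fxD(1)[OF h[unfolded \<Phi>1_def]] .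
    moreover have "insert s X \<subseteq> X \<union> ?S" using s by blast
    ultimately have "proper (insert s X) f \<and> restr E m (insert s X) f" using admD[OF adm_restr[of m], of "X \<union> ?S" f "insert s X"] by blast
    then show ?thesis using fxD(2)[OF h[unfolded \<Phi>1_def] s] by simp
  qed
  have S: "a \<in> ?S" "b \<in> ?S" "c \<in> ?S" by simp_all
  have "\<exists>\<Psi>. adm \<Psi> \<and> lc (opt (opt 12)) \<Psi> \<and> (\<forall>X f. \<Psi> X f --> \<Phi>1 X f) \<and> (\<forall>v. E a v --> known \<Psi> m v)"
    by (rule known_nbrs[OF adm1 l[folded \<Phi>1_def], of a m "\<sigma> a"]) (erule sP[OF _ S(1)])
  then obtain \<Phi>2 where P2: "adm \<Phi>2" "lc (opt (opt 12)) \<Phi>2" "\<forall>X f. \<Phi>2 X f --> \<Phi>1 X f" "\<forall>v. E a v --> known \<Phi>2 m v" by (elim exE conjE)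
  have "\<exists>\<Psi>. adm \<Psi> \<and> lc (opt 12) \<Psi> \<and> (\<forall>X f. \<Psi> X f --> \<Phi>2 X f) \<and> (\<forall>v. E b v --> known \<Psi> m v)"
    by (rule known_nbrs[OF P2(1,2), of b m "\<sigma> b"]) (erule sP[OF P2(3)[rule_format] S(2)])
  then obtain \<Phi>3 where P3: "adm \<Phi>3" "lc (opt 12) \<Phi>3" "\<forall>X f. \<Phi>3 X f --> \<Phi>2 X f" "\<forall>v. E b v --> known \<Phi>3 m v" by (elim exE conjE)
  have "\<exists>\<Psi>. adm \<Psi> \<and> lc (12) \<Psi> \<and> (\<forall>X f. \<Psi> X f --> \<Phi>3 X f) \<and> (\<forall>v. E c v --> known \<Psi> m v)"
    by (rule known_nbrs[OF P3(1,2), of c m "\<sigma> c"]) (erule sP[OF P2(3)[rule_format, OF P3(3)[rule_format]] S(3)])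
  then obtain \<Phi>4 where P4: "adm \<Phi>4" "lc 12 \<Phi>4" "\<forall>X f. \<Phi>4 X f --> \<Phi>3 X f" "\<forall>v. E c v --> known \<Phi>4 m v" by (elim exE conjE)
  have P41: "\<Phi>1 X f" if "\<Phi>4 X f" for X f using P2(3) P3(3) P4(3) that by blast
  have P42: "proper X f \<and> restr E m X f" if "\<Phi>4 X f" for X f
    using admD[OF adm_restr[of m], of "insert a X" f X] sP[OF P41[OF that] S(1)] by blast
  have kn: "known \<Phi>4 m v" if v: "v \<in> ?S \<or> (\<exists>s\<in>?S. E s v)" for v
  proof -
    consider "v \<in> ?S" | "E a v" | "E b v" | "E c v" using v by blast
    then show ?thesis
    proof cases
      case 1
      have "f v = \<sigma> v" if "\<Phi>4 X f" for X f using sP[OF P41[OF that] 1] by simp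
      then show ?thesis unfolding known_def by metis
    next
      case 2
      then have "known \<Phi>2 m v" using P2(4) by simp
      then show ?thesis by (rule known_mono) (use P3(3) P4(3) in blast)
    next
      case 3
      then have "known \<Phi>3 m v" using P3(4) by simp
      then show ?thesis by (rule known_mono) (use P4(3) in blast)
    next
      case 4 then show ?thesis using P4(4) by simp
    qed
  qed
  define A where "A = {v \<in> V. \<forall>X f. \<Phi>4 X f --> v \<in> X --> f v = m}"
  define B where "B = {v \<in> V. \<forall>X f. \<Phi>4 X f --> v \<in> X --> f v \<noteq> m}"
  define U where "U = V - A - B"
  have UU: "u \<notin> ?S \<and> (\<forall>s\<in>?S. \<not> E s u)" if "u \<in> U" for u
    using kn[of u] that unfolding U_def A_def B_def known_def by blast
  show ?thesis
  proof (rule restricted_finish[OF P4(1,2), of A B U m])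
    fix x y z assume xyz: "x \<in> U" "y \<in> U" "z \<in> U"
    show "\<not> indP3 E x y z"
    proof
      assume "indP3 E x y z"
      from P3_P3[OF P this] show False using UU[OF xyz(1)] UU[OF xyz(2)] UU[OF xyz(3)] by blast
    qed
  next
    fix X f x y z assume h: "\<Phi>4 X f" "x \<in> X" "y \<in> X" "z \<in> X" "indP3 E x y z"
    then show "f x = m \<or> f y = m \<or> f z = m" using P42[OF h(1)] unfolding restr_def by blast
  next
    fix X f v assume "\<Phi>4 X f" "v \<in> X" "v \<in> A" then show "f v = m" unfolding A_def by simp
  next
    fix X f v assume "\<Phi>4 X f" "v \<in> X" "v \<in> B" then show "f v \<noteq> m" unfolding B_def by simp
  qed (auto simp: U_def A_def B_def)
qed

definition sd :: "'a set => ('a => col) => nat => bool" where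
  "sd S \<sigma> N \<longleftrightarrow> S \<subseteq> V \<and> lc N (fx proper S \<sigma>)"

text \<open>By \<open>2P3\<close>-freeness, such a \<open>P3\<close> makes the set of vertices
  outside \<open>S\<close> that see no colour but \<open>m\<close> on \<open>S\<close> free of
  induced \<open>P3\<close>s.\<close>

definition hasP :: "col => 'a set => ('a => col) => bool" where
  "hasP m S \<sigma> \<longleftrightarrow> (\<exists>a\<in>S. \<exists>b\<in>S. \<exists>c\<in>S. indP3 E a b c \<and> \<sigma> a \<noteq> m \<and> \<sigma> b \<noteq> m \<and> \<sigma> c \<noteq> m)"

definition extends :: "'a set => ('a => col) => 'a set => ('a => col) => bool" where
  "extends S \<sigma> S' \<sigma>' \<longleftrightarrow> S \<subseteq> S' \<and> (\<forall>s\<in>S. \<sigma>' s = \<sigma> s)"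

lemma hasP_extends: "hasP m S \<sigma> ==> extends S \<sigma> S' \<sigma>' ==> hasP m S' \<sigma>'"
  unfolding hasP_def extends_def by (metis subset_iff)

lemma extends_trans: "extends S \<sigma> S' \<sigma>' ==> extends S' \<sigma>' S'' \<sigma>'' ==> extends S \<sigma> S'' \<sigma>''"
  unfolding extends_def by (metis subset_iff)

text \<open>If \<open>restr\<close> could be imposed for \<open>m\<close>, the graph would be
  colourable by \<open>restricted\<close>. So an induced \<open>P3\<close> avoiding \<open>m\<close>
  can be fixed.\<close>

lemma add_seed:
  assumes sd: "sd S \<sigma> (opt N)" and N: "3 + 3 ^ 3 * opt (opt (opt 12)) \<le> N" and nc: "\<nexists>f. proper V f"
  shows "\<exists>S' \<sigma>'. extends S \<sigma> S' \<sigma>' \<and> card S' \<le> card S + 3 \<and> sd S' \<sigma>' N \<and> hasP m S' \<sigma>'"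
proof -
  have SV: "S \<subseteq> V" and l: "lc (N + 3 ^ N * N) (fx proper S \<sigma>)" using sd unfolding sd_def opt_def by simp_all
  have "lc N (\<lambda>X f. fx proper S \<sigma> X f \<and> restr E m X f) \<or>
    (\<exists>X \<tau>. X \<subseteq> V \<and> card X \<le> N \<and> \<not> restr E m X \<tau> \<and> lc N (fx (fx proper S \<sigma>) X \<tau>))"
    by (rule option_gen[OF adm_fx[OF adm_proper_self] l]) (simp add: restr_def)
  then show ?thesis
  proof (elim disjE exE conjE)
    assume l1: "lc N (\<lambda>X f. fx proper S \<sigma> X f \<and> restr E m X f)"
    have "lc N (\<lambda>X f. proper X f \<and> restr E m X f)"
      unfolding lc_def
    proof (intro allI impI)
      fix X assume "X \<subseteq> V" "card X \<le> N"
      from lcD[OF l1 this] obtain f where f: "fx proper S \<sigma> X f" "restr E m X f" by (elim exE conjE)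
      have "proper X f" by (rule admD[OF adm_proper_self fxD(1)[OF f(1)]]) simp
      then show "\<exists>f. proper X f \<and> restr E m X f" using f(2) by blast
    qed
    from restricted[OF lc_mono[OF this N]] show ?thesis using nc by blast
  next
    fix X \<tau> assume X: "X \<subseteq> V" "\<not> restr E m X \<tau>" and l2: "lc N (fx (fx proper S \<sigma>) X \<tau>)"
    obtain a b c where abc: "a \<in> X" "b \<in> X" "c \<in> X" "indP3 E a b c" "\<tau> a \<noteq> m" "\<tau> b \<noteq> m" "\<tau> c \<noteq> m"
      using X(2) unfolding restr_def by blast
    let ?T = "{a, b, c}" and ?\<sigma> = "\<lambda>x. if x \<in> S then \<sigma> x else \<tau> x"
    have "lc N (fx (fx proper S \<sigma>) ?T \<tau>)" by (rule fx_mono[OF adm_fx[OF adm_proper_self] l2]) (use abc in blast)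
    note f = fx_fx[OF this]
    have s: "?\<sigma> x = \<tau> x" if "x \<in> ?T" for x using f(2)[of x] that by simp
    have "extends S \<sigma> (S \<union> ?T) ?\<sigma>" unfolding extends_def by auto
    moreover have "card ?T \<le> 3" by (simp add: card_insert_if)
    then have "card (S \<union> ?T) \<le> card S + 3" using card_Un_le[of S ?T] by linarith
    moreover have "sd (S \<union> ?T) ?\<sigma> N" unfolding sd_def using f(1) SV abc(1-3) X(1) by blast
    moreover have "hasP m (S \<union> ?T) ?\<sigma>"
      unfolding hasP_def by (rule bexI[of _ a], rule bexI[of _ b], rule bexI[of _ c]) (use abc s in simp_all)
    ultimately show ?thesis by (intro exI[of _ "S \<union> ?T"] exI[of _ ?\<sigma>] conjI)
  qed
qed

definition sc :: "'a set => ('a => col) => 'a => col set" where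
  "sc S \<sigma> x = \<sigma> ` {s \<in> S. E x s}"

text \<open>The configuration in which nothing near \<open>u\<close> is forced at first:
  \<open>u\<close> sees no seed, and each of its three neighbours loses a different single
  colour.\<close>

definition tri :: "'a set => ('a => col) => 'a => (col => 'a) => bool" where
  "tri S \<sigma> u z \<longleftrightarrow> u \<in> V - S \<and> sc S \<sigma> u = {} \<and> (\<forall>x. E u x \<longleftrightarrow> x \<in> range z) \<and> (\<forall>m. z m \<in> V - S \<and> sc S \<sigma> (z m) = {m})"

text \<open>A remedy for \<open>tri\<close>, relative to one colour \<open>c\<close>: it makes two
  of the three neighbours of \<open>u\<close> adjacent. Having it for two colours gives two such
  edges, and these force a neighbour of \<open>u\<close> by \<open>two_edges_force\<close>.\<close>

definition Adj :: "'a set => ('a => col) => col => bool" where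
  "Adj S \<sigma> c \<longleftrightarrow> (\<forall>v x y k l. v \<in> V - S --> sc S \<sigma> v = {} --> x \<in> V - S --> y \<in> V - S --> E v x --> E v y --> x \<noteq> y -->
    sc S \<sigma> x \<subseteq> {k} --> sc S \<sigma> y \<subseteq> {l} --> k \<noteq> c --> l \<noteq> c --> k \<noteq> l --> E x y)"

lemma sc_extends: "extends S \<sigma> S' \<sigma>' ==> sc S \<sigma> x \<subseteq> sc S' \<sigma>' x"
  unfolding sc_def extends_def by force

lemma Adj_extends:
  assumes A: "Adj S \<sigma> c" and e: "extends S \<sigma> S' \<sigma>'"
  shows "Adj S' \<sigma>' c"
  unfolding Adj_def
proof (intro allI impI)
  fix v x y k l
  assume h: "v \<in> V - S'" "sc S' \<sigma>' v = {}" "x \<in> V - S'" "y \<in> V - S'" "E v x" "E v y" "x \<noteq> y"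
    "sc S' \<sigma>' x \<subseteq> {k}" "sc S' \<sigma>' y \<subseteq> {l}" "k \<noteq> c" "l \<noteq> c" "k \<noteq> l"
  have S: "S \<subseteq> S'" using e unfolding extends_def by simp
  have "v \<in> V - S" "x \<in> V - S" "y \<in> V - S" using h(1,3,4) S by blast+
  moreover have "sc S \<sigma> v = {}" "sc S \<sigma> x \<subseteq> {k}" "sc S \<sigma> y \<subseteq> {l}" using sc_extends[OF e] h(2,8,9) by blast+
  ultimately show "E x y" using A h(5-7,10-12) unfolding Adj_def by blast
qed

text \<open>Colour \<open>u\<close> and its neighbours, and let \<open>\<gamma>\<close> be the
  colour of \<open>u\<close>. Then \<open>z \<gamma>\<close> and \<open>z d\<close>, for
  \<open>d\<close> the third colour, share the colour \<open>c\<close>, so they are non-adjacent and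
  form an induced \<open>P3\<close> with \<open>u\<close>. This shows that \<open>Adj\<close> failed
  for \<open>c\<close> before; and a failure afterwards would be a \<open>P3\<close> anticomplete to
  this one, since all neighbours of \<open>u\<close> are now seeds.\<close>

lemma query_tri:
  assumes sd: "sd S \<sigma> (4 + 3 ^ 4 * N)" and t: "tri S \<sigma> u z"
  shows "\<exists>S' \<sigma>' c. extends S \<sigma> S' \<sigma>' \<and> card S' \<le> card S + 4 \<and> sd S' \<sigma>' N \<and> Adj S' \<sigma>' c \<and> \<not> Adj S \<sigma> c"
proof -
  have SV: "S \<subseteq> V" and l: "lc (4 + 3 ^ 4 * N) (fx proper S \<sigma>)" using sd unfolding sd_def by simp_all
  have u: "u \<in> V - S" "sc S \<sigma> u = {}" and Nu: "E u x \<longleftrightarrow> x \<in> range z" and z: "z m \<in> V - S" "sc S \<sigma> (z m) = {m}" for x m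
    using t unfolding tri_def by simp_all
  have Ez: "E u (z m)" for m using Nu by blast
  let ?T = "{u, z CA, z CB, z CC}"
  have zT: "z m \<in> ?T" for m by (cases m) simp_all
  have T: "?T \<subseteq> V" "card ?T \<le> 4" using u z by (auto simp: card_insert_if)
  from query[OF adm_fx[OF adm_proper_self] T l] obtain \<tau> where lt: "lc N (fx (fx proper S \<sigma>) ?T \<tau>)" by (elim exE)
  let ?S = "S \<union> ?T"
  define \<sigma>' where "\<sigma>' = (\<lambda>x. if x \<in> S then \<sigma> x else \<tau> x)"
  have l': "lc N (fx proper ?S \<sigma>')" unfolding \<sigma>'_def by (rule fx_fx(1)[OF lt])
  obtain f where f: "fx proper ?S \<sigma>' {} f" using lcD[OF l', of "{}"] by auto
  have pr: "\<sigma>' x \<noteq> \<sigma>' y" if "x \<in> ?S" "y \<in> ?S" "E x y" for x y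
  proof -
    have "f x \<noteq> f y" by (rule adm_proper[OF adm_proper_self fxD(1)[OF f] _ _ that(3)]) (use that in blast)+
    then show ?thesis using fxD(2)[OF f] that(1,2) by simp
  qed
  have ext: "extends S \<sigma> ?S \<sigma>'" unfolding extends_def \<sigma>'_def by auto
  define \<gamma> where "\<gamma> = \<sigma>' u"
  define c where "c = \<sigma>' (z \<gamma>)"
  define d where "d = oth \<gamma> c"
  have zS: "z m \<in> ?S" "u \<in> ?S" for m using zT by blast+
  have zm: "\<sigma>' (z m) \<noteq> m" for m
  proof -
    have "m \<in> sc S \<sigma> (z m)" using z by simp
    then obtain s where s: "s \<in> S" "E (z m) s" "\<sigma> s = m" unfolding sc_def by blast
    have "\<sigma>' s = m" using s unfolding \<sigma>'_def by simp
    then show ?thesis using pr[OF zS(1) _ s(2)] s(1) by auto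
  qed
  have zu: "\<sigma>' (z m) \<noteq> \<gamma>" for m using pr[OF zS(2,1) Ez] unfolding \<gamma>_def by metis
  have ne: "c \<noteq> \<gamma>" "d \<noteq> \<gamma>" "d \<noteq> c" using zu oth unfolding c_def d_def by simp_all
  have zd: "\<sigma>' (z d) = c" using col_eqI[of "\<sigma>' (z d)" d \<gamma> c] zm[of d] zu[of d] ne by simp
  have nE: "\<not> E (z d) (z \<gamma>)" using pr[OF zS(1) zS(1)] zd c_def by metis
  have zz: "z d \<noteq> z \<gamma>" using z(2)[of d] z(2)[of \<gamma>] ne(2) by auto
  have nA: "\<not> Adj S \<sigma> c"
  proof
    assume A: "Adj S \<sigma> c"
    have "E (z d) (z \<gamma>)"
      by (rule A[unfolded Adj_def, rule_format, OF u z(1) z(1) Ez Ez zz, of d \<gamma>]) (use z(2) ne in auto)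
    then show False using nE by simp
  qed
  have P: "indP3 E (z d) u (z \<gamma>)" unfolding indP3_def using zz nE Ez symE by blast
  have "Adj ?S \<sigma>' c"
    unfolding Adj_def
  proof (intro allI impI, rule ccontr)
    fix v x y k l
    assume h: "v \<in> V - ?S" "sc ?S \<sigma>' v = {}" "x \<in> V - ?S" "y \<in> V - ?S" "E v x" "E v y" "x \<noteq> y"
      "sc ?S \<sigma>' x \<subseteq> {k}" "sc ?S \<sigma>' y \<subseteq> {l}" "k \<noteq> c" "l \<noteq> c" "k \<noteq> l" "\<not> E x y"
    have "indP3 E x v y" unfolding indP3_def using h(5-7,13) symE by blast
    from P3_P3[OF this P] obtain w s where w: "w \<in> {x, v, y}" "s \<in> {z d, u, z \<gamma>}" "E w s" by (elim bexE)
    have sS: "s \<in> ?S" using w(2) zS by blast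
    have in_sc: "\<sigma>' s \<in> sc ?S \<sigma>' w" unfolding sc_def using sS w(3) by blast
    then have "w \<noteq> v" using h(2) by auto
    then have wxy: "w = x \<or> w = y" using w(1) by blast
    have "s \<noteq> u"
    proof
      assume "s = u"
      then have "w \<in> range z" using Nu symE[OF w(3)] by blast
      then have "w \<in> ?S" using zS(1) by blast
      then show False using wxy h(3,4) by blast
    qed
    then have "\<sigma>' s = c" using w(2) zd c_def by auto
    then show False using in_sc wxy h(8-11) by auto
  qed
  moreover have "card ?S \<le> card S + 4" using card_Un_le[of S ?T] T(2) by linarith
  moreover have "sd ?S \<sigma>' N" unfolding sd_def using l' SV T(1) by blast
  ultimately show ?thesis using ext nA by (intro exI[of _ ?S] exI[of _ \<sigma>'] exI[of _ c] conjI)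
qed

text \<open>\<open>a1\<close> and \<open>a2\<close> both avoid the distinct colours
  \<open>a3\<close> and \<open>u\<close>, so they agree, and their common value is neither
  \<open>c1\<close> nor \<open>c2\<close>.\<close>

lemma two_edges_force:
  assumes "c1 \<noteq> c2" "c2 \<noteq> c3" "c1 \<noteq> (c3 :: col)" "a1 \<noteq> c1" "a2 \<noteq> c2" "a3 \<noteq> c3" "a3 \<noteq> a1" "a3 \<noteq> a2" "u \<noteq> a1" "u \<noteq> a2" "u \<noteq> a3"
  shows "a1 = c3"
  using third_col[OF assms(1-3), of a1] third_col[OF assms(1-3), of a2] third_col[OF assms(1-3), of a3] third_col[OF assms(1-3), of u]
    assms by metis

text \<open>The aim is a neighbour of forced colour, a seed or an \<open>fbl\<close> vertex, for
  every vertex that is not itself \<open>fbl\<close>; this gives both two lists and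
  \<open>helpers\<close>. The doubtful vertices see no seed. They lie in all the
  \<open>P3\<close>-free sets \<open>L m\<close>, which arrange their neighbours into cliques of at
  most two vertices per colour; this forces the vertex or a neighbour except under
  \<open>tri\<close>, where the two \<open>Adj\<close> properties do it.\<close>

lemma colour_from_seeds:
  assumes sd: "sd S \<sigma> (N0 * 5 + 4)" and S17: "card S \<le> 17" and hP: "\<And>m. hasP m S \<sigma>"
    and good: "(\<forall>u z. \<not> tri S \<sigma> u z) \<or> (\<exists>c d. c \<noteq> d \<and> Adj S \<sigma> c \<and> Adj S \<sigma> d)"
  shows "\<exists>f. proper V f"
proof -
  have SV: "S \<subseteq> V" and lcS: "lc (N0 * 5 + 4) (fx proper S \<sigma>)" using sd unfolding sd_def by simp_all
  define \<Phi> where "\<Phi> = fx proper S \<sigma>"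
  have adm: "adm \<Phi>" unfolding \<Phi>_def by (rule adm_fx[OF adm_proper_self])
  have lc: "lc (N0 * 5) \<Phi>" "lc 4 \<Phi>" unfolding \<Phi>_def by (rule lc_mono[OF lcS], simp)+
  have fs: "f s = \<sigma> s" if "\<Phi> X f" "s \<in> S" for X f s by (rule fxD(2)[OF that(1)[unfolded \<Phi>_def] that(2)])
  have pr: "f x \<noteq> f y" if "\<Phi> X f" "x \<in> X \<union> S" "y \<in> X \<union> S" "E x y" for X f x y
    by (rule adm_proper[OF adm_proper_self fxD(1)[OF that(1)[unfolded \<Phi>_def]] that(2-4)])
  let ?sc = "sc S \<sigma>"
  have scf: "f x \<noteq> k" if h: "\<Phi> X f" "x \<in> X" "k \<in> ?sc x" for X f x k
  proof -
    obtain s where s: "s \<in> S" "E x s" "\<sigma> s = k" using h(3) unfolding sc_def by blast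
    have "f x \<noteq> f s" by (rule pr[OF h(1) _ _ s(2)]) (use h(2) s(1) in simp_all)
    then show ?thesis using fs[OF h(1) s(1)] s(3) by simp
  qed
  define L where "L m = {x \<in> V - S. ?sc x \<subseteq> {m}}" for m
  have LP3: "\<not> indP3 E x y w" if xyw: "x \<in> L m" "y \<in> L m" "w \<in> L m" for m x y w
  proof
    assume P: "indP3 E x y w"
    obtain a b c where abc: "a \<in> S" "b \<in> S" "c \<in> S" "indP3 E a b c" "\<sigma> a \<noteq> m" "\<sigma> b \<noteq> m" "\<sigma> c \<noteq> m"
      using hP[of m] unfolding hasP_def by (elim bexE conjE)
    from P3_P3[OF P abc(4)] obtain v s where v: "v \<in> {x, y, w}" "s \<in> {a, b, c}" "E v s" by (elim bexE)
    have "\<sigma> s \<in> ?sc v" "\<sigma> s \<noteq> m" using v(2,3) abc unfolding sc_def by auto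
    moreover have "?sc v \<subseteq> {m}" using v(1) xyw unfolding L_def by blast
    ultimately show False by blast
  qed
  have Ladj: "E x y" if "v \<in> L m" "x \<in> L m" "y \<in> L m" "E v x" "E v y" "x \<noteq> y" for v x y m
    using LP3[OF that(2,1,3)] that(4-6) symE unfolding indP3_def by blast
  have L2: "card {x \<in> L m. E v x} \<le> 2" if v: "v \<in> L m" for v m
  proof -
    let ?K = "insert v {x \<in> L m. E v x}"
    have "card ?K \<le> 3"
    proof (rule clique_small[OF adm lc(2)])
      show "?K \<subseteq> V" using v unfolding L_def by blast
      show "E x y" if "x \<in> ?K" "y \<in> ?K" "x \<noteq> y" for x y
        using that Ladj[OF v, of x y] symE by blast
    qed
    moreover have "finite {x \<in> L m. E v x}" by (rule finite_subset[OF _ finN[of v]]) blast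
    then have "card ?K = Suc (card {x \<in> L m. E v x})" using irrE by (subst card_insert_disjoint) auto
    ultimately show ?thesis by simp
  qed
  \<comment> \<open>Forced as soon as three suitable further vertices are coloured; the
    configurations in \<open>nbr\<close> never need more.\<close>
  define fbl where "fbl x \<longleftrightarrow> (\<exists>k Y. Y \<subseteq> V \<and> card Y \<le> 3 \<and> (\<forall>f. \<Phi> (insert x Y) f --> f x = k))" for x
  have fblI: "fbl x" if "Y \<subseteq> V" "card Y \<le> 3" "\<And>f. \<Phi> (insert x Y) f ==> f x = k" for x Y k
    unfolding fbl_def using that by (intro exI[of _ k] exI[of _ Y] conjI allI impI)
  have fS: "fbl s" if "s \<in> S" for s by (rule fblI[of "{}" s "\<sigma> s"]) (use fs that in simp_all)
  have inL: "\<exists>m. x \<in> L m" if x: "x \<in> V" "\<not> fbl x" for x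
  proof (rule ccontr)
    assume n: "\<not> ?thesis"
    have xS: "x \<notin> S" using fS x(2) by blast
    then have "\<not> ?sc x \<subseteq> {m}" for m using n x(1) unfolding L_def by blast
    then obtain i j where ij: "i \<in> ?sc x" "j \<in> ?sc x" "i \<noteq> j" by blast
    have "fbl x"
    proof (rule fblI[of "{}" x "oth i j"])
      fix f assume f: "\<Phi> (insert x {}) f"
      have "f x \<noteq> i" "f x \<noteq> j" using scf[OF f _ ij(1)] scf[OF f _ ij(2)] by simp_all
      then show "f x = oth i j" using col_eqI[of "f x" i j "oth i j"] oth[of i j] ij(3) by blast
    qed simp_all
    then show False using x(2) by simp
  qed
  have nbr: "\<exists>y. E u y \<and> fbl y" if u: "u \<in> V" "u \<notin> S" "?sc u = {}" "\<not> fbl u" for u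
  proof (rule ccontr)
    assume "\<nexists>y. E u y \<and> fbl y"
    then have nf: "\<not> fbl y" if "E u y" for y using that by blast
    let ?N = "{x. E u x}"
    have uL: "u \<in> L m" for m using u unfolding L_def by simp
    have NV: "x \<in> V" if "E u x" for x using EV[OF symE[OF that]] .
    have NL: "\<exists>m. x \<in> L m" if "E u x" for x by (rule inL[OF NV[OF that] nf[OF that]])
    have N3: "3 \<le> card ?N" by (rule deg[OF u(1)])
    show False
    proof (cases "\<exists>u'. E u u' \<and> ?sc u' = {}")
      case True
      then obtain u' where u': "E u u'" "?sc u' = {}" by (elim exE conjE)
      have u'L: "u' \<in> L m" for m using NL[OF u'(1)] u'(2) unfolding L_def by simp
      have "2 \<le> card (?N - {u'})" using N3 finN[of u] u'(1) by simp
      then obtain Y where Y: "Y \<subseteq> ?N - {u'}" "card Y = 2" by (rule obtain_subset_with_card_n)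
      then obtain x y where xy: "E u x" "E u y" "x \<noteq> u'" "y \<noteq> u'" "x \<noteq> y" unfolding card_2_iff by blast
      obtain i j where i: "x \<in> L i" and j: "y \<in> L j" using NL[OF xy(1)] NL[OF xy(2)] by (elim exE)
      have e: "E u' x" "E u' y"
        using Ladj[OF uL u'L i u'(1) xy(1)] Ladj[OF uL u'L j u'(1) xy(2)] xy(3,4) by blast+
      have nsame: False if "x \<in> L m" "y \<in> L m" for m
      proof -
        have "{u', x, y} \<subseteq> {w \<in> L m. E u w}" using that u'L u'(1) xy by blast
        then have "card {u', x, y} \<le> card {w \<in> L m. E u w}"
          by (rule card_mono[rotated]) (rule finite_subset[OF _ finN[of u]], blast)
        moreover have "card {u', x, y} = 3" using xy by simp
        ultimately show False using L2[OF uL, of m] by simp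
      qed
      have ne: "i \<noteq> j" using nsame i j by blast
      have "?sc x \<noteq> {}" using nsame[OF _ j] i unfolding L_def by blast
      then have xi: "i \<in> ?sc x" using i unfolding L_def by blast
      have "?sc y \<noteq> {}" using nsame[OF i] j unfolding L_def by blast
      then have yj: "j \<in> ?sc y" using j unfolding L_def by blast
      \<comment> \<open>\<open>x\<close> and \<open>y\<close> both see the adjacent vertices
        \<open>u\<close> and \<open>u'\<close>, so they have the same colour, which is neither
        \<open>i\<close> nor \<open>j\<close>.\<close>
      have "fbl x"
      proof (rule fblI[of "{u, u', y}" x "oth i j"])
        show "{u, u', y} \<subseteq> V" using u(1) NV[OF u'(1)] NV[OF xy(2)] by blast
        show "card {u, u', y} \<le> 3" by (simp add: card_insert_if)
        fix f assume f: "\<Phi> (insert x {u, u', y}) f"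
        note q = pr[OF f]
        have "f u \<noteq> f u'" "f x \<noteq> f u" "f x \<noteq> f u'" "f y \<noteq> f u" "f y \<noteq> f u'"
          using q[of u u'] q[of u x] q[of u' x] q[of u y] q[of u' y] u'(1) xy(1,2) e by auto
        then have "f x = f y" using col_eqI[of "f x" "f u" "f u'" "f y"] by blast
        moreover have "f x \<noteq> i" "f y \<noteq> j" using scf[OF f _ xi] scf[OF f _ yj] by simp_all
        ultimately show "f x = oth i j" using col_eqI[of "f x" i j "oth i j"] oth[of i j] ne by auto
      qed
      then show False using nf[OF xy(1)] by simp
    next
      case False
      then have scne: "?sc x \<noteq> {}" if "E u x" for x using that by blast
      have scm: "?sc x = {m}" if "E u x" "x \<in> L m" for x m using scne[OF that(1)] that(2) unfolding L_def by blast
      have uniq: "x = y" if h: "E u x" "E u y" "x \<in> L m" "y \<in> L m" for x y m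
      proof (rule ccontr)
        assume xy: "x \<noteq> y"
        have e: "E x y" by (rule Ladj[OF uL h(3,4,1,2) xy])
        have "fbl u"
        proof (rule fblI[of "{x, y}" u m])
          show "{x, y} \<subseteq> V" using NV h(1,2) by blast
          show "card {x, y} \<le> 3" by (simp add: card_insert_if)
          fix f assume f: "\<Phi> (insert u {x, y}) f"
          have "f x \<noteq> m" "f y \<noteq> m" using scf[OF f, of x m] scf[OF f, of y m] scm[OF h(1,3)] scm[OF h(2,4)] by simp_all
          moreover have "f x \<noteq> f y" "f u \<noteq> f x" "f u \<noteq> f y" using pr[OF f, of x y] pr[OF f, of u x] pr[OF f, of u y] e h(1,2) by simp_all
          ultimately show "f u = m" using third_col[of "f x" "f y" "f u" m] by metis
        qed
        then show False using u(4) by simp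
      qed
      define mm where "mm x = (SOME m. x \<in> L m)" for x
      have mm: "x \<in> L (mm x)" if "E u x" for x unfolding mm_def by (rule someI_ex[OF NL[OF that]])
      \<comment> \<open>By \<open>uniq\<close> the neighbours of \<open>u\<close> belong to
        different colours. As there are at least three of them, each colour occurs exactly once,
        which is the situation \<open>tri\<close>.\<close>
      have inj: "inj_on mm ?N"
      proof (rule inj_onI)
        fix x y assume xy: "x \<in> ?N" "y \<in> ?N" "mm x = mm y"
        then have "E u x" "E u y" by simp_all
        then show "x = y" using uniq[OF _ _ mm[of x], of y] mm[of y] xy(3) by simp
      qed
      have "card (mm ` ?N) = card ?N" by (rule card_image[OF inj])
      then have "card (UNIV :: col set) \<le> card (mm ` ?N)" using N3 by simp
      then have surj: "mm ` ?N = UNIV" by (intro card_seteq) auto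
      define z where "z m = (SOME x. E u x \<and> x \<in> L m)" for m
      have z: "E u (z m)" "z m \<in> L m" for m
      proof -
        have "m \<in> mm ` ?N" using surj by simp
        then obtain x where "E u x" "mm x = m" by auto
        then have "\<exists>x. E u x \<and> x \<in> L m" using mm by blast
        from someI_ex[OF this] show "E u (z m)" "z m \<in> L m" unfolding z_def by simp_all
      qed
      have "E u x \<longleftrightarrow> x \<in> range z" for x
      proof
        assume x: "E u x"
        have "x = z (mm x)" by (rule uniq[OF x z(1) mm[OF x] z(2)])
        then show "x \<in> range z" by blast
      qed (use z in blast)
      moreover have "z m \<in> V - S \<and> ?sc (z m) = {m}" for m using scm[OF z] z(2)[of m] unfolding L_def by simp
      ultimately have t: "tri S \<sigma> u z" unfolding tri_def using u by simp
      then obtain c1 c2 where c: "c1 \<noteq> c2" "Adj S \<sigma> c1" "Adj S \<sigma> c2" using good by blast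
      define c3 where "c3 = oth c1 c2"
      have c3: "c2 \<noteq> c3" "c1 \<noteq> c3" using oth[of c1 c2] unfolding c3_def by metis+
      have zV: "z m \<in> V - S" "?sc (z m) = {m}" for m using t unfolding tri_def by simp_all
      have zne: "z k \<noteq> z l" if "k \<noteq> l" for k l using zV(2)[of k] zV(2)[of l] that by auto
      have uVS: "u \<in> V - S" using u by simp
      have adj: "E (z k) (z l)" if "Adj S \<sigma> d" "k \<noteq> d" "l \<noteq> d" "k \<noteq> l" for d k l
        by (rule that(1)[unfolded Adj_def, rule_format, OF uVS u(3) zV(1) zV(1) z(1) z(1) zne[OF that(4)], of k l]) (use zV(2) that in auto)
      have e: "E (z c3) (z c2)" "E (z c3) (z c1)" using adj[OF c(2), of c3 c2] adj[OF c(3), of c3 c1] c(1) c3 by metis+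
      have "fbl (z c1)"
      proof (rule fblI[of "{u, z c2, z c3}" "z c1" c3])
        show "{u, z c2, z c3} \<subseteq> V" using u(1) zV(1) by blast
        show "card {u, z c2, z c3} \<le> 3" by (simp add: card_insert_if)
        fix f assume f: "\<Phi> (insert (z c1) {u, z c2, z c3}) f"
        have zc: "f (z m) \<noteq> m" if "m = c1 \<or> m = c2 \<or> m = c3" for m using scf[OF f, of "z m" m] zV(2)[of m] that by auto
        show "f (z c1) = c3"
          by (rule two_edges_force[OF c(1) c3, of "f (z c1)" "f (z c2)" "f (z c3)" "f u"])
            (use zc pr[OF f, of "z c3" "z c1"] pr[OF f, of "z c3" "z c2"] pr[OF f, of u "z c1"] pr[OF f, of u "z c2"] pr[OF f, of u "z c3"] e z(1) in simp_all)
      qed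
      then show False using nf[OF z(1)] by simp
    qed
  qed
  define Y where "Y x = (SOME Y. Y \<subseteq> V \<and> card Y \<le> 3 \<and> (\<exists>k. \<forall>f. \<Phi> (insert x Y) f --> f x = k))" for x
  have Y: "Y x \<subseteq> V" "card (Y x) \<le> 3" "\<exists>k. \<forall>f. \<Phi> (insert x (Y x)) f --> f x = k" if "fbl x" for x
  proof -
    have "\<exists>Y. Y \<subseteq> V \<and> card Y \<le> 3 \<and> (\<exists>k. \<forall>f. \<Phi> (insert x Y) f --> f x = k)" using that unfolding fbl_def by (elim exE conjE) (intro exI conjI)
    from someI_ex[OF this] show "Y x \<subseteq> V" "card (Y x) \<le> 3" "\<exists>k. \<forall>f. \<Phi> (insert x (Y x)) f --> f x = k" unfolding Y_def by simp_all
  qed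
  define y where "y x = (SOME y. E x y \<and> fbl y)" for x
  have y: "E x (y x)" "fbl (y x)" if "\<exists>y. E x y \<and> fbl y" for x using someI_ex[OF that] unfolding y_def by simp_all
  define D where "D x = (if fbl x then Y x else if \<exists>y. E x y \<and> fbl y then insert (y x) (Y (y x)) else {})" for x
  have DV: "D x \<subseteq> V" "card (D x) \<le> 4" for x
  proof -
    show "D x \<subseteq> V"
    proof (cases "fbl x")
      case True then show ?thesis unfolding D_def using Y(1)[of x] by simp
    next
      case False
      show ?thesis
      proof (cases "\<exists>y. E x y \<and> fbl y")
        case True
        then show ?thesis unfolding D_def using False y[OF True] Y(1)[of "y x"] EV[OF symE[OF y(1)[OF True]]] by simp
      next
        case no: False
        have "D x = {}" unfolding D_def by (simp only: False no if_False)
        then show ?thesis by simp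
      qed
    qed
    show "card (D x) \<le> 4" unfolding D_def using Y(2)[of x] Y(2)[of "y x"] y[of x] card_insert_le_m1[of 4 "Y (y x)" "y x"] by auto
  qed
  have lcD': "lc N0 (cl \<Phi> D)" by (rule closure[OF DV]) (use lc(1) in simp)
  have forced: "forced (cl \<Phi> D) x" if x: "fbl x" for x
  proof -
    obtain k where k: "\<forall>f. \<Phi> (insert x (Y x)) f --> f x = k" using Y(3)[OF x] by (elim exE)
    have "f x = k" if "cl \<Phi> D {x} f" for f using that k x unfolding cl_def D_def by simp
    then show ?thesis unfolding forced_def by (intro exI[of _ k] allI impI)
  qed
  define h where "h v = (if \<exists>s\<in>S. E v s then SOME s. s \<in> S \<and> E v s else y v)" for v
  have hS: "h v \<in> S \<and> E v (h v)" if s: "\<exists>s\<in>S. E v s" for v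
  proof -
    have "\<exists>s. s \<in> S \<and> E v s" using s by blast
    from someI_ex[OF this] show ?thesis using s unfolding h_def by simp
  qed
  have sc0: "?sc v = {}" if "\<not> (\<exists>s\<in>S. E v s)" for v using that unfolding sc_def by blast
  have "helpers 17 V E (cl \<Phi> D) h S"
    unfolding helpers_def
  proof (intro conjI ballI impI)
    show "finite S" by (rule finite_subset[OF SV finV])
    show "card S \<le> 17" by (rule S17)
    fix v assume v: "v \<in> V" "\<not> forced (cl \<Phi> D) v"
    have nf: "\<not> fbl v" using forced v(2) by blast
    have vS: "v \<notin> S" using fS nf by blast
    have ex: "\<exists>y. E v y \<and> fbl y" if "\<not> (\<exists>s\<in>S. E v s)" by (rule nbr[OF v(1) vS sc0[OF that] nf])
    show "E v (h v)" using hS[of v] y(1)[of v] ex unfolding h_def by (cases "\<exists>s\<in>S. E v s") auto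
    show "forced (cl \<Phi> D) (h v)"
      by (rule forced) (use hS[of v] fS y(2)[of v] ex in \<open>cases "\<exists>s\<in>S. E v s"; auto simp: h_def\<close>)
    show "h v \<in> S \<or> card {u \<in> V. E v u \<and> \<not> forced (cl \<Phi> D) u} \<le> 8"
    proof (cases "\<exists>s\<in>S. E v s")
      case True then show ?thesis using hS by blast
    next
      case False
      have vL: "v \<in> L m" for m using v(1) vS sc0[OF False] unfolding L_def by simp
      let ?M = "\<lambda>m. {x \<in> L m. E v x}"
      have "{u \<in> V. E v u \<and> \<not> forced (cl \<Phi> D) u} \<subseteq> ?M CA \<union> (?M CB \<union> ?M CC)"
      proof
        fix x assume "x \<in> {u \<in> V. E v u \<and> \<not> forced (cl \<Phi> D) u}"
        then have x: "x \<in> V" "E v x" "\<not> fbl x" using forced by blast+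
        obtain m where "x \<in> L m" using inL[OF x(1,3)] by (elim exE)
        then show "x \<in> ?M CA \<union> (?M CB \<union> ?M CC)" using x(2) by (cases m) auto
      qed
      moreover have "finite (?M CA \<union> (?M CB \<union> ?M CC))" by (rule finite_subset[OF _ finN[of v]]) blast
      ultimately have "card {u \<in> V. E v u \<and> \<not> forced (cl \<Phi> D) u} \<le> card (?M CA \<union> (?M CB \<union> ?M CC))" by (intro card_mono)
      also have "\<dots> \<le> 6"
        using card_Un_le[of "?M CA" "?M CB \<union> ?M CC"] card_Un_le[of "?M CB" "?M CC"] L2[OF vL, of CA] L2[OF vL, of CB] L2[OF vL, of CC] by linarith
      finally show ?thesis by simp
    qed
  qed
  moreover have "two_lists (cl \<Phi> D)"
    unfolding two_lists_def
  proof
    fix v assume v: "v \<in> V"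
    consider "fbl v" | s where "s \<in> S" "E v s" | "\<not> fbl v" "\<not> (\<exists>s\<in>S. E v s)" by blast
    then show "\<exists>c. \<forall>f. cl \<Phi> D {v} f --> f v \<noteq> c"
    proof cases
      case 1
      then obtain k where k: "\<forall>f. cl \<Phi> D {v} f --> f v = k" using forced[OF 1] unfolding forced_def by (elim exE)
      show ?thesis by (rule forced_list[of _ v k]) (rule k[rule_format])
    next
      case 2
      have "f v \<noteq> \<sigma> s" if f: "cl \<Phi> D {v} f" for f
      proof -
        have "f v \<noteq> f s" by (rule pr[OF f[unfolded cl_def] _ _ 2(2)]) (use 2(1) in simp_all)
        then show ?thesis using fs[OF f[unfolded cl_def] 2(1)] by simp
      qed
      then show ?thesis by (intro exI[of _ "\<sigma> s"] allI impI)
    next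
      case 3
      have vS: "v \<notin> S" using fS 3(1) by blast
      have ex: "\<exists>y. E v y \<and> fbl y" by (rule nbr[OF v vS sc0[OF 3(2)] 3(1)])
      obtain k where k: "\<forall>f. \<Phi> (insert (y v) (Y (y v))) f --> f (y v) = k" using Y(3)[OF y(2)[OF ex]] by (elim exE)
      have "f v \<noteq> k" if f: "cl \<Phi> D {v} f" for f
      proof -
        have f': "\<Phi> (insert v (insert (y v) (Y (y v)))) f" using f 3(1) ex unfolding cl_def D_def by (simp add: insert_commute)
        have "\<Phi> (insert (y v) (Y (y v))) f" by (rule admD[OF adm f']) blast
        then have "f (y v) = k" using k by blast
        moreover have "f v \<noteq> f (y v)" by (rule pr[OF f' _ _ y(1)[OF ex]]) simp_all
        ultimately show ?thesis by simp
      qed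
      then show ?thesis by (intro exI[of _ k] allI impI)
    qed
  qed
  ultimately show ?thesis by (intro helped[OF adm_cl[OF adm] _ lcD'])
qed

definition R1 where "R1 = (3 :: nat) + 3 ^ 3 * opt (opt (opt 12))"
definition t4 where "t4 n = (4 :: nat) + 3 ^ 4 * n"
definition Na where "Na = t4 (t4 (N0 * 5 + 4)) + R1"

text \<open>Three seeds of three vertices, one avoiding each colour, and at most two calls of
  \<open>query_tri\<close> with four vertices each make up the 17 of
  \<open>colour_from_seeds\<close>. The second call returns a colour for which \<open>Adj\<close>
  failed before, so the two colours differ.\<close>

lemma P33_colourable:
  assumes lc: "lc (opt (opt (opt Na))) proper"
  shows "\<exists>f. proper V f"
proof (rule ccontr)
  assume nc: "\<nexists>f. proper V f"
  have R: "3 + 3 ^ 3 * opt (opt (opt 12)) \<le> Na" unfolding Na_def R1_def by simp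
  have R': "3 + 3 ^ 3 * opt (opt (opt 12)) \<le> opt Na" "3 + 3 ^ 3 * opt (opt (opt 12)) \<le> opt (opt Na)"
    using R opt_ge[of Na] opt_ge[of "opt Na"] by linarith+
  define \<sigma>0 where "\<sigma>0 = (\<lambda>_ :: 'a. CA)"
  have s0: "sd {} \<sigma>0 (opt (opt (opt Na)))" unfolding sd_def using lc by (simp add: lc_def fx_def)
  obtain S1 \<sigma>1 where s1: "card S1 \<le> card ({} :: 'a set) + 3" "sd S1 \<sigma>1 (opt (opt Na))" "hasP CA S1 \<sigma>1"
    using add_seed[OF s0 R'(2) nc, of CA] by (elim exE conjE)
  obtain S2 \<sigma>2 where s2: "extends S1 \<sigma>1 S2 \<sigma>2" "card S2 \<le> card S1 + 3" "sd S2 \<sigma>2 (opt Na)" "hasP CB S2 \<sigma>2"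
    using add_seed[OF s1(2) R'(1) nc, of CB] by (elim exE conjE)
  obtain S3 \<sigma>3 where s3: "extends S2 \<sigma>2 S3 \<sigma>3" "card S3 \<le> card S2 + 3" "sd S3 \<sigma>3 Na" "hasP CC S3 \<sigma>3"
    using add_seed[OF s2(3) R nc, of CC] by (elim exE conjE)
  have hP: "hasP m S3 \<sigma>3" for m
    using hasP_extends[OF s1(3) extends_trans[OF s2(1) s3(1)]] hasP_extends[OF s2(4) s3(1)] s3(4) by (cases m) simp_all
  have c9: "card S3 \<le> 9" using s1(1) s2(2) s3(2) by simp
  have sm: "sd S \<sigma> n" if "sd S \<sigma> k" "n \<le> k" for S \<sigma> n k using that lc_mono unfolding sd_def by blast
  have sd3: "sd S3 \<sigma>3 (4 + 3 ^ 4 * t4 (N0 * 5 + 4))" by (rule sm[OF s3(3)]) (simp add: Na_def t4_def)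
  show False
  proof (cases "\<exists>u z. tri S3 \<sigma>3 u z")
    case False
    have "sd S3 \<sigma>3 (N0 * 5 + 4)" by (rule sm[OF s3(3)]) (simp add: Na_def t4_def)
    then show False using colour_from_seeds[of S3 \<sigma>3] c9 hP False nc by auto
  next
    case True
    then obtain u z where "tri S3 \<sigma>3 u z" by (elim exE)
    from query_tri[OF sd3 this] obtain S4 \<sigma>4 c4 where s4: "extends S3 \<sigma>3 S4 \<sigma>4" "card S4 \<le> card S3 + 4" "sd S4 \<sigma>4 (t4 (N0 * 5 + 4))"
      "Adj S4 \<sigma>4 c4" by (elim exE conjE)
    show False
    proof (cases "\<exists>u z. tri S4 \<sigma>4 u z")
      case False
      have "sd S4 \<sigma>4 (N0 * 5 + 4)" by (rule sm[OF s4(3)]) (simp add: t4_def)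
      then show False using colour_from_seeds[of S4 \<sigma>4] c9 s4(2) hasP_extends[OF hP s4(1)] False nc by auto
    next
      case True
      then obtain u' z' where "tri S4 \<sigma>4 u' z'" by (elim exE)
      from query_tri[OF s4(3)[unfolded t4_def] this] obtain S5 \<sigma>5 c5 where s5: "extends S4 \<sigma>4 S5 \<sigma>5" "card S5 \<le> card S4 + 4" "sd S5 \<sigma>5 (N0 * 5 + 4)"
        "Adj S5 \<sigma>5 c5" "\<not> Adj S4 \<sigma>4 c5" by (elim exE conjE)
      have "c4 \<noteq> c5" using s4(4) s5(5) by blast
      then have "\<exists>c d. c \<noteq> d \<and> Adj S5 \<sigma>5 c \<and> Adj S5 \<sigma>5 d" using s5(4) Adj_extends[OF s4(4) s5(1)] by blast
      moreover have "card S5 \<le> 17" using c9 s4(2) s5(2) by simp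
      moreover have "hasP m S5 \<sigma>5" for m by (rule hasP_extends[OF hP extends_trans[OF s4(1) s5(1)]])
      ultimately show False using colour_from_seeds[OF s5(3)] nc by blast
    qed
  qed
qed

end

theorem P33_bounded:
  "\<exists>N. \<forall>V (E :: 'a => 'a => bool). fgraph V E --> p33free E --> (\<forall>v\<in>V. 3 \<le> card {u. E v u}) -->
    fgraph.lc V N (fgraph.proper E) --> (\<exists>f. fgraph.proper E V f)"
proof -
  obtain N0 where N0: "\<forall>V (E :: 'a => 'a => bool) \<Phi>. fgraph V E --> (p33free E \<and> fgraph.adm E \<Phi> \<and> (\<exists>h S. helpers 17 V E \<Phi> h S)) -->
    fgraph.adm E \<Phi> --> fgraph.lc V N0 \<Phi> --> fgraph.two_lists V \<Phi> --> (\<exists>f. fgraph.proper E V f)" using two_lists_2P3[of 17] by (elim exE)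
  have "\<exists>f. fgraph.proper E V f" if h: "fgraph V E" "p33free E" "\<forall>v\<in>V. 3 \<le> card {u. E v u}"
    "fgraph.lc V (opt (opt (opt (p33graph.Na N0)))) (fgraph.proper E)" for V and E :: "'a => 'a => bool"
  proof -
    have "p33graph V E N0"
    proof (rule p33graph.intro[OF h(1)], rule p33graph_axioms.intro[OF h(2)])
      show "3 \<le> card {u. E v u}" if "v \<in> V" for v using h(3) that by simp
      show "\<exists>f. fgraph.proper E V f" if "fgraph.adm E \<Phi>" "helpers 17 V E \<Phi> hh S" "fgraph.lc V N0 \<Phi>" "fgraph.two_lists V \<Phi>" for \<Phi> hh S
        by (rule N0[rule_format, OF h(1) _ that(1,3,4)]) (use h(2) that(1,2) in blast)
    qed
    from p33graph.P33_colourable[OF this h(4)] show ?thesis .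
  qed
  then show ?thesis by (intro exI[of _ "opt (opt (opt (p33graph.Na N0)))"] allI impI)
qed


section \<open>Infinite families: circulant graphs and Mycielskians\<close>

definition embeds :: "'a set => ('a => 'a => bool) => 'b set => ('b => 'b => bool) => bool" where
  "embeds V E W F \<longleftrightarrow> (\<exists>\<phi>. inj_on \<phi> V \<and> \<phi> ` V \<subseteq> W \<and> (\<forall>x\<in>V. \<forall>y\<in>V. E x y \<longleftrightarrow> F (\<phi> x) (\<phi> y)))"

definition (in fgraph) crit :: bool where
  "crit \<longleftrightarrow> (\<nexists>f. proper V f) \<and> (\<forall>A. A \<subset> V --> (\<exists>f. proper A f))"

definition dst :: "nat => nat => nat" where
  "dst i j = (if i < j then j - i else i - j)"

text \<open>Differences are not reduced modulo \<open>n\<close>; the graph is circulant when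
  \<open>\<Delta>\<close> is closed under replacing \<open>d\<close> by
  \<open>n - d\<close>.\<close>

definition circ :: "nat => nat set => nat => nat => bool" where
  "circ n \<Delta> i j \<longleftrightarrow> i < n \<and> j < n \<and> dst i j \<in> \<Delta>"

lemma dst_comm: "dst i j = dst j i"
  unfolding dst_def by auto

lemma circ_fgraph: "0 \<notin> \<Delta> ==> fgraph {..<n} (circ n \<Delta>)"
  by unfold_locales (auto simp: circ_def dst_comm, simp add: dst_def)

definition kol :: "nat => col" where
  "kol m = (if m mod 3 = 0 then CA else if m mod 3 = 1 then CB else CC)"

lemma kol_eq: "kol a = kol b ==> a mod 3 = b mod 3"
proof -
  assume "kol a = kol b"
  moreover have "a mod 3 < 3" "b mod 3 < 3" by simp_all
  ultimately show ?thesis unfolding kol_def by (simp split: if_splits)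
qed

lemma mod3_shift: "a mod 3 = (a + d) mod 3 ==> d mod 3 = (0 :: nat)"
  by presburger

lemma mod3_compl: "d \<le> 3 * r + 1 ==> (3 * r + 1 - d) mod 3 = 0 ==> d mod 3 = (1 :: nat)"
  by presburger

lemma mod3_sub:
  assumes "x mod 3 = 0" "y mod 3 = (1 :: nat)"
  shows "x \<le> y ==> (y - x) mod 3 = 1" "y \<le> x ==> (x - y) mod 3 = 2"
proof -
  obtain a b where x: "x = 3 * a" and y: "y = 3 * b + 1" using assms mult_div_mod_eq[of 3 x] mult_div_mod_eq[of 3 y] by (metis add.right_neutral)
  show "(y - x) mod 3 = 1" if "x \<le> y"
  proof -
    have e: "y - x = 3 * (b - a) + 1" using that x y by linarith
    show ?thesis unfolding e mod_mult_self4 by simp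
  qed
  show "(x - y) mod 3 = 2" if "y \<le> x"
  proof -
    have e: "x - y = 3 * (a - b - 1) + 2" using that x y by linarith
    show ?thesis unfolding e mod_mult_self4 by simp
  qed
qed

text \<open>The distances 1 and 2 force period three along the vertices, which contradicts the edge
  from \<open>0\<close> to \<open>3 * r\<close>. After deleting \<open>x\<close>, counting modulo
  three from the vertex behind \<open>x\<close> is a colouring: a conflict needs a distance
  divisible by three that does not cross \<open>x\<close>, or one of residue 1 that does. The only
  candidates are \<open>3 * r\<close> and \<open>1\<close>, and both are ruled out by the position
  of \<open>x\<close>.\<close>

lemma circ_crit:
  assumes r: "1 \<le> r" and n: "n = 3 * r + 1" and D: "1 \<in> \<Delta>" "2 \<in> \<Delta>" "3 * r \<in> \<Delta>"
    and D0: "\<And>d. d \<in> \<Delta> ==> d mod 3 = 0 ==> d = 3 * r" and D1: "\<And>d. d \<in> \<Delta> ==> d mod 3 = 1 ==> d = 1"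
  shows "fgraph {..<n} (circ n \<Delta>)" "fgraph.crit {..<n} (circ n \<Delta>)"
proof -
  have z: "0 \<notin> \<Delta>" using D0[of 0] r by auto
  show fg: "fgraph {..<n} (circ n \<Delta>)" by (rule circ_fgraph[OF z])
  interpret fgraph "{..<n}" "circ n \<Delta>" by (rule fg)
  have no: False if f: "proper {..<n} f" for f
  proof -
    have ne: "f i \<noteq> f j" if "i < n" "j < n" "dst i j \<in> \<Delta>" for i j
      using f that unfolding proper_def circ_def by blast
    have e1: "f i \<noteq> f (i + 1)" if "i + 1 < n" for i using ne[of i "i + 1"] that D by (simp add: dst_def)
    have e2: "f i \<noteq> f (i + 2)" if "i + 2 < n" for i using ne[of i "i + 2"] that D by (simp add: dst_def)
    have step: "f (i + 3) = f i" if i: "i + 3 < n" for i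
    proof -
      have "f (i + 3) \<noteq> f (i + 1)" "f (i + 3) \<noteq> f (i + 2)" "f i \<noteq> f (i + 1)" "f i \<noteq> f (i + 2)" "f (i + 1) \<noteq> f (i + 2)"
        using e2[of "i + 1"] e1[of "i + 2"] e1[of i] e2[of i] e1[of "i + 1"] i by (simp_all add: numeral_3_eq_3 eval_nat_numeral)
      then show ?thesis by (intro col_eqI[of "f (i + 3)" "f (i + 1)" "f (i + 2)" "f i"])
    qed
    have "f (3 * k) = f 0" if "k \<le> r" for k
      using that
    proof (induction k)
      case (Suc k)
      then show ?case using step[of "3 * k"] n by (simp add: add.commute)
    qed simp
    then have "f (3 * r) = f 0" by simp
    moreover have "f 0 \<noteq> f (3 * r)" using ne[of 0 "3 * r"] D(3) n r by (simp add: dst_def)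
    ultimately show False by simp
  qed
  have del: "\<exists>f. proper A f" if A: "A \<subset> {..<n}" for A
  proof -
    obtain x where x: "x < n" "x \<notin> A" using A by auto
    \<comment> \<open>The position counted cyclically, starting with 0 just behind the deleted
      vertex.\<close>
    define ps where "ps y = (if x < y then y - x - 1 else y + n - x - 1)" for y
    have key: False if y: "y < y'" "y' < n" "y \<noteq> x" "y' \<noteq> x" "y' - y \<in> \<Delta>" and m: "ps y mod 3 = ps y' mod 3" for y y'
    proof -
      consider "y' < x \<or> x < y" | "y < x" "x < y'" using y by linarith
      then show False
      proof cases
        case 1
        then have "ps y' = ps y + (y' - y)" using y x unfolding ps_def by auto
        then have "(y' - y) mod 3 = 0" by (intro mod3_shift[of "ps y"]) (simp only: m)
        from D0[OF y(5) this] show False using 1 y x n by auto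
      next
        case 2
        have "ps y = ps y' + (n - (y' - y))" using 2 y x unfolding ps_def by auto
        then have 3: "(n - (y' - y)) mod 3 = 0" by (intro mod3_shift[of "ps y'"]) (simp only: m[symmetric])
        have "(y' - y) mod 3 = 1" by (rule mod3_compl[of _ r]) (use 3 y n in simp_all)
        from D1[OF y(5) this] show False using 2 by auto
      qed
    qed
    have "proper A (\<lambda>y. kol (ps y))"
      unfolding proper_def
    proof (intro ballI impI notI)
      fix y y' assume yy: "y \<in> A" "y' \<in> A" "circ n \<Delta> y y'" "kol (ps y) = kol (ps y')"
      have m: "ps y mod 3 = ps y' mod 3" by (rule kol_eq[OF yy(4)])
      have b: "y < n" "y' < n" "y \<noteq> x" "y' \<noteq> x" "dst y y' \<in> \<Delta>" using yy x A unfolding circ_def by auto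
      have "y \<noteq> y'" using b(5) z unfolding dst_def by auto
      then consider "y < y'" | "y' < y" by linarith
      then show False
      proof cases
        case 1 then show False using key[OF 1 b(2,3,4) _ m] b(5) unfolding dst_def by simp
      next
        case 2 then show False using key[OF 2 b(1,4,3) _ m[symmetric]] b(5) unfolding dst_def by simp
      qed
    qed
    then show ?thesis by blast
  qed
  show "crit" unfolding crit_def using no del by blast
qed

definition sq :: "nat => nat set" where "sq n = {1, 2, n - 1, n - 2}"
text \<open>For \<open>n = 3 * r + 1\<close> the passage from \<open>d\<close> to
  \<open>n - d\<close> exchanges \<open>1\<close> with \<open>3 * r\<close> and preserves residue 2,
  so this gives a circulant graph.\<close>

definition th :: "nat => nat set" where "th r = {d. d = 1 \<or> d = 3 * r \<or> d mod 3 = 2}"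

lemma sq_crit: "2 \<le> r ==> n = 3 * r + 1 ==> fgraph {..<n} (circ n (sq n)) \<and> fgraph.crit {..<n} (circ n (sq n))"
proof -
  assume r: "2 \<le> r" "n = 3 * r + 1"
  have n2: "n - 2 = 3 * (r - 1) + 2" "n - 1 = 3 * r" using r by simp_all
  have n3: "(n - 2) mod 3 = 2" unfolding n2(1) mod_mult_self4 by simp
  have d: "d = 1 \<or> d = 2 \<or> d = 3 * r \<or> d = n - 2" if "d \<in> sq n" for d using that n2(2) unfolding sq_def by blast
  have a: "d = 3 * r" if "d \<in> sq n" "d mod 3 = 0" for d using d[OF that(1)] that(2) n3 by (elim disjE) simp_all
  have b: "d = 1" if "d \<in> sq n" "d mod 3 = 1" for d using d[OF that(1)] that(2) n3 by (elim disjE) simp_all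
  have c: "1 \<in> sq n" "2 \<in> sq n" "3 * r \<in> sq n" using r unfolding sq_def by simp_all
  have "1 \<le> r" using r by simp
  from circ_crit[OF this r(2) c a b] show ?thesis by simp
qed

lemma th_crit: "2 \<le> r ==> n = 3 * r + 1 ==> fgraph {..<n} (circ n (th r)) \<and> fgraph.crit {..<n} (circ n (th r))"
proof -
  assume r: "2 \<le> r" "n = 3 * r + 1"
  have a: "d = 3 * r" if "d \<in> th r" "d mod 3 = 0" for d using that unfolding th_def by auto
  have b: "d = 1" if "d \<in> th r" "d mod 3 = 1" for d using that r unfolding th_def by auto
  have c: "1 \<in> th r" "2 \<in> th r" "3 * r \<in> th r" unfolding th_def by simp_all
  have "1 \<le> r" using r by simp
  from circ_crit[OF this r(2) c a b] show ?thesis by simp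
qed

definition plus :: "nat => nat => nat => bool" where
  "plus n x y \<longleftrightarrow> y = x + 1 \<or> y = x + 2 \<or> y + n = x + 1 \<or> y + n = x + 2"

lemma sq_side:
  assumes n: "7 \<le> n" and e: "circ n (sq n) x y"
  shows "plus n x y \<or> plus n y x"
proof -
  have d: "dst x y = 1 \<or> dst x y = 2 \<or> dst x y = n - 1 \<or> dst x y = n - 2" and b: "x < n" "y < n"
    using e unfolding circ_def sq_def by simp_all
  show ?thesis
  proof (cases "x < y")
    case True
    then have "y = x + dst x y" unfolding dst_def by simp
    then have "y = x + 1 \<or> y = x + 2 \<or> x + n = y + 1 \<or> x + n = y + 2" using d n by linarith
    then show ?thesis unfolding plus_def by blast
  next
    case False
    then have "x = y + dst x y" unfolding dst_def by simp
    then have "x = y + 1 \<or> x = y + 2 \<or> y + n = x + 1 \<or> y + n = x + 2" using d n by linarith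
    then show ?thesis unfolding plus_def by blast
  qed
qed

lemma sq_same_side:
  assumes n: "7 \<le> n" and b: "x < n" "y < n" "z < n" "y \<noteq> z" and s: "(plus n x y \<and> plus n x z) \<or> (plus n y x \<and> plus n z x)"
  shows "circ n (sq n) y z"
proof -
  have "dst y z = 1 \<or> dst y z = n - 1"
    using s b n unfolding plus_def dst_def by (elim disjE conjE) auto
  then show ?thesis using b unfolding circ_def sq_def by auto
qed

lemma sq_claw_free:
  assumes n: "7 \<le> n" and e: "circ n (sq n) x a" "circ n (sq n) x b" "circ n (sq n) x c" and d: "a \<noteq> b" "b \<noteq> c" "a \<noteq> c"
  shows "circ n (sq n) a b \<or> circ n (sq n) b c \<or> circ n (sq n) a c"
proof -
  have l: "x < n" "a < n" "b < n" "c < n" using e unfolding circ_def by simp_all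
  have s: "plus n x a \<or> plus n a x" "plus n x b \<or> plus n b x" "plus n x c \<or> plus n c x" using sq_side[OF n] e by blast+
  then consider "(plus n x a \<and> plus n x b) \<or> (plus n a x \<and> plus n b x)" | "(plus n x b \<and> plus n x c) \<or> (plus n b x \<and> plus n c x)"
    | "(plus n x a \<and> plus n x c) \<or> (plus n a x \<and> plus n c x)" by blast
  then show ?thesis
  proof cases
    case 1 then show ?thesis using sq_same_side[OF n l(1,2,3) d(1)] by blast
  next
    case 2 then show ?thesis using sq_same_side[OF n l(1,3,4) d(2)] by blast
  next
    case 3 then show ?thesis using sq_same_side[OF n l(1,2,4) d(3)] by blast
  qed
qed

text \<open>Neighbours on the same side of a vertex are adjacent, so two non-adjacent ones lie on
  different sides, and from each vertex \<open>C\<close> goes on forward by one or two steps. Hence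
  of two consecutive vertices of the cycle at least one is in \<open>C\<close>.\<close>

lemma sq_no_small_core:
  assumes n: "7 \<le> n" and C: "C \<subseteq> {..<n}" "C \<noteq> {}"
    and two: "\<And>x. x \<in> C ==> \<exists>y\<in>C. \<exists>z\<in>C. y \<noteq> z \<and> circ n (sq n) x y \<and> circ n (sq n) x z \<and> \<not> circ n (sq n) y z"
  shows "n \<le> 2 * card C"
proof -
  have pl: "\<exists>y\<in>C. plus n x y" if x: "x \<in> C" for x
  proof -
    obtain y z where yz: "y \<in> C" "z \<in> C" "y \<noteq> z" "circ n (sq n) x y" "circ n (sq n) x z" "\<not> circ n (sq n) y z" using two[OF x] by blast
    have l: "x < n" "y < n" "z < n" using x yz C by auto
    have "\<not> (plus n y x \<and> plus n z x)" using sq_same_side[OF n l yz(3)] yz(6) by blast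
    then show ?thesis using sq_side[OF n yz(4)] sq_side[OF n yz(5)] yz(1,2) by blast
  qed
  define nx where "nx j = (if j + 1 = n then 0 else j + 1)" for j
  define ok where "ok j \<longleftrightarrow> j \<in> C \<or> nx j \<in> C" for j
  have st: "ok (nx j)" if j: "ok j" "j < n" for j
  proof (cases "nx j \<in> C")
    case True then show ?thesis unfolding ok_def by simp
  next
    case False
    then have "j \<in> C" using j unfolding ok_def by simp
    then obtain y where y: "y \<in> C" "plus n j y" using pl by blast
    have "y < n" using y C by auto
    then have "y = nx j \<or> y = nx (nx j)" using y(2) j(2) n unfolding plus_def nx_def by auto
    then show ?thesis using y(1) False unfolding ok_def by blast
  qed
  obtain x0 where x0: "x0 \<in> C" "x0 < n" using C by auto
  have up: "ok j" if "x0 \<le> j" "j < n" for j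
    using that
  proof (induction j rule: dec_induct)
    case base then show ?case using x0 unfolding ok_def by simp
  next
    case (step j)
    then show ?case using st[of j] unfolding nx_def by simp
  qed
  have "ok (n - 1)" using up[of "n - 1"] x0 by simp
  then have "ok (nx (n - 1))" using st n by simp
  then have ok0: "ok 0" using n unfolding nx_def by simp
  have ok: "ok j" if "j < n" for j
    using that
  proof (induction j)
    case 0 then show ?case using ok0 by simp
  next
    case (Suc j) then show ?case using st[of j] unfolding nx_def by simp
  qed
  define pr where "pr j = (if j = 0 then n - 1 else j - 1)" for j
  have "{..<n} \<subseteq> C \<union> pr ` C"
  proof
    fix j assume "j \<in> {..<n}"
    then have j: "ok j" "j < n" using ok by simp_all
    show "j \<in> C \<union> pr ` C"
    proof (cases "j \<in> C")
      case False
      then have "nx j \<in> C" using j unfolding ok_def by simp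
      moreover have "pr (nx j) = j" using j(2) n unfolding pr_def nx_def by auto
      ultimately show ?thesis by (metis UnI2 imageI)
    qed simp
  qed
  moreover have fC: "finite C" using C finite_subset by blast
  ultimately have "card {..<n} \<le> card (C \<union> pr ` C)" by (intro card_mono) auto
  also have "\<dots> \<le> card C + card C" using card_Un_le[of C "pr ` C"] card_image_le[OF fC, of pr] by linarith
  finally show ?thesis by simp
qed

lemma dst_rotate:
  assumes b: "e < n" "x < n" "y < n"
  defines "q \<equiv> \<lambda>y. if e \<le> y then y - e else y + n - e"
  shows "dst (q x) (q y) = dst x y \<or> (x \<noteq> y \<and> dst (q x) (q y) + dst x y = n)"
  using b unfolding q_def dst_def by auto

lemma th_rotate:
  assumes n: "n = 3 * r + 1" and b: "e < n" "x < n" "y < n"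
  defines "q \<equiv> \<lambda>y. if e \<le> y then y - e else y + n - e"
  shows "circ n (th r) x y \<longleftrightarrow> circ n (th r) (q x) (q y)"
proof -
  have q: "q x < n" "q y < n" using b unfolding q_def by auto
  have "dst (q x) (q y) = dst x y \<or> (x \<noteq> y \<and> dst (q x) (q y) + dst x y = n)" unfolding q_def by (rule dst_rotate[OF b])
  moreover have half: "d' \<in> th r" if h: "d + d' = n" "0 < d'" "d \<in> th r" for d d'
  proof -
    consider "d = 1" | "d = 3 * r" | "d mod 3 = 2" using h(3) unfolding th_def by blast
    then show ?thesis
    proof cases
      case 3
      define a where "a = d div 3"
      have "d = 3 * a + 2" using mult_div_mod_eq[of 3 d] 3 unfolding a_def by simp
      then have e: "d' = 3 * (r - a - 1) + 2" using h(1,2) n by linarith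
      have "d' mod 3 = 2" unfolding e mod_mult_self4 by simp
      then show ?thesis unfolding th_def by simp
    qed (use h n in \<open>auto simp: th_def\<close>)
  qed
  moreover have sym: "d \<in> th r \<longleftrightarrow> d' \<in> th r" if "d + d' = n" "0 < d" "0 < d'" for d d'
    using half[OF that(1,3)] half[of d' d] that(1,2) by (auto simp: add.commute)
  moreover have "x \<noteq> y ==> 0 < dst x y" unfolding dst_def by auto
  moreover have "x \<noteq> y ==> 0 < dst (q x) (q y)" using b unfolding q_def dst_def by auto
  ultimately have "dst x y \<in> th r \<longleftrightarrow> dst (q x) (q y) \<in> th r" using sym[of "dst x y" "dst (q x) (q y)"] by (metis add.commute)
  then show ?thesis using b q unfolding circ_def by simp
qed

text \<open>Rotate \<open>e\<close> to \<open>0\<close>. Its non-neighbours have residue 0 or 1.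
  Equal residues are not adjacent, and \<open>x\<close> of residue 0 is adjacent to \<open>y\<close>
  of residue 1 exactly if \<open>y \<le> x + 1\<close>; nested neighbourhoods of this kind leave no
  room for a \<open>2P2\<close>.\<close>

lemma th_no_2P2_P1:
  assumes r: "2 \<le> r" and n: "n = 3 * r + 1" and e: "e < n"
    and E: "circ n (th r) a b" "circ n (th r) c d"
    and N: "\<not> circ n (th r) a c" "\<not> circ n (th r) a d" "\<not> circ n (th r) b c" "\<not> circ n (th r) b d"
    and Ne: "\<not> circ n (th r) e a" "\<not> circ n (th r) e b" "\<not> circ n (th r) e c" "\<not> circ n (th r) e d"
    and ne: "e \<noteq> a" "e \<noteq> b" "e \<noteq> c" "e \<noteq> d"
  shows False
proof -
  define q where "q = (\<lambda>y. if e \<le> y then y - e else y + n - e)"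
  have l: "a < n" "b < n" "c < n" "d < n" using E unfolding circ_def by simp_all
  have ql: "q y < n" if "y < n" for y using that e unfolding q_def by auto
  have rot: "circ n (th r) x y \<longleftrightarrow> dst (q x) (q y) \<in> th r" if "x < n" "y < n" for x y
    using th_rotate[OF n e that] ql that unfolding q_def circ_def by simp
  have q0: "q e = 0" unfolding q_def by simp
  have far: "q y mod 3 \<noteq> 2 \<and> q y \<noteq> 1 \<and> q y \<noteq> 3 * r \<and> 0 < q y" if "y < n" "e \<noteq> y" "\<not> circ n (th r) e y" for y
  proof -
    have "dst 0 (q y) = q y" unfolding dst_def by simp
    then have "q y \<notin> th r" using rot[OF e that(1)] that(3) unfolding q0 by simp
    moreover have "0 < q y" using that(1,2) e unfolding q_def by auto
    ultimately show ?thesis unfolding th_def by simp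
  qed
  have adj: "dst x y \<in> th r \<longleftrightarrow> y \<le> x + 1" if "x mod 3 = 0" "y mod 3 = 1" "x < 3 * r" "y < 3 * r" for x y
  proof (cases "x < y")
    case True
    then have "(y - x) mod 3 = 1" using mod3_sub(1)[OF that(1,2)] by simp
    then have "dst x y \<in> th r \<longleftrightarrow> y - x = 1" using True r that unfolding th_def dst_def by auto
    then show ?thesis using True by auto
  next
    case False
    then have "(x - y) mod 3 = 2" using mod3_sub(2)[OF that(1,2)] by simp
    then show ?thesis using False unfolding th_def dst_def by auto
  qed
  have same: "dst x y \<notin> th r" if "x mod 3 = y mod 3" "0 < x" "0 < y" "x < 3 * r" "y < 3 * r" for x y
  proof -
    have "dst x y mod 3 = 0"
      using that(1) mod_eq_dvd_iff_nat[of x y 3] mod_eq_dvd_iff_nat[of y x 3] unfolding dst_def by (cases "x < y") auto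
    moreover have "dst x y < 3 * r" using that unfolding dst_def by auto
    ultimately show ?thesis unfolding th_def by auto
  qed
  have F: "(q y mod 3 = 0 \<or> q y mod 3 = 1) \<and> 0 < q y \<and> q y < 3 * r" if "y < n" "e \<noteq> y" "\<not> circ n (th r) e y" for y
  proof -
    have "q y mod 3 < 3" by simp
    then show ?thesis using far[OF that] ql[OF that(1)] n by linarith
  qed
  note Fa = F[OF l(1) ne(1) Ne(1)] and Fb = F[OF l(2) ne(2) Ne(2)] and Fc = F[OF l(3) ne(3) Ne(3)] and Fd = F[OF l(4) ne(4) Ne(4)]
  have main: False if x: "x mod 3 = 0" "y mod 3 = 1" "x' mod 3 = 0" "y' mod 3 = 1" "x < 3 * r" "y < 3 * r" "x' < 3 * r" "y' < 3 * r"
    "dst x y \<in> th r" "dst x' y' \<in> th r" "dst x y' \<notin> th r" "dst x' y \<notin> th r" for x y x' y'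
    using adj[OF x(1,2,5,6)] adj[OF x(3,4,7,8)] adj[OF x(1,4,5,8)] adj[OF x(3,2,7,6)] x(9-12) by linarith
  note R = rot[OF l(1,2)] rot[OF l(3,4)] rot[OF l(1,3)] rot[OF l(1,4)] rot[OF l(2,3)] rot[OF l(2,4)]
  have G: "dst (q a) (q b) \<in> th r" "dst (q c) (q d) \<in> th r" "dst (q a) (q c) \<notin> th r" "dst (q a) (q d) \<notin> th r"
    "dst (q b) (q c) \<notin> th r" "dst (q b) (q d) \<notin> th r" using R E N by blast+
  have G': "dst (q b) (q a) \<in> th r" "dst (q d) (q c) \<in> th r" "dst (q c) (q a) \<notin> th r" "dst (q d) (q a) \<notin> th r"
    "dst (q c) (q b) \<notin> th r" "dst (q d) (q b) \<notin> th r" using G dst_comm by metis+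
  have nab: "q a mod 3 \<noteq> q b mod 3"
  proof
    assume "q a mod 3 = q b mod 3"
    from same[OF this] show False using G(1) Fa Fb by simp
  qed
  have ncd: "q c mod 3 \<noteq> q d mod 3"
  proof
    assume "q c mod 3 = q d mod 3"
    from same[OF this] show False using G(2) Fc Fd by simp
  qed
  have "(q a mod 3 = 0 \<and> q b mod 3 = 1) \<or> (q a mod 3 = 1 \<and> q b mod 3 = 0)" using Fa Fb nab by argo
  moreover have "(q c mod 3 = 0 \<and> q d mod 3 = 1) \<or> (q c mod 3 = 1 \<and> q d mod 3 = 0)" using Fc Fd ncd by argo
  ultimately consider "q a mod 3 = 0" "q b mod 3 = 1" "q c mod 3 = 0" "q d mod 3 = 1" | "q a mod 3 = 0" "q b mod 3 = 1" "q c mod 3 = 1" "q d mod 3 = 0"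
    | "q a mod 3 = 1" "q b mod 3 = 0" "q c mod 3 = 0" "q d mod 3 = 1" | "q a mod 3 = 1" "q b mod 3 = 0" "q c mod 3 = 1" "q d mod 3 = 0"
    by (elim disjE conjE)
  then show False
  proof cases
    case 1 then show False using main[of "q a" "q b" "q c" "q d"] Fa Fb Fc Fd G G' by simp
  next
    case 2 then show False using main[of "q a" "q b" "q d" "q c"] Fa Fb Fc Fd G G' by simp
  next
    case 3 then show False using main[of "q b" "q a" "q c" "q d"] Fa Fb Fc Fd G G' by simp
  next
    case 4 then show False using main[of "q b" "q a" "q d" "q c"] Fa Fb Fc Fd G G' by simp
  qed
qed

text \<open>The Mycielskian of the cycle of length \<open>n\<close>: \<open>x < n\<close> are the cycle vertices, \<open>n + x\<close> is the copy of
  \<open>x\<close>, and \<open>2 * n\<close> is the apex.\<close>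

definition lev :: "nat => nat => nat" where "lev n x = (if x < n then 0 else if x < 2 * n then 1 else 2)"
definition bas :: "nat => nat => nat" where "bas n x = (if x < n then x else x - n)"
definition cyc :: "nat => nat => nat => bool" where "cyc n i j \<longleftrightarrow> i < n \<and> j < n \<and> (dst i j = 1 \<or> dst i j = n - 1)"
definition myc :: "nat => nat => nat => bool" where
  "myc n x y \<longleftrightarrow> x < 2 * n + 1 \<and> y < 2 * n + 1 \<and> ((lev n x + lev n y \<le> 1 \<and> cyc n (bas n x) (bas n y)) \<or> lev n x + lev n y = 3)"

text \<open>A 3-colouring of the odd cycle that uses \<open>CC\<close> at \<open>j\<close>
  only.\<close>

definition c3 :: "nat => nat => nat => col" where
  "c3 n j i = (let p = (if j \<le> i then i - j else i + n - j) in if p = 0 then CC else if even p then CA else CB)"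

lemma c3_proper:
  assumes n: "odd n" "5 \<le> n" and j: "j < n" and c: "cyc n i i'"
  shows "c3 n j i \<noteq> c3 n j i'"
proof -
  define p where "p i = (if j \<le> i then i - j else i + n - j)" for i
  have b: "i < n" "i' < n" "dst i i' = 1 \<or> dst i i' = n - 1" using c unfolding cyc_def by simp_all
  have "dst (p i) (p i') = dst i i' \<or> dst (p i) (p i') + dst i i' = n" using dst_rotate[OF j b(1,2)] unfolding p_def by blast
  then have d: "dst (p i) (p i') = 1 \<or> dst (p i) (p i') = n - 1" using b(3) n(2) by linarith
  have pl: "p i < n" "p i' < n" using b(1,2) j unfolding p_def by auto
  have "p i = p i' + 1 \<or> p i' = p i + 1 \<or> (p i = 0 \<and> p i' = n - 1) \<or> (p i' = 0 \<and> p i = n - 1)"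
  proof (cases "p i < p i'")
    case True then show ?thesis using d pl n(2) unfolding dst_def by auto
  next
    case False then show ?thesis using d pl n(2) unfolding dst_def by auto
  qed
  then have "(if p i = 0 then CC else if even (p i) then CA else CB) \<noteq> (if p i' = 0 then CC else if even (p i') then CA else CB)"
    using n by auto
  then show ?thesis unfolding c3_def Let_def p_def .
qed

lemma c3_CC: "i < n ==> j < n ==> i \<noteq> j ==> c3 n j i \<noteq> CC"
  unfolding c3_def Let_def by auto

text \<open>In a 3-colouring, replacing the colour of a cycle vertex that agrees with the apex by
  the colour of its copy would 2-colour the odd cycle. For criticality: without the apex, copies
  follow their originals; without the copy of \<open>j\<close>, the apex takes the colour
  \<open>CC\<close> used on the cycle at \<open>j\<close> only; without a cycle vertex, the
  remaining path needs two colours and all copies get \<open>CC\<close>.\<close>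

lemma myc_crit:
  assumes n: "odd n" "5 \<le> n"
  shows "fgraph {..<2 * n + 1} (myc n)" "fgraph.crit {..<2 * n + 1} (myc n)"
proof -
  have cs: "cyc n i j ==> cyc n j i" for i j unfolding cyc_def using dst_comm by simp
  have ci: "\<not> cyc n i i" for i using n unfolding cyc_def dst_def by auto
  have ms: "myc n x y ==> myc n y x" for x y unfolding myc_def using cs by (auto simp: add.commute)
  have mi: "\<not> myc n x x" for x unfolding myc_def using ci by (auto simp: lev_def)
  show fg: "fgraph {..<2 * n + 1} (myc n)"
  proof
    show "finite {..<2 * n + 1}" by simp
    show "myc n x y ==> myc n y x" for x y by (rule ms)
    show "\<not> myc n x x" for x by (rule mi)
    show "myc n x y ==> x \<in> {..<2 * n + 1}" for x y unfolding myc_def by simp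
  qed
  interpret fgraph "{..<2 * n + 1}" "myc n" by (rule fg)
  have no: False if f: "proper {..<2 * n + 1} f" for f
  proof -
    have ne: "f x \<noteq> f y" if "myc n x y" for x y using f that unfolding proper_def myc_def by blast
    define g where "g i = (if f i = f (2 * n) then f (n + i) else f i)" for i
    have u: "f (n + i) \<noteq> f (2 * n)" if "i < n" for i
      by (rule ne) (use that in \<open>simp add: myc_def lev_def\<close>)
    have gm: "g i \<noteq> f (2 * n)" if "i < n" for i using u[OF that] unfolding g_def by simp
    have gp: "g i \<noteq> g j" if c: "cyc n i j" for i j
    proof -
      have b: "i < n" "j < n" using c unfolding cyc_def by simp_all
      have 1: "f i \<noteq> f j" by (rule ne) (use c b in \<open>simp add: myc_def lev_def bas_def\<close>)
      have 2: "f (n + i) \<noteq> f j" by (rule ne) (use c b in \<open>simp add: myc_def lev_def bas_def\<close>)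
      have 3: "f i \<noteq> f (n + j)" by (rule ne) (use c b in \<open>simp add: myc_def lev_def bas_def\<close>)
      show ?thesis using 1 2 3 unfolding g_def by auto
    qed
    have "(g (n - 1) = g 0) = even (n - 1)"
    proof (rule walk_alternates[of "n - 1" g "\<lambda>i. i" "f (2 * n)"])
      show "g i \<noteq> g (Suc i)" if "i < n - 1" for i by (rule gp) (use that in \<open>auto simp: cyc_def dst_def\<close>)
      show "g i \<noteq> f (2 * n)" if "i \<le> n - 1" for i by (rule gm) (use that n in auto)
    qed
    moreover have "g 0 \<noteq> g (n - 1)" by (rule gp) (use n in \<open>auto simp: cyc_def dst_def\<close>)
    ultimately show False using n by auto
  qed
  have del: "\<exists>f. proper A f" if A: "A \<subset> {..<2 * n + 1}" for A
  proof -
    obtain x0 where x0: "x0 < 2 * n + 1" "x0 \<notin> A" using A by auto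
    have lc: "lev n x = 0 \<or> lev n x = 1 \<or> lev n x = 2" for x unfolding lev_def by simp
    have bl: "bas n x < n" if "lev n x \<le> 1" for x using that unfolding lev_def bas_def by (auto split: if_splits)
    have key: "\<exists>f. proper A f" if k: "\<And>x y. x \<in> A ==> y \<in> A ==> myc n x y ==> lev n x \<le> lev n y ==> f x \<noteq> f y" for f :: "nat => col"
    proof -
      have "f x \<noteq> f y" if "x \<in> A" "y \<in> A" "myc n x y" for x y
        using k[OF that] k[OF that(2,1) ms[OF that(3)]] by (cases "lev n x \<le> lev n y") auto
      then show ?thesis unfolding proper_def by blast
    qed
    consider "x0 = 2 * n" | j where "j < n" "x0 = n + j" | "x0 < n" using x0 by (metis add.commute add_diff_inverse_nat less_Suc_eq less_diff_conv2 mult_2 not_less Suc_eq_plus1)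
    then show ?thesis
    proof cases
      case 1
      show ?thesis
      proof (rule key[of "\<lambda>y. c3 n 0 (bas n y)"])
        fix x y assume xy: "x \<in> A" "y \<in> A" "myc n x y"
        have "x \<noteq> 2 * n" "y \<noteq> 2 * n" using xy x0 1 by auto
        then have "lev n x \<noteq> 2" "lev n y \<noteq> 2" using xy A unfolding lev_def myc_def by auto
        then have "cyc n (bas n x) (bas n y)" using xy(3) lc[of x] lc[of y] unfolding myc_def by auto
        then show "c3 n 0 (bas n x) \<noteq> c3 n 0 (bas n y)" using c3_proper[OF n, of 0] n by simp
      qed
    next
      case 2
      show ?thesis
      proof (rule key[of "\<lambda>y. if lev n y = 2 then CC else c3 n j (bas n y)"])
        fix x y assume xy: "x \<in> A" "y \<in> A" "myc n x y" "lev n x \<le> lev n y"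
        show "(if lev n x = 2 then CC else c3 n j (bas n x)) \<noteq> (if lev n y = 2 then CC else c3 n j (bas n y))"
        proof (cases "lev n x + lev n y = 3")
          case True
          then have l: "lev n x = 1" "lev n y = 2" using xy(4) lc[of x] lc[of y] by auto
          have "x \<noteq> n + j" using xy(1) x0 2 by auto
          then have "bas n x \<noteq> j" using l(1) unfolding lev_def bas_def by (auto split: if_splits)
          then show ?thesis using c3_CC[OF bl 2(1)] l by simp
        next
          case False
          then have "cyc n (bas n x) (bas n y)" "lev n x + lev n y \<le> 1" using xy(3) unfolding myc_def by auto
          then show ?thesis using c3_proper[OF n 2(1)] by simp
        qed
      qed
    next
      case 3
      show ?thesis
      proof (rule key[of "\<lambda>y. if lev n y = 2 then CA else if lev n y = 1 then CC else c3 n x0 (bas n y)"])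
        fix x y assume xy: "x \<in> A" "y \<in> A" "myc n x y" "lev n x \<le> lev n y"
        show "(if lev n x = 2 then CA else if lev n x = 1 then CC else c3 n x0 (bas n x)) \<noteq>
          (if lev n y = 2 then CA else if lev n y = 1 then CC else c3 n x0 (bas n y))"
        proof (cases "lev n x + lev n y = 3")
          case True
          then have l: "lev n x = 1" "lev n y = 2" using xy(4) lc[of x] lc[of y] by auto
          then show ?thesis by simp
        next
          case False
          then have c: "cyc n (bas n x) (bas n y)" and s: "lev n x + lev n y \<le> 1" using xy(3) unfolding myc_def by auto
          then have lx: "lev n x = 0" using xy(4) by simp
          then have "bas n x = x" "x < n" unfolding lev_def bas_def by (auto split: if_splits)
          moreover have "x \<noteq> x0" using xy(1) x0 by auto
          ultimately have "c3 n x0 (bas n x) \<noteq> CC" using c3_CC[OF _ 3] by simp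
          then show ?thesis using c3_proper[OF n 3 c] lx s by auto
        qed
      qed
    qed
  qed
  show "crit" unfolding crit_def using no del by blast
qed

lemma myc_triangle_free:
  assumes n: "5 \<le> n" and e: "myc n x y" "myc n y z" "myc n x z"
  shows False
proof -
  have "lev n x + lev n y \<le> 1 \<and> lev n y + lev n z \<le> 1 \<and> lev n x + lev n z \<le> 1"
  proof -
    have "lev n x \<le> 2" "lev n y \<le> 2" "lev n z \<le> 2" unfolding lev_def by simp_all
    moreover have "lev n x + lev n y \<le> 1 \<or> lev n x + lev n y = 3" "lev n y + lev n z \<le> 1 \<or> lev n y + lev n z = 3"
      "lev n x + lev n z \<le> 1 \<or> lev n x + lev n z = 3" using e unfolding myc_def by blast+
    ultimately show ?thesis by arith
  qed
  then have "cyc n (bas n x) (bas n y)" "cyc n (bas n y) (bas n z)" "cyc n (bas n x) (bas n z)" using e unfolding myc_def by auto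
  then show False using n unfolding cyc_def dst_def by (auto split: if_splits)
qed


section \<open>Linear forests without 2P2 + P1\<close>

definition pathR :: "nat => nat => bool" where "pathR i j \<longleftrightarrow> j = Suc i \<or> i = Suc j"

context fgraph
begin

definition ipath :: "nat => (nat => 'a) => bool" where
  "ipath t p \<longleftrightarrow> inj_on p {..<t} \<and> p ` {..<t} \<subseteq> V \<and> (\<forall>i<t. \<forall>j<t. E (p i) (p j) \<longleftrightarrow> pathR i j)"

lemma ipathD: "ipath t p ==> i < t ==> j < t ==> E (p i) (p j) \<longleftrightarrow> pathR i j" "ipath t p ==> i < t ==> p i \<in> V"
  "ipath t p ==> i < t ==> j < t ==> p i = p j \<longleftrightarrow> i = j"
  unfolding ipath_def by (auto simp: inj_on_eq_iff image_subset_iff)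

lemma ipathI:
  assumes "\<And>i. i < t ==> p i \<in> V" "\<And>i j. i < j ==> j < t ==> p i \<noteq> p j" "\<And>i j. i < j ==> j < t ==> E (p i) (p j) \<longleftrightarrow> j = Suc i"
  shows "ipath t p"
  unfolding ipath_def
proof (intro conjI allI impI)
  show "inj_on p {..<t}" by (rule linorder_inj_onI') (use assms(2) in simp)
  show "p ` {..<t} \<subseteq> V" using assms(1) by auto
  fix i j assume ij: "i < t" "j < t"
  show "E (p i) (p j) \<longleftrightarrow> pathR i j"
  proof (cases i j rule: linorder_cases)
    case less then show ?thesis using assms(3)[OF less ij(2)] unfolding pathR_def by auto
  next
    case equal then show ?thesis using irrE unfolding pathR_def by auto
  next
    case greater then show ?thesis using assms(3)[OF greater ij(1)] symE unfolding pathR_def by auto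
  qed
qed

lemma ipath_card: "ipath t p ==> t \<le> card V"
  using card_mono[OF finV, of "p ` {..<t}"] card_image[of p "{..<t}"] unfolding ipath_def by simp

end

text \<open>The condition \<open>core\<close> is acyclicity in the form refuted by
  \<open>sq_no_small_core\<close>: on an induced cycle of length at least four every vertex has two
  non-adjacent neighbours.\<close>

locale linear = fgraph +
  assumes tri: "E x y ==> E y z ==> E x z ==> False"
    and claw: "E x a ==> E x b ==> E x c ==> a \<noteq> b ==> b \<noteq> c ==> a \<noteq> c ==> E a b \<or> E b c \<or> E a c"
    and core: "C \<subseteq> V ==> C \<noteq> {} ==> \<exists>x\<in>C. \<forall>y\<in>C. \<forall>z\<in>C. y \<noteq> z --> E x y --> E x z --> E y z"
    and P221: "e \<in> V ==> E a b ==> E c d ==> \<not> E a c ==> \<not> E a d ==> \<not> E b c ==> \<not> E b d ==>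
      \<not> E e a ==> \<not> E e b ==> \<not> E e c ==> \<not> E e d ==> False"
begin

lemma deg2: "E x a ==> E x b ==> E x c ==> a \<noteq> b ==> b \<noteq> c ==> a \<noteq> c ==> False"
  using claw[of x a b c] tri[of x a b] tri[of x b c] tri[of x a c] by blast

lemma no_core: "C \<subseteq> V ==> C \<noteq> {} ==> (\<And>x. x \<in> C ==> \<exists>y\<in>C. \<exists>z\<in>C. y \<noteq> z \<and> E x y \<and> E x z) ==> False"
proof -
  assume C: "C \<subseteq> V" "C \<noteq> {}" and t: "\<And>x. x \<in> C ==> \<exists>y\<in>C. \<exists>z\<in>C. y \<noteq> z \<and> E x y \<and> E x z"
  obtain x where x: "x \<in> C" "\<forall>y\<in>C. \<forall>z\<in>C. y \<noteq> z --> E x y --> E x z --> E y z" using core[OF C] by (elim bexE)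
  obtain y z where yz: "y \<in> C" "z \<in> C" "y \<noteq> z" "E x y" "E x z" using t[OF x(1)] by (elim bexE conjE)
  have "E y z" using x(2) yz by blast
  then show False using tri[of x y z] yz(4,5) by blast
qed

text \<open>An attachment at an inner vertex gives degree three, at both ends a cycle, and at one
  end only a longer induced path.\<close>

lemma maximal_path_isolated:
  assumes p: "ipath t p" and mx: "\<And>t' p'. ipath t' p' ==> t' \<le> t" and x: "x \<in> V" "x \<notin> p ` {..<t}" and i: "i < t"
  shows "\<not> E x (p i)"
proof
  assume e: "E x (p i)"
  have xp: "x \<noteq> p m" if "m < t" for m using x(2) that by blast
  note ad = ipathD(1)[OF p] and eq = ipathD(3)[OF p] and inV = ipathD(2)[OF p]
  have inner: False if m: "E x (p m)" "0 < m" "m + 1 < t" for m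
  proof -
    have "E (p m) (p (m - 1))" "E (p m) (p (m + 1))" using ad[of m "m - 1"] ad[of m "m + 1"] m unfolding pathR_def by auto
    moreover have "p (m - 1) \<noteq> p (m + 1)" using eq[of "m - 1" "m + 1"] m by auto
    moreover have "x \<noteq> p (m - 1)" "x \<noteq> p (m + 1)" using xp m by auto
    ultimately show False using deg2[of "p m" x "p (m - 1)" "p (m + 1)"] symE[OF m(1)] by blast
  qed
  have t0: "0 < t" using i by simp
  have ends: "m = 0 \<or> m = t - 1" if "E x (p m)" "m < t" for m using inner[OF that(1)] that(2) by force
  consider (both) "2 \<le> t" "E x (p 0)" "E x (p (t - 1))" | (first) "E x (p 0)" "t = 1 \<or> \<not> E x (p (t - 1))" | (last) "E x (p (t - 1))" "\<not> E x (p 0)"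
    using e ends[OF e i] t0 by (cases "t = 1") auto
  then show False
  proof cases
    case both
    let ?C = "insert x (p ` {..<t})"
    show False
    proof (rule no_core[of ?C])
      show "?C \<subseteq> V" using x(1) inV by auto
      fix y assume "y \<in> ?C"
      then consider "y = x" | m where "m < t" "y = p m" by auto
      then show "\<exists>u\<in>?C. \<exists>v\<in>?C. u \<noteq> v \<and> E y u \<and> E y v"
      proof cases
        case 1
        have "p 0 \<noteq> p (t - 1)" using eq[of 0 "t - 1"] both(1) by auto
        then show ?thesis using both 1 t0 by (intro bexI[of _ "p 0"] bexI[of _ "p (t - 1)"]) auto
      next
        case 2
        consider "m = 0" | "m = t - 1" "0 < m" | "0 < m" "m + 1 < t" using 2(1) by linarith
        then show ?thesis
        proof cases
          case 1
          have "E (p 0) (p 1)" "x \<noteq> p 1" using ad[of 0 1] xp[of 1] both(1) unfolding pathR_def by auto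
          then show ?thesis using both 1 2 symE[OF both(2)] by (intro bexI[of _ x] bexI[of _ "p 1"]) auto
        next
          case c: 2
          have "E (p m) (p (m - 1))" "x \<noteq> p (m - 1)" using ad[of m "m - 1"] xp[of "m - 1"] 2(1) c unfolding pathR_def by auto
          then show ?thesis using both c 2 symE[OF both(3)] by (intro bexI[of _ x] bexI[of _ "p (m - 1)"]) auto
        next
          case 3
          have "E (p m) (p (m - 1))" "E (p m) (p (m + 1))" "p (m - 1) \<noteq> p (m + 1)"
            using ad[of m "m - 1"] ad[of m "m + 1"] eq[of "m - 1" "m + 1"] 3 unfolding pathR_def by auto
          then show ?thesis using 2 3 by (intro bexI[of _ "p (m - 1)"] bexI[of _ "p (m + 1)"]) auto
        qed
      qed
    qed simp
  next
    case first
    define q where "q m = (case m of 0 => x | Suc k => p k)" for m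
    have only: "E x (p k) \<longleftrightarrow> k = 0" if "k < t" for k using first ends[OF _ that] that by (cases "k = 0") auto
    have "ipath (Suc t) q"
    proof (rule ipathI)
      fix m assume "m < Suc t" then show "q m \<in> V" unfolding q_def using x(1) inV by (cases m) auto
    next
      fix a b assume ab: "a < b" "b < Suc t"
      obtain k where k: "b = Suc k" "k < t" using ab by (cases b) auto
      show "q a \<noteq> q b" using xp[of k] k ab eq[of "a - 1" k] unfolding q_def by (cases a) auto
      show "E (q a) (q b) \<longleftrightarrow> b = Suc a" using only[of k] k ab ad[of "a - 1" k] unfolding q_def pathR_def by (cases a) auto
    qed
    then show False using mx by fastforce
  next
    case last
    define q where "q m = (if m < t then p m else x)" for m
    have only: "E x (p k) \<longleftrightarrow> k = t - 1" if "k < t" for k using last ends[OF _ that] that by (cases "k = 0") auto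
    have "ipath (Suc t) q"
    proof (rule ipathI)
      fix m assume "m < Suc t" then show "q m \<in> V" unfolding q_def using x(1) inV by auto
    next
      fix a b assume ab: "a < b" "b < Suc t"
      show "q a \<noteq> q b" using xp[of a] ab eq[of a b] unfolding q_def by auto
      show "E (q a) (q b) \<longleftrightarrow> b = Suc a"
      proof (cases "b < t")
        case True then show ?thesis using ab ad[of a b] unfolding q_def pathR_def by auto
      next
        case False
        then have "b = t" "a < t" using ab by auto
        then show ?thesis using only[of a] symE unfolding q_def by auto
      qed
    qed
    then show False using mx by fastforce
  qed
qed

lemma embeds_two_paths:
  assumes p: "ipath t p" "t \<le> 3" and q: "ipath s q" "s \<le> 3" and V: "V = p ` {..<t} \<union> q ` {..<s}"
    and ac: "\<And>i j. i < t ==> j < s ==> \<not> E (p i) (q j) \<and> p i \<noteq> q j"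
  shows "embeds V E ({..<2 :: nat} \<times> {..<3 :: nat}) (\<lambda>a b. fst a = fst b \<and> pathR (snd a) (snd b))"
proof -
  define \<phi> where "\<phi> v = (if v \<in> p ` {..<t} then (0 :: nat, inv_into {..<t} p v) else (1, inv_into {..<s} q v))" for v
  have ip: "inj_on p {..<t}" "inj_on q {..<s}" using p(1) q(1) unfolding ipath_def by simp_all
  have fp: "\<phi> (p i) = (0, i)" if "i < t" for i using that inv_into_f_f[OF ip(1)] unfolding \<phi>_def by simp
  have fq: "\<phi> (q j) = (1, j)" if j: "j < s" for j
  proof -
    have "q j \<notin> p ` {..<t}" using ac[OF _ j] by force
    then show ?thesis using j inv_into_f_f[OF ip(2)] unfolding \<phi>_def by simp
  qed
  have cs: "(\<exists>i<t. v = p i) \<or> (\<exists>j<s. v = q j)" if "v \<in> V" for v using that V by auto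
  have "inj_on \<phi> V"
  proof (rule inj_onI)
    fix v v' assume v: "v \<in> V" "v' \<in> V" "\<phi> v = \<phi> v'"
    show "v = v'" using cs[OF v(1)] cs[OF v(2)] v(3) fp fq by auto
  qed
  moreover have "\<phi> ` V \<subseteq> {..<2} \<times> {..<3}"
  proof
    fix w assume "w \<in> \<phi> ` V"
    then obtain v where v: "v \<in> V" "w = \<phi> v" by blast
    show "w \<in> {..<2} \<times> {..<3}" using cs[OF v(1)] v(2) fp fq p(2) q(2) by auto
  qed
  moreover have "E x y \<longleftrightarrow> fst (\<phi> x) = fst (\<phi> y) \<and> pathR (snd (\<phi> x)) (snd (\<phi> y))" if xy: "x \<in> V" "y \<in> V" for x y
  proof -
    consider i j where "i < t" "x = p i" "j < t" "y = p j" | i j where "i < t" "x = p i" "j < s" "y = q j"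
      | i j where "i < s" "x = q i" "j < t" "y = p j" | i j where "i < s" "x = q i" "j < s" "y = q j" using cs[OF xy(1)] cs[OF xy(2)] by blast
    then show ?thesis
    proof cases
      case 1 then show ?thesis using fp ipathD(1)[OF p(1)] by simp
    next case 2 then show ?thesis using fp fq ac by simp
    next case 3 then show ?thesis using fp fq ac[OF 3(3,1)] symE by auto
    next case 4 then show ?thesis using fq ipathD(1)[OF q(1)] by simp
    qed
  qed
  ultimately show ?thesis unfolding embeds_def by (intro exI[of _ \<phi>]) simp
qed

text \<open>Take a longest induced path, on \<open>t\<close> vertices; the rest \<open>R\<close> is
  anticomplete to it. Avoiding \<open>2P2 + P1\<close> gives \<open>t \<le> 6\<close> if
  \<open>R\<close> is empty, \<open>t \<le> 4\<close> if \<open>R\<close> has vertices but no edge,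
  and \<open>t \<le> 3\<close> otherwise, where \<open>R\<close> is then itself a path on two or
  three vertices.\<close>

lemma classification:
  "embeds V E {..<6} pathR \<or> embeds V E ({..<2 :: nat} \<times> {..<3 :: nat}) (\<lambda>a b. fst a = fst b \<and> pathR (snd a) (snd b)) \<or>
   (\<exists>k. embeds V E ({..<4 :: nat} <+> {..<k :: nat} \<times> {..<1 :: nat}) (\<lambda>a b. \<exists>i j. a = Inl i \<and> b = Inl j \<and> pathR i j))"
proof -
  have "\<exists>t. (\<exists>p. ipath t p) \<and> (\<forall>t'. (\<exists>p. ipath t' p) --> t' \<le> t)"
  proof (rule ex_has_greatest_nat[of "\<lambda>t. \<exists>p. ipath t p" 0 "\<lambda>t. t" "Suc (card V)"])
    show "\<exists>p. ipath 0 p" unfolding ipath_def by simp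
    show "\<forall>t. (\<exists>p. ipath t p) --> t < Suc (card V)" using ipath_card by (auto simp: less_Suc_eq_le)
  qed
  then obtain t p where p: "ipath t p" and mx: "\<And>t' p'. ipath t' p' ==> t' \<le> t" by blast
  let ?P = "p ` {..<t}"
  define R where "R = V - ?P"
  have PV: "?P \<subseteq> V" using p unfolding ipath_def by simp
  have iso: "\<not> E x (p i) \<and> \<not> E (p i) x \<and> p i \<noteq> x" if "x \<in> R" "i < t" for x i
  proof -
    have x: "x \<in> V" "x \<notin> ?P" using that(1) unfolding R_def by simp_all
    have "\<not> E x (p i)" by (rule maximal_path_isolated[OF p mx x that(2)])
    then show ?thesis using symE x(2) that(2) by blast
  qed
  note ad = ipathD(1)[OF p] and inV = ipathD(2)[OF p]
  have Pe: "E (p 0) (p 1)" if "2 \<le> t" using ad[of 0 1] that unfolding pathR_def by simp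
  have RV: "x \<in> V" if "x \<in> R" for x using that unfolding R_def by simp
  show ?thesis
  proof (cases "R = {}")
    case True
    have t6: "t \<le> 6"
    proof (rule ccontr)
      assume "\<not> t \<le> 6"
      then have t: "7 \<le> t" by simp
      show False
        by (rule P221[of "p 6" "p 0" "p 1" "p 3" "p 4"]) (use t inV[of 6] in \<open>simp_all add: ad pathR_def\<close>)
    qed
    have V: "V = ?P" using True PV unfolding R_def by blast
    have ip: "inj_on p {..<t}" using p unfolding ipath_def by simp
    let ?f = "inv_into {..<t} p"
    have f: "?f (p i) = i" if "i < t" for i using inv_into_f_f[OF ip] that by simp
    have "inj_on ?f V" unfolding V by (rule inj_on_inv_into) simp
    moreover have "?f ` V \<subseteq> {..<6}" unfolding V using f t6 by auto
    moreover have "\<forall>x\<in>V. \<forall>y\<in>V. E x y \<longleftrightarrow> pathR (?f x) (?f y)" unfolding V using f ad by auto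
    ultimately show ?thesis unfolding embeds_def by blast
  next
    case Rne: False
    show ?thesis
    proof (cases "\<exists>x\<in>R. \<exists>y\<in>R. E x y")
      case False
      have t4: "t \<le> 4"
      proof (rule ccontr)
        assume "\<not> t \<le> 4"
        then have t: "5 \<le> t" by simp
        obtain x where x: "x \<in> R" using Rne by blast
        show False
          by (rule P221[OF RV[OF x], of "p 0" "p 1" "p 3" "p 4"]) (use t iso[OF x] in \<open>simp_all add: ad pathR_def\<close>)
      qed
      have finR: "finite R" using finV unfolding R_def by simp
      then obtain h where h: "bij_betw h R {0..<card R}" using ex_bij_betw_finite_nat by blast
      have hR: "h x < card R" if "x \<in> R" for x using h that unfolding bij_betw_def by auto
      have hi: "h x = h y \<longleftrightarrow> x = y" if "x \<in> R" "y \<in> R" for x y using h that unfolding bij_betw_def by (auto dest: inj_onD)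
      have ip: "inj_on p {..<t}" using p unfolding ipath_def by simp
      define \<phi> :: "'a => nat + nat \<times> nat" where "\<phi> v = (if v \<in> R then Inr (h v, 0) else Inl (inv_into {..<t} p v))" for v
      have fR: "\<phi> x = Inr (h x, 0)" if "x \<in> R" for x using that unfolding \<phi>_def by simp
      have fp: "\<phi> (p i) = Inl i" if "i < t" for i
      proof -
        have "p i \<notin> R" using that unfolding R_def by blast
        then show ?thesis using inv_into_f_f[OF ip] that unfolding \<phi>_def by simp
      qed
      have cs: "x \<in> R \<or> (\<exists>i<t. x = p i)" if "x \<in> V" for x using that unfolding R_def by blast
      have "inj_on \<phi> V"
      proof (rule inj_onI)
        fix x y assume xy: "x \<in> V" "y \<in> V" "\<phi> x = \<phi> y"
        show "x = y" using cs[OF xy(1)] cs[OF xy(2)] xy(3) fR fp hi by auto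
      qed
      moreover have "\<phi> ` V \<subseteq> {..<4} <+> {..<card R} \<times> {..<1}"
      proof
        fix w assume "w \<in> \<phi> ` V"
        then obtain v where v: "v \<in> V" "w = \<phi> v" by blast
        show "w \<in> {..<4} <+> {..<card R} \<times> {..<1}" using cs[OF v(1)] v(2) fR fp hR t4 by auto
      qed
      moreover have "E x y \<longleftrightarrow> (\<exists>i j. \<phi> x = Inl i \<and> \<phi> y = Inl j \<and> pathR i j)" if xy: "x \<in> V" "y \<in> V" for x y
      proof -
        consider "x \<in> R" "y \<in> R" | i where "x \<in> R" "i < t" "y = p i" | i where "y \<in> R" "i < t" "x = p i"
          | i j where "i < t" "x = p i" "j < t" "y = p j" using cs[OF xy(1)] cs[OF xy(2)] by blast
        then show ?thesis
        proof cases
          case 1 then show ?thesis using False fR by auto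
        next case 2 then show ?thesis using iso[OF 2(1,2)] fR by auto
        next case 3 then show ?thesis using iso[OF 3(1,2)] fR by auto
        next case 4 then show ?thesis using fp ad by auto
        qed
      qed
      ultimately have "embeds V E ({..<4 :: nat} <+> {..<card R} \<times> {..<1 :: nat}) (\<lambda>a b. \<exists>i j. a = Inl i \<and> b = Inl j \<and> pathR i j)"
        unfolding embeds_def by (intro exI[of _ \<phi>]) simp
      then show ?thesis by blast
    next
      case True
      then obtain x0 y0 where xy0: "x0 \<in> R" "y0 \<in> R" "E x0 y0" by blast
      have p2: "ipath 2 (\<lambda>i. if i = 0 then x0 else y0)"
        by (rule ipathI) (use RV[OF xy0(1)] RV[OF xy0(2)] xy0(3) irrE in \<open>auto simp: less_2_cases_iff\<close>)
      then have t2: "2 \<le> t" by (rule mx)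
      have t3: "t \<le> 3"
      proof (rule ccontr)
        assume "\<not> t \<le> 3"
        then have t: "4 \<le> t" by simp
        show False
          by (rule P221[of "p 3" "p 0" "p 1" x0 y0]) (use t iso[OF xy0(1)] iso[OF xy0(2)] xy0(3) inV[of 3] in \<open>simp_all add: ad pathR_def\<close>)
      qed
      have near: "E z x \<or> E z y" if "z \<in> R" "x \<in> R" "y \<in> R" "E x y" for x y z
      proof (rule ccontr)
        assume n: "\<not> ?thesis"
        show False
          by (rule P221[OF RV[OF that(1)] Pe[OF t2] that(4)]) (use n iso[OF that(1)] iso[OF that(2)] iso[OF that(3)] t2 in simp_all)
      qed
      \<comment> \<open>\<open>R\<close> contains a \<open>P3\<close> with centre \<open>x\<close>.
        By \<open>near\<close> a fourth vertex of \<open>R\<close> attaches to it, giving degree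
        three, a four-cycle, or an induced path on four vertices, which is longer than the longest
        one.\<close>
      have fin3: ?thesis if x: "x \<in> R" "y \<in> R" "z \<in> R" "E x y" "E z x" "z \<noteq> y" for x y z
      proof -
        have nzy: "\<not> E z y" using tri[of z x y] x(4,5) by blast
        have R3: "R \<subseteq> {z, x, y}"
        proof
          fix z' assume z': "z' \<in> R"
          show "z' \<in> {z, x, y}"
          proof (rule ccontr)
            assume "z' \<notin> {z, x, y}"
            then have ne: "z' \<noteq> z" "z' \<noteq> x" "z' \<noteq> y" by simp_all
            from near[OF z' x(1,2,4)] show False
            proof
              assume "E z' x"
              then show False using deg2[of x y z z'] x(4,5,6) ne symE by blast
            next
              assume e: "E z' y"
              have nx: "\<not> E z' x" using tri[of z' x y] e x(4) by blast
              show False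
              proof (cases "E z z'")
                case True
                show False
                proof (rule no_core[of "{z, x, y, z'}"])
                  show "{z, x, y, z'} \<subseteq> V" using RV x(1-3) z' by blast
                  fix u assume u: "u \<in> {z, x, y, z'}"
                  have "E z x" "E z z'" "x \<noteq> z'" "E x z" "E x y" "z \<noteq> y" "E y x" "E y z'" "E z' y" "E z' z" using True x e ne symE by blast+
                  then show "\<exists>v\<in>{z, x, y, z'}. \<exists>w\<in>{z, x, y, z'}. v \<noteq> w \<and> E u v \<and> E u w" using u ne by auto
                qed simp
              next
                case False
                have "ipath 4 (\<lambda>i. [z, x, y, z'] ! i)"
                proof (rule ipathI)
                  fix i :: nat assume "i < 4"
                  then have "i = 0 \<or> i = 1 \<or> i = 2 \<or> i = 3" by auto
                  then show "[z, x, y, z'] ! i \<in> V" using RV x(1-3) z' by auto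
                next
                  fix i j :: nat assume "i < j" "j < 4"
                  then have "(i = 0 \<and> (j = 1 \<or> j = 2 \<or> j = 3)) \<or> (i = 1 \<and> (j = 2 \<or> j = 3)) \<or> (i = 2 \<and> j = 3)" by auto
                  moreover have "z \<noteq> x" "x \<noteq> y" using x(4,5) irrE by blast+
                  moreover have "E y z'" by (rule symE[OF e])
                  moreover have "\<not> E x z'" using nx symE by blast
                  moreover note x(4-6) ne ne[symmetric] False nzy
                  ultimately show "[z, x, y, z'] ! i \<noteq> [z, x, y, z'] ! j" "E ([z, x, y, z'] ! i) ([z, x, y, z'] ! j) \<longleftrightarrow> j = Suc i"
                    by (elim disjE conjE; simp)+
                qed
                then have "4 \<le> t" by (rule mx)
                then show False using t3 by simp
              qed
            qed
          qed
        qed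
        let ?q = "\<lambda>i. [z, x, y] ! i"
        have q: "ipath 3 ?q"
        proof (rule ipathI)
          fix i :: nat assume "i < 3"
          then have "i = 0 \<or> i = 1 \<or> i = 2" by auto
          then show "[z, x, y] ! i \<in> V" using RV x(1-3) by auto
        next
          fix i j :: nat assume "i < j" "j < 3"
          then have "(i = 0 \<and> (j = 1 \<or> j = 2)) \<or> (i = 1 \<and> j = 2)" by auto
          moreover have "z \<noteq> x" "x \<noteq> y" using x(4,5) irrE by blast+
          moreover note x(4-6) nzy
          ultimately show "[z, x, y] ! i \<noteq> [z, x, y] ! j" "E ([z, x, y] ! i) ([z, x, y] ! j) \<longleftrightarrow> j = Suc i" by (elim disjE conjE; simp)+
        qed
        have im: "?q ` {..<3} = {z, x, y}" by (auto simp: lessThan_nat_numeral lessThan_Suc)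
        have Veq: "V = ?P \<union> ?q ` {..<3}" unfolding im using R3 PV x(1-3) unfolding R_def by blast
        have qR: "?q j \<in> R" if "j < 3" for j
        proof -
          have "?q j \<in> {z, x, y}" using im that by blast
          then show ?thesis using x(1-3) by (metis insertE singletonD)
        qed
        have "embeds V E ({..<2 :: nat} \<times> {..<3 :: nat}) (\<lambda>a b. fst a = fst b \<and> pathR (snd a) (snd b))"
          by (rule embeds_two_paths[OF p t3 q _ Veq]) (use iso qR in auto)
        then show ?thesis by blast
      qed
      show ?thesis
      proof (cases "R = {x0, y0}")
        case True
        let ?q = "\<lambda>i :: nat. if i = 0 then x0 else y0"
        have im: "?q ` {..<2} = {x0, y0}" by (auto simp: image_iff less_2_cases_iff intro: exI[of _ 0] exI[of _ 1])
        have Veq: "V = ?P \<union> ?q ` {..<2}" unfolding im using True PV unfolding R_def by blast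
        have "embeds V E ({..<2 :: nat} \<times> {..<3 :: nat}) (\<lambda>a b. fst a = fst b \<and> pathR (snd a) (snd b))"
          by (rule embeds_two_paths[OF p t3 p2 _ Veq]) (use iso xy0 in auto)
        then show ?thesis by blast
      next
        case False
        then obtain z where z: "z \<in> R" "z \<noteq> x0" "z \<noteq> y0" using xy0 by blast
        from near[OF z(1) xy0] show ?thesis
        proof
          assume "E z x0" then show ?thesis by (rule fin3[OF xy0(1,2) z(1) xy0(3) _ z(3)])
        next
          assume "E z y0" then show ?thesis by (rule fin3[OF xy0(2,1) z(1) symE[OF xy0(3)] _ z(2)])
        qed
      qed
    qed
  qed
qed

end


section \<open>Critical graphs, and target graphs as embedded patterns\<close>

context fgraph
begin

lemma crit_lc: "crit ==> N < card V ==> lc N proper"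
  unfolding lc_def
proof (intro allI impI)
  fix X assume c: "crit" "N < card V" and X: "X \<subseteq> V" "card X \<le> N"
  then have "X \<subset> V" by auto
  then show "\<exists>f. proper X f" using c(1) unfolding crit_def by simp
qed

lemma crit_conn: "crit ==> connS V"
  unfolding connS_def
proof (intro conjI allI impI)
  assume c: "crit"
  show "V \<noteq> {}"
  proof
    assume "V = {}"
    then have "proper V (\<lambda>_. CA)" unfolding proper_def by simp
    then have "\<exists>f. proper V f" by (rule exI[of "\<lambda>f. proper V f"])
    then show False using c unfolding crit_def by simp
  qed
  fix A assume A: "A \<subseteq> V" "A \<noteq> {}" "A \<noteq> V"
  show "\<exists>a\<in>A. \<exists>b\<in>V - A. E a b"
  proof (rule ccontr)
    assume n: "\<not> ?thesis"
    have "A \<subset> V" "V - A \<subset> V" using A by blast+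
    then have "\<exists>f. proper A f" "\<exists>f. proper (V - A) f" using c unfolding crit_def by simp_all
    then obtain f g where f: "proper A f" and g: "proper (V - A) g" by (elim exE)
    have no: "\<not> E x y" if "x \<in> A" "y \<in> V" "y \<notin> A" for x y using n that by auto
    have "proper V (\<lambda>x. if x \<in> A then f x else g x)"
      unfolding proper_def
    proof (intro ballI impI)
      fix x y assume xy: "x \<in> V" "y \<in> V" "E x y"
      have s: "x \<in> A \<longleftrightarrow> y \<in> A" using no xy symE[OF xy(3)] by auto
      show "(if x \<in> A then f x else g x) \<noteq> (if y \<in> A then f y else g y)"
      proof (cases "x \<in> A")
        case True
        then show ?thesis using s f[unfolded proper_def, rule_format, of x y] xy(3) by simp
      next
        case False
        then show ?thesis using s g[unfolded proper_def, rule_format, of x y] xy by simp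
      qed
    qed
    then have "\<exists>f. proper V f" by (rule exI[of "\<lambda>f. proper V f"])
    then show False using c unfolding crit_def by simp
  qed
qed

lemma crit_deg:
  assumes c: "crit" and v: "v \<in> V"
  shows "3 \<le> card {u. E v u}"
proof (rule ccontr)
  assume n: "\<not> 3 \<le> card {u. E v u}"
  have "V - {v} \<subset> V" using v by blast
  then have "\<exists>f. proper (V - {v}) f" using c unfolding crit_def by simp
  then obtain f where f: "proper (V - {v}) f" by (elim exE)
  have fin: "finite {u. E v u}" by (rule finite_subset[OF _ finV]) (use EV symE in blast)
  have "card (f ` {u. E v u}) < 3" using card_image_le[OF fin, of f] n by simp
  then have "f ` {u. E v u} \<noteq> UNIV" by auto
  then obtain k where k: "k \<notin> f ` {u. E v u}" by blast
  have "proper V (f(v := k))"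
    unfolding proper_def
  proof (intro ballI impI)
    fix x y assume xy: "x \<in> V" "y \<in> V" "E x y"
    consider "x = v" | "y = v" | "x \<noteq> v" "y \<noteq> v" by blast
    then show "(f(v := k)) x \<noteq> (f(v := k)) y"
    proof cases
      case 1
      then have "y \<noteq> v" "f y \<noteq> k" using xy irrE k by auto
      then show ?thesis using 1 by simp
    next
      case 2
      then have "x \<noteq> v" "f x \<noteq> k" using xy irrE k symE by auto
      then show ?thesis using 2 by simp
    next
      case 3
      then show ?thesis using f[unfolded proper_def, rule_format, of x y] xy by simp
    qed
  qed
  then have "\<exists>f. proper V f" by (rule exI[of "\<lambda>f. proper V f"])
  then show False using c unfolding crit_def by simp
qed

lemma ipath_allI:
  assumes "\<forall>i<n. v i \<in> V" and "\<forall>j<n. \<forall>i<j. v i \<noteq> v j \<and> (E (v i) (v j) \<longleftrightarrow> j = Suc i)"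
  shows "ipath n v"
proof (rule ipathI)
  show "v i \<in> V" if "i < n" for i using assms(1) that by simp
  show "v i \<noteq> v j" "E (v i) (v j) \<longleftrightarrow> j = Suc i" if "i < j" "j < n" for i j using assms(2)[rule_format, OF that(2,1)] by simp_all
qed

lemma indP6_ipath:
  assumes P: "indP6 E a b c d e f"
  shows "ipath 6 (\<lambda>i. [a, b, c, d, e, f] ! i)"
proof -
  have p: "E a b" "E b c" "E c d" "E d e" "E e f" "\<not> E a c" "\<not> E a d" "\<not> E a e" "\<not> E a f" "\<not> E b d" "\<not> E b e" "\<not> E b f"
    "\<not> E c e" "\<not> E c f" "\<not> E d f" using P unfolding indP6_def by simp_all
  note q = symE[OF p(1)] symE[OF p(2)] symE[OF p(3)] symE[OF p(4)] symE[OF p(5)]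
  have vV: "a \<in> V" "b \<in> V" "c \<in> V" "d \<in> V" "e \<in> V" "f \<in> V" using EV[OF p(1)] EV[OF p(2)] EV[OF p(3)] EV[OF p(4)] EV[OF p(5)] EV[OF q(5)] by simp_all
  have ne: "x \<noteq> y" if "E x z" "\<not> E y z" for x y z using that by auto
  have ne': "x \<noteq> y" if "E z y" "\<not> E z x" for x y z using that by auto
  have ds: "a \<noteq> b" "b \<noteq> c" "c \<noteq> d" "d \<noteq> e" "e \<noteq> f" using p(1-5) irrE by auto
  have ds': "a \<noteq> c" "a \<noteq> d" "a \<noteq> e" "b \<noteq> d" "b \<noteq> e" "c \<noteq> e" "a \<noteq> f" "b \<noteq> f" "c \<noteq> f" "d \<noteq> f"
    using ne[OF p(3,7)] ne[OF p(4,8)] ne[OF p(5,9)] ne[OF p(4,11)] ne[OF p(5,12)] ne[OF p(5,14)]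
      ne[OF p(1), of f] ne[OF p(2), of f] ne[OF p(3), of f] ne[OF p(4), of f] p symE[of f] by auto
  show ?thesis by (rule ipath_allI) (simp_all add: eval_nat_numeral All_less_Suc vV p ds ds')
qed

lemma indP4_ipath:
  assumes P: "indP4 E a b c d"
  shows "ipath 4 (\<lambda>i. [a, b, c, d] ! i)"
proof -
  have p: "E a b" "E b c" "E c d" "\<not> E a c" "\<not> E a d" "\<not> E b d" using P unfolding indP4_def by simp_all
  have vV: "a \<in> V" "b \<in> V" "c \<in> V" "d \<in> V" using EV[OF p(1)] EV[OF p(2)] EV[OF p(3)] EV[OF symE[OF p(3)]] by simp_all
  have "a \<noteq> b" "b \<noteq> c" "c \<noteq> d" using p(1-3) irrE by auto
  moreover have "a \<noteq> c" "a \<noteq> d" "b \<noteq> d" using p symE[of c d] by auto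
  ultimately show ?thesis by (intro ipath_allI) (simp_all add: eval_nat_numeral All_less_Suc vV p)
qed

lemma indP3_ipath:
  assumes P: "indP3 E a b c"
  shows "ipath 3 (\<lambda>i. [a, b, c] ! i)"
proof -
  have p: "E a b" "E b c" "\<not> E a c" "a \<noteq> c" using P unfolding indP3_def by simp_all
  have vV: "a \<in> V" "b \<in> V" "c \<in> V" using EV[OF p(1)] EV[OF p(2)] EV[OF symE[OF p(2)]] by simp_all
  have "a \<noteq> b" "b \<noteq> c" using p(1,2) irrE by auto
  then show ?thesis by (intro ipath_allI) (simp_all add: eval_nat_numeral All_less_Suc vV p)
qed

lemma embeds_P6: "\<not> p6free E ==> embeds {..<6} pathR V E"
proof -
  assume "\<not> p6free E"
  then obtain a b c d e f where "indP6 E a b c d e f" unfolding p6free_def by blast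
  from indP6_ipath[OF this] show ?thesis unfolding embeds_def ipath_def by (intro exI conjI) auto
qed

lemma embeds_2P3: "\<not> p33free E ==> embeds ({..<2 :: nat} \<times> {..<3 :: nat}) (\<lambda>a b. fst a = fst b \<and> pathR (snd a) (snd b)) V E"
proof -
  assume "\<not> p33free E"
  then obtain a b c a' b' c' where P: "indP3 E a b c" "indP3 E a' b' c'" and n: "\<forall>x\<in>{a, b, c}. \<forall>y\<in>{a', b', c'}. \<not> E x y"
    unfolding p33free_def by blast
  let ?p = "\<lambda>i. [a, b, c] ! i" and ?q = "\<lambda>i. [a', b', c'] ! i"
  have p: "ipath 3 ?p" and q: "ipath 3 ?q" using indP3_ipath P by blast+
  have mem: "?p i \<in> {a, b, c}" "?q i \<in> {a', b', c'}" if "i < 3" for i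
  proof -
    have "i = 0 \<or> i = 1 \<or> i = 2" using that by auto
    then show "?p i \<in> {a, b, c}" "?q i \<in> {a', b', c'}" by auto
  qed
  have nE: "\<not> E (?p i) (?q j)" "\<not> E (?q j) (?p i)" if "i < 3" "j < 3" for i j using n mem that symE by blast+
  have ne: "?p i \<noteq> ?q j" if ij: "i < 3" "j < 3" for i j
  proof
    assume e: "?p i = ?q j"
    define k where "k = (if i = 1 then 0 else 1 :: nat)"
    have "E (?p k) (?p i)" using ipathD(1)[OF p, of k i] ij unfolding k_def pathR_def by auto
    moreover have "k < 3" unfolding k_def by simp
    ultimately show False using nE(1)[OF _ ij(2), of k] e by simp
  qed
  define \<psi> where "\<psi> w = (if fst w = (0 :: nat) then ?p (snd w) else ?q (snd w))" for w
  have "inj_on \<psi> ({..<2 :: nat} \<times> {..<3 :: nat})"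
  proof (rule inj_onI)
    fix x y assume xy: "x \<in> {..<2 :: nat} \<times> {..<3 :: nat}" "y \<in> {..<2} \<times> {..<3}" "\<psi> x = \<psi> y"
    have l: "snd x < 3" "snd y < 3" "fst x = 0 \<or> fst x = 1" "fst y = 0 \<or> fst y = 1" using xy by auto
    have "fst x = fst y \<and> snd x = snd y"
      using l(3,4) xy(3) ipathD(3)[OF p l(1,2)] ipathD(3)[OF q l(1,2)] ne[OF l(1,2)] ne[OF l(2,1)] unfolding \<psi>_def by (elim disjE) auto
    then show "x = y" by (simp add: prod_eq_iff)
  qed
  moreover have "\<psi> ` ({..<2 :: nat} \<times> {..<3 :: nat}) \<subseteq> V" using ipathD(2)[OF p] ipathD(2)[OF q] unfolding \<psi>_def by auto
  moreover have "(fst x = fst y \<and> pathR (snd x) (snd y)) \<longleftrightarrow> E (\<psi> x) (\<psi> y)" if xy: "x \<in> {..<2 :: nat} \<times> {..<3 :: nat}" "y \<in> {..<2} \<times> {..<3}" for x y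
  proof -
    have l: "snd x < 3" "snd y < 3" "fst x = 0 \<or> fst x = 1" "fst y = 0 \<or> fst y = 1" using xy by auto
    show ?thesis
      using l(3,4) ipathD(1)[OF p l(1,2)] ipathD(1)[OF q l(1,2)] nE[OF l(1,2)] nE[OF l(2,1)] unfolding \<psi>_def by (elim disjE) auto
  qed
  ultimately show ?thesis unfolding embeds_def by (intro exI[of _ \<psi>]) simp
qed

lemma embeds_P4_kP1:
  assumes P: "indP4k E a b c d S" and S: "finite S" "card S = k" "S \<subseteq> V"
  shows "embeds ({..<4 :: nat} <+> {..<k :: nat} \<times> {..<1 :: nat}) (\<lambda>a b. \<exists>i j. a = Inl i \<and> b = Inl j \<and> pathR i j) V E"
proof -
  let ?p = "\<lambda>i. [a, b, c, d] ! i"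
  have P4: "indP4 E a b c d" and nS: "\<And>x. x \<in> S ==> \<not> E a x \<and> \<not> E b x \<and> \<not> E c x \<and> \<not> E d x" and SS: "\<And>x y. x \<in> S ==> y \<in> S ==> \<not> E x y"
    using P unfolding indP4k_def by simp_all
  have p: "ipath 4 ?p" by (rule indP4_ipath[OF P4])
  obtain h where h: "bij_betw h {0..<k} S" using ex_bij_betw_nat_finite[OF S(1)] S(2) by blast
  have hS: "h j \<in> S" if "j < k" for j using h that unfolding bij_betw_def by auto
  have hi: "h i = h j \<longleftrightarrow> i = j" if "i < k" "j < k" for i j using h that unfolding bij_betw_def by (auto simp: inj_on_eq_iff)
  have nE: "\<not> E (?p i) x" "\<not> E x (?p i)" if "i < 4" "x \<in> S" for i x
  proof -
    have "i = 0 \<or> i = 1 \<or> i = 2 \<or> i = 3" using that(1) by auto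
    then show "\<not> E (?p i) x" using nS[OF that(2)] by auto
    then show "\<not> E x (?p i)" using symE by blast
  qed
  have ne: "?p i \<noteq> x" if ix: "i < 4" "x \<in> S" for i x
  proof
    assume e: "?p i = x"
    define m where "m = (if i = 1 then 0 else if i = 0 then 1 else if i = 2 then 1 else 2 :: nat)"
    have "i = 0 \<or> i = 1 \<or> i = 2 \<or> i = 3" using ix(1) by auto
    then have "E (?p m) (?p i)" "m < 4" using ipathD(1)[OF p, of m i] ix unfolding m_def pathR_def by auto
    then show False using nE(1)[OF _ ix(2), of m] e by simp
  qed
  define \<psi> where "\<psi> w = (case w of Inl i => ?p i | Inr x => h (fst x))" for w :: "nat + nat \<times> nat"
  have pl: "\<psi> (Inl i) = ?p i" "\<psi> (Inr (j, z)) = h j" for i j z unfolding \<psi>_def by simp_all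
  have cs: "(\<exists>i<4. w = Inl i) \<or> (\<exists>j<k. w = Inr (j, 0))" if "w \<in> {..<4} <+> {..<k} \<times> {..<1}" for w :: "nat + nat \<times> nat" using that by auto
  have "inj_on \<psi> ({..<4 :: nat} <+> {..<k :: nat} \<times> {..<1 :: nat})"
  proof (rule inj_onI)
    fix x y assume xy: "x \<in> {..<4} <+> {..<k} \<times> {..<1}" "y \<in> {..<4} <+> {..<k} \<times> {..<1}" "\<psi> x = \<psi> y"
    consider i j where "i < 4" "x = Inl i" "j < 4" "y = Inl j" | i j where "i < 4" "x = Inl i" "j < k" "y = Inr (j, 0)"
      | i j where "i < k" "x = Inr (i, 0)" "j < 4" "y = Inl j" | i j where "i < k" "x = Inr (i, 0)" "j < k" "y = Inr (j, 0)"
      using cs[OF xy(1)] cs[OF xy(2)] by blast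
    then show "x = y"
    proof cases
      case 1 then show ?thesis using xy(3) ipathD(3)[OF p 1(1,3)] by (simp add: pl)
    next case 2 then show ?thesis using xy(3) ne[OF 2(1) hS[OF 2(3)]] by (simp add: pl)
    next case 3 then show ?thesis using xy(3) ne[OF 3(3) hS[OF 3(1)]] by (simp add: pl)
    next case 4 then show ?thesis using xy(3) hi[OF 4(1,3)] by (simp add: pl)
    qed
  qed
  moreover have "\<psi> ` ({..<4 :: nat} <+> {..<k :: nat} \<times> {..<1 :: nat}) \<subseteq> V"
  proof
    fix v assume "v \<in> \<psi> ` ({..<4 :: nat} <+> {..<k :: nat} \<times> {..<1 :: nat})"
    then obtain w where w: "w \<in> {..<4} <+> {..<k} \<times> {..<1}" "v = \<psi> w" by blast
    show "v \<in> V" using cs[OF w(1)] w(2) ipathD(2)[OF p] hS S(3) pl by auto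
  qed
  moreover have "(\<exists>i j. x = Inl i \<and> y = Inl j \<and> pathR i j) \<longleftrightarrow> E (\<psi> x) (\<psi> y)"
    if xy: "x \<in> {..<4} <+> {..<k} \<times> {..<1}" "y \<in> {..<4} <+> {..<k} \<times> {..<1}" for x y
  proof -
    consider i j where "i < 4" "x = Inl i" "j < 4" "y = Inl j" | i j where "i < 4" "x = Inl i" "j < k" "y = Inr (j, 0)"
      | i j where "i < k" "x = Inr (i, 0)" "j < 4" "y = Inl j" | i j where "i < k" "x = Inr (i, 0)" "j < k" "y = Inr (j, 0)"
      using cs[OF xy(1)] cs[OF xy(2)] by blast
    then show ?thesis
    proof cases
      case 1 then show ?thesis using ipathD(1)[OF p 1(1,3)] by (simp add: pl)
    next case 2 then show ?thesis using nE[OF 2(1) hS[OF 2(3)]] by (simp add: pl)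
    next case 3 then show ?thesis using nE[OF 3(3) hS[OF 3(1)]] by (simp add: pl)
    next case 4 then show ?thesis using SS[OF hS[OF 4(1)] hS[OF 4(3)]] by (simp add: pl)
    qed
  qed
  ultimately show ?thesis unfolding embeds_def by (intro exI[of _ \<psi>]) simp
qed

end

section \<open>Translation to digraphs and isomorphism classes\<close>

lemma embeds_trans: "embeds V E W F ==> embeds W F X G ==> embeds V E X G"
proof -
  assume "embeds V E W F" "embeds W F X G"
  then obtain \<phi> \<psi> where p: "inj_on \<phi> V" "\<phi> ` V \<subseteq> W" "\<forall>x\<in>V. \<forall>y\<in>V. E x y \<longleftrightarrow> F (\<phi> x) (\<phi> y)"
    and q: "inj_on \<psi> W" "\<psi> ` W \<subseteq> X" "\<forall>x\<in>W. \<forall>y\<in>W. F x y \<longleftrightarrow> G (\<psi> x) (\<psi> y)" unfolding embeds_def by (elim exE conjE)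
  have pW: "\<phi> x \<in> W" if "x \<in> V" for x using p(2) that by blast
  have "inj_on (\<psi> \<circ> \<phi>) V" by (rule comp_inj_on[OF p(1) inj_on_subset[OF q(1) p(2)]])
  moreover have "(\<psi> \<circ> \<phi>) ` V \<subseteq> X" using q(2) pW by auto
  moreover have "\<forall>x\<in>V. \<forall>y\<in>V. E x y \<longleftrightarrow> G ((\<psi> \<circ> \<phi>) x) ((\<psi> \<circ> \<phi>) y)" using p(3) q(3) pW by simp
  ultimately show ?thesis unfolding embeds_def by (intro exI[of _ "\<psi> \<circ> \<phi>"]) simp
qed

lemma embeds_cong:
  assumes "\<And>x y. x \<in> W ==> y \<in> W ==> F x y \<longleftrightarrow> F' x y"
  shows "embeds V E W F \<longleftrightarrow> embeds V E W F'" "embeds W F V E \<longleftrightarrow> embeds W F' V E"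
proof -
  have "(\<forall>x\<in>V. \<forall>y\<in>V. E x y \<longleftrightarrow> F (\<phi> x) (\<phi> y)) \<longleftrightarrow> (\<forall>x\<in>V. \<forall>y\<in>V. E x y \<longleftrightarrow> F' (\<phi> x) (\<phi> y))" if im: "\<phi> ` V \<subseteq> W" for \<phi>
  proof -
    have "F (\<phi> x) (\<phi> y) \<longleftrightarrow> F' (\<phi> x) (\<phi> y)" if "x \<in> V" "y \<in> V" for x y by (rule assms) (use im that in blast)+
    then show ?thesis by simp
  qed
  note c = this
  show "embeds V E W F \<longleftrightarrow> embeds V E W F'"
    unfolding embeds_def by (rule ex_cong1, rule conj_cong[OF refl], rule conj_cong[OF refl], rule c, assumption)
  show "embeds W F V E \<longleftrightarrow> embeds W F' V E" unfolding embeds_def using assms by simp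
qed

definition adjG :: "'a pair_pre_digraph => 'a => 'a => bool" where
  "adjG G x y \<longleftrightarrow> (x, y) \<in> parcs G"

lemma pair_fgraph:
  assumes "pair_graph G"
  shows "fgraph (pverts G) (adjG G)"
proof -
  interpret pair_graph G by (rule assms)
  have s: "sym (parcs G)" using pair_sym_arcs by (simp add: symmetric_def)
  show ?thesis
  proof
    show "finite (pverts G)" by (rule pair_finite_verts)
    show "adjG G x y ==> adjG G y x" for x y using s unfolding adjG_def by (rule symD)
    show "\<not> adjG G x x" for x using pair_no_loops[of "(x, x)"] unfolding adjG_def by auto
    show "adjG G x y ==> x \<in> pverts G" for x y using arc_fst_in_verts[of "(x, y)"] unfolding adjG_def by simp
  qed
qed

text \<open>The arc map carries no information of its own: tails and heads are \<open>fst\<close>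
  and \<open>snd\<close> on both sides, so the image of an arc is the pair of the images of its
  ends.\<close>

lemma iso_induced_imp_embeds:
  assumes "iso_induced_subgraph (with_proj H) (with_proj G)"
  shows "embeds (pverts H) (adjG H) (pverts G) (adjG G)"
proof -
  obtain F where F: "induced_subgraph F (with_proj G)" "digraph_iso F (with_proj H)" using assms unfolding iso_induced_subgraph_def by blast
  obtain hom where hom: "pre_digraph.digraph_isomorphism F hom" and H: "with_proj H = app_iso hom F" using F(2) unfolding digraph_iso_def by blast
  have sub: "verts F \<subseteq> pverts G" "wf_digraph F" "tail F = fst" "head F = snd"
    using F(1) unfolding induced_subgraph_def subgraph_def compatible_def by auto
  have arcs: "arcs F = {e \<in> parcs G. fst e \<in> verts F \<and> snd e \<in> verts F}" using F(1) unfolding induced_subgraph_def by simp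
  let ?i = "iso_verts hom"
  have vH: "pverts H = ?i ` verts F" and aH: "parcs H = iso_arcs hom ` arcs F" and tl: "fst = iso_tail hom" and hd: "snd = iso_head hom"
    using arg_cong[OF H, of verts] arg_cong[OF H, of arcs] arg_cong[OF H, of tail] arg_cong[OF H, of head] by simp_all
  have inj: "inj_on ?i (verts F)" using hom by (rule pre_digraph.digraph_isomorphism_inj_on_verts)
  have ends: "iso_arcs hom e = (?i (fst e), ?i (snd e))" if "e \<in> arcs F" for e
    using pre_digraph.iso_verts_tail[OF hom that] pre_digraph.iso_verts_head[OF hom that] tl hd sub(3,4) by (metis prod.collapse)
  have adj: "adjG H (?i u) (?i v) \<longleftrightarrow> adjG G u v" if uv: "u \<in> verts F" "v \<in> verts F" for u v
  proof
    assume "adjG H (?i u) (?i v)"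
    then obtain e where e: "e \<in> arcs F" "(?i u, ?i v) = iso_arcs hom e" unfolding adjG_def aH by blast
    then have "?i u = ?i (fst e)" "?i v = ?i (snd e)" using ends[OF e(1)] by simp_all
    then have "u = fst e" "v = snd e" using inj uv e(1) arcs by (auto dest: inj_onD)
    then show "adjG G u v" using e(1) arcs unfolding adjG_def by simp
  next
    assume "adjG G u v"
    then have "(u, v) \<in> arcs F" using uv arcs unfolding adjG_def by simp
    then show "adjG H (?i u) (?i v)" unfolding adjG_def aH using ends[of "(u, v)"] by force
  qed
  let ?f = "inv_into (verts F) ?i"
  have f: "?f x \<in> verts F" "?i (?f x) = x" if "x \<in> pverts H" for x
    using that unfolding vH by (auto intro: inv_into_into f_inv_into_f)
  have "inj_on ?f (pverts H)" unfolding vH by (rule inj_on_inv_into) simp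
  moreover have "?f ` pverts H \<subseteq> pverts G" using f(1) sub(1) by blast
  moreover have "adjG H x y \<longleftrightarrow> adjG G (?f x) (?f y)" if "x \<in> pverts H" "y \<in> pverts H" for x y
    using adj[OF f(1)[OF that(1)] f(1)[OF that(2)]] f(2) that by simp
  ultimately show ?thesis unfolding embeds_def by (intro exI[of _ ?f]) simp
qed

lemma embeds_imp_iso_induced:
  assumes H: "pair_wf_digraph H" and G: "pair_wf_digraph G" and emb: "embeds (pverts H) (adjG H) (pverts G) (adjG G)"
  shows "iso_induced_subgraph (with_proj H) (with_proj G)"
proof -
  interpret H: pair_wf_digraph H by (rule H)
  interpret G: pair_wf_digraph G by (rule G)
  obtain \<phi> where p: "inj_on \<phi> (pverts H)" "\<phi> ` pverts H \<subseteq> pverts G" "\<forall>x\<in>pverts H. \<forall>y\<in>pverts H. adjG H x y \<longleftrightarrow> adjG G (\<phi> x) (\<phi> y)"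
    using emb unfolding embeds_def by (elim exE conjE)
  let ?W = "\<phi> ` pverts H"
  define F where "F = with_proj G \<restriction> ?W"
  define \<psi> where "\<psi> = inv_into (pverts H) \<phi>"
  have ps: "\<psi> (\<phi> x) = x" if "x \<in> pverts H" for x unfolding \<psi>_def by (rule inv_into_f_f[OF p(1) that])
  have ind: "induced_subgraph F (with_proj G)" unfolding F_def by (rule G.induced_induce) (use p(2) in simp)
  then have wf: "wf_digraph F" unfolding induced_subgraph_def subgraph_def by simp
  have aF: "arcs F = {e \<in> parcs G. fst e \<in> ?W \<and> snd e \<in> ?W}" and vF: "verts F = ?W" and tF: "tail F = fst" "head F = snd"
    unfolding F_def by (simp_all add: induce_subgraph_def)
  define hom where "hom = \<lparr>iso_verts = \<psi>, iso_arcs = map_prod \<psi> \<psi>, iso_head = snd, iso_tail = fst\<rparr>"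
  have injW: "inj_on \<psi> ?W" unfolding \<psi>_def by (rule inj_on_inv_into) simp
  have "inj_on (map_prod \<psi> \<psi>) (arcs F)"
    by (rule inj_on_subset[OF map_prod_inj_on[OF injW injW]]) (auto simp: aF mem_Times_iff)
  then have iso: "pre_digraph.digraph_isomorphism F hom"
    unfolding pre_digraph.digraph_isomorphism_def using wf injW vF tF by (simp add: hom_def)
  have "\<psi> ` ?W = pverts H" using ps by (auto simp: image_image)
  moreover have "map_prod \<psi> \<psi> ` arcs F = parcs H"
  proof
    show "map_prod \<psi> \<psi> ` arcs F \<subseteq> parcs H"
    proof
      fix e assume "e \<in> map_prod \<psi> \<psi> ` arcs F"
      then obtain x y where xy: "x \<in> pverts H" "y \<in> pverts H" "(\<phi> x, \<phi> y) \<in> parcs G" "e = map_prod \<psi> \<psi> (\<phi> x, \<phi> y)" unfolding aF by auto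
      have "adjG H x y" using p(3) xy(1-3) unfolding adjG_def by simp
      then show "e \<in> parcs H" using xy ps unfolding adjG_def by simp
    qed
    show "parcs H \<subseteq> map_prod \<psi> \<psi> ` arcs F"
    proof
      fix e assume e: "e \<in> parcs H"
      obtain x y where xy: "e = (x, y)" by (cases e)
      have v: "x \<in> pverts H" "y \<in> pverts H" using H.arc_fst_in_verts[OF e] H.arc_snd_in_verts[OF e] xy by simp_all
      have "(\<phi> x, \<phi> y) \<in> parcs G" using p(3) v e xy unfolding adjG_def by simp
      then have "(\<phi> x, \<phi> y) \<in> arcs F" unfolding aF using v by simp
      moreover have "e = map_prod \<psi> \<psi> (\<phi> x, \<phi> y)" using ps v xy by simp
      ultimately show "e \<in> map_prod \<psi> \<psi> ` arcs F" by (rule rev_image_eqI)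
    qed
  qed
  ultimately have "with_proj H = app_iso hom F" by (simp add: app_iso_def hom_def vF with_proj_def)
  then have "digraph_iso F (with_proj H)" unfolding digraph_iso_def using iso by blast
  then show ?thesis unfolding iso_induced_subgraph_def using ind by blast
qed

fun col_of :: "nat => col" where
  "col_of 0 = CA" | "col_of (Suc 0) = CB" | "col_of (Suc (Suc _)) = CC"

fun nat_of :: "col => nat" where
  "nat_of CA = 0" | "nat_of CB = 1" | "nat_of CC = 2"

lemma col_of_inj: "a < 3 ==> b < 3 ==> col_of a = col_of b ==> a = b"
proof -
  assume h: "a < 3" "b < 3" "col_of a = col_of b"
  have "a = 0 \<or> a = 1 \<or> a = 2" "b = 0 \<or> b = 1 \<or> b = 2" using h(1,2) by auto
  then show ?thesis using h(3) by (elim disjE) (simp_all add: numeral_2_eq_2)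
qed

lemma nat_of_inj: "nat_of a = nat_of b \<longleftrightarrow> a = b"
  by (cases a; cases b) auto

lemma nat_of_less: "nat_of a < 3"
  by (cases a) auto

text \<open>\<open>F\<close> is any digraph whose arcs are those of \<open>G\<close> between its
  vertices, so that one lemma covers \<open>G\<close> and its induced subgraphs.\<close>

lemma colorable_iff:
  assumes fg: "fgraph V (adjG G)" and F: "tail F = fst" "head F = snd" "arcs F = {e \<in> parcs G. fst e \<in> verts F \<and> snd e \<in> verts F}"
  shows "colorable 3 F \<longleftrightarrow> (\<exists>f. fgraph.proper (adjG G) (verts F) f)"
proof
  assume "colorable 3 F"
  then obtain c where c: "c ` verts F \<subseteq> {..<3::nat}" "\<forall>e\<in>arcs F. c (fst e) \<noteq> c (snd e)" unfolding colorable_def F(1,2) by blast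
  have "fgraph.proper (adjG G) (verts F) (\<lambda>x. col_of (c x))"
    unfolding fgraph.proper_def[OF fg]
  proof (intro ballI impI)
    fix x y assume xy: "x \<in> verts F" "y \<in> verts F" "adjG G x y"
    then have "(x, y) \<in> arcs F" unfolding F(3) adjG_def by simp
    then have "c x \<noteq> c y" using c(2) by fastforce
    moreover have "c x < 3" "c y < 3" using c(1) xy by auto
    ultimately show "col_of (c x) \<noteq> col_of (c y)" using col_of_inj by blast
  qed
  then show "\<exists>f. fgraph.proper (adjG G) (verts F) f" by blast
next
  assume "\<exists>f. fgraph.proper (adjG G) (verts F) f"
  then obtain f where f: "fgraph.proper (adjG G) (verts F) f" by blast
  have "(nat_of \<circ> f) (tail F e) \<noteq> (nat_of \<circ> f) (head F e)" if e: "e \<in> arcs F" for e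
  proof -
    have "adjG G (fst e) (snd e)" "fst e \<in> verts F" "snd e \<in> verts F" using e unfolding F(3) adjG_def by auto
    then have "f (fst e) \<noteq> f (snd e)" using f unfolding fgraph.proper_def[OF fg] by blast
    then show ?thesis unfolding F(1,2) by (simp add: nat_of_inj)
  qed
  moreover have "(nat_of \<circ> f) ` verts F \<subseteq> {..<3}" using nat_of_less by auto
  ultimately show "colorable 3 F" unfolding colorable_def by blast
qed

lemma critical_iff:
  assumes G: "pair_graph G"
  shows "four_vertex_critical (with_proj G) \<longleftrightarrow> fgraph.crit (pverts G) (adjG G)"
proof -
  interpret pair_graph G by (rule G)
  note fg = pair_fgraph[OF G]
  have "parcs G = {e \<in> parcs G. fst e \<in> pverts G \<and> snd e \<in> pverts G}" using arc_fst_in_verts arc_snd_in_verts by blast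
  then have whole: "colorable 3 (with_proj G) \<longleftrightarrow> (\<exists>f. fgraph.proper (adjG G) (pverts G) f)"
    using colorable_iff[OF fg, of "with_proj G"] by simp
  have ind: "colorable 3 F \<longleftrightarrow> (\<exists>f. fgraph.proper (adjG G) (verts F) f)" if "induced_subgraph F (with_proj G)" for F
    by (rule colorable_iff[OF fg]) (use that in \<open>auto simp: induced_subgraph_def subgraph_def compatible_def\<close>)
  have "(\<forall>F. induced_subgraph F (with_proj G) \<and> verts F \<subset> verts (with_proj G) --> colorable 3 F) \<longleftrightarrow>
    (\<forall>A. A \<subset> pverts G --> (\<exists>f. fgraph.proper (adjG G) A f))"
  proof (intro iffI allI impI)
    fix A assume h: "\<forall>F. induced_subgraph F (with_proj G) \<and> verts F \<subset> verts (with_proj G) --> colorable 3 F" and A: "A \<subset> pverts G"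
    have i: "induced_subgraph (with_proj G \<restriction> A) (with_proj G)" by (rule induced_induce) (use A in auto)
    then show "\<exists>f. fgraph.proper (adjG G) A f" using h A ind[OF i] by simp
  next
    fix F assume h: "\<forall>A. A \<subset> pverts G --> (\<exists>f. fgraph.proper (adjG G) A f)" and F: "induced_subgraph F (with_proj G) \<and> verts F \<subset> verts (with_proj G)"
    then show "colorable 3 F" using ind[of F] by simp
  qed
  then show ?thesis unfolding four_vertex_critical_def fgraph.crit_def[OF fg] whole by blast
qed

text \<open>Nothing is assumed about \<open>X\<close>, because the classes of \<open>iso_rel\<close>
  are formed among arbitrary records.\<close>

lemma iso_char:
  assumes G: "pair_wf_digraph G"
  shows "digraph_iso (with_proj G) (with_proj X) \<longleftrightarrow>
    (\<exists>\<phi>. inj_on \<phi> (pverts G) \<and> pverts X = \<phi> ` pverts G \<and> parcs X = map_prod \<phi> \<phi> ` parcs G)"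
proof -
  interpret pair_wf_digraph G by (rule G)
  show ?thesis
  proof
    assume "digraph_iso (with_proj G) (with_proj X)"
    then obtain hom where hom: "digraph_isomorphism hom" and X: "with_proj X = app_iso hom (with_proj G)" unfolding digraph_iso_def by blast
    let ?i = "iso_verts hom"
    have vX: "pverts X = ?i ` pverts G" and aX: "parcs X = iso_arcs hom ` parcs G" and tl: "fst = iso_tail hom" and hd: "snd = iso_head hom"
      using arg_cong[OF X, of verts] arg_cong[OF X, of arcs] arg_cong[OF X, of tail] arg_cong[OF X, of head] by simp_all
    have "iso_arcs hom e = map_prod ?i ?i e" if "e \<in> parcs G" for e
      using iso_verts_tail[OF hom, of e] iso_verts_head[OF hom, of e] that tl hd
      by (metis map_prod_simp prod.collapse with_proj_simps(2,4,5))
    then have "parcs X = map_prod ?i ?i ` parcs G" unfolding aX by (simp cong: image_cong)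
    moreover have "inj_on ?i (pverts G)" using digraph_isomorphism_inj_on_verts[OF hom] by simp
    ultimately show "\<exists>\<phi>. inj_on \<phi> (pverts G) \<and> pverts X = \<phi> ` pverts G \<and> parcs X = map_prod \<phi> \<phi> ` parcs G" using vX by blast
  next
    assume "\<exists>\<phi>. inj_on \<phi> (pverts G) \<and> pverts X = \<phi> ` pverts G \<and> parcs X = map_prod \<phi> \<phi> ` parcs G"
    then obtain \<phi> where p: "inj_on \<phi> (pverts G)" "pverts X = \<phi> ` pverts G" "parcs X = map_prod \<phi> \<phi> ` parcs G" by blast
    define hom where "hom = \<lparr>iso_verts = \<phi>, iso_arcs = map_prod \<phi> \<phi>, iso_head = snd, iso_tail = fst\<rparr>"
    have "inj_on (map_prod \<phi> \<phi>) (parcs G)"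
      by (rule inj_on_subset[OF map_prod_inj_on[OF p(1) p(1)]]) (auto dest: wellformed')
    then have "digraph_isomorphism hom"
      using p(1) wf_digraph_axioms by (auto simp: digraph_isomorphism_def hom_def)
    moreover have "with_proj X = app_iso hom (with_proj G)" using p(2,3) by (simp add: app_iso_def hom_def with_proj_def)
    ultimately show "digraph_iso (with_proj G) (with_proj X)" unfolding digraph_iso_def by blast
  qed
qed

text \<open>A graph with at most \<open>N\<close> vertices is moved onto an initial segment of the
  numbers. As \<open>iso_rel\<close> is not reflexive on ill-formed records, equality of the two
  classes is proved element by element.\<close>

lemma finite_quotient:
  fixes X :: "nat pair_pre_digraph set"
  assumes X: "\<And>G. G \<in> X ==> pair_graph G \<and> card (pverts G) \<le> N"
  shows "finite (X // iso_rel)"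
proof -
  let ?G = "(\<lambda>(A, B). \<lparr>pverts = A, parcs = B\<rparr>) ` (Pow {..<N} \<times> Pow ({..<N} \<times> {..<N}))"
  have "X // iso_rel \<subseteq> (\<lambda>G'. iso_rel `` {G'}) ` ?G"
  proof
    fix C assume "C \<in> X // iso_rel"
    then obtain G where G: "G \<in> X" "C = iso_rel `` {G}" by (rule quotientE)
    interpret pair_graph G using X[OF G(1)] by simp
    obtain f where f: "bij_betw f (pverts G) {0..<card (pverts G)}" using ex_bij_betw_finite_nat[OF pair_finite_verts] by blast
    have inj: "inj_on f (pverts G)" and im: "f ` pverts G \<subseteq> {..<N}" using f X[OF G(1)] unfolding bij_betw_def by auto
    define G' where "G' = \<lparr>pverts = f ` pverts G, parcs = map_prod f f ` parcs G\<rparr>"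
    have "map_prod f f ` parcs G \<subseteq> {..<N} \<times> {..<N}"
    proof
      fix e assume "e \<in> map_prod f f ` parcs G"
      then obtain x y where "(x, y) \<in> parcs G" "e = (f x, f y)" by auto
      moreover from this have "x \<in> pverts G" "y \<in> pverts G" by (auto dest: wellformed')
      ultimately show "e \<in> {..<N} \<times> {..<N}" using im by auto
    qed
    then have G'in: "G' \<in> ?G" using im unfolding G'_def by (intro image_eqI[of _ _ "(f ` pverts G, map_prod f f ` parcs G)"]) auto
    have wf': "pair_wf_digraph G'"
      by unfold_locales (auto simp: G'_def dest: wellformed')
    have G1: "pair_wf_digraph G" by unfold_locales
    have "digraph_iso (with_proj G) (with_proj Y) \<longleftrightarrow> digraph_iso (with_proj G') (with_proj Y)" for Y :: "nat pair_pre_digraph"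
      unfolding iso_char[OF G1] iso_char[OF wf']
    proof
      assume "\<exists>\<phi>. inj_on \<phi> (pverts G) \<and> pverts Y = \<phi> ` pverts G \<and> parcs Y = map_prod \<phi> \<phi> ` parcs G"
      then obtain \<phi> where p: "inj_on \<phi> (pverts G)" "pverts Y = \<phi> ` pverts G" "parcs Y = map_prod \<phi> \<phi> ` parcs G" by blast
      let ?g = "inv_into (pverts G) f"
      have g: "?g (f x) = x" if "x \<in> pverts G" for x by (rule inv_into_f_f[OF inj that])
      have "inj_on (\<phi> \<circ> ?g) (pverts G')"
        by (rule comp_inj_on) (use p(1) g in \<open>auto simp: G'_def image_image inj_on_def\<close>)
      moreover have "pverts Y = (\<phi> \<circ> ?g) ` pverts G'" unfolding p(2) G'_def using g by (auto simp: image_image)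
      moreover have "parcs Y = map_prod (\<phi> \<circ> ?g) (\<phi> \<circ> ?g) ` parcs G'"
      proof -
        have e: "map_prod (\<phi> \<circ> ?g) (\<phi> \<circ> ?g) (map_prod f f e) = map_prod \<phi> \<phi> e" if "e \<in> parcs G" for e
          using g[OF arc_fst_in_verts[OF that]] g[OF arc_snd_in_verts[OF that]] by (cases e) simp
        have "map_prod (\<phi> \<circ> ?g) (\<phi> \<circ> ?g) ` parcs G' = (\<lambda>e. map_prod (\<phi> \<circ> ?g) (\<phi> \<circ> ?g) (map_prod f f e)) ` parcs G"
          unfolding G'_def by (simp only: pair_pre_digraph.select_convs image_image)
        also have "\<dots> = map_prod \<phi> \<phi> ` parcs G" by (rule image_cong[OF refl e])
        finally show ?thesis using p(3) by simp
      qed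
      ultimately show "\<exists>\<phi>. inj_on \<phi> (pverts G') \<and> pverts Y = \<phi> ` pverts G' \<and> parcs Y = map_prod \<phi> \<phi> ` parcs G'" by blast
    next
      assume "\<exists>\<phi>. inj_on \<phi> (pverts G') \<and> pverts Y = \<phi> ` pverts G' \<and> parcs Y = map_prod \<phi> \<phi> ` parcs G'"
      then obtain \<phi> where p: "inj_on \<phi> (f ` pverts G)" "pverts Y = \<phi> ` f ` pverts G" "parcs Y = map_prod \<phi> \<phi> ` map_prod f f ` parcs G"
        unfolding G'_def by auto
      have "inj_on (\<phi> \<circ> f) (pverts G)" by (rule comp_inj_on[OF inj p(1)])
      moreover have "pverts Y = (\<phi> \<circ> f) ` pverts G" unfolding p(2) by (simp add: image_image)
      moreover have "parcs Y = map_prod (\<phi> \<circ> f) (\<phi> \<circ> f) ` parcs G" unfolding p(3) by (simp add: image_image map_prod_def split_beta)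
      ultimately show "\<exists>\<phi>. inj_on \<phi> (pverts G) \<and> pverts Y = \<phi> ` pverts G \<and> parcs Y = map_prod \<phi> \<phi> ` parcs G" by blast
    qed
    then have "C = iso_rel `` {G'}" unfolding G(2) iso_rel_def by auto
    then show "C \<in> (\<lambda>G'. iso_rel `` {G'}) ` ?G" using G'in by blast
  qed
  moreover have "finite ?G" by simp
  ultimately show ?thesis by (meson finite_imageI finite_subset)
qed

text \<open>The number of vertices is constant on each class, so finitely many classes would bound
  it.\<close>

lemma infinite_quotient:
  fixes X :: "nat pair_pre_digraph set"
  assumes X: "\<And>G. G \<in> X ==> pair_graph G" and big: "\<And>N. \<exists>G\<in>X. N < card (pverts G)"
  shows "infinite (X // iso_rel)"
proof
  assume fin: "finite (X // iso_rel)"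
  define c where "c C = card (pverts (SOME Y. Y \<in> C))" for C :: "nat pair_pre_digraph set"
  have "card (pverts G) \<in> c ` (X // iso_rel)" if G: "G \<in> X" for G
  proof -
    interpret pair_graph G by (rule X[OF G])
    have G1: "pair_wf_digraph G" by unfold_locales
    have ch: "Y \<in> iso_rel `` {G} \<longleftrightarrow> (\<exists>\<phi>. inj_on \<phi> (pverts G) \<and> pverts Y = \<phi> ` pverts G \<and> parcs Y = map_prod \<phi> \<phi> ` parcs G)" for Y
      using iso_char[OF G1, of Y] unfolding iso_rel_def by simp
    have "G \<in> iso_rel `` {G}" unfolding ch by (rule exI[of _ id]) (simp add: map_prod.id)
    then have "(SOME Y. Y \<in> iso_rel `` {G}) \<in> iso_rel `` {G}" by (rule someI)
    then have "c (iso_rel `` {G}) = card (pverts G)" unfolding ch c_def by (metis card_image)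
    then show ?thesis using quotientI[OF G, of iso_rel] by (metis imageI)
  qed
  then have "card (pverts G) \<le> Max (c ` (X // iso_rel))" if "G \<in> X" for G using that fin by (intro Max_ge) auto
  then show False using big[of "Max (c ` (X // iso_rel))"] by (meson not_less)
qed


section \<open>Assembling the equivalence\<close>

definition gph :: "nat => (nat => nat => bool) => nat pair_pre_digraph" where
  "gph n R = \<lparr>pverts = {..<n}, parcs = {(i, j). R i j}\<rparr>"

lemma gph_simps: "pverts (gph n R) = {..<n}" "adjG (gph n R) = R"
  by (simp_all add: gph_def adjG_def fun_eq_iff)

lemma gph_pair_graph:
  assumes "fgraph {..<n} R"
  shows "pair_graph (gph n R)"
proof -
  interpret fgraph "{..<n}" R by (rule assms)
  have e: "x < n \<and> y < n" if "R x y" for x y using EV[OF that] EV[OF symE[OF that]] by simp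
  show ?thesis
  proof
    have "sym {(i, j). R i j}" using symE by (auto intro!: symI)
    then show "symmetric (with_proj (gph n R))" by (simp add: symmetric_def gph_def)
    show "finite (pverts (gph n R))" by (simp add: gph_def)
    have "parcs (gph n R) \<subseteq> {..<n} \<times> {..<n}" using e by (auto simp: gph_def)
    then show "finite (parcs (gph n R))" by (rule finite_subset) simp
    fix d assume d: "d \<in> parcs (gph n R)"
    then have R: "R (fst d) (snd d)" by (auto simp: gph_def)
    show "fst d \<noteq> snd d" using R irrE by metis
    show "fst d \<in> pverts (gph n R)" "snd d \<in> pverts (gph n R)" using e[OF R] by (simp_all add: gph_def)
  qed
qed

lemma targets_wf: "pair_wf_digraph (path_graph t)" "pair_wf_digraph (copies k (path_graph t))"
  "pair_wf_digraph (disjoint_union (path_graph t) (copies k (path_graph s)))"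
  by (unfold_locales; auto simp: path_graph_def copies_def disjoint_union_def)+

lemma embeds_P6_iff: "embeds V E (pverts (path_graph 6)) (adjG (path_graph 6)) \<longleftrightarrow> embeds V E {..<6} pathR"
  "embeds (pverts (path_graph 6)) (adjG (path_graph 6)) V E \<longleftrightarrow> embeds {..<6} pathR V E"
proof -
  have v: "pverts (path_graph 6) = {..<6}" by (simp add: path_graph_def)
  have a: "adjG (path_graph 6) x y \<longleftrightarrow> pathR x y" if "x \<in> {..<6}" "y \<in> {..<6}" for x y
    using that by (auto simp: adjG_def path_graph_def pathR_def)
  show "embeds V E (pverts (path_graph 6)) (adjG (path_graph 6)) \<longleftrightarrow> embeds V E {..<6} pathR"
    unfolding v by (rule embeds_cong(1)[OF a])
  show "embeds (pverts (path_graph 6)) (adjG (path_graph 6)) V E \<longleftrightarrow> embeds {..<6} pathR V E"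
    unfolding v by (rule embeds_cong(2)[OF a])
qed

lemma embeds_2P3_iff:
  "embeds V E (pverts (copies 2 (path_graph 3))) (adjG (copies 2 (path_graph 3))) \<longleftrightarrow>
    embeds V E ({..<2 :: nat} \<times> {..<3 :: nat}) (\<lambda>a b. fst a = fst b \<and> pathR (snd a) (snd b))"
  "embeds (pverts (copies 2 (path_graph 3))) (adjG (copies 2 (path_graph 3))) V E \<longleftrightarrow>
    embeds ({..<2 :: nat} \<times> {..<3 :: nat}) (\<lambda>a b. fst a = fst b \<and> pathR (snd a) (snd b)) V E"
proof -
  let ?G = "copies 2 (path_graph 3)" and ?R = "\<lambda>a b. fst a = fst b \<and> pathR (snd a) (snd b)"
  have v: "pverts ?G = {..<2 :: nat} \<times> {..<3 :: nat}" by (simp add: path_graph_def copies_def)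
  have a: "adjG ?G x y \<longleftrightarrow> ?R x y" if "x \<in> {..<2 :: nat} \<times> {..<3 :: nat}" "y \<in> {..<2 :: nat} \<times> {..<3 :: nat}" for x y
    using that by (auto simp: adjG_def path_graph_def copies_def pathR_def)
  show "embeds V E (pverts ?G) (adjG ?G) \<longleftrightarrow> embeds V E ({..<2 :: nat} \<times> {..<3 :: nat}) ?R"
    unfolding v by (rule embeds_cong(1)[OF a])
  show "embeds (pverts ?G) (adjG ?G) V E \<longleftrightarrow> embeds ({..<2 :: nat} \<times> {..<3 :: nat}) ?R V E"
    unfolding v by (rule embeds_cong(2)[OF a])
qed

lemma embeds_P4k_iff:
  fixes k :: nat
  defines "G \<equiv> disjoint_union (path_graph 4) (copies k (path_graph 1))"
  shows "embeds V E (pverts G) (adjG G) \<longleftrightarrow>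
      embeds V E ({..<4 :: nat} <+> {..<k :: nat} \<times> {..<1 :: nat}) (\<lambda>a b. \<exists>i j. a = Inl i \<and> b = Inl j \<and> pathR i j)"
    "embeds (pverts G) (adjG G) V E \<longleftrightarrow>
      embeds ({..<4 :: nat} <+> {..<k :: nat} \<times> {..<1 :: nat}) (\<lambda>a b. \<exists>i j. a = Inl i \<and> b = Inl j \<and> pathR i j) V E"
proof -
  let ?R = "\<lambda>a b. \<exists>i j. a = Inl i \<and> b = Inl j \<and> pathR i j" and ?W = "{..<4 :: nat} <+> {..<k :: nat} \<times> {..<1 :: nat}"
  have v: "pverts G = ?W" by (simp add: G_def disjoint_union_def path_graph_def copies_def)
  have a: "adjG G x y \<longleftrightarrow> ?R x y" if "x \<in> ?W" "y \<in> ?W" for x y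
    using that by (auto simp: G_def adjG_def disjoint_union_def path_graph_def copies_def pathR_def)
  show "embeds V E (pverts G) (adjG G) \<longleftrightarrow> embeds V E ?W ?R" unfolding v by (rule embeds_cong(1)[OF a])
  show "embeds (pverts G) (adjG G) V E \<longleftrightarrow> embeds ?W ?R V E" unfolding v by (rule embeds_cong(2)[OF a])
qed

text \<open>A critical graph with more than \<open>N\<close> vertices is colourable on every set of
  at most \<open>N\<close> vertices. The bound would then colour all of it, which criticality
  forbids.\<close>

lemma bounded_family:
  assumes H: "pair_wf_digraph H"
    and N: "\<And>G :: nat pair_pre_digraph. pair_graph G ==> \<not> embeds (pverts H) (adjG H) (pverts G) (adjG G) ==>
      fgraph.crit (pverts G) (adjG G) ==> fgraph.lc (pverts G) N (fgraph.proper (adjG G)) ==> \<exists>f. fgraph.proper (adjG G) (pverts G) f"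
  shows "finite ({G :: nat pair_pre_digraph. pair_graph G \<and> four_vertex_critical (with_proj G)
    \<and> induced_free (with_proj H) (with_proj G)} // iso_rel)"
proof (rule finite_quotient[of _ N])
  fix G :: "nat pair_pre_digraph"
  assume "G \<in> {G. pair_graph G \<and> four_vertex_critical (with_proj G) \<and> induced_free (with_proj H) (with_proj G)}"
  then have G: "pair_graph G" "four_vertex_critical (with_proj G)" "induced_free (with_proj H) (with_proj G)" by simp_all
  interpret G: pair_graph G by (rule G(1))
  interpret fgraph "pverts G" "adjG G" by (rule pair_fgraph[OF G(1)])
  have c: "crit" using critical_iff[OF G(1)] G(2) by simp
  have wf: "pair_wf_digraph G" by unfold_locales
  have ne: "\<not> embeds (pverts H) (adjG H) (pverts G) (adjG G)"
    using embeds_imp_iso_induced[OF H wf] G(3) unfolding induced_free_def by blast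
  show "pair_graph G \<and> card (pverts G) \<le> N"
  proof (rule conjI[OF G(1)], rule ccontr)
    assume "\<not> card (pverts G) \<le> N"
    then have "lc N proper" by (intro crit_lc[OF c]) simp
    from N[OF G(1) ne c this] show False using c unfolding crit_def by simp
  qed
qed

lemma infinite_family:
  assumes big: "\<And>N. \<exists>(n :: nat) R. N < n \<and> fgraph {..<n} R \<and> fgraph.crit {..<n} R \<and> \<not> embeds (pverts H) (adjG H) {..<n} R"
  shows "infinite ({G :: nat pair_pre_digraph. pair_graph G \<and> four_vertex_critical (with_proj G)
    \<and> induced_free (with_proj H) (with_proj G)} // iso_rel)" (is "infinite (?X // _)")
proof (rule infinite_quotient)
  fix N :: nat
  obtain n R where R: "N < n" "fgraph {..<n} R" "fgraph.crit {..<n} R" "\<not> embeds (pverts H) (adjG H) {..<n} R" using big[of N] by blast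
  have g: "pair_graph (gph n R)" by (rule gph_pair_graph[OF R(2)])
  have "four_vertex_critical (with_proj (gph n R))" using critical_iff[OF g] R(3) by (simp add: gph_simps)
  moreover have "induced_free (with_proj H) (with_proj (gph n R))"
    using iso_induced_imp_embeds[of H "gph n R"] R(4) unfolding induced_free_def gph_simps by blast
  ultimately have "gph n R \<in> ?X" using g by simp
  then show "\<exists>G\<in>?X. N < card (pverts G)" using R(1) by (intro bexI[of _ "gph n R"]) (simp_all add: gph_simps)
qed simp

text \<open>Each way of failing \<open>linear\<close> is answered by the family that excludes the
  offending configuration: Mycielskians for triangles, squares of cycles for claws and cores, the
  third family for \<open>2P2 + P1\<close>.\<close>

lemma not_linear_infinite:
  assumes H: "fgraph V E" and nl: "\<not> linear V E"
  shows "\<exists>(n :: nat) R. N < n \<and> fgraph {..<n} R \<and> fgraph.crit {..<n} R \<and> \<not> embeds V E {..<n} R"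
proof -
  interpret fgraph V E by (rule H)
  \<comment> \<open>Large enough that the order exceeds \<open>N\<close>, and that a core, which
    needs half of the \<open>n\<close> vertices, does not fit into the image of
    \<open>V\<close>.\<close>
  define r where "r = N + 2 * card V + 2"
  define n where "n = 3 * r + 1"
  have r2: "2 \<le> r" and n7: "7 \<le> n" and nN: "N < n" and nV: "2 * card V < n" unfolding r_def n_def by simp_all
  note sq = sq_crit[OF r2 n_def] and th = th_crit[OF r2 n_def]
  have emb: "\<exists>\<phi>. inj_on \<phi> V \<and> \<phi> ` V \<subseteq> {..<m} \<and> (\<forall>x\<in>V. \<forall>y\<in>V. E x y \<longleftrightarrow> R (\<phi> x) (\<phi> y))" if "embeds V E {..<m} R" for m R
    using that unfolding embeds_def by blast
  have EV2: "x \<in> V" "y \<in> V" if "E x y" for x y using EV[OF that] EV[OF symE[OF that]] by simp_all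
  consider (tri) x y z where "E x y" "E y z" "E x z"
    | (claw) x a b c where "E x a" "E x b" "E x c" "a \<noteq> b" "b \<noteq> c" "a \<noteq> c" "\<not> E a b" "\<not> E b c" "\<not> E a c"
    | (core) C where "C \<subseteq> V" "C \<noteq> {}" "\<And>x. x \<in> C ==> \<exists>y\<in>C. \<exists>z\<in>C. y \<noteq> z \<and> E x y \<and> E x z \<and> \<not> E y z"
    | (P221) e a b c d where "e \<in> V" "E a b" "E c d" "\<not> E a c" "\<not> E a d" "\<not> E b c" "\<not> E b d" "\<not> E e a" "\<not> E e b" "\<not> E e c" "\<not> E e d"
  proof -
    note cs = that
    show ?thesis
    proof (rule ccontr)
      assume no: "\<not> ?thesis"
      have "linear V E"
      proof (intro linear.intro H linear_axioms.intro)
        show False if h: "E x y" "E y z" "E x z" for x y z using cs(1)[OF h] no by simp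
        show "E a b \<or> E b c \<or> E a c" if h: "E x a" "E x b" "E x c" "a \<noteq> b" "b \<noteq> c" "a \<noteq> c" for x a b c
          using cs(2)[OF h] no by blast
        show "\<exists>x\<in>C. \<forall>y\<in>C. \<forall>z\<in>C. y \<noteq> z --> E x y --> E x z --> E y z" if h: "C \<subseteq> V" "C \<noteq> {}" for C
        proof (rule ccontr)
          assume n: "\<not> (\<exists>x\<in>C. \<forall>y\<in>C. \<forall>z\<in>C. y \<noteq> z --> E x y --> E x z --> E y z)"
          show False by (rule notE[OF no], rule cs(3)[OF h]) (use n in blast)
        qed
        show False if h: "e \<in> V" "E a b" "E c d" "\<not> E a c" "\<not> E a d" "\<not> E b c" "\<not> E b d" "\<not> E e a" "\<not> E e b" "\<not> E e c" "\<not> E e d"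
          for e a b c d using cs(4)[OF h] no by simp
      qed
      then show False using nl by simp
    qed
  qed
  then show ?thesis
  proof cases
    case tri
    define m where "m = 2 * (N + 2) + 1"
    have m: "odd m" "5 \<le> m" "N < 2 * m + 1" unfolding m_def by simp_all
    have "\<not> embeds V E {..<2 * m + 1} (myc m)"
    proof
      assume "embeds V E {..<2 * m + 1} (myc m)"
      from emb[OF this] obtain \<phi> where p: "\<forall>x\<in>V. \<forall>y\<in>V. E x y \<longleftrightarrow> myc m (\<phi> x) (\<phi> y)" by (elim exE conjE)
      have "myc m (\<phi> u) (\<phi> v)" if "E u v" for u v using p EV2[OF that] that by simp
      then show False using myc_triangle_free[OF m(2), of "\<phi> x" "\<phi> y" "\<phi> z"] tri by simp
    qed
    then show ?thesis using m(3) myc_crit[OF m(1,2)] by (intro exI[of _ "2 * m + 1"] exI[of _ "myc m"]) simp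
  next
    case claw
    have "\<not> embeds V E {..<n} (circ n (sq n))"
    proof
      assume "embeds V E {..<n} (circ n (sq n))"
      from emb[OF this] obtain \<phi> where p: "inj_on \<phi> V" "\<forall>x\<in>V. \<forall>y\<in>V. E x y \<longleftrightarrow> circ n (sq n) (\<phi> x) (\<phi> y)" by (elim exE conjE)
      have v: "x \<in> V" "a \<in> V" "b \<in> V" "c \<in> V" using EV2 claw(1-3) by blast+
      have "\<phi> a \<noteq> \<phi> b" "\<phi> b \<noteq> \<phi> c" "\<phi> a \<noteq> \<phi> c" using inj_on_eq_iff[OF p(1)] v claw(4-6) by simp_all
      then show False using sq_claw_free[OF n7, of "\<phi> x" "\<phi> a" "\<phi> b" "\<phi> c"] p(2) v claw by simp
    qed
    then show ?thesis using nN sq by (intro exI[of _ n] exI[of _ "circ n (sq n)"]) simp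
  next
    case core
    have "\<not> embeds V E {..<n} (circ n (sq n))"
    proof
      assume "embeds V E {..<n} (circ n (sq n))"
      from emb[OF this] obtain \<phi> where p: "inj_on \<phi> V" "\<phi> ` V \<subseteq> {..<n}" "\<forall>x\<in>V. \<forall>y\<in>V. E x y \<longleftrightarrow> circ n (sq n) (\<phi> x) (\<phi> y)" by (elim exE conjE)
      have "n \<le> 2 * card (\<phi> ` C)"
      proof (rule sq_no_small_core[OF n7])
        show "\<phi> ` C \<subseteq> {..<n}" "\<phi> ` C \<noteq> {}" using core(1,2) p(2) by blast+
        fix w assume "w \<in> \<phi> ` C"
        then obtain x where x: "x \<in> C" "w = \<phi> x" by blast
        obtain y z where yz: "y \<in> C" "z \<in> C" "y \<noteq> z" "E x y" "E x z" "\<not> E y z" using core(3)[OF x(1)] by (elim bexE conjE)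
        have v: "x \<in> V" "y \<in> V" "z \<in> V" using core(1) x yz by blast+
        have "\<phi> y \<noteq> \<phi> z" "circ n (sq n) w (\<phi> y)" "circ n (sq n) w (\<phi> z)" "\<not> circ n (sq n) (\<phi> y) (\<phi> z)"
          using inj_on_eq_iff[OF p(1)] p(3) v yz x(2) by simp_all
        then show "\<exists>y\<in>\<phi> ` C. \<exists>z\<in>\<phi> ` C. y \<noteq> z \<and> circ n (sq n) w y \<and> circ n (sq n) w z \<and> \<not> circ n (sq n) y z" using yz(1,2) by blast
      qed
      also have "card (\<phi> ` C) \<le> card V"
        using card_image_le[OF finite_subset[OF core(1) finV], of \<phi>] card_mono[OF finV core(1)] by linarith
      then have "2 * card (\<phi> ` C) \<le> 2 * card V" by simp
      finally show False using nV by simp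
    qed
    then show ?thesis using nN sq by (intro exI[of _ n] exI[of _ "circ n (sq n)"]) simp
  next
    case P221
    have "\<not> embeds V E {..<n} (circ n (th r))"
    proof
      assume "embeds V E {..<n} (circ n (th r))"
      from emb[OF this] obtain \<phi> where p: "inj_on \<phi> V" "\<phi> ` V \<subseteq> {..<n}" "\<forall>x\<in>V. \<forall>y\<in>V. E x y \<longleftrightarrow> circ n (th r) (\<phi> x) (\<phi> y)" by (elim exE conjE)
      have v: "a \<in> V" "b \<in> V" "c \<in> V" "d \<in> V" using EV2 P221(2,3) by blast+
      have "e \<noteq> a" "e \<noteq> b" "e \<noteq> c" "e \<noteq> d" using P221(2,3,8-11) symE by blast+
      then have "\<phi> e \<noteq> \<phi> a" "\<phi> e \<noteq> \<phi> b" "\<phi> e \<noteq> \<phi> c" "\<phi> e \<noteq> \<phi> d" using inj_on_eq_iff[OF p(1)] v P221(1) by simp_all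
      moreover have "\<phi> e < n" using p(2) P221(1) by blast
      ultimately show False using th_no_2P2_P1[OF r2 n_def, of "\<phi> e" "\<phi> a" "\<phi> b" "\<phi> c" "\<phi> d"] p(3) v P221 by simp
    qed
    then show ?thesis using nN th by (intro exI[of _ n] exI[of _ "circ n (th r)"]) simp
  qed
qed

theorem theorem2:
  fixes H :: "'a pair_pre_digraph"
  assumes "pair_graph H"
  shows "finite ({G :: nat pair_pre_digraph. pair_graph G
                    \<and> four_vertex_critical (with_proj G)
                    \<and> induced_free (with_proj H) (with_proj G)} // iso_rel)
    \<longleftrightarrow>
      iso_induced_subgraph (with_proj H) (with_proj (path_graph 6))
      \<or> iso_induced_subgraph (with_proj H) (with_proj (copies 2 (path_graph 3)))
      \<or> (\<exists>k :: nat. iso_induced_subgraph (with_proj H)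
                      (with_proj (disjoint_union (path_graph 4) (copies k (path_graph 1)))))"
    (is "finite ?Q \<longleftrightarrow> ?R")
proof -
  interpret H: pair_graph H by (rule assms)
  have wf: "pair_wf_digraph H" by unfold_locales
  let ?emb = "\<lambda>W F. embeds (pverts H) (adjG H) W F"
  note iso = embeds_imp_iso_induced[OF wf] and emb = iso_induced_imp_embeds[of H]
  show ?thesis
  proof
    assume fin: "finite ?Q"
    have "linear (pverts H) (adjG H)"
    proof (rule ccontr)
      assume "\<not> linear (pverts H) (adjG H)"
      from infinite_family[of H, OF not_linear_infinite[OF pair_fgraph[OF assms] this]] show False using fin by blast
    qed
    from linear.classification[OF this] show ?R
    proof (elim disjE exE)
      assume "?emb {..<6} pathR"
      then have "iso_induced_subgraph (with_proj H) (with_proj (path_graph 6))" by (intro iso targets_wf) (simp add: embeds_P6_iff)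
      then show ?R by blast
    next
      assume "?emb ({..<2 :: nat} \<times> {..<3 :: nat}) (\<lambda>a b. fst a = fst b \<and> pathR (snd a) (snd b))"
      then have "iso_induced_subgraph (with_proj H) (with_proj (copies 2 (path_graph 3)))" by (intro iso targets_wf) (simp only: embeds_2P3_iff)
      then show ?R by blast
    next
      fix k :: nat
      assume "?emb ({..<4 :: nat} <+> {..<k} \<times> {..<1 :: nat}) (\<lambda>a b. \<exists>i j. a = Inl i \<and> b = Inl j \<and> pathR i j)"
      then have "iso_induced_subgraph (with_proj H) (with_proj (disjoint_union (path_graph 4) (copies k (path_graph 1))))"
        by (intro iso targets_wf) (simp only: embeds_P4k_iff)
      then show ?R by blast
    qed
  next
    assume ?R
    then consider "?emb {..<6} pathR" | "?emb ({..<2 :: nat} \<times> {..<3 :: nat}) (\<lambda>a b. fst a = fst b \<and> pathR (snd a) (snd b))"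
      | k :: nat where "?emb ({..<4 :: nat} <+> {..<k} \<times> {..<1 :: nat}) (\<lambda>a b. \<exists>i j. a = Inl i \<and> b = Inl j \<and> pathR i j)"
      using emb[of "path_graph 6"] emb[of "copies 2 (path_graph 3)"] emb[of "disjoint_union (path_graph 4) (copies _ (path_graph 1))"]
      unfolding embeds_P6_iff embeds_2P3_iff embeds_P4k_iff by blast
    then show "finite ?Q"
    proof cases
      case 1
      obtain N where N: "\<forall>V (E :: nat => nat => bool). fgraph V E --> p6free E --> fgraph.connS E V -->
        fgraph.lc V N (fgraph.proper E) --> (\<exists>f. fgraph.proper E V f)" using P6_bounded by (elim exE)
      show ?thesis
      proof (rule bounded_family[OF wf, of N])
        fix G :: "nat pair_pre_digraph"
        assume G: "pair_graph G" "\<not> embeds (pverts H) (adjG H) (pverts G) (adjG G)" "fgraph.crit (pverts G) (adjG G)"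
          "fgraph.lc (pverts G) N (fgraph.proper (adjG G))"
        note fg = pair_fgraph[OF G(1)]
        have "p6free (adjG G)" using fgraph.embeds_P6[OF fg] embeds_trans[OF 1] G(2) by blast
        from N[rule_format, OF fg this fgraph.crit_conn[OF fg G(3)] G(4)] show "\<exists>f. fgraph.proper (adjG G) (pverts G) f" .
      qed
    next
      case 2
      obtain N where N: "\<forall>V (E :: nat => nat => bool). fgraph V E --> p33free E --> (\<forall>v\<in>V. 3 \<le> card {u. E v u}) -->
        fgraph.lc V N (fgraph.proper E) --> (\<exists>f. fgraph.proper E V f)" using P33_bounded by (elim exE)
      show ?thesis
      proof (rule bounded_family[OF wf, of N])
        fix G :: "nat pair_pre_digraph"
        assume G: "pair_graph G" "\<not> embeds (pverts H) (adjG H) (pverts G) (adjG G)" "fgraph.crit (pverts G) (adjG G)"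
          "fgraph.lc (pverts G) N (fgraph.proper (adjG G))"
        note fg = pair_fgraph[OF G(1)]
        have f: "p33free (adjG G)" using fgraph.embeds_2P3[OF fg] embeds_trans[OF 2] G(2) by blast
        have "\<forall>v\<in>pverts G. 3 \<le> card {u. adjG G v u}" using fgraph.crit_deg[OF fg G(3)] by simp
        from N[rule_format, OF fg f this[rule_format] G(4)] show "\<exists>f. fgraph.proper (adjG G) (pverts G) f" by simp
      qed
    next
      case (3 k)
      obtain N where N: "\<forall>V (E :: nat => nat => bool). fgraph V E --> kfree k V E --> fgraph.connS E V -->
        fgraph.lc V N (fgraph.proper E) --> (\<exists>f. fgraph.proper E V f)" using P4k_bounded[of k] by (elim exE)
      show ?thesis
      proof (rule bounded_family[OF wf, of N])
        fix G :: "nat pair_pre_digraph"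
        assume G: "pair_graph G" "\<not> embeds (pverts H) (adjG H) (pverts G) (adjG G)" "fgraph.crit (pverts G) (adjG G)"
          "fgraph.lc (pverts G) N (fgraph.proper (adjG G))"
        note fg = pair_fgraph[OF G(1)]
        have "kfree k (pverts G) (adjG G)"
          unfolding kfree_def
        proof (intro allI impI notI)
          fix a b c d S assume S: "S \<subseteq> pverts G" "finite S" "card S = k" "indP4k (adjG G) a b c d S"
          show False using embeds_trans[OF 3 fgraph.embeds_P4_kP1[OF fg S(4,2,3,1)]] G(2) by simp
        qed
        from N[rule_format, OF fg this fgraph.crit_conn[OF fg G(3)] G(4)] show "\<exists>f. fgraph.proper (adjG G) (pverts G) f" .
      qed
    qed
  qed
qed

end
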